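(* Let $t<s<k$, $k\ge0$. Suppose that $\phi\in W_2^s(\mathbb{R}^d)$ and that, for some $\eta_1,\eta_2>0$ and some ball $\Omega$ centered at the origin, $$\eta_1\le|\widehat\phi|\le\eta_2\quad\text{a.e. on }\Omega\qquad\text{and}\qquad\sum_{\beta\in2\pi\mathbb{Z}^d\setminus\{0\}}|\beta|^{2s}\max_{\gamma:\,|\gamma|\le k}\|D^\gamma\widehat\phi\|^2_{L_\infty(\beta+\Omega)}<\infty.$$ Then $S_\phi(W_2^s)$ provides approximation order $k$ (in $W_2^s(\mathbb{R}^d)$) if and only if $S_\phi(W_2^t)$ provides that same approximation order $k$ (in $W_2^t(\mathbb{R}^d)$).
   Context: $|\cdot|$ is the Euclidean norm on $\mathbb{R}^d$; for a multi-index $\gamma\in\mathbb{Z}_+^d$, $|\gamma|=\gamma_1+\dots+\gamma_d$ and $D^\gamma=\partial^\gamma/\gamma!$. $\widehat f(\omega)=\int f(x)e^{-i\omega\cdot x}dx$. For $s\in\mathbb{R}$, $W_2^s=W_2^s(\mathbb{R}^d)$ is the space of tempered distributions $f$ with $\widehat f$ locally in $L_2(\mathbb{R}^d)$ and $\|f\|_{W_2^s}^2=\int(1+|\omega|)^{2s}|\widehat f(\omega)|^2d\omega<\infty$. For $\phi\in W_2^s$, $S_\phi(W_2^s)$ is the smallest closed subspace of $W_2^s$ containing $\phi$ and invariant under integer translations. For $k>s$, "$S_\phi(W_2^s)$ provides approximation order $k$" means: with $S^h=\{g(\cdot/h):g\in S_\phi(W_2^s)\}$, there is a constant $C$ such that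 $\inf_{g\in S^h}\|f-g\|_{W_2^s}\le Ch^{k-s}\|f\|_{W_2^k}$ for every $f\in W_2^k(\mathbb{R}^d)$ and every $h>0$.
   Formalization: The order k is taken to be a non-negative integer; for non-integer real k the equivalence as stated fails, since only derivatives of order up to the integer part of k are controlled. *)

theory Defs
  imports "HOL-Analysis.Analysis" "HOL-Probability.Essential_Supremum"
begin

section \<open>Derivatives and multi-indices\<close>

type_synonym 'n fn = "real ^ 'n \<Rightarrow> complex"

definition partial :: "'n::finite \<Rightarrow> 'n fn \<Rightarrow> 'n fn" where
  "partial i f x = frechet_derivative f (at x) (axis i 1)"

text \<open>\<open>C\<close>-infinity: every iterated partial derivative is differentiable everywhere.\<close>

definition smooth :: "'n::finite fn \<Rightarrow> bool" where
  "smooth f \<longleftrightarrow> (\<forall>is. \<forall>x. fold partial is f differentiable (at x))"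

type_synonym 'n multi_index = "'n \<Rightarrow> nat"

definition mi_order :: "'n::finite multi_index \<Rightarrow> nat" where
  "mi_order \<gamma> = (\<Sum>i\<in>UNIV. \<gamma> i)"

definition mi_fact :: "'n::finite multi_index \<Rightarrow> real" where
  "mi_fact \<gamma> = (\<Prod>i\<in>UNIV. fact (\<gamma> i))"

text \<open>The unnormalised multi-index derivative. The coordinates are processed in some fixed order,
  which is immaterial because this is only applied to smooth functions.\<close>

definition mpartial :: "'n::finite multi_index \<Rightarrow> 'n fn \<Rightarrow> 'n fn" where
  "mpartial \<gamma> f =
     fold (\<lambda>i. partial i ^^ \<gamma> i) (SOME is. distinct is \<and> set is = UNIV) f"

definition test_functions :: "(real ^ 'n::finite) set \<Rightarrow> 'n fn set" where
  "test_functions U =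
     {u. smooth u \<and> compact (closure {x. u x \<noteq> 0}) \<and> closure {x. u x \<noteq> 0} \<subseteq> U}"

definition locally_integrable_on :: "'n::finite fn \<Rightarrow> (real ^ 'n) set \<Rightarrow> bool" where
  "locally_integrable_on f U \<longleftrightarrow> (\<forall>K. compact K \<and> K \<subseteq> U \<longrightarrow> set_integrable lborel K f)"

text \<open>\<open>g\<close> is the distributional derivative of \<open>f\<close> of multi-order \<open>\<gamma>\<close> on the open set \<open>U\<close>.\<close>

definition weak_derivative ::
  "(real ^ 'n::finite) set \<Rightarrow> 'n multi_index \<Rightarrow> 'n fn \<Rightarrow> 'n fn \<Rightarrow> bool" where
  "weak_derivative U \<gamma> f g \<longleftrightarrow>
     locally_integrable_on f U \<and> locally_integrable_on g U \<and>
     (\<forall>u\<in>test_functions U.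
        (\<integral>x. f x * mpartial \<gamma> u x \<partial>lborel) = (-1) ^ mi_order \<gamma> * (\<integral>x. g x * u x \<partial>lborel))"

text \<open>The essentially bounded norm on \<open>U\<close> of the distribution \<open>D\<^sup>\<gamma> f = \<partial>\<^sup>\<gamma> f / \<gamma>!\<close>. Weak
  derivatives are unique up to null sets, so the infimum is over at most one value; it is \<open>\<infinity>\<close>
  when the derivative is not a locally integrable function.\<close>

definition Linf_norm_D :: "'n::finite multi_index \<Rightarrow> 'n fn \<Rightarrow> (real ^ 'n) set \<Rightarrow> ennreal" where
  "Linf_norm_D \<gamma> f U =
     (INF g\<in>{g. weak_derivative U \<gamma> f g}.
        esssup (restrict_space lborel U) (\<lambda>x. ennreal (cmod (g x) / mi_fact \<gamma>)))"


section \<open>Tempered distributions and the Fourier transform\<close>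

definition schwartz :: "'n::finite fn set" where
  "schwartz = {u. smooth u \<and> (\<forall>N \<gamma>. bounded (range (\<lambda>x. (1 + norm x) ^ N *\<^sub>R mpartial \<gamma> u x)))}"

definition schwartz_seminorm :: "nat \<Rightarrow> 'n::finite fn \<Rightarrow> real" where
  "schwartz_seminorm N u =
     (SUP (x, \<gamma>)\<in>UNIV \<times> {\<gamma>. mi_order \<gamma> \<le> N}. (1 + norm x) ^ N * cmod (mpartial \<gamma> u x))"

type_synonym 'n functional = "'n fn \<Rightarrow> complex"

text \<open>Continuous linear functionals on the Schwartz space. They are total functions in HOL, so
  we fix the value \<open>0\<close> off the Schwartz space: then equality of functionals is equality of
  distributions.\<close>

definition tempered :: "'n::finite functional set" where
  "tempered = {T.
     (\<forall>u. u \<notin> schwartz \<longrightarrow> T u = 0) \<and>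
     (\<forall>u\<in>schwartz. \<forall>v\<in>schwartz. T (\<lambda>x. u x + v x) = T u + T v) \<and>
     (\<forall>c. \<forall>u\<in>schwartz. T (\<lambda>x. c * u x) = c * T u) \<and>
     (\<exists>N C. \<forall>u\<in>schwartz. cmod (T u) \<le> C * schwartz_seminorm N u)}"

definition fourier :: "'n::finite fn \<Rightarrow> 'n fn" where
  "fourier u \<omega> = (\<integral>x. u x * cis (- (\<omega> \<bullet> x)) \<partial>lborel)"

definition fourier_dist :: "'n::finite functional \<Rightarrow> 'n functional" where
  "fourier_dist T u = (if u \<in> schwartz then T (fourier u) else 0)"

text \<open>The Fourier transform of \<open>T\<close> is, as a distribution, the locally square-integrable
  function \<open>g\<close>.\<close>

definition is_fourier_fun :: "'n::finite functional \<Rightarrow> 'n fn \<Rightarrow> bool" where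
  "is_fourier_fun T g \<longleftrightarrow>
     g \<in> borel_measurable borel \<and>
     (\<forall>K. compact K \<longrightarrow> set_integrable lborel K (\<lambda>\<omega>. (cmod (g \<omega>))\<^sup>2)) \<and>
     (\<forall>u\<in>test_functions UNIV. fourier_dist T u = (\<integral>\<omega>. g \<omega> * u \<omega> \<partial>lborel))"

text \<open>A representative of the Fourier transform, which is determined almost everywhere.\<close>

definition fourier_fun :: "'n::finite functional \<Rightarrow> 'n fn" where
  "fourier_fun T = (SOME g. is_fourier_fun T g)"


section \<open>Sobolev spaces and principal shift-invariant spaces\<close>

definition sobolev :: "real \<Rightarrow> 'n::finite functional set" where
  "sobolev s = {T\<in>tempered. (\<exists>g. is_fourier_fun T g) \<and>
     integrable lborel (\<lambda>\<omega>. (1 + norm \<omega>) powr (2 * s) * (cmod (fourier_fun T \<omega>))\<^sup>2)}"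

definition sobolev_norm :: "real \<Rightarrow> 'n::finite functional \<Rightarrow> real" where
  "sobolev_norm s T =
     sqrt (\<integral>\<omega>. (1 + norm \<omega>) powr (2 * s) * (cmod (fourier_fun T \<omega>))\<^sup>2 \<partial>lborel)"

definition closed_subspace :: "real \<Rightarrow> 'n::finite functional set \<Rightarrow> bool" where
  "closed_subspace s V \<longleftrightarrow>
     V \<subseteq> sobolev s \<and> (\<lambda>u. 0) \<in> V \<and>
     (\<forall>S\<in>V. \<forall>T\<in>V. (\<lambda>u. S u + T u) \<in> V) \<and>
     (\<forall>c. \<forall>T\<in>V. (\<lambda>u. c * T u) \<in> V) \<and>
     (\<forall>T\<in>sobolev s. \<forall>X. (\<forall>n::nat. X n \<in> V) \<and>
        (\<lambda>n. sobolev_norm s (\<lambda>u. X n u - T u)) \<longlonglongrightarrow> 0 \<longrightarrow> T \<in> V)"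

definition int_lattice :: "(real ^ 'n::finite) set" where
  "int_lattice = {\<alpha>. \<forall>i. \<alpha> $ i \<in> \<int>}"

text \<open>The distributions \<open>f(\<cdot> - \<alpha>)\<close> and, for \<open>h > 0\<close>, \<open>f(\<cdot> / h)\<close>, by duality.\<close>

definition translate :: "real ^ 'n \<Rightarrow> 'n::finite functional \<Rightarrow> 'n functional" where
  "translate \<alpha> T u = T (\<lambda>x. u (x + \<alpha>))"

definition dilate :: "real \<Rightarrow> 'n::finite functional \<Rightarrow> 'n functional" where
  "dilate h T u = of_real (h ^ CARD('n)) * T (\<lambda>x. u (h *\<^sub>R x))"

definition psi_space :: "real \<Rightarrow> 'n::finite functional \<Rightarrow> 'n functional set" where
  "psi_space s \<phi> = \<Inter>{V. closed_subspace s V \<and> (\<forall>\<alpha>\<in>int_lattice. translate \<alpha> ` V \<subseteq> V) \<and> \<phi> \<in> V}"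

text \<open>The space generated by \<open>\<phi>\<close> in the Sobolev space of order \<open>s\<close> provides approximation
  order \<open>k\<close>; meant for \<open>k > s\<close>.\<close>

definition provides_approx_order :: "real \<Rightarrow> 'n::finite functional \<Rightarrow> real \<Rightarrow> bool" where
  "provides_approx_order s \<phi> k \<longleftrightarrow>
     (\<exists>C. \<forall>f\<in>sobolev k. \<forall>h>0.
        (INF g\<in>dilate h ` psi_space s \<phi>. sobolev_norm s (\<lambda>u. f u - g u))
          \<le> C * h powr (k - s) * sobolev_norm k f)"

end

theory Submission
  imports Defs "HOL-Real_Asymp.Real_Asymp" "HOL-Probability.Probability"
begin

text \<open>Both sides of the equivalence say that the spectrum \<open>p = fourier_fun \<phi>\<close> vanishes to order \<open>k\<close> at every
  nonzero point \<open>\<beta>\<close> of the dual lattice \<open>2 \<pi> \<int>\<^sup>d\<close>, in the sense that \<open>cmod (p (\<omega> + \<beta>)) \<le> C\<^sub>\<beta> * norm \<omega> ^ k\<close>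
  for almost all \<open>\<omega>\<close> near \<open>0\<close>.  The exponent of the Sobolev space does not occur in this condition.

  The condition is necessary (\<open>approximation_order_implies_vanishing\<close>).  Every element of the shift-invariant
  space has a spectrum \<open>g\<close> with \<open>g(\<omega>) p(\<omega> + \<beta>) = g(\<omega> + \<beta>) p(\<omega>)\<close>, because this relation defines a closed
  shift-invariant space that contains \<open>\<phi>\<close> (\<open>psi_space_subset_ratio_space\<close>).  If the target has its spectrum
  at low frequencies where \<open>p(\<omega> + \<beta>)\<close> is too large, then whatever approximates it there has a large alias
  near \<open>\<beta>\<close>, where the target has no spectrum.

  The constants \<open>C\<^sub>\<beta>\<close> found in this way are arbitrary, but they can be replaced by multiples of the
  \<open>L\<^sub>\<infinity>\<close> norms of the derivatives of \<open>p\<close>, on a ball that is the same for all \<open>\<beta>\<close>: this is Taylor's theorem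
  (\<open>vanishing_order_bound\<close>).  Since \<open>p\<close> is a class of functions modulo null sets with weak derivatives,
  Taylor's theorem is applied to the smooth functions \<open>x \<mapsto> \<integral> v(x z) u(z) dz\<close> for test functions \<open>u\<close>
  (\<open>taylor_dual\<close>), and the pointwise bound is recovered by duality (\<open>AE_bound_if_test_bound\<close>).

  Vanishing with constants such that \<open>\<Sum>\<^sub>\<beta> norm \<beta> powr (2 \<sigma>) * C\<^sub>\<beta>\<^sup>2\<close> is finite is sufficient in the Sobolev space of order
  \<open>\<sigma>\<close> (\<open>vanishing_implies_approximation_order\<close>).  At scale \<open>h\<close>, divide the dilated spectrum of the target by
  \<open>p\<close> on a ball around \<open>0\<close> and continue the quotient periodically.  The resulting multiple of \<open>p\<close> reproduces the
  low frequencies; the error consists of the high frequencies, where the weights of the two Sobolev norms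
  differ by the desired power of \<open>h\<close>, and of the aliases near the points \<open>\<beta>\<close>, where the vanishing of \<open>p\<close>
  supplies that power.  The multiplier can be taken to be a trigonometric polynomial by density
  (\<open>trig_dense\<close>), and such multiples of \<open>p\<close> are spectra of combinations of integer translates of \<open>\<phi>\<close>.  The
  sum is finite for \<open>\<sigma> = s\<close> by hypothesis, hence also for \<open>\<sigma> = t < s\<close> as \<open>norm \<beta> \<ge> 2 \<pi> > 1\<close>.\<close>

section \<open>Smooth functions and test functions\<close>

lemma smooth_differentiable: "smooth f \<Longrightarrow> f differentiable (at x)"
  unfolding smooth_def by (metis fold_Nil id_apply)

lemma smooth_partial: "smooth f \<Longrightarrow> smooth (partial i f)"
  unfolding smooth_def by (metis fold_Cons comp_apply)

lemma smooth_coinduct: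
  assumes "f \<in> C" "\<And>g x. g \<in> C \<Longrightarrow> g differentiable (at x)"
    and "\<And>g i. g \<in> C \<Longrightarrow> partial i g \<in> C"
  shows "smooth f"
proof -
  have "fold partial is g \<in> C" if "g \<in> C" for "is" g
    using that by (induction "is" arbitrary: g) (auto intro: assms)
  then show ?thesis unfolding smooth_def using assms by blast
qed

lemma smoothI:
  assumes "\<And>x. f differentiable (at x)" "\<And>i. smooth (partial i f)"
  shows "smooth f"
  by (rule smooth_coinduct[where C = "insert f (Collect smooth)"])
    (auto simp: assms smooth_partial smooth_differentiable)

lemma has_derivative_frechet: "f differentiable (at x) \<Longrightarrow>
    (f has_derivative frechet_derivative f (at x)) (at x)"
  by (simp add: frechet_derivative_works)

lemma partial_eqI: "(f has_derivative f') (at x) \<Longrightarrow> partial i f x = f' (axis i 1)"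
  unfolding partial_def by (metis frechet_derivative_at)

lemma partial_add:
  assumes "f differentiable (at x)" "g differentiable (at x)"
  shows "partial i (\<lambda>x. f x + g x) x = partial i f x + partial i g x"
proof -
  note d = has_derivative_add[OF has_derivative_frechet[OF assms(1)]
        has_derivative_frechet[OF assms(2)]]
  show ?thesis by (subst partial_eqI[OF d]) (simp add: partial_def)
qed

lemma partial_mult:
  assumes "f differentiable (at x)" "g differentiable (at x)"
  shows "partial i (\<lambda>x. f x * g x) x = f x * partial i g x + partial i f x * g x"
proof -
  note d = has_derivative_mult[OF has_derivative_frechet[OF assms(1)]
        has_derivative_frechet[OF assms(2)]]
  show ?thesis by (subst partial_eqI[OF d]) (simp add: partial_def)
qed

lemma partial_const: "partial i (\<lambda>x. c) = (\<lambda>x. 0)"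
  by (rule ext) (subst partial_eqI[OF has_derivative_const], simp)

lemma smooth_const [simp]: "smooth (\<lambda>x. c)"
  by (rule smooth_coinduct[where C = "range (\<lambda>c x. c)"]) (auto simp: partial_const)

lemma differentiable_coordinate:
  "(\<lambda>x::real^'n::finite. complex_of_real (x $ i)) differentiable (at x)"
  by (intro bounded_linear_imp_differentiable bounded_linear_compose[OF bounded_linear_of_real]
      bounded_linear_vec_nth)

lemma partial_coordinate:
  "partial i (\<lambda>x::real^'n::finite. complex_of_real (x $ j)) = (\<lambda>x. if i = j then 1 else 0)"
proof
  fix x :: "real^'n"
  have "bounded_linear (\<lambda>x::real^'n. complex_of_real (x $ j))"
    by (intro bounded_linear_compose[OF bounded_linear_of_real] bounded_linear_vec_nth)
  from partial_eqI[OF bounded_linear_imp_has_derivative[OF this]]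
  show "partial i (\<lambda>x::real^'n. complex_of_real (x $ j)) x = (if i = j then 1 else 0)"
    by (simp add: axis_def)
qed

lemma smooth_coordinate [simp]: "smooth (\<lambda>x::real^'n::finite. complex_of_real (x $ i))"
  by (rule smoothI) (auto simp: partial_coordinate intro!: differentiable_coordinate)

lemma smooth_add:
  assumes "smooth f" "smooth g"
  shows "smooth (\<lambda>x. f x + g x)"
proof (rule smooth_coinduct[where C = "{\<lambda>x. f x + g x |f g. smooth f \<and> smooth g}"])
  fix h :: "'a fn" and i
  assume "h \<in> {\<lambda>x. f x + g x |f g. smooth f \<and> smooth g}"
  then obtain f g where h: "h = (\<lambda>x. f x + g x)" and fg: "smooth f" "smooth g" by blast
  then have "partial i h = (\<lambda>x. partial i f x + partial i g x)"
    by (auto intro!: partial_add smooth_differentiable)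
  then show "partial i h \<in> {\<lambda>x. f x + g x |f g. smooth f \<and> smooth g}"
    using fg smooth_partial by blast
next
  show "(\<lambda>x. f x + g x) \<in> {\<lambda>x. f x + g x |f g. smooth f \<and> smooth g}"
    using assms by blast
qed (auto intro!: differentiable_add intro: smooth_differentiable)

text \<open>Products and composites are not closed under partial derivatives by themselves, but the
  spans of the functions of that form are.\<close>

inductive_set product_span :: "'n::finite fn set" where
  prod: "smooth f \<Longrightarrow> smooth g \<Longrightarrow> (\<lambda>x. f x * g x) \<in> product_span"
| add: "a \<in> product_span \<Longrightarrow> b \<in> product_span \<Longrightarrow> (\<lambda>x. a x + b x) \<in> product_span"

lemma smooth_mult:
  assumes "smooth f" "smooth g"
  shows "smooth (\<lambda>x. f x * g x)"
proof (rule smooth_coinduct[where C = product_span])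
  show d: "h differentiable (at x)" if "h \<in> product_span" for h :: "'a fn" and x
    using that
    by induction (auto intro!: differentiable_add differentiable_mult intro: smooth_differentiable)
  show "partial i h \<in> product_span" if "h \<in> product_span" for h :: "'a fn" and i
    using that
  proof induction
    case (prod f g)
    then have "partial i (\<lambda>x. f x * g x) = (\<lambda>x. f x * partial i g x + partial i f x * g x)"
      by (auto intro!: partial_mult smooth_differentiable)
    with prod show ?case by (simp add: product_span.intros smooth_partial)
  next
    case (add a b)
    then have "partial i (\<lambda>x. a x + b x) = (\<lambda>x. partial i a x + partial i b x)"
      by (auto intro!: partial_add d)
    with add show ?case by (simp add: product_span.intros)
  qed
  show "(\<lambda>x. f x * g x) \<in> product_span"
    by (intro product_span.intros assms)
qed

lemma smooth_sum: "(\<And>i. i \<in> I \<Longrightarrow> smooth (f i)) \<Longrightarrow> smooth (\<lambda>x. \<Sum>i\<in>I. f i x)"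
  by (induction I rule: infinite_finite_induct) (simp_all add: smooth_add)

lemma smooth_prod: "(\<And>i. i \<in> I \<Longrightarrow> smooth (f i)) \<Longrightarrow> smooth (\<lambda>x. \<Prod>i\<in>I. f i x)"
  by (induction I rule: infinite_finite_induct) (simp_all add: smooth_mult)

lemma has_derivative_affine:
  fixes f :: "'n::finite fn"
  assumes "f differentiable (at (c *\<^sub>R x + a))"
  shows "((\<lambda>x. f (c *\<^sub>R x + a)) has_derivative
           (\<lambda>v. frechet_derivative f (at (c *\<^sub>R x + a)) (c *\<^sub>R v))) (at x)"
proof -
  have "((\<lambda>x. c *\<^sub>R x + a) has_derivative (\<lambda>v. c *\<^sub>R v)) (at x)"
    by (auto intro!: derivative_eq_intros)
  from has_derivative_compose[OF this has_derivative_frechet[OF assms]] show ?thesis .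
qed

lemma partial_affine:
  fixes f :: "'n::finite fn"
  assumes "f differentiable (at (c *\<^sub>R x + a))"
  shows "partial i (\<lambda>x. f (c *\<^sub>R x + a)) x = of_real c * partial i f (c *\<^sub>R x + a)"
proof -
  have "linear (frechet_derivative f (at (c *\<^sub>R x + a)))"
    using assms linear_frechet_derivative by blast
  then have "frechet_derivative f (at (c *\<^sub>R x + a)) (c *\<^sub>R axis i 1) =
      c *\<^sub>R frechet_derivative f (at (c *\<^sub>R x + a)) (axis i 1)"
    by (rule linear_scale)
  then show ?thesis
    by (subst partial_eqI[OF has_derivative_affine[OF assms]])
      (simp only: partial_def scaleR_conv_of_real[where 'a=complex])
qed

lemma smooth_affine:
  assumes "smooth f"
  shows "smooth (\<lambda>x. f (c *\<^sub>R x + a))"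
proof (rule smooth_coinduct[where C = "{\<lambda>x. k * f (c *\<^sub>R x + a) |f k. smooth f}"])
  let ?C = "{\<lambda>x. k * f (c *\<^sub>R x + a) |f k. smooth f}"
  show "(\<lambda>x. f (c *\<^sub>R x + a)) \<in> ?C"
    using assms by (auto intro!: exI[of _ f] exI[of _ 1])
  fix h :: "'a fn"
  assume "h \<in> ?C"
  then obtain f k where h: "h = (\<lambda>x. k * f (c *\<^sub>R x + a))" and f: "smooth f" by blast
  have d: "(\<lambda>x. f (c *\<^sub>R x + a)) differentiable (at x)" for x
    using has_derivative_affine[OF smooth_differentiable[OF f]] by (auto simp: differentiable_def)
  show "h differentiable (at x)" for x unfolding h by (intro derivative_intros d)
  fix i
  have "partial i h = (\<lambda>x. (k * of_real c) * partial i f (c *\<^sub>R x + a))"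
    unfolding h by (rule ext)
      (simp add: partial_mult d partial_const partial_affine[OF smooth_differentiable[OF f]])
  then show "partial i h \<in> ?C" using f smooth_partial by blast
qed

lemma has_derivative_cis_inner:
  "((\<lambda>x. cis (a \<bullet> x)) has_derivative (\<lambda>v. \<i> * of_real (a \<bullet> v) * cis (a \<bullet> x))) (at x)"
proof -
  have "((\<lambda>x. \<i> * complex_of_real (a \<bullet> x)) has_derivative (\<lambda>v. \<i> * complex_of_real (a \<bullet> v))) (at x)"
    by (intro bounded_linear_imp_has_derivative bounded_linear_const_mult
        bounded_linear_compose[OF bounded_linear_of_real] bounded_linear_inner_right)
  from has_derivative_compose[OF this DERIV_exp[unfolded has_field_derivative_def]]
  show ?thesis unfolding cis_conv_exp by (simp add: mult.commute)
qed

lemma smooth_cis_inner [simp]: "smooth (\<lambda>x::real^'n::finite. cis (a \<bullet> x))"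
proof (rule smooth_coinduct[where C = "range (\<lambda>c x. c * cis (a \<bullet> x))"])
  have p: "partial i (\<lambda>x. c * cis (a \<bullet> x)) = (\<lambda>x. (c * \<i> * of_real (a $ i)) * cis (a \<bullet> x))"
    for c and i :: 'n
    by (rule ext, subst partial_eqI[OF has_derivative_mult_right[OF has_derivative_cis_inner]])
      (simp add: inner_axis)
  show "(\<lambda>x. cis (a \<bullet> x)) \<in> range (\<lambda>c x. c * cis (a \<bullet> x))"
    by (rule range_eqI[of _ _ 1]) simp
  show "g differentiable (at x)" if "g \<in> range (\<lambda>c x. c * cis (a \<bullet> x))" for g x
    using that has_derivative_mult_right[OF has_derivative_cis_inner[of a x]]
    unfolding differentiable_def by blast
  show "partial i g \<in> range (\<lambda>c x. c * cis (a \<bullet> x))"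
    if "g \<in> range (\<lambda>c x. c * cis (a \<bullet> x))" for g i
    using that p by auto
qed

lemma smooth_imp_continuous_on: "smooth f \<Longrightarrow> continuous_on S f"
  by (meson continuous_at_imp_continuous_on differentiable_imp_continuous_within
      smooth_differentiable)

lemma smooth_measurable [measurable_dest]: "smooth f \<Longrightarrow> f \<in> borel_measurable borel"
  by (intro borel_measurable_continuous_onI smooth_imp_continuous_on)

abbreviation support :: "'n::finite fn \<Rightarrow> (real^'n) set" where
  "support u \<equiv> closure {x. u x \<noteq> 0}"

lemma test_functionsI:
  assumes "smooth u" "{x. u x \<noteq> 0} \<subseteq> K" "compact K" "K \<subseteq> U"
  shows "u \<in> test_functions U"
proof -
  have "support u \<subseteq> K" using assms by (simp add: closure_minimal compact_imp_closed)
  moreover have "compact (support u)"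
    using assms by (meson bounded_subset compact_closure compact_imp_bounded)
  ultimately show ?thesis using assms by (simp only: test_functions_def mem_Collect_eq) blast
qed

lemma test_functionsD:
  assumes "u \<in> test_functions U"
  shows "smooth u" "compact (support u)" "support u \<subseteq> U" "\<And>x. x \<notin> support u \<Longrightarrow> u x = 0"
proof -
  show "smooth u" "compact (support u)" "support u \<subseteq> U"
    using assms by (simp_all only: test_functions_def mem_Collect_eq)
  show "u x = 0" if "x \<notin> support u" for x
    using that closure_subset[of "{x. u x \<noteq> 0}"] by blast
qed

lemma test_mono: "u \<in> test_functions U \<Longrightarrow> U \<subseteq> V \<Longrightarrow> u \<in> test_functions V"
  by (simp only: test_functions_def mem_Collect_eq) blast

lemma test_UNIV: "u \<in> test_functions U \<Longrightarrow> u \<in> test_functions UNIV"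
  by (rule test_mono[OF _ subset_UNIV])

lemma test_zero [simp]: "(\<lambda>x. 0) \<in> test_functions U"
  by (simp add: test_functions_def)

lemma test_mult:
  assumes "smooth g" "u \<in> test_functions U"
  shows "(\<lambda>x. g x * u x) \<in> test_functions U"
proof (rule test_functionsI[of _ "support u"])
  show "{x. g x * u x \<noteq> 0} \<subseteq> support u"
    using closure_subset[of "{x. u x \<noteq> 0}"] by auto
qed (use assms(1) test_functionsD(1-3)[OF assms(2)] in \<open>auto intro!: smooth_mult\<close>)

lemma test_add:
  assumes "u \<in> test_functions U" "v \<in> test_functions U"
  shows "(\<lambda>x. u x + v x) \<in> test_functions U"
proof (rule test_functionsI[of _ "support u \<union> support v"])
  show "{x. u x + v x \<noteq> 0} \<subseteq> support u \<union> support v"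
  proof
    fix x assume "x \<in> {x. u x + v x \<noteq> 0}"
    then have "u x \<noteq> 0 \<or> v x \<noteq> 0" by auto
    then show "x \<in> support u \<union> support v"
      using test_functionsD(4)[OF assms(1)] test_functionsD(4)[OF assms(2)] by blast
  qed
qed (use assms[THEN test_functionsD(1)] assms[THEN test_functionsD(2)]
    assms[THEN test_functionsD(3)] in \<open>auto intro!: smooth_add\<close>)

lemma test_sum: "(\<And>i. i \<in> I \<Longrightarrow> f i \<in> test_functions U) \<Longrightarrow> (\<lambda>x. \<Sum>i\<in>I. f i x) \<in> test_functions U"
  by (induction I rule: infinite_finite_induct) (simp_all add: test_add)

lemma partial_zero_outside:
  assumes "x \<notin> support u"
  shows "partial i u x = 0"
proof -
  have "open (- support u)" "x \<in> - support u" using assms by auto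
  moreover have "\<And>y. y \<in> - support u \<Longrightarrow> 0 = u y"
    using closure_subset[of "{x. u x \<noteq> 0}"] by auto
  ultimately have "(u has_derivative (\<lambda>v. 0)) (at x)"
    by (rule has_derivative_transform_within_open[OF has_derivative_const])
  from partial_eqI[OF this] show ?thesis by simp
qed

lemma test_partial:
  assumes "u \<in> test_functions U"
  shows "partial i u \<in> test_functions U"
proof (rule test_functionsI[of _ "support u"])
  show "{x. partial i u x \<noteq> 0} \<subseteq> support u"
    using partial_zero_outside by blast
qed (use test_functionsD(1-3)[OF assms] smooth_partial in auto)

lemma test_affine:
  assumes "u \<in> test_functions U" "c \<noteq> 0" "\<And>x. c *\<^sub>R x + a \<in> U \<Longrightarrow> x \<in> V"
  shows "(\<lambda>x. u (c *\<^sub>R x + a)) \<in> test_functions V"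
proof (rule test_functionsI[of _ "(\<lambda>y. (1/c) *\<^sub>R (y - a)) ` support u"])
  have inv: "x = (1/c) *\<^sub>R ((c *\<^sub>R x + a) - a)" for x using assms by simp
  show "{x. u (c *\<^sub>R x + a) \<noteq> 0} \<subseteq> (\<lambda>y. (1/c) *\<^sub>R (y - a)) ` support u"
    using inv test_functionsD(4)[OF assms(1)] by fast
  show "(\<lambda>y. (1/c) *\<^sub>R (y - a)) ` support u \<subseteq> V"
    using test_functionsD(3)[OF assms(1)] assms(2,3) by (auto simp: subset_eq)
  show "compact ((\<lambda>y. (1/c) *\<^sub>R (y - a)) ` support u)"
    by (intro compact_continuous_image continuous_intros test_functionsD(2)[OF assms(1)])
qed (intro smooth_affine test_functionsD(1)[OF assms(1)])

lemma test_bounded: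
  assumes "u \<in> test_functions U"
  shows "\<exists>B>0. \<forall>x. cmod (u x) \<le> B"
proof -
  have "compact (u ` support u)"
    using test_functionsD(1,2)[OF assms]
    by (intro compact_continuous_image smooth_imp_continuous_on)
  then obtain B where B: "\<And>y. y \<in> u ` support u \<Longrightarrow> cmod y \<le> B" "B > 0"
    using compact_imp_bounded bounded_pos by metis
  have "cmod (u x) \<le> B" for x
    using B test_functionsD(4)[OF assms, of x] by (cases "x \<in> support u") auto
  with B(2) show ?thesis by blast
qed

lemma integrable_mult_test:
  fixes g :: "'n::finite fn"
  assumes "u \<in> test_functions U" "\<And>K. compact K \<Longrightarrow> K \<subseteq> U \<Longrightarrow> set_integrable lborel K g"
  shows "integrable lborel (\<lambda>x. g x * u x)"
proof -
  obtain B where B: "B > 0" "\<And>x. cmod (u x) \<le> B"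
    using test_bounded[OF assms(1)] by blast
  have i: "integrable lborel (\<lambda>x. indicator (support u) x *\<^sub>R g x)"
    using assms(2)[OF test_functionsD(2,3)[OF assms(1)]] unfolding set_integrable_def .
  have u: "u \<in> borel_measurable lborel" using test_functionsD(1)[OF assms(1)] smooth_measurable by simp
  have "g x * u x = (indicator (support u) x *\<^sub>R g x) * u x" for x
    using test_functionsD(4)[OF assms(1), of x] by (cases "x \<in> support u") simp_all
  then have e: "(\<lambda>x. g x * u x) = (\<lambda>x. (indicator (support u) x *\<^sub>R g x) * u x)"
    by blast
  show ?thesis unfolding e
  proof (rule Bochner_Integration.integrable_bound[OF integrable_mult_left[OF i, of "of_real B"]])
    show "(\<lambda>x. (indicator (support u) x *\<^sub>R g x) * u x) \<in> borel_measurable lborel"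
      by (intro borel_measurable_times borel_measurable_integrable[OF i] u)
    show "AE x in lborel. cmod (indicator (support u) x *\<^sub>R g x * u x)
        \<le> cmod (indicator (support u) x *\<^sub>R g x * of_real B)"
      using B by (intro AE_I2) (simp add: norm_mult mult_left_mono)
  qed
qed

lemma set_integrable_continuous:
  fixes g :: "'n::finite fn"
  assumes "compact K" "continuous_on K g"
  shows "set_integrable lborel K g"
  unfolding set_integrable_def using borel_integrable_compact[OF assms]
  by (rule Bochner_Integration.integrable_cong[THEN iffD1, rotated 2]) auto

lemma test_integrable:
  assumes "u \<in> test_functions U"
  shows "integrable lborel u"
  using integrable_mult_test[OF assms, of "\<lambda>x. 1", OF set_integrable_continuous] by simp

section \<open>Cut-off functions\<close>

text \<open>The functions \<open>P(1/x) exp(-1/x)\<close> (\<open>x > 0\<close>), extended by \<open>0\<close>: a family of bump profiles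
  that is closed under differentiation.\<close>

definition flat :: "real poly \<Rightarrow> real \<Rightarrow> real" where
  "flat P x = (if x > 0 then poly P (1 / x) * exp (- (1 / x)) else 0)"

lemma poly_exp_tendsto_0: "((\<lambda>y. poly P y * exp (- y)) \<longlongrightarrow> (0::real)) at_top"
proof -
  have "((\<lambda>y. \<Sum>i\<le>degree P. coeff P i * (y ^ i / exp y)) \<longlongrightarrow> (\<Sum>i\<le>degree P. coeff P i * 0)) at_top"
    by (intro tendsto_intros tendsto_power_div_exp_0)
  moreover have "(\<Sum>i\<le>degree P. coeff P i * (y ^ i / exp y)) = poly P y * exp (- y)" for y
    by (simp add: poly_altdef sum_distrib_right exp_minus divide_inverse mult.assoc)
  ultimately show ?thesis by simp
qed

lemma flat_has_derivative:
  "(flat P has_real_derivative flat (pCons 0 (pCons 0 (P - pderiv P))) x) (at x)"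
proof -
  consider "x > 0" | "x < 0" | "x = 0" by linarith
  then show ?thesis
  proof cases
    case 1
    have "((\<lambda>x. poly P (1 / x) * exp (- (1 / x))) has_real_derivative
        flat (pCons 0 (pCons 0 (P - pderiv P))) x) (at x)"
      using 1 by (auto intro!: derivative_eq_intros DERIV_chain'[OF _ poly_DERIV]
          simp: flat_def field_simps power2_eq_square)
    then show ?thesis
      by (rule has_field_derivative_transform_within_open[of _ _ _ "{0<..}"])
        (use 1 in \<open>auto simp: flat_def\<close>)
  next
    case 2
    have "((\<lambda>x. 0) has_real_derivative flat (pCons 0 (pCons 0 (P - pderiv P))) x) (at x)"
      using 2 by (simp add: flat_def)
    then show ?thesis
      by (rule has_field_derivative_transform_within_open[of _ _ _ "{..<0}"])
        (use 2 in \<open>auto simp: flat_def\<close>)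
  next
    case 3
    have "((\<lambda>h. (flat P (0 + h) - flat P 0) / h) \<longlongrightarrow> 0) (at_right 0)"
    proof -
      have "((\<lambda>h. poly (pCons 0 P) (inverse h) * exp (- inverse h)) \<longlongrightarrow> (0::real)) (at_right 0)"
        by (rule filterlim_compose[OF poly_exp_tendsto_0 filterlim_inverse_at_top_right])
      then show ?thesis
        by (rule Lim_transform_eventually)
          (auto simp: eventually_at_filter flat_def field_simps)
    qed
    moreover have "((\<lambda>h. (flat P (0 + h) - flat P 0) / h) \<longlongrightarrow> 0) (at_left 0)"
      by (rule Lim_transform_eventually[OF tendsto_const])
        (auto simp: eventually_at_filter flat_def)
    ultimately have "((\<lambda>h. (flat P (0 + h) - flat P 0) / h) \<longlongrightarrow> 0) (at 0)"
      using filterlim_split_at by blast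
    then show ?thesis using 3 by (simp add: DERIV_def flat_def)
  qed
qed

inductive_set flat_span :: "(real^'n::finite \<Rightarrow> real) \<Rightarrow> 'n fn set" for p where
  flat: "smooth g \<Longrightarrow> (\<lambda>x. of_real (flat P (p x)) * g x) \<in> flat_span p"
| add: "a \<in> flat_span p \<Longrightarrow> b \<in> flat_span p \<Longrightarrow> (\<lambda>x. a x + b x) \<in> flat_span p"

lemma has_derivative_flat_comp:
  assumes "smooth (\<lambda>x. complex_of_real (p x))"
  shows "((\<lambda>x. complex_of_real (flat P (p x))) has_derivative
    (\<lambda>v. of_real (flat (pCons 0 (pCons 0 (P - pderiv P))) (p x)) *
       frechet_derivative (\<lambda>x. complex_of_real (p x)) (at x) v)) (at x)"
    (is "(_ has_derivative (\<lambda>v. of_real ?c * ?D v)) _")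
proof -
  note d = has_derivative_frechet[OF smooth_differentiable[OF assms], of x]
  have e: "of_real (Re (?D v)) = ?D v" for v
  proof -
    have "((\<lambda>x. Im (complex_of_real (p x))) has_derivative (\<lambda>v. Im (?D v))) (at x)"
      by (rule has_derivative_Im[OF d])
    then have "(\<lambda>v. Im (?D v)) = (\<lambda>v. 0)"
      using has_derivative_unique[OF _ has_derivative_const[of 0]] by simp
    then show ?thesis by (simp add: complex_eq_iff fun_eq_iff)
  qed
  have "(p has_derivative (\<lambda>v. Re (?D v))) (at x)"
    using has_derivative_Re[OF d] by simp
  from has_derivative_compose[OF this flat_has_derivative[unfolded has_field_derivative_def]]
  have "((\<lambda>x. flat P (p x)) has_derivative (\<lambda>v. ?c * Re (?D v))) (at x)" by simp
  from has_derivative_of_real[OF this, where 'a=complex]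
  show ?thesis by (simp only: of_real_mult e)
qed

lemma smooth_flat_comp:
  fixes p :: "real^'n::finite \<Rightarrow> real"
  assumes p: "smooth (\<lambda>x. complex_of_real (p x))"
  shows "smooth (\<lambda>x. complex_of_real (flat P (p x)))"
proof (rule smooth_coinduct[where C = "flat_span p"])
  note df = has_derivative_flat_comp[OF p]
  have d0: "(\<lambda>x. complex_of_real (flat P (p x))) differentiable (at x)" for P x
    using df unfolding differentiable_def by blast
  show d: "h differentiable (at x)" if "h \<in> flat_span p" for h x
    using that
    by induction (auto intro!: differentiable_add differentiable_mult d0 intro: smooth_differentiable)
  show "partial i h \<in> flat_span p" if "h \<in> flat_span p" for h i
    using that
  proof induction
    case (flat g P)
    have "partial i (\<lambda>x. of_real (flat P (p x)) * g x) = (\<lambda>x. of_real (flat P (p x)) * partial i g x +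
        of_real (flat (pCons 0 (pCons 0 (P - pderiv P))) (p x)) *
          (partial i (\<lambda>x. complex_of_real (p x)) x * g x))"
      by (rule ext, subst partial_mult[OF d0 smooth_differentiable[OF flat]],
          subst partial_eqI[OF df]) (simp add: partial_def)
    then show ?case
      by (simp only:) (intro flat_span.intros smooth_mult smooth_partial flat p)
  next
    case (add a b)
    then have "partial i (\<lambda>x. a x + b x) = (\<lambda>x. partial i a x + partial i b x)"
      by (auto intro!: partial_add d)
    with add show ?case by (simp add: flat_span.intros)
  qed
  show "(\<lambda>x. complex_of_real (flat P (p x))) \<in> flat_span p"
    using flat_span.flat[OF smooth_const[of 1], of P p] by simp
qed

definition cutoff :: "real \<Rightarrow> real" where "cutoff = flat 1"

lemma cutoff_bounds: "0 \<le> cutoff x" "cutoff x \<le> 1"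
  by (auto simp: cutoff_def flat_def)

lemma cutoff_nonpos: "x \<le> 0 \<Longrightarrow> cutoff x = 0"
  by (simp add: cutoff_def flat_def)

lemma smooth_cutoff_comp: "smooth (\<lambda>x. complex_of_real (p x)) \<Longrightarrow>
    smooth (\<lambda>x. complex_of_real (cutoff (p x)))"
  unfolding cutoff_def by (rule smooth_flat_comp)

lemma cutoff_tendsto_1:
  assumes "filterlim f at_top F"
  shows "((\<lambda>n. cutoff (f n)) \<longlongrightarrow> 1) F"
proof -
  have "((\<lambda>n. exp (- inverse (f n))) \<longlongrightarrow> exp (- 0)) F"
    by (intro tendsto_intros tendsto_inverse_0_at_top assms)
  moreover have "eventually (\<lambda>n. f n > 0) F"
    using assms filterlim_at_top_dense by blast
  ultimately show ?thesis
    by (auto intro!: Lim_transform_eventually[of "\<lambda>n. exp (- inverse (f n))"]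
        elim!: eventually_mono simp: cutoff_def flat_def divide_inverse)
qed

lemma filterlim_square_linear:
  fixes a b :: real
  assumes "a > 0"
  shows "filterlim (\<lambda>n. (real n)\<^sup>2 * a + b * real n) at_top sequentially"
  using assms by real_asymp

text \<open>The summand \<open>real n\<close> decides the boundary case: at \<open>x = a\<close> the argument still tends to infinity, so the
  limit is the indicator of the closed half-line.\<close>

lemma cutoff_halfspace_tendsto:
  "(\<lambda>n. cutoff ((real n)\<^sup>2 * (a - x) + real n)) \<longlonglongrightarrow> (if x \<le> a then 1 else 0)"
proof (cases "x \<le> a")
  case True
  have "filterlim (\<lambda>n. (real n)\<^sup>2 * (a - x) + real n) at_top sequentially"
    by (rule filterlim_at_top_mono[OF filterlim_real_sequentially]) (use True in auto)
  with True show ?thesis using cutoff_tendsto_1 by auto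
next
  case False
  then have "filterlim (\<lambda>n. (real n)\<^sup>2 * (x - a) + (-1) * real n) at_top sequentially"
    by (intro filterlim_square_linear) auto
  then have "eventually (\<lambda>n. (real n)\<^sup>2 * (x - a) + (-1) * real n > 0) sequentially"
    by (simp only: filterlim_at_top_dense)
  then have "eventually (\<lambda>n. 0 = cutoff ((real n)\<^sup>2 * (a - x) + real n)) sequentially"
    by eventually_elim (rule cutoff_nonpos[symmetric], simp add: algebra_simps)
  then show ?thesis using False by (auto intro: Lim_transform_eventually[OF tendsto_const])
qed

section \<open>Dense subspaces of weighted square-integrable functions\<close>

text \<open>A criterion for density in \<open>L\<^sub>2\<close> of a finite measure: it suffices to reach the indicators of the orthants
  \<open>{..a}\<close> by bounded pointwise limits, since the orthants generate the Borel sets.  It is used for the test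
  functions on a ball and for the trigonometric polynomials on the torus.\<close>

locale L2_dense =
  fixes M :: "(real^'n::finite) measure" and D :: "'n fn set"
  assumes finite_M: "finite_measure M" and sets_M [simp, measurable_cong]: "sets M = sets borel"
    and D_zero: "(\<lambda>x. 0) \<in> D"
    and D_add: "\<And>u v. u \<in> D \<Longrightarrow> v \<in> D \<Longrightarrow> (\<lambda>x. u x + v x) \<in> D"
    and D_scale: "\<And>u c. u \<in> D \<Longrightarrow> (\<lambda>x. c * u x) \<in> D"
    and D_meas: "\<And>u. u \<in> D \<Longrightarrow> u \<in> borel_measurable borel"
    and D_orthant: "\<And>a. \<exists>u B. (\<forall>n::nat. u n \<in> D \<and> (\<forall>x. cmod (u n x) \<le> B)) \<and>
        (AE x in M. (\<lambda>n. u n x) \<longlonglongrightarrow> indicator {..a} x)"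
begin

definition approximable :: "'n fn \<Rightarrow> bool" where
  "approximable f \<longleftrightarrow> f \<in> borel_measurable borel \<and>
     (\<forall>e>0. \<exists>u\<in>D. (\<integral>\<^sup>+x. ennreal ((cmod (f x - u x))\<^sup>2) \<partial>M) < ennreal e)"

lemma space_M [simp]: "space M = UNIV"
  using sets_eq_imp_space_eq[OF sets_M] by simp

lemma nn_integral_sum_squares_le:
  assumes [measurable]: "f \<in> borel_measurable borel" "g \<in> borel_measurable borel"
    and "\<And>x. cmod (h x) \<le> cmod (f x) + cmod (g x)"
  shows "(\<integral>\<^sup>+x. ennreal ((cmod (h x))\<^sup>2) \<partial>M) \<le>
    2 * (\<integral>\<^sup>+x. ennreal ((cmod (f x))\<^sup>2) \<partial>M) + 2 * (\<integral>\<^sup>+x. ennreal ((cmod (g x))\<^sup>2) \<partial>M)"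
proof -
  have "(cmod (h x))\<^sup>2 \<le> 2 * (cmod (f x))\<^sup>2 + 2 * (cmod (g x))\<^sup>2" for x
  proof -
    have "(cmod (h x))\<^sup>2 \<le> (cmod (f x) + cmod (g x))\<^sup>2"
      by (intro power_mono assms) auto
    also have "\<dots> \<le> 2 * (cmod (f x))\<^sup>2 + 2 * (cmod (g x))\<^sup>2"
      using sum_squares_bound[of "cmod (f x)" "cmod (g x)"] by (simp add: power2_sum)
    finally show ?thesis .
  qed
  then have "(\<integral>\<^sup>+x. ennreal ((cmod (h x))\<^sup>2) \<partial>M) \<le>
      (\<integral>\<^sup>+x. 2 * ennreal ((cmod (f x))\<^sup>2) + 2 * ennreal ((cmod (g x))\<^sup>2) \<partial>M)"
    by (intro nn_integral_mono)
      (simp add: ennreal_mult'[symmetric] ennreal_plus[symmetric] del: ennreal_plus ennreal_numeral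
         flip: ennreal_numeral)
  also have "\<dots> = 2 * (\<integral>\<^sup>+x. ennreal ((cmod (f x))\<^sup>2) \<partial>M) + 2 * (\<integral>\<^sup>+x. ennreal ((cmod (g x))\<^sup>2) \<partial>M)"
    by (simp add: nn_integral_add nn_integral_cmult)
  finally show ?thesis .
qed

lemma approximable_limit:
  assumes f: "f \<in> borel_measurable borel"
    and "\<And>e. e > 0 \<Longrightarrow> \<exists>g. approximable g \<and> (\<integral>\<^sup>+x. ennreal ((cmod (f x - g x))\<^sup>2) \<partial>M) < ennreal e"
  shows "approximable f"
  unfolding approximable_def
proof (intro conjI allI impI f)
  fix e :: real assume e: "e > 0"
  obtain g where g: "approximable g" "(\<integral>\<^sup>+x. ennreal ((cmod (f x - g x))\<^sup>2) \<partial>M) < ennreal (e/4)"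
    using assms(2)[of "e/4"] e by auto
  then obtain u where u: "u \<in> D" "(\<integral>\<^sup>+x. ennreal ((cmod (g x - u x))\<^sup>2) \<partial>M) < ennreal (e/4)"
    using e unfolding approximable_def by (meson divide_pos_pos zero_less_numeral)
  have [measurable]: "g \<in> borel_measurable borel" "u \<in> borel_measurable borel"
    using g(1) u(1) D_meas by (auto simp: approximable_def)
  have "(\<integral>\<^sup>+x. ennreal ((cmod (f x - u x))\<^sup>2) \<partial>M) \<le>
      2 * (\<integral>\<^sup>+x. ennreal ((cmod (f x - g x))\<^sup>2) \<partial>M) + 2 * (\<integral>\<^sup>+x. ennreal ((cmod (g x - u x))\<^sup>2) \<partial>M)"
  proof (intro nn_integral_sum_squares_le)
    show "cmod (f x - u x) \<le> cmod (f x - g x) + cmod (g x - u x)" for x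
      using norm_triangle_ineq[of "f x - g x" "g x - u x"] by simp
  qed (use f in measurable)
  also have "\<dots> < 2 * ennreal (e/4) + 2 * ennreal (e/4)"
    by (intro add_strict_mono ennreal_mult_strict_left_mono g u) auto
  also have "\<dots> = ennreal e"
    using e by (simp add: ennreal_mult'[symmetric] ennreal_plus[symmetric] del: ennreal_plus ennreal_numeral
         flip: ennreal_numeral)
  finally show "\<exists>u\<in>D. (\<integral>\<^sup>+x. ennreal ((cmod (f x - u x))\<^sup>2) \<partial>M) < ennreal e"
    using u(1) by blast
qed

lemma approximable_D: "u \<in> D \<Longrightarrow> approximable u"
  unfolding approximable_def by (auto intro!: bexI[of _ u] D_meas)

lemma approximable_add:
  assumes "approximable f" "approximable g"
  shows "approximable (\<lambda>x. f x + g x)"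
proof -
  have [measurable]: "f \<in> borel_measurable borel" "g \<in> borel_measurable borel"
    using assms by (auto simp: approximable_def)
  show ?thesis
  proof (rule approximable_limit)
    fix e :: real assume e: "e > 0"
    then have "e / 4 > 0" by simp
    then obtain u v where uv: "u \<in> D" "v \<in> D"
      "(\<integral>\<^sup>+x. ennreal ((cmod (f x - u x))\<^sup>2) \<partial>M) < ennreal (e/4)"
      "(\<integral>\<^sup>+x. ennreal ((cmod (g x - v x))\<^sup>2) \<partial>M) < ennreal (e/4)"
      using assms unfolding approximable_def by meson
    have [measurable]: "u \<in> borel_measurable borel" "v \<in> borel_measurable borel"
      using uv D_meas by auto
    have "(\<integral>\<^sup>+x. ennreal ((cmod ((f x + g x) - (u x + v x)))\<^sup>2) \<partial>M) \<le>
        2 * (\<integral>\<^sup>+x. ennreal ((cmod (f x - u x))\<^sup>2) \<partial>M) + 2 * (\<integral>\<^sup>+x. ennreal ((cmod (g x - v x))\<^sup>2) \<partial>M)"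
    proof (intro nn_integral_sum_squares_le)
      show "cmod ((f x + g x) - (u x + v x)) \<le> cmod (f x - u x) + cmod (g x - v x)" for x
        using norm_triangle_ineq[of "f x - u x" "g x - v x"] by (simp add: algebra_simps)
    qed measurable
    also have "\<dots> < 2 * ennreal (e/4) + 2 * ennreal (e/4)"
      by (intro add_strict_mono ennreal_mult_strict_left_mono uv) auto
    also have "\<dots> = ennreal e"
      using e by (simp add: ennreal_mult'[symmetric] ennreal_plus[symmetric] del: ennreal_plus ennreal_numeral
           flip: ennreal_numeral)
    finally show "\<exists>g'. approximable g' \<and> (\<integral>\<^sup>+x. ennreal ((cmod (f x + g x - g' x))\<^sup>2) \<partial>M) < ennreal e"
      using approximable_D[OF D_add[OF uv(1,2)]] by blast
  qed measurable
qed

lemma approximable_scale: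
  assumes "approximable f"
  shows "approximable (\<lambda>x. c * f x)"
proof (cases "c = 0")
  case True
  then show ?thesis using approximable_D[OF D_zero] by simp
next
  case False
  have [measurable]: "f \<in> borel_measurable borel"
    using assms by (auto simp: approximable_def)
  show ?thesis
  proof (rule approximable_limit)
    fix e :: real assume e: "e > 0"
    with False have "e / (cmod c)\<^sup>2 > 0" by simp
    then obtain u where u: "u \<in> D"
      "(\<integral>\<^sup>+x. ennreal ((cmod (f x - u x))\<^sup>2) \<partial>M) < ennreal (e / (cmod c)\<^sup>2)"
      using assms unfolding approximable_def by meson
    have [measurable]: "u \<in> borel_measurable borel"
      using u D_meas by auto
    have "(\<integral>\<^sup>+x. ennreal ((cmod (c * f x - c * u x))\<^sup>2) \<partial>M) =
        (\<integral>\<^sup>+x. ennreal ((cmod c)\<^sup>2) * ennreal ((cmod (f x - u x))\<^sup>2) \<partial>M)"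
      by (simp add: right_diff_distrib[symmetric] norm_mult power_mult_distrib ennreal_mult')
    also have "\<dots> = ennreal ((cmod c)\<^sup>2) * (\<integral>\<^sup>+x. ennreal ((cmod (f x - u x))\<^sup>2) \<partial>M)"
      by (simp add: nn_integral_cmult)
    also have "\<dots> < ennreal ((cmod c)\<^sup>2) * ennreal (e / (cmod c)\<^sup>2)"
      using False by (intro ennreal_mult_strict_left_mono u) auto
    also have "\<dots> = ennreal e"
      using e False by (simp add: ennreal_mult'[symmetric])
    finally show "\<exists>g. approximable g \<and> (\<integral>\<^sup>+x. ennreal ((cmod (c * f x - g x))\<^sup>2) \<partial>M) < ennreal e"
      using approximable_D[OF D_scale[OF u(1)]] by blast
  qed measurable
qed

lemma approximable_sum:
  "(\<And>i. i \<in> I \<Longrightarrow> approximable (f i)) \<Longrightarrow> approximable (\<lambda>x. \<Sum>i\<in>I. f i x)"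
  by (induction I rule: infinite_finite_induct) (simp_all add: approximable_add approximable_D[OF D_zero])

lemma approximable_dominated:
  assumes [measurable]: "f \<in> borel_measurable borel" and g: "\<And>n::nat. approximable (g n)"
    and w [measurable]: "w \<in> borel_measurable borel" "(\<integral>\<^sup>+x. ennreal ((w x)\<^sup>2) \<partial>M) < \<infinity>"
    and bd: "\<And>n x. cmod (g n x) \<le> w x"
    and lim: "AE x in M. (\<lambda>n. g n x) \<longlonglongrightarrow> f x"
  shows "approximable f"
proof (rule approximable_limit)
  have [measurable]: "g n \<in> borel_measurable borel" for n
    using g by (auto simp: approximable_def)
  have "(\<lambda>n. \<integral>\<^sup>+x. ennreal ((cmod (f x - g n x))\<^sup>2) \<partial>M) \<longlonglongrightarrow> (\<integral>\<^sup>+x. 0 \<partial>M)"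
  proof (rule nn_integral_dominated_convergence[where w = "\<lambda>x. 4 * ennreal ((w x)\<^sup>2)"])
    show "AE x in M. ennreal ((cmod (f x - g n x))\<^sup>2) \<le> 4 * ennreal ((w x)\<^sup>2)" for n
      using lim
    proof eventually_elim
      case (elim x)
      have "cmod (f x) \<le> w x"
        by (rule tendsto_le[OF _ tendsto_const tendsto_norm[OF elim]]) (auto simp: bd)
      then have "cmod (f x - g n x) \<le> 2 * w x"
        using bd[of n x] norm_triangle_ineq4[of "f x" "g n x"] by simp
      then have "(cmod (f x - g n x))\<^sup>2 \<le> (2 * w x)\<^sup>2" by (intro power_mono) auto
      then have "ennreal ((cmod (f x - g n x))\<^sup>2) \<le> ennreal (4 * (w x)\<^sup>2)"
        by (intro ennreal_leI) (simp add: power_mult_distrib)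
      then show ?case by (simp add: ennreal_mult)
    qed
    show "AE x in M. (\<lambda>n. ennreal ((cmod (f x - g n x))\<^sup>2)) \<longlonglongrightarrow> 0"
      using lim
    proof eventually_elim
      case (elim x)
      have "(\<lambda>n. ennreal ((cmod (f x - g n x))\<^sup>2)) \<longlonglongrightarrow> ennreal ((cmod (f x - f x))\<^sup>2)"
        by (intro tendsto_intros elim)
      then show ?case by simp
    qed
    show "(\<integral>\<^sup>+x. 4 * ennreal ((w x)\<^sup>2) \<partial>M) < \<infinity>"
      using w(2) by (simp add: nn_integral_cmult ennreal_mult_less_top)
  qed measurable
  then have lim0: "(\<lambda>n. \<integral>\<^sup>+x. ennreal ((cmod (f x - g n x))\<^sup>2) \<partial>M) \<longlonglongrightarrow> 0" by simp
  fix e :: real assume "e > 0"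
  then have "eventually (\<lambda>n. (\<integral>\<^sup>+x. ennreal ((cmod (f x - g n x))\<^sup>2) \<partial>M) < ennreal e) sequentially"
    using order_tendstoD(2)[OF lim0] by simp
  then show "\<exists>g. approximable g \<and> (\<integral>\<^sup>+x. ennreal ((cmod (f x - g x))\<^sup>2) \<partial>M) < ennreal e"
    using g by (meson eventually_sequentially order_refl)
qed measurable

lemma approximable_bounded_limit:
  assumes "f \<in> borel_measurable borel" "\<And>n::nat. approximable (g n)"
    and "\<And>n x. cmod (g n x) \<le> B"
    and "AE x in M. (\<lambda>n. g n x) \<longlonglongrightarrow> f x"
  shows "approximable f"
proof (rule approximable_dominated[where w = "\<lambda>x. B" and g = g])
  interpret finite_measure M by (rule finite_M)
  show "(\<integral>\<^sup>+x. ennreal (B\<^sup>2) \<partial>M) < \<infinity>"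
    using emeasure_finite[of UNIV] by (simp add: ennreal_mult_eq_top_iff less_top[symmetric])
qed (use assms in auto)

lemma approximable_indicator_UNIV: "approximable (\<lambda>x. 1)"
proof (rule approximable_bounded_limit[where B = 1])
  have a: "approximable (indicator {..a})" for a
  proof -
    obtain u B where u: "\<And>n::nat. u n \<in> D" "\<And>n x. cmod (u n x) \<le> B"
      "AE x in M. (\<lambda>n. u n x) \<longlonglongrightarrow> indicator {..a} x" using D_orthant by meson
    show ?thesis
      by (rule approximable_bounded_limit[OF _ approximable_D[OF u(1)] u(2,3)]) simp
  qed
  show "approximable (indicator {..(\<chi> i. real n)})" for n by (rule a)
  show "AE x in M. (\<lambda>n. indicator {..(\<chi> i. real n)} x :: complex) \<longlonglongrightarrow> 1"
  proof (rule AE_I2)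
    fix x :: "real^'n"
    obtain N :: nat where N: "norm x \<le> real N" using real_arch_simple by blast
    have "x \<in> {..(\<chi> i. real n)}" if "n \<ge> N" for n
      using that N component_le_norm_cart[of x] by (auto simp: less_eq_vec_def abs_le_iff)
        (meson abs_ge_self of_nat_mono order_trans)
    then have "eventually (\<lambda>n. 1 = (indicator {..(\<chi> i. real n)} x :: complex)) sequentially"
      unfolding eventually_sequentially indicator_def by (intro exI[of _ N]) simp
    then show "(\<lambda>n. indicator {..(\<chi> i. real n)} x :: complex) \<longlonglongrightarrow> 1"
      by (rule Lim_transform_eventually[OF tendsto_const])
  qed
qed (auto simp: indicator_def)

text \<open>The orthants are closed under intersection, and the sets with approximable indicator form a Dynkin
  system.\<close>

lemma approximable_indicator:
  assumes "A \<in> sets borel"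
  shows "approximable (indicator A)"
proof -
  let ?G = "range (\<lambda>a::real^'n. {..a})"
  have G: "sets borel = sigma_sets UNIV ?G"
    unfolding borel_eq_atMost by simp
  have "Int_stable ?G"
  proof (intro Int_stableI, elim rangeE)
    fix A B and a b :: "real^'n" assume "A = {..a}" "B = {..b}"
    then have "A \<inter> B = {..inf a b}" by auto
    then show "A \<inter> B \<in> ?G" by simp
  qed
  moreover have "?G \<subseteq> Pow UNIV" by simp
  moreover have "A \<in> sigma_sets UNIV ?G" using assms G by simp
  ultimately show ?thesis
  proof (induction rule: sigma_sets_induct_disjoint)
    case (basic A)
    then obtain a where A: "A = {..a}" by auto
    obtain u B where u: "\<And>n::nat. u n \<in> D" "\<And>n x. cmod (u n x) \<le> B"
      "AE x in M. (\<lambda>n. u n x) \<longlonglongrightarrow> indicator {..a} x" using D_orthant by meson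
    show ?case unfolding A
      by (rule approximable_bounded_limit[OF _ approximable_D[OF u(1)] u(2,3)]) simp
  next
    case empty
    then show ?case using approximable_D[OF D_zero] by (simp add: indicator_def)
  next
    case (compl A)
    have "indicator (UNIV - A) = (\<lambda>x. 1 + (-1) * indicator A x :: complex)"
      by (auto simp: indicator_def)
    then show ?case
      using approximable_add[OF approximable_indicator_UNIV approximable_scale[OF compl(2), of "-1"]]
      by simp
  next
    case (union A)
    have m: "A i \<in> sets borel" for i using union(2) G by auto
    show ?case
    proof (rule approximable_bounded_limit[where B = 1])
      show "approximable (\<lambda>x. \<Sum>i<n. indicator (A i) x)" for n
        by (intro approximable_sum union)
      show "indicator (\<Union>i. A i) \<in> borel_measurable borel"
        using m by (intro borel_measurable_indicator) auto
      have e: "(\<Sum>i<n. indicator (A i) x) = (indicator (\<Union>i<n. A i) x :: complex)" for n x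
        using union(1) by (subst indicator_UN_disjoint)
          (auto simp: disjoint_family_on_def)
      show "cmod (\<Sum>i<n. indicator (A i) x) \<le> 1" for n x
        unfolding e by (simp add: indicator_def)
      show "AE x in M. (\<lambda>n. \<Sum>i<n. indicator (A i) x :: complex) \<longlonglongrightarrow> indicator (\<Union>i. A i) x"
        unfolding e by (intro AE_I2 LIMSEQ_indicator_UN)
    qed
  qed
qed

proposition approximable_L2:
  assumes [measurable]: "f \<in> borel_measurable borel"
    and f2: "(\<integral>\<^sup>+x. ennreal ((cmod (f x))\<^sup>2) \<partial>M) < \<infinity>"
  shows "approximable f"
proof -
  have fM: "f \<in> borel_measurable M" by measurable
  obtain s where s: "\<And>i. simple_function M (s i)" "\<And>x. (\<lambda>i. s i x) \<longlonglongrightarrow> f x"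
    "\<And>i x. cmod (s i x) \<le> 2 * cmod (f x)"
    using borel_measurable_implies_sequence_metric[OF fM, of 0] by auto
  show ?thesis
  proof (rule approximable_dominated[where g = s and w = "\<lambda>x. 2 * cmod (f x)"])
    show "approximable (s i)" for i
    proof -
      have "s i = (\<lambda>x. \<Sum>y\<in>range (s i). y * indicator (s i -` {y}) x)"
      proof
        fix x
        have "x \<in> space M" by simp
        from simple_function_indicator_representation_banach[OF s(1)[of i] this]
        have "s i x = (\<Sum>y\<in>range (s i). indicator (s i -` {y}) x *\<^sub>R y)"
          unfolding space_M Int_UNIV_right .
        then show "s i x = (\<Sum>y\<in>range (s i). y * indicator (s i -` {y}) x)"
          by (rule trans) (intro sum.cong refl, simp add: indicator_def)
      qed
      moreover have "approximable (\<lambda>x. \<Sum>y\<in>range (s i). y * indicator (s i -` {y}) x)"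
      proof (intro approximable_sum approximable_scale approximable_indicator)
        fix y
        show "s i -` {y} \<in> sets borel"
          using simple_functionD(2)[OF s(1)[of i], of "{y}"] by simp
      qed
      ultimately show ?thesis by simp
    qed
    have "(\<integral>\<^sup>+x. ennreal ((2 * cmod (f x))\<^sup>2) \<partial>M) = 4 * (\<integral>\<^sup>+x. ennreal ((cmod (f x))\<^sup>2) \<partial>M)"
      by (simp add: power_mult_distrib ennreal_mult nn_integral_cmult)
    then show "(\<integral>\<^sup>+x. ennreal ((2 * cmod (f x))\<^sup>2) \<partial>M) < \<infinity>"
      using f2 by (simp add: ennreal_mult_less_top)
  qed (use s in auto)
qed

corollary dense_L2:
  assumes "f \<in> borel_measurable borel" "(\<integral>\<^sup>+x. ennreal ((cmod (f x))\<^sup>2) \<partial>M) < \<infinity>" "e > 0"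
  shows "\<exists>u\<in>D. (\<integral>\<^sup>+x. ennreal ((cmod (f x - u x))\<^sup>2) \<partial>M) < ennreal e"
  using approximable_L2[OF assms(1,2)] assms(3) unfolding approximable_def by blast

end

section \<open>Testing an almost everywhere bound\<close>

lemma le_one_plus_square: "(t::real) \<le> 1 + t\<^sup>2"
proof (cases "t \<ge> 0")
  case True
  have "2 * t \<le> 1 + t\<^sup>2" using sum_squares_bound[of 1 t] by simp
  with True show ?thesis by linarith
next
  case False
  have "0 \<le> t\<^sup>2" by simp
  with False show ?thesis by linarith
qed

lemma smooth_of_real_norm_diff_square:
  "smooth (\<lambda>x::real^'n::finite. complex_of_real ((norm (x - c))\<^sup>2))"
proof -
  have e: "complex_of_real ((norm (x - c))\<^sup>2) =
      (\<Sum>i\<in>UNIV. (of_real (x $ i) + - of_real (c $ i)) * (of_real (x $ i) + - of_real (c $ i)))" for x :: "real^'n"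
    unfolding power2_norm_eq_inner inner_vec_def by simp
  show ?thesis unfolding e
    by (intro smooth_sum smooth_mult smooth_add smooth_coordinate smooth_const)
qed

lemma emeasure_density_indicator_UNIV:
  "A \<in> sets M \<Longrightarrow> emeasure (density M (indicator A)) (space M) = emeasure M A"
  by (subst emeasure_density) (auto cong: nn_integral_cong)

text \<open>The indicator of an orthant is the limit of products of half-line cut-offs in the coordinates; a further
  factor, which tends to \<open>1\<close> on the ball, gives them compact support there.\<close>

lemma test_functions_L2_dense:
  fixes c :: "real^'n::finite"
  assumes r: "r > 0"
  shows "L2_dense (density lborel (indicator (ball c r))) (test_functions (ball c r))"
proof (rule L2_dense.intro)
  show "finite_measure (density lborel (indicator (ball c r)))"
    by (rule finite_measureI)
      (use emeasure_bounded_finite[of "ball c r"] in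
        \<open>simp add: emeasure_density_indicator_UNIV[of "ball c r" lborel, simplified]\<close>)
  fix a :: "real^'n"
  define p where "p = (\<lambda>n x. (real n)\<^sup>2 * (r\<^sup>2 - (norm (x - c))\<^sup>2) + (-1) * real n)"
  define u where "u = (\<lambda>n x. complex_of_real (\<Prod>i\<in>UNIV. cutoff ((real n)\<^sup>2 * (a $ i - x $ i) + real n)) *
    complex_of_real (cutoff (p n x)))"
  have "u n \<in> test_functions (ball c r)" for n
  proof (rule test_functionsI)
    have 1: "smooth (\<lambda>x::real^'n. complex_of_real ((real n)\<^sup>2 * (a $ i - x $ i) + real n))" for i
    proof -
      have "complex_of_real ((real n)\<^sup>2 * (a $ i - x $ i) + real n) =
        of_real (real n ^ 2 * a $ i + real n) + of_real (- (real n)\<^sup>2) * of_real (x $ i)" for x :: "real^'n"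
        by (simp add: algebra_simps)
      then show ?thesis by (simp only:) (intro smooth_add smooth_mult smooth_const smooth_coordinate)
    qed
    have 2: "smooth (\<lambda>x::real^'n. complex_of_real (p n x))"
    proof -
      have "complex_of_real (p n x) =
        of_real (real n ^ 2 * r\<^sup>2 - real n) + of_real (- (real n)\<^sup>2) * of_real ((norm (x - c))\<^sup>2)" for x :: "real^'n"
        by (simp add: p_def algebra_simps)
      then show ?thesis
        by (simp only:) (intro smooth_add smooth_mult smooth_const smooth_of_real_norm_diff_square)
    qed
    show "smooth (u n)"
      unfolding u_def of_real_prod by (intro smooth_mult smooth_prod smooth_cutoff_comp 1 2)
    let ?K = "{x. real n * (norm (x - c))\<^sup>2 \<le> real n * r\<^sup>2 - 1 \<and> n > 0}"
    show "{x. u n x \<noteq> 0} \<subseteq> ?K"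
    proof safe
      fix x assume "u n x \<noteq> 0"
      then have "cutoff (p n x) \<noteq> 0" by (auto simp: u_def)
      then have p: "p n x > 0" using cutoff_nonpos[of "p n x"] by linarith
      then show n: "n > 0" by (intro gr0I) (simp add: p_def)
      have "0 < real n * (real n * (r\<^sup>2 - (norm (x - c))\<^sup>2) - 1)"
        using p by (simp add: p_def power2_eq_square algebra_simps)
      with n have "0 < real n * (r\<^sup>2 - (norm (x - c))\<^sup>2) - 1"
        by (simp only: zero_less_mult_iff of_nat_0_less_iff) linarith
      then show "real n * (norm (x - c))\<^sup>2 \<le> real n * r\<^sup>2 - 1"
        by (simp add: algebra_simps)
    qed
    show K: "?K \<subseteq> ball c r"
    proof safe
      fix x assume "real n * (norm (x - c))\<^sup>2 \<le> real n * r\<^sup>2 - 1" "n > 0"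
      then have "real n * (norm (x - c))\<^sup>2 < real n * r\<^sup>2" by linarith
      then have "(norm (x - c))\<^sup>2 < r\<^sup>2" using \<open>n > 0\<close>
        by (simp only: mult_less_cancel_left_pos of_nat_0_less_iff)
      then show "x \<in> ball c r" using r by (simp add: dist_norm norm_minus_commute power2_less_imp_less)
    qed
    have "closed ?K"
    proof (cases "n > 0")
      case True
      then show ?thesis by (simp add: closed_Collect_le continuous_intros)
    qed simp
    then show "compact ?K"
      using K bounded_subset[OF bounded_ball] by (auto simp: compact_eq_bounded_closed)
  qed
  moreover have "cmod (u n x) \<le> 1" for n x
    unfolding u_def norm_mult norm_of_real
    by (intro mult_le_one) (auto simp: cutoff_bounds abs_prod intro!: prod_le_1)
  moreover have "AE x in density lborel (indicator (ball c r)). (\<lambda>n. u n x) \<longlonglongrightarrow> indicator {..a} x"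
  proof -
    have "(\<lambda>n. u n x) \<longlonglongrightarrow> indicator {..a} x" if "x \<in> ball c r" for x
    proof -
      have "(\<lambda>n. cutoff (p n x)) \<longlonglongrightarrow> 1"
        unfolding p_def
      proof (intro cutoff_tendsto_1 filterlim_square_linear)
        show "0 < r\<^sup>2 - (norm (x - c))\<^sup>2"
          using that by (simp add: dist_norm norm_minus_commute power_strict_mono)
      qed
      then have "(\<lambda>n. u n x) \<longlonglongrightarrow> of_real (\<Prod>i\<in>UNIV. if x $ i \<le> a $ i then 1 else 0) * of_real 1"
        unfolding u_def by (intro tendsto_mult tendsto_of_real tendsto_prod cutoff_halfspace_tendsto)
      moreover have "(\<Prod>i\<in>UNIV. if x $ i \<le> a $ i then 1 else 0 :: real) = indicator {..a} x"
        by (auto simp: indicator_def less_eq_vec_def)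
      ultimately show ?thesis by (cases "x \<le> a") (simp_all add: indicator_def)
    qed
    then show ?thesis
      by (subst AE_density, intro borel_measurable_indicator)
        (auto simp: indicator_def split: if_splits intro!: AE_I2)
  qed
  ultimately show "\<exists>u B. (\<forall>n::nat. u n \<in> test_functions (ball c r) \<and> (\<forall>x. cmod (u n x) \<le> B)) \<and>
        (AE x in density lborel (indicator (ball c r)). (\<lambda>n. u n x) \<longlonglongrightarrow> indicator {..a} x)"
    by blast
qed (auto intro: test_add test_mult[OF smooth_const] smooth_measurable[OF test_functionsD(1)])

text \<open>An \<open>L\<^sub>1\<close>-\<open>L\<^sub>\<infinity>\<close> duality: a pointwise bound is seen by pairing with test functions, because the
  unimodular function \<open>cnj (sgn v)\<close> on the exceptional set is a limit of test functions.\<close>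

lemma AE_bound_if_test_bound:
  fixes v :: "'n::finite fn" and W :: "real^'n \<Rightarrow> real"
  assumes r: "r > 0" and [measurable]: "v \<in> borel_measurable borel" "W \<in> borel_measurable borel"
    and v2: "set_integrable lborel (ball c r) (\<lambda>x. (cmod (v x))\<^sup>2)"
    and W0: "\<And>x. 0 \<le> W x" and WB: "\<And>x. x \<in> ball c r \<Longrightarrow> W x \<le> B"
    and bound: "\<And>u. u \<in> test_functions (ball c r) \<Longrightarrow>
      cmod (\<integral>x. v x * u x \<partial>lborel) \<le> (\<integral>x. W x * cmod (u x) \<partial>lborel)"
  shows "AE x in lborel. x \<in> ball c r \<longrightarrow> cmod (v x) \<le> W x"
proof -
  let ?b = "\<lambda>x. indicator (ball c r) x :: real"
  have [measurable]: "ball c r \<in> sets borel" by simp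
  define E where "E = {x \<in> ball c r. W x < cmod (v x)}"
  define a where "a = (\<lambda>x. indicator E x * cnj (sgn (v x)))"
  have E [measurable]: "E \<in> sets borel" unfolding E_def by measurable
  have "(\<lambda>x. cnj (sgn (v x))) \<in> borel_measurable borel"
  proof (rule measurable_compose[OF _ borel_measurable_continuous_onI[of cnj]])
    show "(\<lambda>x. sgn (v x)) \<in> borel_measurable borel" unfolding sgn_div_norm by measurable
  qed (intro continuous_on_cnj continuous_on_id)
  then have a_meas [measurable]: "a \<in> borel_measurable borel" unfolding a_def by measurable
  have a1: "cmod (a x) \<le> 1" for x
    by (simp add: a_def norm_mult indicator_def norm_sgn)
  have ib: "integrable lborel ?b"
    using emeasure_bounded_finite[of "ball c r"] by (simp add: less_top[symmetric])
  have iv2: "integrable lborel (\<lambda>x. ?b x * (cmod (v x))\<^sup>2)"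
    using v2 by (simp add: set_integrable_def)
  have iS: "integrable lborel (\<lambda>x. ?b x * (cmod (v x) + W x)\<^sup>2)"
  proof (rule Bochner_Integration.integrable_bound[of _ "\<lambda>x. 2 * (?b x * (cmod (v x))\<^sup>2) + ?b x * (2 * B\<^sup>2)"])
    show "integrable lborel (\<lambda>x. 2 * (?b x * (cmod (v x))\<^sup>2) + ?b x * (2 * B\<^sup>2))"
      by (intro Bochner_Integration.integrable_add integrable_mult_left integrable_mult_right ib iv2)
    have "(cmod (v x) + W x)\<^sup>2 \<le> 2 * (cmod (v x))\<^sup>2 + 2 * B\<^sup>2" if "x \<in> ball c r" for x
    proof -
      have "(W x)\<^sup>2 \<le> B\<^sup>2" using W0 WB[OF that] by (intro power_mono)
      then show ?thesis
        using sum_squares_bound[of "cmod (v x)" "W x"] by (simp add: power2_sum)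
    qed
    then show "AE x in lborel. norm (?b x * (cmod (v x) + W x)\<^sup>2) \<le>
        norm (2 * (?b x * (cmod (v x))\<^sup>2) + ?b x * (2 * B\<^sup>2))"
      by (auto simp: indicator_def)
  qed measurable
  define S where "S = (\<integral>x. ?b x * (cmod (v x) + W x)\<^sup>2 \<partial>lborel)"
  let ?f = "\<lambda>x. indicator E x * (cmod (v x) - W x)"
  have iEf: "integrable lborel ?f"
  proof (rule Bochner_Integration.integrable_bound[of _ "\<lambda>x. ?b x + ?b x * (cmod (v x) + W x)\<^sup>2"])
    show "integrable lborel (\<lambda>x. ?b x + ?b x * (cmod (v x) + W x)\<^sup>2)" by (intro Bochner_Integration.integrable_add ib iS)
    have "\<bar>cmod (v x) - W x\<bar> \<le> 1 + (cmod (v x) + W x)\<^sup>2" for x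
    proof -
      have "\<bar>cmod (v x) - W x\<bar> \<le> cmod (v x) + W x" using W0[of x] by (simp add: abs_le_iff)
      also have "\<dots> \<le> 1 + (cmod (v x) + W x)\<^sup>2"
        by (rule le_one_plus_square)
      finally show ?thesis .
    qed
    then show "AE x in lborel. norm (?f x) \<le> norm (?b x + ?b x * (cmod (v x) + W x)\<^sup>2)"
      using W0 by (intro AE_I2) (force simp: indicator_def E_def abs_le_iff)
  qed measurable
  have "(\<integral>x. ?f x \<partial>lborel) \<le> d * ((S + 1) / 2)" if d: "d > 0" for d
  proof -
    have "(\<integral>\<^sup>+x. ennreal ((cmod (a x))\<^sup>2) \<partial>density lborel (indicator (ball c r))) \<le>
        (\<integral>\<^sup>+x. 1 \<partial>density lborel (indicator (ball c r)))"
      using a1 by (intro nn_integral_mono) (simp add: power_le_one)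
    also have "\<dots> < \<infinity>"
      using emeasure_bounded_finite[of "ball c r"]
      by (simp add: emeasure_density_indicator_UNIV[of "ball c r" lborel, simplified])
    finally obtain u where u: "u \<in> test_functions (ball c r)"
      "(\<integral>\<^sup>+x. ennreal ((cmod (a x - u x))\<^sup>2) \<partial>density lborel (indicator (ball c r))) < ennreal (d\<^sup>2)"
      using L2_dense.dense_L2[OF test_functions_L2_dense[OF r] a_meas] d by (meson zero_less_power)
    have [measurable]: "u \<in> borel_measurable borel"
      using smooth_measurable[OF test_functionsD(1)[OF u(1)]] .
    have u0: "u x = 0" if "x \<notin> ball c r" for x
      using test_functionsD(3,4)[OF u(1)] that by blast
    have nn: "(\<integral>\<^sup>+x. ennreal (?b x * (cmod (a x - u x))\<^sup>2) \<partial>lborel) < ennreal (d\<^sup>2)"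
      using u(2) by (simp add: nn_integral_density ennreal_mult' ennreal_indicator)
    have iT: "integrable lborel (\<lambda>x. ?b x * (cmod (a x - u x))\<^sup>2)"
      using nn by (intro integrableI_nonneg) (auto simp: order.strict_trans)
    have T: "(\<integral>x. ?b x * (cmod (a x - u x))\<^sup>2 \<partial>lborel) \<le> d\<^sup>2"
      using nn d by (subst integral_eq_nn_integral) (auto simp: enn2real_leI)
    have ivu: "integrable lborel (\<lambda>x. v x * u x)"
    proof (rule integrable_mult_test[OF u(1)])
      fix K assume K: "compact K" "K \<subseteq> ball c r"
      then have [measurable]: "K \<in> sets borel" by (simp add: compact_imp_closed)
      show "set_integrable lborel K v" unfolding set_integrable_def
      proof (rule Bochner_Integration.integrable_bound[OF Bochner_Integration.integrable_add[OF ib iv2]])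
        have "cmod (v x) \<le> 1 + (cmod (v x))\<^sup>2" for x
          by (rule le_one_plus_square)
        then show "AE x in lborel. norm (indicator K x *\<^sub>R v x) \<le> norm (?b x + ?b x * (cmod (v x))\<^sup>2)"
          using K(2) by (intro AE_I2) (auto simp: indicator_def subset_iff)
      qed measurable
    qed
    have "integrable lborel (\<lambda>x. of_real (W x) * u x)"
    proof (rule integrable_mult_test[OF u(1)])
      fix K assume K: "compact K" "K \<subseteq> ball c r"
      then have [measurable]: "K \<in> sets borel" by (simp add: compact_imp_closed)
      show "set_integrable lborel K (\<lambda>x. complex_of_real (W x))" unfolding set_integrable_def
      proof (rule Bochner_Integration.integrable_bound[OF integrable_mult_left[OF ib, of B]])
        show "AE x in lborel. norm (indicator K x *\<^sub>R complex_of_real (W x)) \<le> norm (?b x * B)"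
        proof (intro AE_I2)
          fix x show "norm (indicator K x *\<^sub>R complex_of_real (W x)) \<le> norm (?b x * B)"
            using K(2) W0[of x] WB[of x] by (auto simp: indicator_def subset_iff)
        qed
      qed measurable
    qed
    from integrable_norm[OF this] have iWu: "integrable lborel (\<lambda>x. W x * cmod (u x))"
      using W0 by (simp add: norm_mult)
    have pw: "?f x \<le> Re (v x * u x) - W x * cmod (u x) +
        (d / 2 * (?b x * (cmod (v x) + W x)\<^sup>2) + 1 / (2 * d) * (?b x * (cmod (a x - u x))\<^sup>2))" for x
    proof (cases "x \<in> ball c r")
      case True
      have "?f x = Re (v x * a x) - W x * cmod (a x)"
      proof (cases "x \<in> E")
        case True
        then have "v x \<noteq> 0" using W0[of x] by (auto simp: E_def)
        moreover have "v x * cnj (sgn (v x)) = of_real (cmod (v x))"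
          using \<open>v x \<noteq> 0\<close> by (simp add: sgn_div_norm complex_norm_square[symmetric] scaleR_conv_of_real
              power2_eq_square flip: of_real_mult)
            (simp add: field_simps complex_norm_square[symmetric] power2_eq_square mult.assoc[symmetric])
        ultimately show ?thesis using True by (simp add: a_def norm_sgn)
      qed (simp add: a_def)
      also have "\<dots> = Re (v x * u x) + Re (v x * (a x - u x)) - W x * cmod (a x)"
        by (simp add: algebra_simps)
      also have "\<dots> \<le> Re (v x * u x) + cmod (v x) * cmod (a x - u x)
          - W x * (cmod (u x) - cmod (a x - u x))"
      proof -
        have "Re (v x * (a x - u x)) \<le> cmod (v x) * cmod (a x - u x)"
          by (metis complex_Re_le_cmod norm_mult)
        moreover have "W x * (cmod (u x) - cmod (a x - u x)) \<le> W x * cmod (a x)"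
          using norm_triangle_ineq2[of "u x" "a x"] W0[of x]
          by (intro mult_left_mono) (auto simp: norm_minus_commute)
        ultimately show ?thesis by linarith
      qed
      also have "\<dots> = Re (v x * u x) - W x * cmod (u x) + (cmod (v x) + W x) * cmod (a x - u x)"
        by (simp add: algebra_simps)
      \<comment> \<open>Young's inequality; only \<open>a - u\<close> is small, and only in \<open>L\<^sub>2\<close>.\<close>
      also have "(cmod (v x) + W x) * cmod (a x - u x) \<le>
          d / 2 * (cmod (v x) + W x)\<^sup>2 + 1 / (2 * d) * (cmod (a x - u x))\<^sup>2"
      proof -
        have "0 \<le> (d * (cmod (v x) + W x) - cmod (a x - u x))\<^sup>2 / (2 * d)" using d by simp
        also have "\<dots> = d / 2 * (cmod (v x) + W x)\<^sup>2 + 1 / (2 * d) * (cmod (a x - u x))\<^sup>2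
            - (cmod (v x) + W x) * cmod (a x - u x)"
          using d by (simp add: power2_diff power_mult_distrib field_simps) (simp add: power2_eq_square field_simps)
        finally show ?thesis by simp
      qed
      finally show ?thesis using True by simp
    next
      case False
      then show ?thesis by (simp add: u0 E_def)
    qed
    have "(\<integral>x. ?f x \<partial>lborel) \<le> (\<integral>x. Re (v x * u x) - W x * cmod (u x) +
        (d / 2 * (?b x * (cmod (v x) + W x)\<^sup>2) + 1 / (2 * d) * (?b x * (cmod (a x - u x))\<^sup>2)) \<partial>lborel)"
      by (intro integral_mono iEf Bochner_Integration.integrable_add Bochner_Integration.integrable_diff integrable_mult_right iS iT iWu
          integrable_Re ivu pw)
    also have "\<dots> = Re (\<integral>x. v x * u x \<partial>lborel) - (\<integral>x. W x * cmod (u x) \<partial>lborel) +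
        (d / 2 * S + 1 / (2 * d) * (\<integral>x. ?b x * (cmod (a x - u x))\<^sup>2 \<partial>lborel))"
      unfolding S_def integral_Re[OF ivu, symmetric] using iS iT iWu integrable_Re[OF ivu]
      by (simp del: times_complex.sel)
    also have "\<dots> \<le> 0 + (d / 2 * S + 1 / (2 * d) * d\<^sup>2)"
      using bound[OF u(1)] complex_Re_le_cmod[of "\<integral>x. v x * u x \<partial>lborel"] d T
      by (intro add_mono mult_left_mono) auto
    also have "\<dots> = d * ((S + 1) / 2)" using d by (simp add: power2_eq_square field_simps)
    finally show ?thesis .
  qed
  note small = this
  \<comment> \<open>Letting \<open>d\<close> tend to \<open>0\<close>.\<close>
  have S0: "S \<ge> 0" unfolding S_def by (intro integral_nonneg_AE) auto
  have "(\<integral>x. ?f x \<partial>lborel) \<le> 0"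
  proof (rule field_le_epsilon)
    fix e :: real assume "e > 0"
    then show "(\<integral>x. ?f x \<partial>lborel) \<le> 0 + e"
      using small[of "e / ((S + 1) / 2)"] S0 by simp
  qed
  moreover have f0: "0 \<le> ?f x" for x by (simp add: E_def indicator_def)
  ultimately have "(\<integral>x. ?f x \<partial>lborel) = 0"
    by (intro antisym integral_nonneg_AE AE_I2)
  then have "AE x in lborel. ?f x = 0"
    using integral_nonneg_eq_0_iff_AE[OF iEf] f0 by simp
  then show ?thesis
    by eventually_elim (auto simp: E_def indicator_def split: if_splits)
qed

section \<open>Changes of variables and product integrals\<close>

lemma lborel_affine_vec:
  fixes t :: "real^'n::finite"
  shows "c \<noteq> 0 \<Longrightarrow> lborel = density (distr lborel borel (\<lambda>x. t + c *\<^sub>R x)) (\<lambda>_. ennreal (\<bar>c\<bar> ^ CARD('n)))"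
  using lborel_affine[of c t] by simp

lemma nn_integral_affine:
  fixes f :: "real^'n::finite \<Rightarrow> ennreal"
  assumes [measurable]: "f \<in> borel_measurable borel" and c: "c \<noteq> 0"
  shows "(\<integral>\<^sup>+x. f x \<partial>lborel) = ennreal (\<bar>c\<bar> ^ CARD('n)) * (\<integral>\<^sup>+x. f (t + c *\<^sub>R x) \<partial>lborel)"
  using arg_cong[OF lborel_affine_vec[OF c, of t], of "\<lambda>M. integral\<^sup>N M f"]
  by (simp add: nn_integral_density nn_integral_distr nn_integral_cmult)

lemma integral_affine:
  fixes f :: "'n::finite fn"
  assumes [measurable]: "f \<in> borel_measurable borel" and c: "c \<noteq> 0"
  shows "(\<integral>x. f x \<partial>lborel) = of_real (\<bar>c\<bar> ^ CARD('n)) * (\<integral>x. f (t + c *\<^sub>R x) \<partial>lborel)"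
proof -
  have "(\<integral>x. f x \<partial>lborel) =
      integral\<^sup>L (density (distr lborel borel (\<lambda>x. t + c *\<^sub>R x)) (\<lambda>_. ennreal (\<bar>c\<bar> ^ CARD('n)))) f"
    by (rule arg_cong[OF lborel_affine_vec[OF c, of t], of "\<lambda>M. integral\<^sup>L M f"])
  also have "\<dots> = of_real (\<bar>c\<bar> ^ CARD('n)) * (\<integral>x. f (t + c *\<^sub>R x) \<partial>lborel)"
    by (subst integral_density) (simp_all add: integral_distr scaleR_conv_of_real[where 'a=complex])
  finally show ?thesis .
qed

lemma AE_affine:
  fixes P :: "real^'n::finite \<Rightarrow> bool"
  assumes "AE x in lborel. P x" and c: "c \<noteq> 0"
  shows "AE x in lborel. P (t + c *\<^sub>R x)"
proof -
  obtain N where N: "{x. \<not> P x} \<subseteq> N" "emeasure lborel N = 0" "N \<in> sets lborel"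
    using AE_E[OF assms(1)] by auto
  have [measurable]: "N \<in> sets borel" using N by simp
  have "(\<integral>\<^sup>+x. indicator N x \<partial>lborel) = ennreal (\<bar>c\<bar> ^ CARD('n)) * (\<integral>\<^sup>+x. indicator N (t + c *\<^sub>R x) \<partial>lborel)"
    by (rule nn_integral_affine) (use c in auto)
  then have "(\<integral>\<^sup>+x. indicator N (t + c *\<^sub>R x) \<partial>(lborel :: (real^'n) measure)) = 0"
    using N c by simp
  then have "AE x in lborel. indicator N (t + c *\<^sub>R x) = (0::ennreal)"
    by (subst (asm) nn_integral_0_iff_AE) auto
  then show ?thesis
    by eventually_elim (use N(1) in \<open>auto simp: indicator_def split: if_splits\<close>)
qed

lemma integral_translate:
  fixes f :: "'n::finite fn"
  assumes "f \<in> borel_measurable borel"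
  shows "(\<integral>x. f (x + a) \<partial>lborel) = (\<integral>x. f x \<partial>lborel)"
  using integral_affine[OF assms, of 1 a] by (simp add: add.commute)

lemma bij_axis_Basis: "bij_betw (\<lambda>i::'n::finite. axis i (1::real)) UNIV Basis"
  by (auto simp: bij_betw_def inj_on_def axis_eq_axis Basis_vec_def)

lemma
  fixes f :: "'n::finite \<Rightarrow> real \<Rightarrow> complex"
  assumes f: "\<And>i. integrable lborel (f i)"
  shows integrable_lborel_prod: "integrable lborel (\<lambda>x::real^'n. \<Prod>i\<in>UNIV. f i (x $ i))"
    and integral_lborel_prod: "(\<integral>x. (\<Prod>i\<in>UNIV. f i (x $ i)) \<partial>(lborel :: (real^'n) measure)) = (\<Prod>i\<in>UNIV. \<integral>x. f i x \<partial>lborel)"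
proof -
  define ix where "ix = the_inv_into UNIV (\<lambda>i::'n. axis i (1::real))"
  have ix: "ix (axis i 1) = i" for i
    unfolding ix_def by (rule the_inv_into_f_f) (auto simp: inj_on_def axis_eq_axis)
  interpret product_sigma_finite "\<lambda>b::real^'n. lborel::real measure" by standard
  let ?T = "\<lambda>y. \<Sum>b\<in>Basis. y b *\<^sub>R b :: real^'n"
  let ?P = "Pi\<^sub>M (Basis::(real^'n) set) (\<lambda>b. lborel::real measure)"
  have lb: "(lborel :: (real^'n) measure) = distr ?P borel ?T"
    by (subst lborel_def) (simp add: lborel_eq_real)
  have T [measurable]: "?T \<in> ?P \<rightarrow>\<^sub>M borel" by measurable
  have [measurable]: "f i \<in> borel_measurable borel" for i
    using borel_measurable_integrable[OF f[of i]] by simp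
  let ?F = "\<lambda>x::real^'n. \<Prod>i\<in>UNIV. f i (x $ i)"
  have F [measurable]: "?F \<in> borel_measurable borel" by measurable
  have e: "?F x = (\<Prod>b\<in>Basis. f (ix b) (x \<bullet> b))" for x
    by (subst prod.reindex_bij_betw[OF bij_axis_Basis, symmetric])
      (simp add: ix cart_eq_inner_axis)
  have e2: "?F (?T y) = (\<Prod>b\<in>Basis. f (ix b) (y b))" for y
    unfolding e by (intro prod.cong) simp_all
  have "integrable ?P (\<lambda>y. \<Prod>b\<in>Basis. f (ix b) (y b))"
    by (rule product_integrable_prod) (auto intro: f)
  then show "integrable lborel ?F"
    unfolding lb by (subst integrable_distr_eq[OF T F]) (simp only: e2)
  have "integral\<^sup>L lborel ?F = (\<integral>y. (\<Prod>b\<in>Basis. f (ix b) (y b)) \<partial>?P)"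
    unfolding lb by (subst integral_distr[OF T F]) (simp only: e2)
  also have "\<dots> = (\<Prod>b\<in>Basis. \<integral>x. f (ix b) x \<partial>lborel)"
    by (rule product_integral_prod) (auto intro: f)
  also have "\<dots> = (\<Prod>i\<in>UNIV. \<integral>x. f i x \<partial>lborel)"
    by (subst prod.reindex_bij_betw[OF bij_axis_Basis, symmetric]) (simp add: ix)
  finally show "integral\<^sup>L lborel ?F = (\<Prod>i\<in>UNIV. \<integral>x. f i x \<partial>lborel)" .
qed

text \<open>The function is dominated by the product of the one-dimensional functions \<open>1 / (1 + x\<^sub>i\<^sup>2)\<close>.\<close>

lemma integrable_inverse_one_plus_norm_power:
  "integrable lborel (\<lambda>x::real^'n::finite. 1 / (1 + norm x) ^ (2 * CARD('n)))"
proof -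
  have 1: "integrable lborel (\<lambda>x::real. complex_of_real (inverse (1 + x\<^sup>2)))"
  proof (rule integrable_of_real)
    show "integrable lborel (\<lambda>x::real. inverse (1 + x\<^sup>2))"
      using integrable_inverse_1_plus_square by (simp add: set_integrable_def)
  qed
  have 2: "integrable lborel (\<lambda>x::real^'n. \<Prod>i\<in>UNIV. complex_of_real (inverse (1 + (x $ i)\<^sup>2)))"
    using integrable_lborel_prod[of "\<lambda>_. \<lambda>x. complex_of_real (inverse (1 + x\<^sup>2))"] 1 by simp
  show ?thesis
  proof (rule Bochner_Integration.integrable_bound[OF 2])
    have "norm (1 / (1 + norm x) ^ (2 * CARD('n))) \<le> cmod (\<Prod>i\<in>UNIV. complex_of_real (inverse (1 + (x $ i)\<^sup>2)))"
      for x :: "real^'n"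
    proof -
      have "norm (1 / (1 + norm x) ^ (2 * CARD('n))) = (\<Prod>i\<in>(UNIV::'n set). inverse ((1 + norm x)\<^sup>2))"
        by (simp add: power_mult power_inverse divide_inverse)
      also have "\<dots> \<le> (\<Prod>i\<in>UNIV. inverse (1 + (x $ i)\<^sup>2))"
      proof (intro prod_mono conjI le_imp_inverse_le)
        fix i
        have "(x $ i)\<^sup>2 \<le> (norm x)\<^sup>2"
          using power_mono[OF component_le_norm_cart[of x i], of 2] by simp
        moreover have "0 \<le> 2 * norm x" by simp
        ultimately show "1 + (x $ i)\<^sup>2 \<le> (1 + norm x)\<^sup>2"
          unfolding power2_sum power_one mult_1_right by linarith
        show "0 < 1 + (x $ i)\<^sup>2" by (simp add: add_pos_nonneg)
      qed simp
      also have "\<dots> = cmod (\<Prod>i\<in>UNIV. complex_of_real (inverse (1 + (x $ i)\<^sup>2)))"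
        by (simp only: of_real_prod[symmetric] norm_of_real, subst abs_of_nonneg)
          (auto intro!: prod_nonneg)
      finally show ?thesis .
    qed
    then show "AE x in lborel. norm (1 / (1 + norm (x::real^'n)) ^ (2 * CARD('n))) \<le>
        cmod (\<Prod>i\<in>UNIV. complex_of_real (inverse (1 + (x $ i)\<^sup>2)))" by simp
  qed measurable
qed

section \<open>Integration by parts\<close>

lemma has_vector_derivative_line:
  assumes "f differentiable (at (x + t *\<^sub>R axis i 1))"
  shows "((\<lambda>t. f (x + t *\<^sub>R axis i 1)) has_vector_derivative partial i f (x + t *\<^sub>R axis i 1)) (at t)"
proof -
  let ?y = "x + t *\<^sub>R axis i 1"
  have "((\<lambda>t. x + t *\<^sub>R axis i 1) has_derivative (\<lambda>s. s *\<^sub>R axis i 1)) (at t)"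
    by (auto intro!: derivative_eq_intros)
  from has_derivative_compose[OF this has_derivative_frechet[OF assms]]
  have "((\<lambda>t. f (x + t *\<^sub>R axis i 1)) has_derivative
      (\<lambda>s. frechet_derivative f (at ?y) (s *\<^sub>R axis i 1))) (at t)" .
  moreover have "linear (frechet_derivative f (at ?y))"
    using assms linear_frechet_derivative by blast
  ultimately show ?thesis
    by (simp add: has_vector_derivative_def partial_def linear_scale)
qed

text \<open>The difference quotients have integral \<open>0\<close> by translation invariance, and they converge dominatedly to
  the partial derivative.\<close>

lemma test_integral_partial:
  fixes z :: "'n::finite fn"
  assumes z: "z \<in> test_functions U"
  shows "(\<integral>x. partial i z x \<partial>lborel) = 0"
proof -
  let ?e = "axis i 1 :: real^'n"
  have sm: "smooth z" using z by (rule test_functionsD(1))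
  obtain B where B: "\<And>x. cmod (partial i z x) \<le> B"
    using test_bounded[OF test_partial[OF z]] by blast
  have B0: "B \<ge> 0" using B[of 0] norm_ge_zero order_trans by blast
  obtain R where R: "\<And>x. x \<in> support z \<Longrightarrow> norm x \<le> R"
    using compact_imp_bounded[OF test_functionsD(2)[OF z]] by (auto simp: bounded_iff)
  have lip: "cmod (z (x + t *\<^sub>R ?e) - z x) \<le> B * \<bar>t\<bar>" for x t
  proof -
    have "cmod (z (x + t *\<^sub>R ?e) - z (x + 0 *\<^sub>R ?e)) \<le> B * norm (t - 0)"
    proof (rule differentiable_bound[of UNIV "\<lambda>t. z (x + t *\<^sub>R ?e)" "\<lambda>t s. s *\<^sub>R partial i z (x + t *\<^sub>R ?e)"])
      fix t :: real
      show "((\<lambda>t. z (x + t *\<^sub>R ?e)) has_derivative (\<lambda>s. s *\<^sub>R partial i z (x + t *\<^sub>R ?e))) (at t)"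
        using has_vector_derivative_line[OF smooth_differentiable[OF sm]]
        by (simp add: has_vector_derivative_def)
      show "onorm (\<lambda>s. s *\<^sub>R partial i z (x + t *\<^sub>R ?e)) \<le> B"
      proof (rule onorm_le)
        fix s :: real
        show "norm (s *\<^sub>R partial i z (x + t *\<^sub>R ?e)) \<le> B * norm s"
          using mult_right_mono[OF B[of "x + t *\<^sub>R ?e"] abs_ge_zero[of s]] by (simp add: mult.commute)
      qed
    qed auto
    then show ?thesis by simp
  qed
  let ?q = "\<lambda>n x. of_nat (Suc n) * (z (x + inverse (real (Suc n)) *\<^sub>R ?e) - z x)"
  have [measurable]: "z \<in> borel_measurable borel" "partial i z \<in> borel_measurable borel"
    using smooth_measurable[OF sm] smooth_measurable[OF smooth_partial[OF sm]] by auto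
  have "(\<lambda>n. \<integral>x. ?q n x \<partial>lborel) \<longlonglongrightarrow> (\<integral>x. partial i z x \<partial>lborel)"
  proof (rule integral_dominated_convergence[where w = "\<lambda>x. B * indicator (cball 0 (R + 1)) x"])
    have "integrable lborel (indicator (cball 0 (R + 1) :: (real^'n) set) :: _ \<Rightarrow> real)"
      by (rule integrable_real_indicator) (simp, rule emeasure_lborel_cball_finite)
    then show "integrable lborel (\<lambda>x::real^'n. B * indicator (cball 0 (R + 1)) x)"
      by (rule integrable_mult_right)
    show "AE x in lborel. (\<lambda>n. ?q n x) \<longlonglongrightarrow> partial i z x"
    proof (rule AE_I2)
      fix x
      have "((\<lambda>t. z (x + t *\<^sub>R ?e)) has_vector_derivative partial i z (x + 0 *\<^sub>R ?e)) (at 0)"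
        by (rule has_vector_derivative_line[OF smooth_differentiable[OF sm]])
      then have l: "((\<lambda>t. norm (z (x + t *\<^sub>R ?e) - z x - t *\<^sub>R partial i z x) / norm t) \<longlongrightarrow> 0) (at 0)"
        by (simp add: has_vector_derivative_def has_derivative_iff_norm)
      have "((\<lambda>t. (z (x + t *\<^sub>R ?e) - z x) /\<^sub>R t - partial i z x) \<longlongrightarrow> 0) (at 0)"
      proof (rule tendsto_norm_zero_cancel, rule Lim_transform_eventually[OF l])
        have "norm (z (x + t *\<^sub>R ?e) - z x - t *\<^sub>R partial i z x) / norm t =
            norm ((z (x + t *\<^sub>R ?e) - z x) /\<^sub>R t - partial i z x)" if "t \<noteq> 0" for t
        proof -
          have "(z (x + t *\<^sub>R ?e) - z x) /\<^sub>R t - partial i z x =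
              (z (x + t *\<^sub>R ?e) - z x - t *\<^sub>R partial i z x) /\<^sub>R t"
            using that by (simp add: scaleR_diff_right)
          then show ?thesis by (simp add: divide_inverse mult.commute)
        qed
        then show "eventually (\<lambda>t. norm (z (x + t *\<^sub>R ?e) - z x - t *\<^sub>R partial i z x) / norm t =
            norm ((z (x + t *\<^sub>R ?e) - z x) /\<^sub>R t - partial i z x)) (at 0)"
          by (auto simp: eventually_at_filter)
      qed
      then have "((\<lambda>t. (z (x + t *\<^sub>R ?e) - z x) /\<^sub>R t) \<longlongrightarrow> partial i z x) (at 0)"
        by (rule LIM_zero_cancel)
      moreover have "filterlim (\<lambda>n. inverse (real (Suc n))) (at 0) sequentially"
        using LIMSEQ_inverse_real_of_nat by (auto simp: filterlim_at)
      ultimately have "(\<lambda>n. (z (x + inverse (real (Suc n)) *\<^sub>R ?e) - z x) /\<^sub>R inverse (real (Suc n)))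
          \<longlonglongrightarrow> partial i z x"
        by (rule filterlim_compose)
      then show "(\<lambda>n. ?q n x) \<longlonglongrightarrow> partial i z x"
        by (simp add: scaleR_conv_of_real)
    qed
    show "AE x in lborel. cmod (?q n x) \<le> B * indicator (cball 0 (R + 1)) x" for n
    proof (rule AE_I2)
      fix x
      show "cmod (?q n x) \<le> B * indicator (cball 0 (R + 1)) x"
      proof (cases "x \<in> cball 0 (R + 1)")
        case True
        have "cmod (?q n x) = real (Suc n) * cmod (z (x + inverse (real (Suc n)) *\<^sub>R ?e) - z x)"
          by (simp only: norm_mult norm_of_nat)
        also have "\<dots> \<le> real (Suc n) * (B * \<bar>inverse (real (Suc n))\<bar>)"
          by (intro mult_left_mono lip) simp
        also have "\<dots> = B" by simp
        finally show ?thesis using True by simp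
      next
        case False
        have "x \<notin> support z" using False R[of x] by auto
        moreover have "norm (x + inverse (real (Suc n)) *\<^sub>R ?e) > R"
        proof -
          have "norm x \<le> norm (x + inverse (real (Suc n)) *\<^sub>R ?e) + norm (inverse (real (Suc n)) *\<^sub>R ?e)"
            using norm_triangle_ineq4[of "x + inverse (real (Suc n)) *\<^sub>R ?e" "inverse (real (Suc n)) *\<^sub>R ?e"] by simp
          moreover have "norm (inverse (real (Suc n)) *\<^sub>R ?e) \<le> 1"
            by (simp add: norm_axis_1 inverse_le_1_iff)
          moreover have "norm x > R + 1" using False by simp
          ultimately show ?thesis by linarith
        qed
        then have "x + inverse (real (Suc n)) *\<^sub>R ?e \<notin> support z" using R by fastforce
        ultimately have "z x = 0" "z (x + inverse (real (Suc n)) *\<^sub>R ?e) = 0"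
          by (auto intro: test_functionsD(4)[OF z])
        then show ?thesis using B0 by simp
      qed
    qed
  qed measurable
  moreover have "(\<integral>x. ?q n x \<partial>lborel) = 0" for n
  proof -
    let ?a = "inverse (real (Suc n)) *\<^sub>R ?e"
    have i: "integrable lborel z" by (rule test_integrable[OF z])
    have i2: "integrable lborel (\<lambda>x. z (x + ?a))"
      using test_integrable[OF test_affine[OF test_UNIV[OF z], of 1 ?a UNIV]] by simp
    have "(\<integral>x. z (x + ?a) - z x \<partial>lborel) = 0"
      using Bochner_Integration.integral_diff[OF i2 i] integral_translate[of z ?a] by simp
    then show ?thesis by (simp only: integral_mult_right_zero mult_zero_right)
  qed
  ultimately have "(\<lambda>n::nat. 0) \<longlonglongrightarrow> (\<integral>x. partial i z x \<partial>lborel)" by (simp only:)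
  then show ?thesis by (rule LIMSEQ_unique) (rule tendsto_const)
qed

section \<open>The Fourier transform of a test function\<close>

lemma cis_inner_measurable [measurable]:
  "(\<lambda>\<omega>. cis (- (\<omega> \<bullet> x))) \<in> borel_measurable borel" "(\<lambda>\<omega>. cis (\<omega> \<bullet> x)) \<in> borel_measurable borel"
  "(\<lambda>\<omega>. cis (- (x \<bullet> \<omega>))) \<in> borel_measurable borel" "(\<lambda>\<omega>. cis (x \<bullet> \<omega>)) \<in> borel_measurable borel"
  by (auto intro!: borel_measurable_continuous_onI continuous_intros)

lemma test_mult_cis: "u \<in> test_functions U \<Longrightarrow> (\<lambda>x. u x * cis (- (\<omega> \<bullet> x))) \<in> test_functions U"
  using test_mult[OF smooth_cis_inner[of "- \<omega>"], of u U] by (simp add: mult.commute)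

lemma norm_fourier_le: "cmod (fourier u \<omega>) \<le> (\<integral>x. cmod (u x) \<partial>lborel)"
  unfolding fourier_def
  by (rule order_trans[OF integral_norm_bound]) (simp add: norm_mult)

lemma partial_cis_inner: "partial i (\<lambda>x. cis (a \<bullet> x)) x = \<i> * of_real (a $ i) * cis (a \<bullet> x)"
  by (subst partial_eqI[OF has_derivative_cis_inner]) (simp add: inner_axis)

lemma fourier_partial:
  assumes "u \<in> test_functions U"
  shows "fourier (partial i u) \<omega> = \<i> * of_real (\<omega> $ i) * fourier u \<omega>"
proof -
  let ?z = "\<lambda>x. u x * cis ((- \<omega>) \<bullet> x)"
  have z: "?z \<in> test_functions U" using test_mult_cis[OF assms, of \<omega>] by simp
  have "partial i ?z x = partial i u x * cis (- (\<omega> \<bullet> x)) -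
      \<i> * of_real (\<omega> $ i) * (u x * cis (- (\<omega> \<bullet> x)))" for x
    using partial_mult[OF smooth_differentiable[OF test_functionsD(1)[OF assms]]
        smooth_differentiable[OF smooth_cis_inner[of "- \<omega>"]], of i x]
    by (simp only: partial_cis_inner) (simp add: algebra_simps)
  then have "(\<integral>x. partial i u x * cis (- (\<omega> \<bullet> x)) -
      \<i> * of_real (\<omega> $ i) * (u x * cis (- (\<omega> \<bullet> x))) \<partial>lborel) = 0"
    using test_integral_partial[OF z, of i] by simp
  moreover have "integrable lborel (\<lambda>x. partial i u x * cis (- (\<omega> \<bullet> x)))"
    by (rule test_integrable[OF test_mult_cis[OF test_partial[OF assms]]])
  moreover have "integrable lborel (\<lambda>x. \<i> * of_real (\<omega> $ i) * (u x * cis (- (\<omega> \<bullet> x))))"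
    by (intro integrable_mult_right test_integrable[OF test_mult_cis[OF assms]])
  ultimately have "(\<integral>x. partial i u x * cis (- (\<omega> \<bullet> x)) \<partial>lborel) -
      (\<integral>x. \<i> * of_real (\<omega> $ i) * (u x * cis (- (\<omega> \<bullet> x))) \<partial>lborel) = 0"
    by (simp only: Bochner_Integration.integral_diff)
  then show ?thesis
    unfolding fourier_def by (simp only: integral_mult_right_zero right_minus_eq)
qed

lemma cis_taylor: "cmod (cis (- t) - 1 + \<i> * of_real t) \<le> t\<^sup>2 / 2"
  using iexp_approx1[of "- t" 1] by (simp add: cis_conv_exp power2_eq_square algebra_simps)

text \<open>Differentiation under the integral sign; the second-order remainder of \<open>cis\<close> is controlled by the second
  moment of \<open>u\<close>.\<close>

lemma fourier_has_derivative:
  assumes "u \<in> test_functions U"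
  shows "(fourier u has_derivative
    (\<lambda>v. \<Sum>i\<in>UNIV. of_real (v $ i) * fourier (\<lambda>x. - \<i> * of_real (x $ i) * u x) \<omega>)) (at \<omega>)"
    (is "(_ has_derivative ?D) _")
  unfolding has_derivative_iff_norm
proof
  show "bounded_linear ?D"
    by (intro bounded_linear_sum bounded_linear_mult_const
        bounded_linear_compose[OF bounded_linear_of_real] bounded_linear_vec_nth)
  have xu: "(\<lambda>x. - \<i> * of_real (x $ i) * u x) \<in> test_functions U" for i
    by (intro test_mult[OF _ assms] smooth_mult smooth_const smooth_coordinate)
  have iu: "integrable lborel (\<lambda>x. u x * cis (- (w \<bullet> x)))" for w
    by (rule test_integrable[OF test_mult_cis[OF assms]])
  have ix: "integrable lborel (\<lambda>x. - \<i> * of_real (x $ i) * u x * cis (- (w \<bullet> x)))" for w i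
    by (rule test_integrable[OF test_mult_cis[OF xu]])
  have i2: "integrable lborel (\<lambda>x. cmod (of_real ((norm x)\<^sup>2) * u x))"
    using test_integrable[OF test_mult[OF smooth_of_real_norm_diff_square[of 0] assms]]
    by (intro integrable_norm) simp
  define K where "K = (\<integral>x. cmod (of_real ((norm x)\<^sup>2) * u x) \<partial>lborel)"
  have bd: "cmod (fourier u y - fourier u \<omega> - ?D (y - \<omega>)) \<le> K / 2 * (norm (y - \<omega>))\<^sup>2" for y
  proof -
    have D: "?D (y - \<omega>) = (\<integral>x. (- \<i> * of_real ((y - \<omega>) \<bullet> x)) * u x * cis (- (\<omega> \<bullet> x)) \<partial>lborel)"
    proof -
      have "?D (y - \<omega>) = (\<integral>x. (\<Sum>i\<in>UNIV. of_real ((y - \<omega>) $ i) *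
          (- \<i> * of_real (x $ i) * u x * cis (- (\<omega> \<bullet> x)))) \<partial>lborel)"
        unfolding fourier_def by (subst Bochner_Integration.integral_sum)
          (intro integrable_mult_right ix, simp only: integral_mult_right_zero)
      also have "\<dots> = (\<integral>x. (- \<i> * of_real ((y - \<omega>) \<bullet> x)) * u x * cis (- (\<omega> \<bullet> x)) \<partial>lborel)"
        by (intro Bochner_Integration.integral_cong refl)
          (simp add: inner_vec_def sum_distrib_left sum_distrib_right mult_ac)
      finally show ?thesis .
    qed
    have iD: "integrable lborel (\<lambda>x. (- \<i> * of_real ((y - \<omega>) \<bullet> x)) * u x * cis (- (\<omega> \<bullet> x)))"
    proof -
      have "(\<lambda>x. (- \<i> * of_real ((y - \<omega>) \<bullet> x)) * u x * cis (- (\<omega> \<bullet> x))) =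
        (\<lambda>x. \<Sum>i\<in>UNIV. of_real ((y - \<omega>) $ i) * (- \<i> * of_real (x $ i) * u x * cis (- (\<omega> \<bullet> x))))"
        by (rule ext) (simp add: inner_vec_def sum_distrib_left sum_distrib_right mult_ac)
      then show ?thesis
        by (simp only:) (intro Bochner_Integration.integrable_sum integrable_mult_right ix)
    qed
    have "fourier u y - fourier u \<omega> - ?D (y - \<omega>) =
        (\<integral>x. u x * cis (- (y \<bullet> x)) - u x * cis (- (\<omega> \<bullet> x)) -
          (- \<i> * of_real ((y - \<omega>) \<bullet> x)) * u x * cis (- (\<omega> \<bullet> x)) \<partial>lborel)"
      unfolding D unfolding fourier_def
      by (simp only: Bochner_Integration.integral_diff[OF Bochner_Integration.integrable_diff[OF iu iu] iD]
          Bochner_Integration.integral_diff[OF iu iu])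
    also have "cmod \<dots> \<le> (\<integral>x. (norm (y - \<omega>))\<^sup>2 / 2 * cmod (of_real ((norm x)\<^sup>2) * u x) \<partial>lborel)"
    proof (rule Bochner_Integration.integral_norm_bound_integral)
      fix x
      let ?t = "(y - \<omega>) \<bullet> x"
      have "u x * cis (- (y \<bullet> x)) - u x * cis (- (\<omega> \<bullet> x)) - (- \<i> * of_real ?t) * u x * cis (- (\<omega> \<bullet> x)) =
          u x * cis (- (\<omega> \<bullet> x)) * (cis (- ?t) - 1 + \<i> * of_real ?t)"
      proof -
        have "cis (- (y \<bullet> x)) = cis (- (\<omega> \<bullet> x)) * cis (- ?t)"
          by (simp add: cis_mult inner_diff_left)
        then show ?thesis by (simp add: algebra_simps)
      qed
      also have "cmod \<dots> \<le> cmod (u x) * (?t\<^sup>2 / 2)"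
        unfolding norm_mult norm_cis mult_1_right by (intro mult_left_mono cis_taylor norm_ge_zero)
      also have "cmod (u x) * (?t\<^sup>2 / 2) \<le> cmod (u x) * ((norm (y - \<omega>) * norm x)\<^sup>2 / 2)"
        using power_mono[OF Cauchy_Schwarz_ineq2[of "y - \<omega>" x], of 2]
        by (intro mult_left_mono divide_right_mono) auto
      also have "\<dots> = (norm (y - \<omega>))\<^sup>2 / 2 * cmod (of_real ((norm x)\<^sup>2) * u x)"
        by (simp add: norm_mult power_mult_distrib norm_power)
      finally show "cmod (u x * cis (- (y \<bullet> x)) - u x * cis (- (\<omega> \<bullet> x)) -
          (- \<i> * of_real ?t) * u x * cis (- (\<omega> \<bullet> x))) \<le>
          (norm (y - \<omega>))\<^sup>2 / 2 * cmod (of_real ((norm x)\<^sup>2) * u x)" .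
    qed (intro Bochner_Integration.integrable_diff iu iD integrable_mult_right i2)+
    also have "\<dots> = K / 2 * (norm (y - \<omega>))\<^sup>2"
      unfolding K_def by (simp only: integral_mult_right_zero) (simp add: mult_ac)
    finally show ?thesis .
  qed
  show "((\<lambda>y. norm (fourier u y - fourier u \<omega> - ?D (y - \<omega>)) / norm (y - \<omega>)) \<longlongrightarrow> 0) (at \<omega>)"
  proof (rule Lim_null_comparison)
    have "norm (norm (fourier u y - fourier u \<omega> - ?D (y - \<omega>)) / norm (y - \<omega>)) \<le> K / 2 * norm (y - \<omega>)" for y
      using bd[of y] by (cases "y = \<omega>") (simp_all add: divide_le_eq power2_eq_square mult.assoc)
    then show "eventually (\<lambda>y. norm (norm (fourier u y - fourier u \<omega> - ?D (y - \<omega>)) / norm (y - \<omega>))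
        \<le> K / 2 * norm (y - \<omega>)) (at \<omega>)" by simp
    have "((\<lambda>y. K / 2 * norm (y - \<omega>)) \<longlongrightarrow> K / 2 * norm (\<omega> - \<omega>)) (at \<omega>)"
      by (intro tendsto_intros)
    then show "((\<lambda>y. K / 2 * norm (y - \<omega>)) \<longlongrightarrow> 0) (at \<omega>)" by simp
  qed
qed

lemma partial_fourier:
  assumes "u \<in> test_functions U"
  shows "partial i (fourier u) = fourier (\<lambda>x. - \<i> * of_real (x $ i) * u x)"
proof
  fix \<omega>
  show "partial i (fourier u) \<omega> = fourier (\<lambda>x. - \<i> * of_real (x $ i) * u x) \<omega>"
    by (subst partial_eqI[OF fourier_has_derivative[OF assms]]) (simp add: axis_def if_distrib if_distribR cong: if_cong)
qed

lemma fourier_test_closed: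
  assumes "g \<in> fourier ` test_functions UNIV"
  shows "partial i g \<in> fourier ` test_functions UNIV"
proof -
  obtain u where u: "g = fourier u" "u \<in> test_functions UNIV" using assms by auto
  have h: "(\<lambda>x. - \<i> * of_real (x $ i) * u x) \<in> test_functions UNIV"
    by (intro test_mult[OF _ u(2)] smooth_mult smooth_const smooth_coordinate)
  show ?thesis unfolding u(1) partial_fourier[OF u(2)] using h by (rule imageI)
qed

lemma smooth_fourier: "u \<in> test_functions UNIV \<Longrightarrow> smooth (fourier u)"
proof (rule smooth_coinduct[where C = "fourier ` test_functions UNIV"])
  show "g differentiable (at x)" if "g \<in> fourier ` test_functions UNIV" for g :: "'a fn" and x
    using that fourier_has_derivative unfolding differentiable_def by blast
qed (erule imageI, erule fourier_test_closed)

lemma mpartial_closed: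
  assumes "\<And>g i. g \<in> C \<Longrightarrow> partial i g \<in> C" "f \<in> C"
  shows "mpartial \<gamma> f \<in> C"
proof -
  have p: "(partial i ^^ m) g \<in> C" if "g \<in> C" for g i m
    using that by (induction m) (auto intro: assms)
  have "fold (\<lambda>i. partial i ^^ \<gamma> i) xs g \<in> C" if "g \<in> C" for xs g
    using that by (induction xs arbitrary: g) (auto intro: p)
  then show ?thesis using assms(2) by (simp add: mpartial_def)
qed

text \<open>One factor \<open>1 + norm \<omega>\<close> is absorbed by the partial derivatives of \<open>w\<close>, whose transforms are those of \<open>w\<close>
  times the coordinates.\<close>

lemma fourier_decay:
  "w \<in> test_functions UNIV \<Longrightarrow> \<exists>B. \<forall>\<omega>. (1 + norm \<omega>) ^ N * cmod (fourier w \<omega>) \<le> B"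
proof (induction N arbitrary: w)
  case 0
  then show ?case using norm_fourier_le by auto
next
  case (Suc N)
  obtain B0 where B0: "\<And>\<omega>. (1 + norm \<omega>) ^ N * cmod (fourier w \<omega>) \<le> B0"
    using Suc by blast
  have "\<forall>i. \<exists>B. \<forall>\<omega>. (1 + norm \<omega>) ^ N * cmod (fourier (partial i w) \<omega>) \<le> B"
    using Suc.IH[OF test_partial[OF Suc.prems]] by blast
  then obtain B where B: "\<And>i \<omega>. (1 + norm \<omega>) ^ N * cmod (fourier (partial i w) \<omega>) \<le> B i"
    by metis
  have "(1 + norm \<omega>) ^ Suc N * cmod (fourier w \<omega>) \<le> B0 + (\<Sum>i\<in>UNIV. B i)" for \<omega>
  proof -
    have "(1 + norm \<omega>) ^ Suc N * cmod (fourier w \<omega>) = (1 + norm \<omega>) * ((1 + norm \<omega>) ^ N * cmod (fourier w \<omega>))"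
      by simp
    also have "\<dots> \<le> (1 + (\<Sum>i\<in>UNIV. \<bar>\<omega> $ i\<bar>)) * ((1 + norm \<omega>) ^ N * cmod (fourier w \<omega>))"
      by (intro mult_right_mono add_left_mono norm_le_l1_cart) simp
    also have "\<dots> = (1 + norm \<omega>) ^ N * cmod (fourier w \<omega>) +
        (\<Sum>i\<in>UNIV. (1 + norm \<omega>) ^ N * cmod (fourier (partial i w) \<omega>))"
      by (simp add: fourier_partial[OF Suc.prems] norm_mult algebra_simps sum_distrib_left sum_distrib_right)
    also have "\<dots> \<le> B0 + (\<Sum>i\<in>UNIV. B i)"
      by (intro add_mono sum_mono B0 B)
    finally show ?thesis .
  qed
  then show ?case by blast
qed

lemma schwartzI:
  assumes "smooth u" "\<And>N \<gamma>. \<exists>B. \<forall>x. (1 + norm x) ^ N * cmod (mpartial \<gamma> u x) \<le> B"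
  shows "u \<in> schwartz"
proof -
  have "bounded (range (\<lambda>x. (1 + norm x) ^ N *\<^sub>R mpartial \<gamma> u x))" for N \<gamma>
  proof -
    obtain B where "\<And>x. (1 + norm x) ^ N * cmod (mpartial \<gamma> u x) \<le> B" using assms(2) by blast
    then show ?thesis unfolding bounded_iff
      by (intro exI[of _ B]) (auto simp: abs_mult power_abs)
  qed
  then show ?thesis using assms(1) by (simp add: schwartz_def)
qed

lemma fourier_test_schwartz:
  assumes "u \<in> test_functions UNIV"
  shows "fourier u \<in> schwartz"
proof (rule schwartzI[OF smooth_fourier[OF assms]])
  fix N and \<gamma> :: "'a multi_index"
  have "mpartial \<gamma> (fourier u) \<in> fourier ` test_functions UNIV"
    by (rule mpartial_closed) (use fourier_test_closed assms in auto)
  then obtain w where "mpartial \<gamma> (fourier u) = fourier w" "w \<in> test_functions UNIV" by blast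
  then show "\<exists>B. \<forall>x. (1 + norm x) ^ N * cmod (mpartial \<gamma> (fourier u) x) \<le> B"
    using fourier_decay[of w N] by simp
qed

lemma test_schwartz:
  assumes "u \<in> test_functions U"
  shows "u \<in> schwartz"
proof (rule schwartzI[OF test_functionsD(1)[OF assms]])
  fix N and \<gamma> :: "'a multi_index"
  have w: "mpartial \<gamma> u \<in> test_functions U" (is "?w \<in> _")
    by (rule mpartial_closed) (use assms test_partial in auto)
  have c: "continuous_on (support ?w) ?w"
    by (rule smooth_imp_continuous_on[OF test_functionsD(1)[OF w]])
  let ?S = "(\<lambda>x. (1 + norm x) ^ N * cmod (?w x)) ` support ?w"
  have "compact ?S"
    by (intro compact_continuous_image continuous_intros c test_functionsD(2)[OF w])
  then have "\<exists>B>0. \<forall>y\<in>?S. norm y \<le> B"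
    by (rule compact_imp_bounded[THEN bounded_pos[THEN iffD1]])
  then obtain B where B: "\<And>y. y \<in> ?S \<Longrightarrow> norm y \<le> B" "B > 0" by blast
  have "(1 + norm x) ^ N * cmod (?w x) \<le> B" for x
  proof (cases "x \<in> support ?w")
    case True
    from B(1)[OF imageI[OF True]] show ?thesis unfolding real_norm_def by (rule order_trans[OF abs_ge_self])
  next
    case False
    then have "?w x = 0" by (rule test_functionsD(4)[OF w])
    then show ?thesis using B(2) by simp
  qed
  then show "\<exists>B. \<forall>x. (1 + norm x) ^ N * cmod (?w x) \<le> B" by blast
qed

lemma integrable_decay:
  fixes f :: "'n::finite fn"
  assumes "f \<in> borel_measurable borel" "\<And>x. (1 + norm x) ^ (2 * CARD('n)) * cmod (f x) \<le> B"
  shows "integrable lborel f"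
proof (rule Bochner_Integration.integrable_bound[OF integrable_mult_right[OF integrable_inverse_one_plus_norm_power, of B]])
  have "cmod (f x) \<le> norm (B * (1 / (1 + norm x) ^ (2 * CARD('n))))" for x
  proof -
    have "0 < (1 + norm x) ^ (2 * CARD('n))" by (simp add: add_pos_nonneg)
    then have "cmod (f x) \<le> B / (1 + norm x) ^ (2 * CARD('n))"
      using assms(2)[of x] by (simp add: pos_le_divide_eq mult.commute)
    also have "\<dots> \<le> \<bar>B\<bar> / (1 + norm x) ^ (2 * CARD('n))"
      by (intro divide_right_mono) auto
    finally show ?thesis by simp
  qed
  then show "AE x in lborel. cmod (f x) \<le> norm (B * (1 / (1 + norm x) ^ (2 * CARD('n))))" by simp
qed (use assms(1) in simp)

section \<open>Fourier inversion\<close>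

definition gauss :: "real^'n::finite \<Rightarrow> real" where
  "gauss x = (\<Prod>i\<in>UNIV. std_normal_density (x $ i))"

lemma gauss_bounds: "0 \<le> gauss x" "gauss x \<le> 1"
proof -
  have "std_normal_density t \<le> 1" for t
  proof -
    have "1 \<le> sqrt (2 * pi)" using pi_gt3 by (intro real_le_rsqrt) simp
    then have "1 / sqrt (2 * pi) * exp (- t\<^sup>2 / 2) \<le> 1 * 1"
      by (intro mult_mono) simp_all
    then show ?thesis by (simp add: std_normal_density_def)
  qed
  then show "0 \<le> gauss x" "gauss x \<le> 1"
    unfolding gauss_def by (auto intro!: prod_nonneg prod_le_1)
qed

lemma gauss_measurable [measurable]: "gauss \<in> borel_measurable borel"
  unfolding gauss_def by measurable

text \<open>The Gaussian is its own Fourier transform up to a constant; in one dimension this is the characteristic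
  function of the standard normal distribution.\<close>

lemma gauss_fourier:
  fixes y :: "real^'n::finite"
  shows "integrable lborel (\<lambda>\<omega>. of_real (gauss \<omega>) * cis (- (\<omega> \<bullet> y)))"
    and "(\<integral>\<omega>. of_real (gauss \<omega>) * cis (- (\<omega> \<bullet> y)) \<partial>lborel) = of_real (sqrt (2 * pi) ^ CARD('n) * gauss y)"
proof -
  define f where "f = (\<lambda>i t. complex_of_real (std_normal_density t) * cis (- (t * y $ i)))"
  have e: "of_real (gauss \<omega>) * cis (- (\<omega> \<bullet> y)) = (\<Prod>i\<in>UNIV. f i (\<omega> $ i))" for \<omega>
  proof -
    have "cis (- (\<omega> \<bullet> y)) = (\<Prod>i\<in>UNIV. cis (- (\<omega> $ i * y $ i)))"
      by (simp add: cis_conv_exp inner_vec_def exp_sum[symmetric] sum_negf[symmetric] sum_distrib_left)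
    then show ?thesis by (simp add: f_def gauss_def prod.distrib)
  qed
  have i: "integrable lborel (f i)" for i
  proof (rule Bochner_Integration.integrable_bound[of _ "std_normal_density"])
    show "integrable lborel std_normal_density" by simp
    have "continuous_on UNIV (\<lambda>t::real. cis (- (t * y $ i)))" by (intro continuous_intros)
    then have [measurable]: "(\<lambda>t. cis (- (t * y $ i))) \<in> borel_measurable borel"
      by (rule borel_measurable_continuous_onI)
    show "f i \<in> borel_measurable lborel" unfolding f_def by measurable
  qed (simp add: f_def norm_mult)
  show "integrable lborel (\<lambda>\<omega>. of_real (gauss \<omega>) * cis (- (\<omega> \<bullet> y)))"
    unfolding e by (rule integrable_lborel_prod[OF i])
  have v: "(\<integral>t. f i t \<partial>lborel) = of_real (exp (- (y $ i)\<^sup>2 / 2))" for i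
  proof -
    have "char std_normal_distribution (- (y $ i)) = (\<integral>t. f i t \<partial>lborel)"
      unfolding char_def f_def
      by (subst integral_density)
        (auto simp: cis_conv_exp scaleR_conv_of_real mult.commute intro!: borel_measurable_continuous_onI continuous_intros)
    then show ?thesis unfolding char_std_normal_distribution by simp
  qed
  have "(\<integral>\<omega>. of_real (gauss \<omega>) * cis (- (\<omega> \<bullet> y)) \<partial>lborel) = (\<Prod>i\<in>UNIV. of_real (exp (- (y $ i)\<^sup>2 / 2)))"
    unfolding e by (subst integral_lborel_prod[OF i]) (simp add: v)
  also have "\<dots> = of_real (\<Prod>i\<in>UNIV. sqrt (2 * pi) * std_normal_density (y $ i))"
    by (simp add: std_normal_density_def)
  also have "\<dots> = of_real (sqrt (2 * pi) ^ CARD('n) * gauss y)"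
    by (simp add: prod.distrib gauss_def)
  finally show "(\<integral>\<omega>. of_real (gauss \<omega>) * cis (- (\<omega> \<bullet> y)) \<partial>lborel) = of_real (sqrt (2 * pi) ^ CARD('n) * gauss y)" .
qed

lemma fourier_integrable:
  assumes "u \<in> test_functions UNIV"
  shows "integrable lborel (fourier u)"
  using fourier_decay[OF assms] smooth_measurable[OF smooth_fourier[OF assms]]
  by (meson integrable_decay)

lemma gauss_scaled_tendsto:
  fixes \<omega> :: "real^'n::finite"
  shows "(\<lambda>m. gauss (inverse (real (Suc m)) *\<^sub>R \<omega>)) \<longlonglongrightarrow> gauss (0 :: real^'n)"
proof -
  have "(\<lambda>m. \<Prod>i\<in>UNIV. (1 / sqrt (2 * pi)) * exp (- (inverse (real (Suc m)) * \<omega> $ i)\<^sup>2 / 2))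
      \<longlonglongrightarrow> (\<Prod>i\<in>(UNIV::'n set). (1 / sqrt (2 * pi)) * exp (- (0 * \<omega> $ i)\<^sup>2 / 2))"
    by (intro tendsto_intros LIMSEQ_inverse_real_of_nat) auto
  then show ?thesis by (simp add: gauss_def std_normal_density_def)
qed

lemma gauss_zero: "gauss (0 :: real^'n::finite) = 1 / sqrt (2 * pi) ^ CARD('n)"
  by (simp add: gauss_def std_normal_density_def power_one_over)

text \<open>Fubini's theorem moves the transform from \<open>u\<close> to a widely dilated Gaussian factor in the frequency
  variable, which becomes a concentrated Gaussian in the space variable.  Both sides pass to the limit as
  the dilation goes to infinity.\<close>

lemma fourier_inversion_at_0:
  fixes u :: "'n::finite fn"
  assumes u: "u \<in> test_functions UNIV"
  shows "(\<integral>\<omega>. fourier u \<omega> \<partial>lborel) = of_real ((2 * pi) ^ CARD('n)) * u 0"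
proof -
  let ?c = "sqrt (2 * pi) ^ CARD('n)"
  have c: "?c > 0" by simp
  have cancel: "X = of_real (a * a) * y" if "X * of_real (1 / a) = of_real a * y" "a > 0"
    for X y :: complex and a :: real
    using that by (simp add: field_simps)
  have sm: "smooth u" by (rule test_functionsD(1)[OF u])
  have [measurable]: "u \<in> borel_measurable borel" "fourier u \<in> borel_measurable borel"
    using smooth_measurable sm smooth_fourier[OF u] by auto
  obtain B where B: "\<And>x. cmod (u x) \<le> B" using test_bounded[OF u] by blast
  have ig: "integrable lborel (gauss :: real^'n \<Rightarrow> real)"
    using integrable_Re[OF gauss_fourier(1)[of 0]] by simp
  have igc: "(\<integral>\<omega>. complex_of_real (gauss \<omega>) \<partial>(lborel :: (real^'n) measure)) = 1"
    using gauss_fourier(2)[of "0::real^'n"] by (simp add: gauss_zero)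
  have ism: "integrable lborel (\<lambda>\<omega>::real^'n. gauss (inverse (real (Suc m)) *\<^sub>R \<omega>))" for m
  proof -
    have "integrable lborel (\<lambda>\<omega>::real^'n. \<Prod>i\<in>UNIV.
        complex_of_real (std_normal_density (0 + inverse (real (Suc m)) * \<omega> $ i)))"
      by (intro integrable_lborel_prod integrable_of_real
          lborel_integrable_real_affine[of std_normal_density]) simp_all
    from integrable_Re[OF this] show ?thesis
      by (simp add: gauss_def del: of_nat_Suc flip: of_real_prod)
  qed
  have eq: "(\<integral>\<omega>. fourier u \<omega> * of_real (gauss (inverse (real (Suc m)) *\<^sub>R \<omega>)) \<partial>lborel) =
      of_real ?c * (\<integral>y. u (inverse (real (Suc m)) *\<^sub>R y) * of_real (gauss y) \<partial>lborel)" for m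
  proof -
    let ?e = "inverse (real (Suc m))"
    let ?F = "\<lambda>x \<omega>. u x * cis (- (\<omega> \<bullet> x)) * of_real (gauss (?e *\<^sub>R \<omega>))"
    have cm: "(\<lambda>(x, \<omega>). cis (- (\<omega> \<bullet> x))) \<in> borel_measurable (borel \<Otimes>\<^sub>M (borel :: (real^'n) measure))"
      unfolding borel_prod case_prod_beta by (intro borel_measurable_continuous_onI continuous_intros)
    have m: "case_prod ?F \<in> borel_measurable (lborel \<Otimes>\<^sub>M lborel)"
      unfolding case_prod_beta
      by (intro borel_measurable_times) (use cm in \<open>auto simp: case_prod_beta\<close>)
    have ip: "integrable (lborel \<Otimes>\<^sub>M lborel) (case_prod ?F)"
    proof (rule lborel_pair.Fubini_integrable[OF m])
      have "(\<lambda>x. \<integral>\<omega>. norm (case (x, \<omega>) of (x, \<omega>) \<Rightarrow> ?F x \<omega>) \<partial>lborel) =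
          (\<lambda>x. cmod (u x) * (\<integral>\<omega>. gauss (?e *\<^sub>R \<omega>) \<partial>(lborel :: (real^'n) measure)))"
        by (simp add: norm_mult gauss_bounds)
      then show "integrable lborel (\<lambda>x. \<integral>\<omega>. norm (case (x, \<omega>) of (x, \<omega>) \<Rightarrow> ?F x \<omega>) \<partial>lborel)"
        using integrable_norm[OF test_integrable[OF u]] by simp
      have "integrable lborel (\<lambda>\<omega>. ?F x \<omega>)" for x
      proof (rule Bochner_Integration.integrable_bound[OF integrable_mult_right[OF ism[of m], of "cmod (u x)"]])
        show "(\<lambda>\<omega>. ?F x \<omega>) \<in> borel_measurable lborel" by measurable
      qed (simp add: norm_mult gauss_bounds)
      then show "AE x in lborel. integrable lborel (\<lambda>\<omega>. case (x, \<omega>) of (x, \<omega>) \<Rightarrow> ?F x \<omega>)"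
        by simp
    qed
    have inner: "(\<integral>\<omega>. ?F x \<omega> \<partial>lborel) = of_real (?c * real (Suc m) ^ CARD('n)) * (u x * of_real (gauss (real (Suc m) *\<^sub>R x)))" for x
    proof -
      have "(\<integral>\<omega>. of_real (gauss (?e *\<^sub>R \<omega>)) * cis (- (\<omega> \<bullet> x)) \<partial>lborel) =
          of_real (\<bar>real (Suc m)\<bar> ^ CARD('n)) *
          (\<integral>\<omega>. of_real (gauss (?e *\<^sub>R (0 + real (Suc m) *\<^sub>R \<omega>))) * cis (- ((0 + real (Suc m) *\<^sub>R \<omega>) \<bullet> x)) \<partial>lborel)"
      proof (rule integral_affine)
        show "(\<lambda>\<omega>. complex_of_real (gauss (?e *\<^sub>R \<omega>)) * cis (- (\<omega> \<bullet> x))) \<in> borel_measurable borel" by measurable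
      qed simp
      also have "(\<integral>\<omega>. of_real (gauss (?e *\<^sub>R (0 + real (Suc m) *\<^sub>R \<omega>))) * cis (- ((0 + real (Suc m) *\<^sub>R \<omega>) \<bullet> x)) \<partial>lborel) =
          (\<integral>\<omega>. of_real (gauss \<omega>) * cis (- (\<omega> \<bullet> (real (Suc m) *\<^sub>R x))) \<partial>lborel)"
        by (intro Bochner_Integration.integral_cong refl) (simp del: of_nat_Suc)
      also have "\<dots> = of_real (?c * gauss (real (Suc m) *\<^sub>R x))" by (rule gauss_fourier(2))
      finally have *: "(\<integral>\<omega>. of_real (gauss (?e *\<^sub>R \<omega>)) * cis (- (\<omega> \<bullet> x)) \<partial>lborel) =
        of_real (real (Suc m) ^ CARD('n)) * of_real (?c * gauss (real (Suc m) *\<^sub>R x))" by (simp del: of_nat_Suc)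
      have "(\<integral>\<omega>. ?F x \<omega> \<partial>lborel) = (\<integral>\<omega>. u x * (of_real (gauss (?e *\<^sub>R \<omega>)) * cis (- (\<omega> \<bullet> x))) \<partial>lborel)"
        by (intro Bochner_Integration.integral_cong refl) (simp add: mult_ac)
      also have "\<dots> = u x * (\<integral>\<omega>. of_real (gauss (?e *\<^sub>R \<omega>)) * cis (- (\<omega> \<bullet> x)) \<partial>lborel)"
        by (rule integral_mult_right_zero)
      finally show ?thesis unfolding * by (simp add: mult_ac del: of_nat_Suc)
    qed
    have "(\<integral>\<omega>. fourier u \<omega> * of_real (gauss (?e *\<^sub>R \<omega>)) \<partial>lborel) = (\<integral>\<omega>. (\<integral>x. ?F x \<omega> \<partial>lborel) \<partial>lborel)"
      unfolding fourier_def by (simp only: integral_mult_left_zero)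
    also have "\<dots> = (\<integral>x. (\<integral>\<omega>. ?F x \<omega> \<partial>lborel) \<partial>lborel)"
      by (rule lborel_pair.Fubini_integral[OF ip])
    also have "\<dots> = of_real (?c * real (Suc m) ^ CARD('n)) * (\<integral>x. u x * of_real (gauss (real (Suc m) *\<^sub>R x)) \<partial>lborel)"
      unfolding inner by (rule integral_mult_right_zero)
    also have "(\<integral>x. u x * of_real (gauss (real (Suc m) *\<^sub>R x)) \<partial>lborel) =
        of_real (\<bar>?e\<bar> ^ CARD('n)) * (\<integral>x. u (0 + ?e *\<^sub>R x) * of_real (gauss (real (Suc m) *\<^sub>R (0 + ?e *\<^sub>R x))) \<partial>lborel)"
      by (rule integral_affine) auto
    also have "of_real (?c * real (Suc m) ^ CARD('n)) * \<dots> =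
        of_real ?c * (\<integral>y. u (?e *\<^sub>R y) * of_real (gauss y) \<partial>lborel)"
      by (simp add: power_inverse del: of_nat_Suc)
    finally show ?thesis .
  qed
  have "(\<lambda>m. \<integral>\<omega>. fourier u \<omega> * of_real (gauss (inverse (real (Suc m)) *\<^sub>R \<omega>)) \<partial>lborel)
      \<longlonglongrightarrow> (\<integral>\<omega>. fourier u \<omega> * of_real (gauss (0::real^'n)) \<partial>lborel)"
  proof (rule integral_dominated_convergence[where w = "\<lambda>\<omega>. cmod (fourier u \<omega>)"])
    show "integrable lborel (\<lambda>\<omega>. cmod (fourier u \<omega>))"
      by (intro integrable_norm fourier_integrable u)
    show "AE \<omega> in lborel. (\<lambda>m. fourier u \<omega> * of_real (gauss (inverse (real (Suc m)) *\<^sub>R \<omega>)))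
        \<longlonglongrightarrow> fourier u \<omega> * of_real (gauss (0::real^'n))"
      by (intro AE_I2 tendsto_mult tendsto_const tendsto_of_real gauss_scaled_tendsto)
    show "AE \<omega> in lborel. cmod (fourier u \<omega> * of_real (gauss (inverse (real (Suc m)) *\<^sub>R \<omega>))) \<le> cmod (fourier u \<omega>)" for m
      by (intro AE_I2) (simp add: norm_mult gauss_bounds mult_left_le del: of_nat_Suc)
  qed measurable
  moreover have "(\<lambda>m. of_real ?c * (\<integral>y. u (inverse (real (Suc m)) *\<^sub>R y) * of_real (gauss y) \<partial>lborel))
      \<longlonglongrightarrow> of_real ?c * (\<integral>y. u 0 * of_real (gauss y) \<partial>(lborel :: (real^'n) measure))"
  proof (intro tendsto_mult tendsto_const integral_dominated_convergence[where w = "\<lambda>y. B * gauss y"])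
    show "integrable lborel (\<lambda>y::real^'n. B * gauss y)" using ig by simp
    show "AE y in lborel. (\<lambda>m. u (inverse (real (Suc m)) *\<^sub>R y) * of_real (gauss y)) \<longlonglongrightarrow> u 0 * of_real (gauss y)"
    proof (intro AE_I2 tendsto_mult tendsto_const)
      fix y :: "real^'n"
      have "isCont u 0" using smooth_imp_continuous_on[OF sm, of UNIV] by (simp add: continuous_on_eq_continuous_at)
      moreover have "(\<lambda>m. inverse (real (Suc m)) *\<^sub>R y) \<longlonglongrightarrow> 0"
        using tendsto_scaleR[OF LIMSEQ_inverse_real_of_nat tendsto_const[of y]]
        by (simp only: scaleR_zero_left)
      ultimately show "(\<lambda>m. u (inverse (real (Suc m)) *\<^sub>R y)) \<longlonglongrightarrow> u 0"
        by (rule isCont_tendsto_compose)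
    qed
    show "AE y in lborel. cmod (u (inverse (real (Suc m)) *\<^sub>R y) * of_real (gauss y)) \<le> B * gauss y" for m
      using B by (intro AE_I2) (simp add: norm_mult gauss_bounds mult_right_mono del: of_nat_Suc)
  qed measurable
  ultimately have "(\<integral>\<omega>. fourier u \<omega> * of_real (gauss (0::real^'n)) \<partial>lborel) =
      of_real ?c * (\<integral>y. u 0 * of_real (gauss y) \<partial>(lborel :: (real^'n) measure))"
    unfolding eq by (rule LIMSEQ_unique)
  then have "(\<integral>\<omega>. fourier u \<omega> \<partial>lborel) * of_real (1 / ?c) = of_real ?c * u 0"
    by (simp only: integral_mult_left_zero integral_mult_right_zero igc gauss_zero mult_1_right)
  then have "(\<integral>\<omega>. fourier u \<omega> \<partial>lborel) = of_real (?c * ?c) * u 0"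
    using c by (rule cancel)
  also have "?c * ?c = (2 * pi) ^ CARD('n)"
    unfolding power_mult_distrib[symmetric] real_sqrt_mult_self by simp
  finally show ?thesis .
qed

lemma fourier_inversion:
  fixes u :: "'n::finite fn"
  assumes u: "u \<in> test_functions UNIV"
  shows "(\<integral>\<omega>. fourier u \<omega> * cis (\<omega> \<bullet> x) \<partial>lborel) = of_real ((2 * pi) ^ CARD('n)) * u x"
proof -
  have v: "(\<lambda>y. u (y + x)) \<in> test_functions UNIV"
    using test_affine[OF u, of 1 x UNIV] by simp
  have "fourier (\<lambda>y. u (y + x)) \<omega> = fourier u \<omega> * cis (\<omega> \<bullet> x)" for \<omega>
  proof -
    have m: "(\<lambda>y. u y * cis (- (\<omega> \<bullet> (y - x)))) \<in> borel_measurable borel"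
      by (intro borel_measurable_times smooth_measurable[OF test_functionsD(1)[OF u]]
          borel_measurable_continuous_onI continuous_intros)
    have "fourier (\<lambda>y. u (y + x)) \<omega> = (\<integral>y. u y * cis (- (\<omega> \<bullet> (y - x))) \<partial>lborel)"
      unfolding fourier_def using integral_translate[OF m, of x] by simp
    also have "\<dots> = (\<integral>y. u y * cis (- (\<omega> \<bullet> y)) * cis (\<omega> \<bullet> x) \<partial>lborel)"
      by (intro Bochner_Integration.integral_cong refl) (simp add: inner_diff_right cis_mult mult.assoc)
    finally show ?thesis by (simp add: fourier_def)
  qed
  then show ?thesis using fourier_inversion_at_0[OF v] by simp
qed

text \<open>Injectivity of the Fourier transform turns the commutation of multiplication operators into
  that of the partial derivatives.\<close>

lemma partial_commute:
  assumes "u \<in> test_functions U"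
  shows "partial i (partial j u) = partial j (partial i u)"
proof
  fix x
  have u: "u \<in> test_functions UNIV" using assms by (rule test_UNIV)
  have f: "fourier (partial i (partial j u)) = fourier (partial j (partial i u))"
    by (rule ext) (simp add: fourier_partial[OF u] fourier_partial[OF test_partial[OF u]])
  show "partial i (partial j u) x = partial j (partial i u) x"
    using fourier_inversion[OF test_partial[OF test_partial[OF u]], of i j x]
      fourier_inversion[OF test_partial[OF test_partial[OF u]], of j i x]
    unfolding f by simp
qed

section \<open>Iterated partial derivatives\<close>

lemma mpartial_fold_shift:
  fixes u :: "'n::finite fn"
  assumes "u \<in> test_functions U" "distinct L"
  shows "fold (\<lambda>j. partial j ^^ \<gamma> j) L (partial i u) =
    (if i \<in> set L then fold (\<lambda>j. partial j ^^ (\<gamma>(i := Suc (\<gamma> i))) j) L u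
     else partial i (fold (\<lambda>j. partial j ^^ \<gamma> j) L u))"
  using assms
proof (induction L arbitrary: u)
  case (Cons j L)
  have c: "(partial j ^^ m) (partial i v) = partial i ((partial j ^^ m) v) \<and>
      (partial j ^^ m) v \<in> test_functions U" if "v \<in> test_functions U" for m v
    using that by (induction m) (auto intro: test_partial partial_commute)
  show ?case
  proof (cases "j = i")
    case True
    have e: "fold (\<lambda>j. partial j ^^ (\<gamma>(i := Suc (\<gamma> i))) j) L = fold (\<lambda>j. partial j ^^ \<gamma> j) L"
      using True Cons.prems(2) by (intro fold_cong ext) auto
    show ?thesis
      using True c[OF Cons.prems(1), of "\<gamma> j"] by (simp add: e fun_upd_same del: fun_upd_apply)
  next
    case False
    let ?v = "(partial j ^^ \<gamma> j) u"
    have "?v \<in> test_functions U" using c[OF Cons.prems(1)] by blast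
    moreover have "(partial j ^^ \<gamma> j) (partial i u) = partial i ?v" using c[OF Cons.prems(1)] by blast
    ultimately show ?thesis using False Cons by simp
  qed
qed simp

lemma mpartial_Suc:
  fixes u :: "'n::finite fn"
  assumes "u \<in> test_functions U"
  shows "mpartial \<gamma> (partial i u) = mpartial (\<gamma>(i := Suc (\<gamma> i))) u"
proof -
  have "\<exists>is::'n list. distinct is \<and> set is = UNIV"
    using finite_distinct_list[OF finite, of "UNIV::'n set"] by blast
  from someI_ex[OF this] show ?thesis
    unfolding mpartial_def by (subst mpartial_fold_shift[OF assms]) auto
qed

text \<open>Partial derivatives of test functions along a word depend only on how often each coordinate occurs in
  it.  Words are convenient for inductions, multi-indices for stating hypotheses.\<close>

lemma fold_partial_eq_mpartial:
  fixes u :: "'n::finite fn"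
  shows "u \<in> test_functions U \<Longrightarrow> fold partial W u = mpartial (count_list W) u"
proof (induction W arbitrary: u)
  case Nil
  have p: "(\<lambda>i::'n. partial i ^^ 0) = (\<lambda>i. id)" by auto
  have "fold (\<lambda>i::'n. id) xs u = u" for xs and u :: "'n fn" by (induction xs) auto
  then show ?case by (simp add: mpartial_def p)
next
  case (Cons i W)
  have "(count_list W)(i := Suc (count_list W i)) = count_list (i # W)" by auto
  then show ?case using Cons mpartial_Suc[OF Cons.prems, of "count_list W" i] test_partial[OF Cons.prems]
    by (simp del: count_list.simps)
qed

lemma mi_order_count_list: "mi_order (count_list (W :: 'n::finite list)) = length W"
  unfolding mi_order_def by (rule sum_count_set) auto

section \<open>The Schwartz space\<close>

lemma mpartial_rel:
  assumes "\<And>f g i. R f g \<Longrightarrow> R (partial i f) (partial i g)" "R f g"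
  shows "R (mpartial \<gamma> f) (mpartial \<gamma> g)"
proof -
  have p: "R ((partial i ^^ m) f) ((partial i ^^ m) g)" if "R f g" for i m f g
    using that by (induction m) (auto intro: assms(1))
  have "R (fold (\<lambda>i. partial i ^^ \<gamma> i) xs f) (fold (\<lambda>i. partial i ^^ \<gamma> i) xs g)" if "R f g" for xs f g
    using that by (induction xs arbitrary: f g) (auto intro: p)
  then show ?thesis using assms(2) by (simp add: mpartial_def)
qed

lemma mpartial_add:
  fixes f g :: "'n::finite fn"
  assumes "smooth f" "smooth g"
  shows "mpartial \<gamma> (\<lambda>x. f x + g x) = (\<lambda>x. mpartial \<gamma> f x + mpartial \<gamma> g x)"
proof -
  have p: "smooth ((partial i ^^ m) f) \<and> smooth ((partial i ^^ m) g) \<and>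
      (partial i ^^ m) (\<lambda>x. f x + g x) = (\<lambda>x. (partial i ^^ m) f x + (partial i ^^ m) g x)"
    if "smooth f" "smooth g" for i m and f g :: "'n fn"
    using that
    by (induction m) (auto intro!: smooth_partial partial_add intro: smooth_differentiable)
  have "fold (\<lambda>i. partial i ^^ \<gamma> i) xs (\<lambda>x. f x + g x) =
      (\<lambda>x. fold (\<lambda>i. partial i ^^ \<gamma> i) xs f x + fold (\<lambda>i. partial i ^^ \<gamma> i) xs g x)"
    if "smooth f" "smooth g" for xs and f g :: "'n fn"
    using that
  proof (induction xs arbitrary: f g)
    case (Cons i xs)
    then show ?case using p[OF Cons.prems, of "\<gamma> i" i] by simp
  qed simp
  then show ?thesis using assms by (simp add: mpartial_def)
qed

lemma mpartial_scale:
  fixes f :: "'n::finite fn"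
  assumes "smooth f"
  shows "mpartial \<gamma> (\<lambda>x. c * f x) = (\<lambda>x. c * mpartial \<gamma> f x)"
proof -
  have "smooth (mpartial \<gamma> f) \<and> mpartial \<gamma> (\<lambda>x. c * f x) = (\<lambda>x. c * mpartial \<gamma> f x)"
  proof (rule mpartial_rel[where R = "\<lambda>f g. smooth f \<and> g = (\<lambda>x. c * f x)"])
    fix f g :: "'n fn" and i
    assume fg: "smooth f \<and> g = (\<lambda>x. c * f x)"
    then have sf: "smooth f" by blast
    have "partial i (\<lambda>x. c * f x) x = c * partial i f x" for x
      using partial_mult[OF smooth_differentiable[OF smooth_const[of c]] smooth_differentiable[OF sf]]
      by (simp add: partial_const)
    then show "smooth (partial i f) \<and> partial i g = (\<lambda>x. c * partial i f x)"
      using fg smooth_partial[OF sf] by auto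
  qed (use assms in simp)
  then show ?thesis ..
qed

lemma mpartial_translate:
  fixes f :: "'n::finite fn"
  assumes "smooth f"
  shows "mpartial \<gamma> (\<lambda>x. f (x + a)) = (\<lambda>x. mpartial \<gamma> f (x + a))"
proof -
  have "smooth (mpartial \<gamma> f) \<and> mpartial \<gamma> (\<lambda>x. f (x + a)) = (\<lambda>x. mpartial \<gamma> f (x + a))"
  proof (rule mpartial_rel[where R = "\<lambda>f g. smooth f \<and> g = (\<lambda>x. f (x + a))"])
    fix f g :: "'n fn" and i
    assume fg: "smooth f \<and> g = (\<lambda>x. f (x + a))"
    then have sf: "smooth f" by blast
    have "partial i (\<lambda>x. f (x + a)) x = partial i f (x + a)" for x
      using partial_affine[of f 1 x a i, OF smooth_differentiable[OF sf]] by simp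
    then show "smooth (partial i f) \<and> partial i g = (\<lambda>x. partial i f (x + a))"
      using fg smooth_partial[OF sf] by auto
  qed (use assms in simp)
  then show ?thesis ..
qed

lemma schwartzD:
  assumes "u \<in> schwartz"
  shows "smooth u" "\<exists>B. \<forall>x. (1 + norm x) ^ N * cmod (mpartial \<gamma> u x) \<le> B"
proof -
  show "smooth u" using assms by (simp add: schwartz_def)
  have "bounded (range (\<lambda>x. (1 + norm x) ^ N *\<^sub>R mpartial \<gamma> u x))"
    using assms by (simp add: schwartz_def)
  then obtain B where "\<And>x. norm ((1 + norm x) ^ N *\<^sub>R mpartial \<gamma> u x) \<le> B"
    by (auto simp: bounded_iff)
  then have "(1 + norm x) ^ N * cmod (mpartial \<gamma> u x) \<le> B" for x
    by (simp add: power_abs)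
  then show "\<exists>B. \<forall>x. (1 + norm x) ^ N * cmod (mpartial \<gamma> u x) \<le> B" by blast
qed

lemma schwartz_add:
  assumes "u \<in> schwartz" "v \<in> schwartz"
  shows "(\<lambda>x. u x + v x) \<in> schwartz"
proof (rule schwartzI)
  show "smooth (\<lambda>x. u x + v x)" by (intro smooth_add schwartzD(1) assms)
  fix N and \<gamma> :: "'a multi_index"
  obtain B where B: "\<And>x. (1 + norm x) ^ N * cmod (mpartial \<gamma> u x) \<le> B"
    using schwartzD(2)[OF assms(1)] by blast
  obtain C where C: "\<And>x. (1 + norm x) ^ N * cmod (mpartial \<gamma> v x) \<le> C"
    using schwartzD(2)[OF assms(2)] by blast
  have "(1 + norm x) ^ N * cmod (mpartial \<gamma> (\<lambda>x. u x + v x) x) \<le> B + C" for x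
  proof -
    have "(1 + norm x) ^ N * cmod (mpartial \<gamma> (\<lambda>x. u x + v x) x) \<le>
        (1 + norm x) ^ N * (cmod (mpartial \<gamma> u x) + cmod (mpartial \<gamma> v x))"
      unfolding mpartial_add[OF schwartzD(1)[OF assms(1)] schwartzD(1)[OF assms(2)]]
      by (intro mult_left_mono norm_triangle_ineq) simp
    also have "\<dots> \<le> B + C" using B[of x] C[of x] by (simp add: distrib_left)
    finally show ?thesis .
  qed
  then show "\<exists>B. \<forall>x. (1 + norm x) ^ N * cmod (mpartial \<gamma> (\<lambda>x. u x + v x) x) \<le> B" by blast
qed

lemma schwartz_scale:
  assumes "u \<in> schwartz"
  shows "(\<lambda>x. c * u x) \<in> schwartz"
proof (rule schwartzI)
  show "smooth (\<lambda>x. c * u x)" by (intro smooth_mult smooth_const schwartzD(1) assms)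
  fix N and \<gamma> :: "'a multi_index"
  obtain B where B: "\<And>x. (1 + norm x) ^ N * cmod (mpartial \<gamma> u x) \<le> B"
    using schwartzD(2)[OF assms(1)] by blast
  have "(1 + norm x) ^ N * cmod (mpartial \<gamma> (\<lambda>x. c * u x) x) \<le> cmod c * B" for x
    unfolding mpartial_scale[OF schwartzD(1)[OF assms]]
    using mult_left_mono[OF B[of x] norm_ge_zero[of c]] by (simp add: norm_mult mult_ac)
  then show "\<exists>B. \<forall>x. (1 + norm x) ^ N * cmod (mpartial \<gamma> (\<lambda>x. c * u x) x) \<le> B" by blast
qed

lemma finite_mi_order_le: "finite {\<gamma> :: 'n::finite multi_index. mi_order \<gamma> \<le> N}"
proof (rule finite_subset)
  show "{\<gamma> :: 'n multi_index. mi_order \<gamma> \<le> N} \<subseteq> PiE UNIV (\<lambda>_. {..N})"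
  proof
    fix \<gamma> :: "'n multi_index" assume "\<gamma> \<in> {\<gamma>. mi_order \<gamma> \<le> N}"
    then have "\<gamma> i \<le> N" for i
      using member_le_sum[of i UNIV \<gamma>] by (simp add: mi_order_def)
    then show "\<gamma> \<in> PiE UNIV (\<lambda>_. {..N})" by (simp add: PiE_iff)
  qed
qed (auto intro: finite_PiE)

lemma seminorm_upper:
  fixes u :: "'n::finite fn"
  assumes "u \<in> schwartz" "mi_order \<gamma> \<le> N"
  shows "(1 + norm x) ^ N * cmod (mpartial \<gamma> u x) \<le> schwartz_seminorm N u"
proof -
  have "\<forall>\<gamma>. \<exists>B. \<forall>x. (1 + norm x) ^ N * cmod (mpartial \<gamma> u x) \<le> B"
    using schwartzD(2)[OF assms(1)] by blast
  then obtain B where B: "\<And>\<gamma> x. (1 + norm x) ^ N * cmod (mpartial \<gamma> u x) \<le> B \<gamma>" by metis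
  let ?F = "\<lambda>(x, \<gamma>). (1 + norm x) ^ N * cmod (mpartial \<gamma> u x)"
  let ?I = "{\<gamma> :: 'n multi_index. mi_order \<gamma> \<le> N}"
  have "bdd_above (?F ` (UNIV \<times> ?I))"
  proof (rule bdd_aboveI2)
    fix p :: "(real^'n) \<times> 'n multi_index" assume p: "p \<in> UNIV \<times> ?I"
    have "B (snd p) \<le> \<bar>B (snd p)\<bar>" by simp
    also have "\<dots> \<le> (\<Sum>\<gamma>\<in>?I. \<bar>B \<gamma>\<bar>)"
      by (rule member_le_sum[where f = "\<lambda>\<gamma>. \<bar>B \<gamma>\<bar>"]) (use p finite_mi_order_le in auto)
    finally show "?F p \<le> (\<Sum>\<gamma>\<in>?I. \<bar>B \<gamma>\<bar>)"
      using B[of "fst p" "snd p"] by (simp add: case_prod_beta)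
  qed
  from cSUP_upper[OF _ this, of "(x, \<gamma>)"] show ?thesis
    unfolding schwartz_seminorm_def using assms(2) by simp
qed

lemma seminorm_least:
  assumes "\<And>x \<gamma>. mi_order \<gamma> \<le> N \<Longrightarrow> (1 + norm x) ^ N * cmod (mpartial \<gamma> u x) \<le> B"
  shows "schwartz_seminorm N u \<le> B"
  unfolding schwartz_seminorm_def
proof (rule cSUP_least)
  have "mi_order (\<lambda>_. 0) \<le> N" by (simp add: mi_order_def)
  then show "UNIV \<times> {\<gamma>. mi_order \<gamma> \<le> N} \<noteq> {}" by blast
qed (use assms in auto)

lemma
  assumes "u \<in> schwartz"
  shows schwartz_translate: "(\<lambda>x. u (x + a)) \<in> schwartz"
    and seminorm_translate: "schwartz_seminorm N (\<lambda>x. u (x + a)) \<le> (1 + norm a) ^ N * schwartz_seminorm N u"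
proof -
  have sm: "smooth u" using schwartzD(1)[OF assms] .
  have *: "(1 + norm x) ^ N * cmod (mpartial \<gamma> (\<lambda>x. u (x + a)) x) \<le>
      (1 + norm a) ^ N * ((1 + norm (x + a)) ^ N * cmod (mpartial \<gamma> u (x + a)))" for x N \<gamma>
  proof -
    have "1 + norm x \<le> (1 + norm a) * (1 + norm (x + a))"
    proof -
      have "norm x \<le> norm (x + a) + norm a" using norm_triangle_ineq4[of "x + a" a] by simp
      moreover have "0 \<le> norm a * norm (x + a)" by simp
      moreover have "(1 + norm a) * (1 + norm (x + a)) = 1 + norm a + norm (x + a) + norm a * norm (x + a)"
        by (simp add: distrib_left distrib_right)
      ultimately show ?thesis by linarith
    qed
    then have "(1 + norm x) ^ N \<le> ((1 + norm a) * (1 + norm (x + a))) ^ N"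
      by (intro power_mono) auto
    from mult_right_mono[OF this norm_ge_zero[of "mpartial \<gamma> u (x + a)"]] show ?thesis
      unfolding mpartial_translate[OF sm] by (simp add: power_mult_distrib mult_ac)
  qed
  have "smooth (\<lambda>x. u (x + a))" using smooth_affine[OF sm, of 1 a] by simp
  then show "(\<lambda>x. u (x + a)) \<in> schwartz"
  proof (rule schwartzI)
    fix N and \<gamma> :: "'a multi_index"
    obtain B where B: "\<And>x. (1 + norm x) ^ N * cmod (mpartial \<gamma> u x) \<le> B"
      using schwartzD(2)[OF assms(1)] by blast
    have "(1 + norm x) ^ N * cmod (mpartial \<gamma> (\<lambda>x. u (x + a)) x) \<le> (1 + norm a) ^ N * B" for x
      by (rule order_trans[OF *]) (intro mult_left_mono B, simp)
    then show "\<exists>B. \<forall>x. (1 + norm x) ^ N * cmod (mpartial \<gamma> (\<lambda>x. u (x + a)) x) \<le> B" by blast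
  qed
  show "schwartz_seminorm N (\<lambda>x. u (x + a)) \<le> (1 + norm a) ^ N * schwartz_seminorm N u"
    by (rule seminorm_least, rule order_trans[OF *])
      (intro mult_left_mono seminorm_upper assms, simp_all)
qed

lemma schwartz_translate_iff: "(\<lambda>x. u (x + a)) \<in> schwartz \<longleftrightarrow> u \<in> schwartz"
  using schwartz_translate[of u a] schwartz_translate[of "\<lambda>x. u (x + a)" "- a"] by auto

lemma schwartz_integrable:
  fixes u :: "'n::finite fn"
  assumes "u \<in> schwartz"
  shows "integrable lborel u"
    and "(\<integral>x. cmod (u x) \<partial>lborel) \<le> schwartz_seminorm (2 * CARD('n)) u *
      (\<integral>x. 1 / (1 + norm x) ^ (2 * CARD('n)) \<partial>(lborel :: (real^'n) measure))"
proof -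
  let ?N = "2 * CARD('n)" and ?S = "schwartz_seminorm (2 * CARD('n)) u"
  have z: "mpartial (\<lambda>_. 0) u = u"
  proof -
    have p: "(\<lambda>i::'n. partial i ^^ 0) = (\<lambda>i. id)" by auto
    have "fold (\<lambda>i::'n. id) xs u = u" for xs and u :: "'n fn" by (induction xs) auto
    then show ?thesis by (simp add: mpartial_def p)
  qed
  have b: "(1 + norm x) ^ ?N * cmod (u x) \<le> ?S" for x
    using seminorm_upper[OF assms, of "\<lambda>_. 0" ?N x] by (simp add: z mi_order_def)
  show i: "integrable lborel u"
    by (rule integrable_decay[OF smooth_measurable[OF schwartzD(1)[OF assms]] b])
  have "(\<integral>x. cmod (u x) \<partial>lborel) \<le> (\<integral>x. ?S * (1 / (1 + norm x) ^ ?N) \<partial>(lborel :: (real^'n) measure))"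
  proof (rule integral_mono)
    show "integrable lborel (\<lambda>x. cmod (u x))" using i by simp
    show "integrable lborel (\<lambda>x::real^'n. ?S * (1 / (1 + norm x) ^ ?N))"
      by (intro integrable_mult_right integrable_inverse_one_plus_norm_power)
    fix x :: "real^'n"
    have "0 < (1 + norm x) ^ ?N" by (simp add: add_pos_nonneg)
    then show "cmod (u x) \<le> ?S * (1 / (1 + norm x) ^ ?N)"
      using b[of x] by (simp add: pos_le_divide_eq mult.commute)
  qed
  then show "(\<integral>x. cmod (u x) \<partial>lborel) \<le> ?S * (\<integral>x. 1 / (1 + norm x) ^ ?N \<partial>(lborel :: (real^'n) measure))"
    by (simp only: integral_mult_right_zero)
qed

section \<open>Calculus of Fourier representatives\<close>

lemma inverse_cancel: "a \<noteq> 0 \<Longrightarrow> inverse a * (a * x) = (x :: complex)"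
  by (simp add: mult.assoc[symmetric])

text \<open>By Fourier inversion the functional \<open>v \<mapsto> (2 \<pi>)\<^sup>-\<^sup>d \<integral>\<^sub>E \<integral> v(x) cis (\<omega> \<bullet> x) dx d\<omega>\<close> has spectrum
  \<open>indicator E\<close>.  These distributions are the test cases in the necessity of the condition at the dual
  lattice: their spectrum can be placed exactly where that condition would fail.\<close>

lemma exists_tempered_indicator:
  fixes E :: "(real^'n::finite) set"
  assumes E: "E \<in> sets borel" "bounded E"
  shows "\<exists>f\<in>tempered. is_fourier_fun f (indicator E)"
proof -
  let ?c = "inverse (complex_of_real ((2 * pi) ^ CARD('n)))"
  let ?G = "\<lambda>v \<omega>. \<integral>x. v x * cis (\<omega> \<bullet> x) \<partial>lborel"
  define f :: "'n functional" where
    "f v = (if v \<in> schwartz then ?c * (\<integral>\<omega>. indicator E \<omega> * ?G v \<omega> \<partial>lborel) else 0)" for v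
  have cc: "?c * (complex_of_real ((2 * pi) ^ CARD('n)) * X) = X" for X
    by (rule inverse_cancel) simp
  have [measurable]: "E \<in> sets borel" by fact
  have Efin: "emeasure lborel E < \<infinity>" using E(2) by (rule emeasure_bounded_finite)
  have iE: "integrable lborel (indicator E :: _ \<Rightarrow> real)"
    by (rule integrable_real_indicator) (use Efin in auto)
  have ic: "integrable lborel (\<lambda>x. v x * cis (\<omega> \<bullet> x))" if "v \<in> schwartz" for v \<omega>
  proof (rule Bochner_Integration.integrable_bound[OF schwartz_integrable(1)[OF that]])
    have [measurable]: "v \<in> borel_measurable borel" by (rule smooth_measurable[OF schwartzD(1)[OF that]])
    show "(\<lambda>x. v x * cis (\<omega> \<bullet> x)) \<in> borel_measurable lborel" by measurable
  qed (simp add: norm_mult)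
  have Gb: "cmod (?G v \<omega>) \<le> (\<integral>x. cmod (v x) \<partial>lborel)" for v :: "'n fn" and \<omega>
    by (rule order_trans[OF integral_norm_bound]) (simp add: norm_mult)
  have iG: "integrable lborel (\<lambda>\<omega>. indicator E \<omega> * ?G v \<omega>)" if v: "v \<in> schwartz" for v
  proof (rule Bochner_Integration.integrable_bound[OF integrable_mult_left[OF iE, of "\<integral>x. cmod (v x) \<partial>lborel"]])
    have [measurable]: "v \<in> borel_measurable borel" by (rule smooth_measurable[OF schwartzD(1)[OF v]])
    have cm: "(\<lambda>(\<omega>, x). cis (\<omega> \<bullet> x)) \<in> borel_measurable (borel \<Otimes>\<^sub>M (borel :: (real^'n) measure))"
      unfolding borel_prod case_prod_beta by (intro borel_measurable_continuous_onI continuous_intros)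
    have "(\<lambda>(\<omega>, x). v x * cis (\<omega> \<bullet> x)) \<in> borel_measurable (lborel \<Otimes>\<^sub>M lborel)"
      unfolding case_prod_beta
      by (intro borel_measurable_times) (use cm in \<open>auto simp: case_prod_beta\<close>)
    from lborel.borel_measurable_lebesgue_integral[OF this]
    show "(\<lambda>\<omega>. indicator E \<omega> * ?G v \<omega>) \<in> borel_measurable lborel" by simp
    have "0 \<le> (\<integral>x. cmod (v x) \<partial>lborel)" by (intro integral_nonneg_AE) simp
    then show "AE \<omega> in lborel. norm (indicator E \<omega> * ?G v \<omega>) \<le> norm (indicator E \<omega> * (\<integral>x. cmod (v x) \<partial>lborel))"
      using Gb[of v] by (intro AE_I2) (simp add: norm_mult indicator_def)
  qed
  have "f \<in> tempered"
    unfolding tempered_def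
  proof (intro CollectI conjI allI ballI impI)
    show "f u = 0" if "u \<notin> schwartz" for u using that by (simp add: f_def)
    fix u v :: "'n fn" assume uv: "u \<in> schwartz" "v \<in> schwartz"
    have "?G (\<lambda>x. u x + v x) \<omega> = ?G u \<omega> + ?G v \<omega>" for \<omega>
      using Bochner_Integration.integral_add[OF ic[OF uv(1)] ic[OF uv(2)], of \<omega> \<omega>] by (simp add: distrib_right)
    then show "f (\<lambda>x. u x + v x) = f u + f v"
      using uv schwartz_add[OF uv] Bochner_Integration.integral_add[OF iG[OF uv(1)] iG[OF uv(2)]]
      by (simp add: f_def distrib_left)
  next
    fix c and u :: "'n fn" assume u: "u \<in> schwartz"
    have "?G (\<lambda>x. c * u x) \<omega> = c * ?G u \<omega>" for \<omega>
      by (simp only: mult.assoc integral_mult_right_zero)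
    then have "(\<integral>\<omega>. indicator E \<omega> * ?G (\<lambda>x. c * u x) \<omega> \<partial>lborel) = (\<integral>\<omega>. c * (indicator E \<omega> * ?G u \<omega>) \<partial>lborel)"
      by (simp only: mult.left_commute)
    then show "f (\<lambda>x. c * u x) = c * f u"
      using u schwartz_scale[OF u, of c] by (simp add: f_def)
  next
    let ?D = "\<integral>x. 1 / (1 + norm x) ^ (2 * CARD('n)) \<partial>(lborel :: (real^'n) measure)"
    have D0: "?D \<ge> 0" by (intro integral_nonneg_AE) simp
    have "cmod (f u) \<le> (cmod ?c * (measure lborel E * ?D)) * schwartz_seminorm (2 * CARD('n)) u"
      if u: "u \<in> schwartz" for u
    proof -
      let ?I = "\<integral>x. cmod (u x) \<partial>lborel"
      have "cmod (\<integral>\<omega>. indicator E \<omega> * ?G u \<omega> \<partial>lborel) \<le> (\<integral>\<omega>. indicator E \<omega> * ?I \<partial>lborel)"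
      proof (rule Bochner_Integration.integral_norm_bound_integral[OF iG[OF u] integrable_mult_left[OF iE]])
        show "cmod (indicator E \<omega> * ?G u \<omega>) \<le> indicator E \<omega> * ?I" for \<omega>
          using Gb[of u \<omega>] by (simp add: norm_mult indicator_def)
      qed
      also have "\<dots> = measure lborel E * ?I" by simp
      also have "\<dots> \<le> measure lborel E * (schwartz_seminorm (2 * CARD('n)) u * ?D)"
        by (intro mult_left_mono schwartz_integrable(2) u) simp
      finally have "cmod ?c * cmod (\<integral>\<omega>. indicator E \<omega> * ?G u \<omega> \<partial>lborel) \<le>
          cmod ?c * (measure lborel E * (schwartz_seminorm (2 * CARD('n)) u * ?D))"
        by (rule mult_left_mono) simp
      then show ?thesis using u by (simp add: f_def norm_mult mult_ac)
    qed
    then show "\<exists>N C. \<forall>u\<in>schwartz. cmod (f u) \<le> C * schwartz_seminorm N u" by blast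
  qed
  moreover have "is_fourier_fun f (indicator E)"
    unfolding is_fourier_fun_def
  proof (intro conjI allI impI ballI)
    show "(indicator E :: 'n fn) \<in> borel_measurable borel" by measurable
    fix K :: "(real^'n) set" assume "compact K"
    then have K [measurable]: "K \<in> sets borel" by (simp add: compact_imp_closed)
    show "set_integrable lborel K (\<lambda>\<omega>. (cmod (indicator E \<omega>))\<^sup>2)"
      unfolding set_integrable_def
      by (rule Bochner_Integration.integrable_bound[OF iE]) (auto simp: indicator_def)
  next
    fix u :: "'n fn" assume u: "u \<in> test_functions UNIV"
    have "?G (fourier u) \<omega> = of_real ((2 * pi) ^ CARD('n)) * u \<omega>" for \<omega>
      using fourier_inversion[OF u, of \<omega>] by (simp add: inner_commute)
    then have "(\<integral>\<omega>. indicator E \<omega> * ?G (fourier u) \<omega> \<partial>lborel) =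
        (\<integral>\<omega>. of_real ((2 * pi) ^ CARD('n)) * (indicator E \<omega> * u \<omega>) \<partial>lborel)"
      by (simp only: mult.left_commute)
    then show "fourier_dist f u = (\<integral>\<omega>. indicator E \<omega> * u \<omega> \<partial>lborel)"
      using test_schwartz[OF u] fourier_test_schwartz[OF u]
      by (simp only: fourier_dist_def f_def if_True integral_mult_right_zero cc)
  qed
  ultimately show ?thesis by blast
qed

lemma is_fourier_funD:
  assumes "is_fourier_fun T g"
  shows "g \<in> borel_measurable borel" "compact K \<Longrightarrow> set_integrable lborel K (\<lambda>\<omega>. (cmod (g \<omega>))\<^sup>2)"
    "u \<in> test_functions UNIV \<Longrightarrow> fourier_dist T u = (\<integral>\<omega>. g \<omega> * u \<omega> \<partial>lborel)"
  using assms by (auto simp: is_fourier_fun_def)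

lemma set_integrable_of_square:
  fixes g :: "'n::finite fn"
  assumes [measurable]: "g \<in> borel_measurable borel" and K: "compact K"
    and g: "set_integrable lborel K (\<lambda>\<omega>. (cmod (g \<omega>))\<^sup>2)"
  shows "set_integrable lborel K g"
proof -
  have [measurable]: "K \<in> sets borel" using K by (simp add: compact_imp_closed)
  have iK: "integrable lborel (indicator K :: _ \<Rightarrow> real)"
    by (rule integrable_real_indicator) (use emeasure_bounded_finite[OF compact_imp_bounded[OF K]] in simp_all)
  show ?thesis unfolding set_integrable_def
  proof (rule Bochner_Integration.integrable_bound)
    show "integrable lborel (\<lambda>x. indicator K x + indicator K x *\<^sub>R (cmod (g x))\<^sup>2)"
      using g iK by (intro Bochner_Integration.integrable_add) (simp_all add: set_integrable_def)
    show "AE x in lborel. norm (indicator K x *\<^sub>R g x) \<le> norm (indicator K x + indicator K x *\<^sub>R (cmod (g x))\<^sup>2)"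
      using le_one_plus_square by (intro AE_I2) (simp add: indicator_def)
  qed measurable
qed

lemma is_fourier_fun_integrable:
  assumes "is_fourier_fun T g" "u \<in> test_functions UNIV"
  shows "integrable lborel (\<lambda>\<omega>. g \<omega> * u \<omega>)"
  by (rule integrable_mult_test[OF assms(2)])
    (intro set_integrable_of_square is_fourier_funD[OF assms(1)])

lemma set_integrable_square_add:
  fixes g h :: "'n::finite fn"
  assumes [measurable]: "g \<in> borel_measurable borel" "h \<in> borel_measurable borel" "K \<in> sets borel"
    and g: "set_integrable lborel K (\<lambda>\<omega>. (cmod (g \<omega>))\<^sup>2)"
    and h: "set_integrable lborel K (\<lambda>\<omega>. (cmod (h \<omega>))\<^sup>2)"
  shows "set_integrable lborel K (\<lambda>\<omega>. (cmod (g \<omega> + h \<omega>))\<^sup>2)"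
  unfolding set_integrable_def
proof (rule Bochner_Integration.integrable_bound)
  show "integrable lborel (\<lambda>x. 2 * (indicator K x *\<^sub>R (cmod (g x))\<^sup>2) + 2 * (indicator K x *\<^sub>R (cmod (h x))\<^sup>2))"
    using g h by (intro Bochner_Integration.integrable_add integrable_mult_right) (simp_all add: set_integrable_def)
  have "(cmod (g x + h x))\<^sup>2 \<le> 2 * (cmod (g x))\<^sup>2 + 2 * (cmod (h x))\<^sup>2" for x
  proof -
    have "(cmod (g x + h x))\<^sup>2 \<le> (cmod (g x) + cmod (h x))\<^sup>2"
      by (intro power_mono norm_triangle_ineq) simp
    then show ?thesis
      using sum_squares_bound[of "cmod (g x)" "cmod (h x)"] by (simp add: power2_sum)
  qed
  then show "AE x in lborel. norm (indicator K x *\<^sub>R (cmod (g x + h x))\<^sup>2) \<le>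
      norm (2 * (indicator K x *\<^sub>R (cmod (g x))\<^sup>2) + 2 * (indicator K x *\<^sub>R (cmod (h x))\<^sup>2))"
    by (intro AE_I2) (simp add: indicator_def)
qed measurable

lemma is_fourier_fun_add:
  assumes S: "is_fourier_fun S g" and T: "is_fourier_fun T h"
  shows "is_fourier_fun (\<lambda>u. S u + T u) (\<lambda>\<omega>. g \<omega> + h \<omega>)"
  unfolding is_fourier_fun_def
proof (intro conjI allI impI ballI)
  show "(\<lambda>\<omega>. g \<omega> + h \<omega>) \<in> borel_measurable borel"
    using is_fourier_funD(1)[OF S] is_fourier_funD(1)[OF T] by simp
  show "set_integrable lborel K (\<lambda>\<omega>. (cmod (g \<omega> + h \<omega>))\<^sup>2)" if "compact K" for K
    using that by (intro set_integrable_square_add is_fourier_funD[OF S] is_fourier_funD[OF T])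
      (simp add: compact_imp_closed)
  show "fourier_dist (\<lambda>u. S u + T u) u = (\<integral>\<omega>. (g \<omega> + h \<omega>) * u \<omega> \<partial>lborel)"
    if u: "u \<in> test_functions UNIV" for u
    using Bochner_Integration.integral_add[OF is_fourier_fun_integrable[OF S u] is_fourier_fun_integrable[OF T u]]
      is_fourier_funD(3)[OF S u] is_fourier_funD(3)[OF T u] test_schwartz[OF u]
    by (simp add: fourier_dist_def distrib_right)
qed

lemma is_fourier_fun_scale:
  assumes S: "is_fourier_fun S g"
  shows "is_fourier_fun (\<lambda>u. c * S u) (\<lambda>\<omega>. c * g \<omega>)"
  unfolding is_fourier_fun_def
proof (intro conjI allI impI ballI)
  show "(\<lambda>\<omega>. c * g \<omega>) \<in> borel_measurable borel"
    using is_fourier_funD(1)[OF S] by simp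
  show "set_integrable lborel K (\<lambda>\<omega>. (cmod (c * g \<omega>))\<^sup>2)" if "compact K" for K
  proof -
    have "integrable lborel (\<lambda>\<omega>. (cmod c)\<^sup>2 * (indicator K \<omega> *\<^sub>R (cmod (g \<omega>))\<^sup>2))"
      using is_fourier_funD(2)[OF S that] unfolding set_integrable_def by (rule integrable_mult_right)
    then show ?thesis unfolding set_integrable_def
      by (rule back_subst[of "integrable lborel"]) (auto simp: fun_eq_iff norm_mult power_mult_distrib)
  qed
  show "fourier_dist (\<lambda>u. c * S u) u = (\<integral>\<omega>. (c * g \<omega>) * u \<omega> \<partial>lborel)"
    if u: "u \<in> test_functions UNIV" for u
    using is_fourier_funD(3)[OF S u] test_schwartz[OF u]
    by (simp add: fourier_dist_def mult.assoc)
qed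

lemma is_fourier_fun_diff:
  assumes "is_fourier_fun S g" "is_fourier_fun T h"
  shows "is_fourier_fun (\<lambda>u. S u - T u) (\<lambda>\<omega>. g \<omega> - h \<omega>)"
  using is_fourier_fun_add[OF assms(1) is_fourier_fun_scale[OF assms(2), of "-1"]] by simp

lemma is_fourier_fun_translate:
  assumes S: "is_fourier_fun S g"
  shows "is_fourier_fun (translate \<alpha> S) (\<lambda>\<omega>. cis (- (\<alpha> \<bullet> \<omega>)) * g \<omega>)"
  unfolding is_fourier_fun_def
proof (intro conjI allI impI ballI)
  show "(\<lambda>\<omega>. cis (- (\<alpha> \<bullet> \<omega>)) * g \<omega>) \<in> borel_measurable borel"
    using is_fourier_funD(1)[OF S] by simp
  show "set_integrable lborel K (\<lambda>\<omega>. (cmod (cis (- (\<alpha> \<bullet> \<omega>)) * g \<omega>))\<^sup>2)" if "compact K" for K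
    using is_fourier_funD(2)[OF S that] by (simp add: norm_mult)
  fix u :: "'a fn" assume u: "u \<in> test_functions UNIV"
  let ?v = "\<lambda>x. u x * cis (- (\<alpha> \<bullet> x))"
  have v: "?v \<in> test_functions UNIV" by (rule test_mult_cis[OF u])
  have "fourier u (\<omega> + \<alpha>) = fourier ?v \<omega>" for \<omega>
    unfolding fourier_def
    by (intro Bochner_Integration.integral_cong refl) (simp add: inner_add_left cis_mult mult.assoc add.commute)
  then have "fourier_dist (translate \<alpha> S) u = fourier_dist S ?v"
    using test_schwartz[OF u] test_schwartz[OF v] by (simp add: fourier_dist_def translate_def)
  then show "fourier_dist (translate \<alpha> S) u = (\<integral>\<omega>. (cis (- (\<alpha> \<bullet> \<omega>)) * g \<omega>) * u \<omega> \<partial>lborel)"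
    using is_fourier_funD(3)[OF S v] by (simp add: mult_ac)
qed

lemma is_fourier_fun_dilate:
  fixes S :: "'n::finite functional"
  assumes S: "is_fourier_fun S g" and T: "S \<in> tempered" and h: "h > 0"
  shows "is_fourier_fun (dilate h S) (\<lambda>\<omega>. of_real (h ^ CARD('n)) * g (h *\<^sub>R \<omega>))"
  unfolding is_fourier_fun_def
proof (intro conjI allI impI ballI)
  have [measurable]: "g \<in> borel_measurable borel" using is_fourier_funD(1)[OF S] .
  show "(\<lambda>\<omega>. of_real (h ^ CARD('n)) * g (h *\<^sub>R \<omega>)) \<in> borel_measurable borel" by measurable
  show "set_integrable lborel K (\<lambda>\<omega>. (cmod (of_real (h ^ CARD('n)) * g (h *\<^sub>R \<omega>)))\<^sup>2)" if K: "compact K" for K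
  proof -
    let ?K = "(\<lambda>x. h *\<^sub>R x) ` K"
    have cK: "compact ?K" using K by (rule compact_scaling)
    have [measurable]: "K \<in> sets borel" "?K \<in> sets borel" using K cK by (auto simp: compact_imp_closed)
    have "integrable lborel (\<lambda>\<omega>. indicator ?K \<omega> *\<^sub>R (cmod (g \<omega>))\<^sup>2)"
      using is_fourier_funD(2)[OF S cK] by (simp add: set_integrable_def)
    then have "(\<integral>\<^sup>+\<omega>. ennreal (indicator ?K \<omega> * (cmod (g \<omega>))\<^sup>2) \<partial>lborel) < \<infinity>"
      by (subst nn_integral_eq_integral) auto
    then have "ennreal (\<bar>h\<bar> ^ CARD('n)) * (\<integral>\<^sup>+\<omega>. ennreal (indicator ?K (0 + h *\<^sub>R \<omega>) * (cmod (g (0 + h *\<^sub>R \<omega>)))\<^sup>2) \<partial>lborel) < \<infinity>"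
      using h by (subst (asm) nn_integral_affine[where c = h and t = 0]) auto
    moreover have "indicator ?K (h *\<^sub>R \<omega>) = (indicator K \<omega> :: real)" for \<omega>
      using h by (auto simp: indicator_def)
    ultimately have "(\<integral>\<^sup>+\<omega>. ennreal (indicator K \<omega> * (cmod (g (h *\<^sub>R \<omega>)))\<^sup>2) \<partial>lborel) < \<infinity>"
      using h by (auto simp: ennreal_mult_less_top)
    then have "integrable lborel (\<lambda>\<omega>. indicator K \<omega> * (cmod (g (h *\<^sub>R \<omega>)))\<^sup>2)"
      by (intro integrableI_nonneg) auto
    then have "integrable lborel (\<lambda>\<omega>. (h ^ CARD('n))\<^sup>2 * (indicator K \<omega> * (cmod (g (h *\<^sub>R \<omega>)))\<^sup>2))"
      by (rule integrable_mult_right)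
    then show ?thesis
      using h by (simp add: set_integrable_def norm_mult power_mult_distrib norm_power mult.left_commute)
  qed
  fix u :: "'n fn" assume u: "u \<in> test_functions UNIV"
  let ?v = "\<lambda>x. u ((1 / h) *\<^sub>R x)"
  have v: "?v \<in> test_functions UNIV"
    using test_affine[OF u, of "1 / h" 0 UNIV] h by simp
  have [measurable]: "u \<in> borel_measurable borel" by (rule smooth_measurable[OF test_functionsD(1)[OF u]])
  have f: "fourier ?v \<omega> = of_real (h ^ CARD('n)) * fourier u (h *\<^sub>R \<omega>)" for \<omega>
  proof -
    have "fourier ?v \<omega> = of_real (\<bar>h\<bar> ^ CARD('n)) * (\<integral>x. ?v (0 + h *\<^sub>R x) * cis (- (\<omega> \<bullet> (0 + h *\<^sub>R x))) \<partial>lborel)"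
      unfolding fourier_def by (rule integral_affine) (use h in auto)
    then show ?thesis using h by (simp add: fourier_def)
  qed
  have lin: "S (\<lambda>x. c * w x) = c * S w" if "w \<in> schwartz" for c w
    using T that by (simp add: tempered_def)
  have sc: "(\<lambda>\<omega>. fourier u (h *\<^sub>R \<omega>)) \<in> schwartz"
  proof -
    have "(\<lambda>\<omega>. fourier u (h *\<^sub>R \<omega>)) = (\<lambda>\<omega>. inverse (of_real (h ^ CARD('n))) * fourier ?v \<omega>)"
      unfolding f using h by (subst inverse_cancel) auto
    then show ?thesis using schwartz_scale[OF fourier_test_schwartz[OF v]] by simp
  qed
  have "fourier_dist (dilate h S) u = S (fourier ?v)"
    using test_schwartz[OF u] lin[OF sc, of "of_real (h ^ CARD('n))"]
    by (simp add: fourier_dist_def dilate_def f[abs_def] del: of_real_power)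
  also have "\<dots> = (\<integral>\<omega>. g \<omega> * ?v \<omega> \<partial>lborel)"
    using is_fourier_funD(3)[OF S v] test_schwartz[OF v] by (simp add: fourier_dist_def)
  also have "\<dots> = of_real (\<bar>h\<bar> ^ CARD('n)) * (\<integral>\<omega>. g (0 + h *\<^sub>R \<omega>) * ?v (0 + h *\<^sub>R \<omega>) \<partial>lborel)"
    by (rule integral_affine) (use h in auto)
  finally show "fourier_dist (dilate h S) u = (\<integral>\<omega>. of_real (h ^ CARD('n)) * g (h *\<^sub>R \<omega>) * u \<omega> \<partial>lborel)"
    using h by (simp add: mult.assoc del: of_real_power)
qed

lemma AE_lborel_if_AE_balls:
  fixes P :: "real^'n::finite \<Rightarrow> bool"
  assumes "\<And>n::nat. AE x in lborel. x \<in> ball 0 (real (Suc n)) \<longrightarrow> P x"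
  shows "AE x in lborel. P x"
proof -
  have "AE x in lborel. \<forall>n. x \<in> ball 0 (real (Suc n)) \<longrightarrow> P x"
    using assms by (simp only: AE_all_countable) blast
  then show ?thesis
  proof eventually_elim
    case (elim x)
    obtain n :: nat where "norm x < real n" using reals_Archimedean2 by blast
    then have "x \<in> ball 0 (real (Suc n))" by simp
    then show ?case using elim by blast
  qed
qed

text \<open>Two representatives of the same functional have the same pairings with all test functions, so their
  difference satisfies the almost everywhere bound by \<open>0\<close>.\<close>

lemma is_fourier_fun_unique:
  assumes "is_fourier_fun T g" "is_fourier_fun T h"
  shows "AE \<omega> in lborel. g \<omega> = h \<omega>"
proof (rule AE_lborel_if_AE_balls)
  fix n
  let ?r = "real (Suc n)" and ?v = "\<lambda>\<omega>. g \<omega> - h \<omega>"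
  have d: "is_fourier_fun (\<lambda>u. T u - T u) ?v" by (rule is_fourier_fun_diff[OF assms])
  have "AE x in lborel. x \<in> ball 0 ?r \<longrightarrow> cmod (?v x) \<le> 0"
  proof (rule AE_bound_if_test_bound)
    show "?v \<in> borel_measurable borel" by (rule is_fourier_funD(1)[OF d])
    show "set_integrable lborel (ball 0 ?r) (\<lambda>x. (cmod (?v x))\<^sup>2)"
      by (rule set_integrable_subset[OF is_fourier_funD(2)[OF d, of "cball 0 ?r"]]) auto
    fix u :: "'a fn" assume "u \<in> test_functions (ball 0 ?r)"
    then have u: "u \<in> test_functions UNIV" by (rule test_UNIV)
    show "cmod (\<integral>x. ?v x * u x \<partial>lborel) \<le> (\<integral>x. 0 * cmod (u x) \<partial>lborel)"
      using is_fourier_funD(3)[OF d u] by (simp add: fourier_dist_def)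
  qed auto
  then show "AE x in lborel. x \<in> ball 0 ?r \<longrightarrow> g x = h x"
    by eventually_elim auto
qed

lemma is_fourier_fun_cong_AE:
  assumes "is_fourier_fun T g" "h \<in> borel_measurable borel" "AE \<omega> in lborel. g \<omega> = h \<omega>"
  shows "AE \<omega> in lborel. fourier_fun T \<omega> = h \<omega>"
proof -
  have "is_fourier_fun T (fourier_fun T)"
    unfolding fourier_fun_def by (rule someI[of "is_fourier_fun T"]) (rule assms(1))
  from is_fourier_fun_unique[OF this assms(1)] assms(3) show ?thesis
    by eventually_elim simp
qed

lemma fourier_fun_AE: "is_fourier_fun T g \<Longrightarrow> AE \<omega> in lborel. fourier_fun T \<omega> = g \<omega>"
  by (rule is_fourier_fun_cong_AE) (auto intro: is_fourier_funD(1))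

lemma is_fourier_fun_fourier_fun: "is_fourier_fun T g \<Longrightarrow> is_fourier_fun T (fourier_fun T)"
  unfolding fourier_fun_def by (rule someI[of "is_fourier_fun T" g])

section \<open>Weighted norms of Fourier representatives\<close>

definition sob2 :: "real \<Rightarrow> 'n::finite fn \<Rightarrow> ennreal" where
  "sob2 \<sigma> g = (\<integral>\<^sup>+\<omega>. ennreal ((1 + norm \<omega>) powr (2 * \<sigma>) * (cmod (g \<omega>))\<^sup>2) \<partial>lborel)"

text \<open>The same integral after the substitution \<open>\<xi> = h \<omega>\<close>; the order of approximation is read off
  from it, since all translates of the spectrum live on the fixed lattice in the variable \<open>\<xi>\<close>.\<close>

definition scaled2 :: "real \<Rightarrow> real \<Rightarrow> 'n::finite fn \<Rightarrow> ennreal" where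
  "scaled2 \<sigma> h F = (\<integral>\<^sup>+\<xi>. ennreal ((1 + norm \<xi> / h) powr (2 * \<sigma>) * (cmod (F \<xi>))\<^sup>2) \<partial>lborel)"

lemma weight_measurable [measurable]:
  "(\<lambda>\<omega>::real^'n::finite. (1 + norm \<omega> / h) powr p) \<in> borel_measurable borel"
  "(\<lambda>\<omega>::real^'n::finite. (1 + norm \<omega>) powr p) \<in> borel_measurable borel"
  by measurable

lemma ennreal_not_finite: "\<not> X < \<infinity> \<Longrightarrow> X = (\<top>::ennreal)"
  by (simp add: not_less top_unique)

lemma finite_if_mult_finite:
  assumes "c > 0" "ennreal c * X < \<infinity>"
  shows "X < \<infinity>"
proof (rule ccontr)
  assume "\<not> X < \<infinity>"
  then have "X = \<top>" by (rule ennreal_not_finite)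
  then show False using assms by (simp add: ennreal_mult_top)
qed

lemma sob2_cong_AE:
  assumes "AE \<omega> in lborel. g \<omega> = h \<omega>"
  shows "sob2 \<sigma> g = sob2 \<sigma> h"
  unfolding sob2_def by (rule nn_integral_cong_AE) (use assms in \<open>eventually_elim, simp\<close>)

lemma sob2_mono:
  assumes "\<sigma> \<le> \<tau>"
  shows "sob2 \<sigma> g \<le> sob2 \<tau> g"
  unfolding sob2_def
  by (intro nn_integral_mono ennreal_leI mult_right_mono powr_mono) (use assms in auto)

lemma sob2_add_le:
  assumes [measurable]: "g \<in> borel_measurable borel" "h \<in> borel_measurable borel"
  shows "sob2 \<sigma> (\<lambda>\<omega>. g \<omega> + h \<omega>) \<le> 2 * sob2 \<sigma> g + 2 * sob2 \<sigma> h"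
proof -
  have "ennreal ((1 + norm \<omega>) powr (2 * \<sigma>) * (cmod (g \<omega> + h \<omega>))\<^sup>2) \<le>
      2 * ennreal ((1 + norm \<omega>) powr (2 * \<sigma>) * (cmod (g \<omega>))\<^sup>2) +
      2 * ennreal ((1 + norm \<omega>) powr (2 * \<sigma>) * (cmod (h \<omega>))\<^sup>2)" for \<omega>
  proof -
    let ?w = "(1 + norm \<omega>) powr (2 * \<sigma>)"
    have "(cmod (g \<omega> + h \<omega>))\<^sup>2 \<le> (cmod (g \<omega>) + cmod (h \<omega>))\<^sup>2"
      by (intro power_mono norm_triangle_ineq) simp
    then have "(cmod (g \<omega> + h \<omega>))\<^sup>2 \<le> 2 * (cmod (g \<omega>))\<^sup>2 + 2 * (cmod (h \<omega>))\<^sup>2"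
      using sum_squares_bound[of "cmod (g \<omega>)" "cmod (h \<omega>)"] by (simp add: power2_sum)
    then have "?w * (cmod (g \<omega> + h \<omega>))\<^sup>2 \<le> ?w * (2 * (cmod (g \<omega>))\<^sup>2 + 2 * (cmod (h \<omega>))\<^sup>2)"
      by (rule mult_left_mono) simp
    also have "\<dots> = 2 * (?w * (cmod (g \<omega>))\<^sup>2) + 2 * (?w * (cmod (h \<omega>))\<^sup>2)"
      by (simp add: distrib_left)
    finally have "ennreal (?w * (cmod (g \<omega> + h \<omega>))\<^sup>2) \<le>
        ennreal (2 * (?w * (cmod (g \<omega>))\<^sup>2) + 2 * (?w * (cmod (h \<omega>))\<^sup>2))"
      by (rule ennreal_leI)
    then show ?thesis by (simp add: ennreal_mult)
  qed
  then have "sob2 \<sigma> (\<lambda>\<omega>. g \<omega> + h \<omega>) \<le> (\<integral>\<^sup>+\<omega>. 2 * ennreal ((1 + norm \<omega>) powr (2 * \<sigma>) * (cmod (g \<omega>))\<^sup>2) +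
      2 * ennreal ((1 + norm \<omega>) powr (2 * \<sigma>) * (cmod (h \<omega>))\<^sup>2) \<partial>lborel)"
    unfolding sob2_def by (intro nn_integral_mono)
  also have "\<dots> = 2 * sob2 \<sigma> g + 2 * sob2 \<sigma> h"
    unfolding sob2_def by (subst nn_integral_add) (simp_all add: nn_integral_cmult)
  finally show ?thesis .
qed

lemma sob2_scale:
  assumes [measurable]: "g \<in> borel_measurable borel"
  shows "sob2 \<sigma> (\<lambda>\<omega>. c * g \<omega>) = ennreal ((cmod c)\<^sup>2) * sob2 \<sigma> g"
proof -
  have "ennreal ((1 + norm \<omega>) powr (2 * \<sigma>) * (cmod (c * g \<omega>))\<^sup>2) =
      ennreal ((cmod c)\<^sup>2) * ennreal ((1 + norm \<omega>) powr (2 * \<sigma>) * (cmod (g \<omega>))\<^sup>2)" for \<omega>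
    by (simp add: norm_mult power_mult_distrib ennreal_mult'[symmetric] mult_ac)
  then show ?thesis unfolding sob2_def by (simp add: nn_integral_cmult)
qed

lemma powr_between:
  fixes x :: real
  assumes "0 < a" "a \<le> x" "x \<le> b"
  shows "min (a powr p) (b powr p) \<le> x powr p" "x powr p \<le> max (a powr p) (b powr p)"
proof -
  have "min (a powr p) (b powr p) \<le> x powr p \<and> x powr p \<le> max (a powr p) (b powr p)"
  proof (cases "p \<ge> 0")
    case True
    then have "a powr p \<le> x powr p" "x powr p \<le> b powr p" using assms by (auto intro!: powr_mono2)
    then show ?thesis by (simp add: min_le_iff_disj le_max_iff_disj)
  next
    case False
    then have "x powr p \<le> a powr p" "b powr p \<le> x powr p" using assms by (auto intro!: powr_mono2')
    then show ?thesis by (simp add: min_le_iff_disj le_max_iff_disj)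
  qed
  then show "min (a powr p) (b powr p) \<le> x powr p" "x powr p \<le> max (a powr p) (b powr p)" by auto
qed

lemma sob2_dilate:
  fixes F :: "'n::finite fn"
  assumes [measurable]: "F \<in> borel_measurable borel" and h: "h > 0"
  shows "scaled2 \<sigma> h F = ennreal (h ^ CARD('n)) * sob2 \<sigma> (\<lambda>\<omega>. F (h *\<^sub>R \<omega>))"
proof -
  have "scaled2 \<sigma> h F = ennreal (\<bar>h\<bar> ^ CARD('n)) *
      (\<integral>\<^sup>+\<omega>. ennreal ((1 + norm (0 + h *\<^sub>R \<omega>) / h) powr (2 * \<sigma>) * (cmod (F (0 + h *\<^sub>R \<omega>)))\<^sup>2) \<partial>lborel)"
    unfolding scaled2_def by (rule nn_integral_affine) (use h in auto)
  then show ?thesis using h by (simp add: sob2_def)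
qed

lemma scaled2_finite:
  fixes F :: "'n::finite fn"
  assumes [measurable]: "F \<in> borel_measurable borel" and h: "h > 0" and F: "sob2 \<sigma> F < \<infinity>"
  shows "scaled2 \<sigma> h F < \<infinity>"
proof -
  define a b where "a = min 1 (1 / h)" and "b = max 1 (1 / h)"
  have ab: "0 < a" "0 < b" using h by (auto simp: a_def b_def)
  define K where "K = max (a powr (2 * \<sigma>)) (b powr (2 * \<sigma>))"
  have K0: "0 \<le> K" by (simp add: K_def le_max_iff_disj)
  have "(1 + norm \<xi> / h) powr (2 * \<sigma>) \<le> K * (1 + norm \<xi>) powr (2 * \<sigma>)" for \<xi> :: "real^'n"
  proof -
    have n: "0 < 1 + norm \<xi>" by (simp add: add_pos_nonneg)
    have "a * (1 + norm \<xi>) \<le> 1 + norm \<xi> / h"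
    proof -
      have "a \<le> 1" "a \<le> 1 / h" by (auto simp: a_def)
      moreover from this(2) have "a * norm \<xi> \<le> 1 / h * norm \<xi>" by (rule mult_right_mono) simp
      ultimately show ?thesis by (simp add: distrib_left)
    qed
    moreover have "1 + norm \<xi> / h \<le> b * (1 + norm \<xi>)"
    proof -
      have "1 \<le> b" "1 / h \<le> b" by (auto simp: b_def)
      moreover from this(2) have "1 / h * norm \<xi> \<le> b * norm \<xi>" by (rule mult_right_mono) simp
      ultimately show ?thesis by (simp add: distrib_left)
    qed
    ultimately have "(1 + norm \<xi> / h) powr (2 * \<sigma>) \<le>
        max ((a * (1 + norm \<xi>)) powr (2 * \<sigma>)) ((b * (1 + norm \<xi>)) powr (2 * \<sigma>))"
      using ab n by (intro powr_between) auto
    also have "\<dots> = K * (1 + norm \<xi>) powr (2 * \<sigma>)"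
      using ab n by (simp add: K_def powr_mult max_mult_distrib_right)
    finally show ?thesis .
  qed
  then have "scaled2 \<sigma> h F \<le> (\<integral>\<^sup>+\<xi>. ennreal K * ennreal ((1 + norm \<xi>) powr (2 * \<sigma>) * (cmod (F \<xi>))\<^sup>2) \<partial>lborel)"
    unfolding scaled2_def using K0
    by (intro nn_integral_mono) (simp add: ennreal_mult'[symmetric] mult.assoc[symmetric] mult_right_mono ennreal_leI)
  also have "\<dots> = ennreal K * sob2 \<sigma> F"
    unfolding sob2_def by (rule nn_integral_cmult) measurable
  also have "\<dots> < \<infinity>" using F by (simp add: ennreal_mult_less_top)
  finally show ?thesis .
qed

lemma sob2_dilate_finite:
  fixes F :: "'n::finite fn"
  assumes [measurable]: "F \<in> borel_measurable borel" and h: "h > 0" and F: "sob2 \<sigma> F < \<infinity>"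
  shows "sob2 \<sigma> (\<lambda>\<omega>. F (h *\<^sub>R \<omega>)) < \<infinity>"
  by (rule finite_if_mult_finite[of "h ^ CARD('n)"])
    (use h scaled2_finite[OF assms] in \<open>simp_all add: sob2_dilate[OF assms(1,2)]\<close>)

section \<open>Sobolev spaces\<close>

lemma tempered_lin:
  assumes "T \<in> tempered"
  shows "u \<notin> schwartz \<Longrightarrow> T u = 0"
    "u \<in> schwartz \<Longrightarrow> v \<in> schwartz \<Longrightarrow> T (\<lambda>x. u x + v x) = T u + T v"
    "u \<in> schwartz \<Longrightarrow> T (\<lambda>x. c * u x) = c * T u"
    "\<exists>N C. \<forall>u\<in>schwartz. cmod (T u) \<le> C * schwartz_seminorm N u"
  using assms by (simp_all add: tempered_def)

lemma seminorm_nonneg: "u \<in> schwartz \<Longrightarrow> 0 \<le> schwartz_seminorm N u"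
  using seminorm_upper[of u "\<lambda>_. 0" N 0] by (simp add: mi_order_def order_trans[OF norm_ge_zero])

lemma seminorm_mono:
  assumes "u \<in> schwartz" "N \<le> M"
  shows "schwartz_seminorm N u \<le> schwartz_seminorm M u"
proof (rule seminorm_least)
  fix x and \<gamma> :: "'a multi_index"
  assume "mi_order \<gamma> \<le> N"
  then have "(1 + norm x) ^ M * cmod (mpartial \<gamma> u x) \<le> schwartz_seminorm M u"
    using assms by (intro seminorm_upper) auto
  moreover have "(1 + norm x) ^ N * cmod (mpartial \<gamma> u x) \<le> (1 + norm x) ^ M * cmod (mpartial \<gamma> u x)"
    by (intro mult_right_mono power_increasing assms(2)) auto
  ultimately show "(1 + norm x) ^ N * cmod (mpartial \<gamma> u x) \<le> schwartz_seminorm M u" by linarith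
qed

lemma tempered_zero: "(\<lambda>u. 0) \<in> tempered"
  unfolding tempered_def by (auto intro!: exI[of _ 0])

lemma tempered_add:
  assumes S: "S \<in> tempered" and T: "T \<in> tempered"
  shows "(\<lambda>u. S u + T u) \<in> tempered"
proof -
  obtain N C where N: "\<And>u. u \<in> schwartz \<Longrightarrow> cmod (S u) \<le> C * schwartz_seminorm N u"
    using tempered_lin(4)[OF S] by blast
  obtain M D where M: "\<And>u. u \<in> schwartz \<Longrightarrow> cmod (T u) \<le> D * schwartz_seminorm M u"
    using tempered_lin(4)[OF T] by blast
  have "cmod (S u + T u) \<le> (\<bar>C\<bar> + \<bar>D\<bar>) * schwartz_seminorm (max N M) u" if u: "u \<in> schwartz" for u
  proof -
    have "cmod (S u) \<le> \<bar>C\<bar> * schwartz_seminorm (max N M) u"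
      by (rule order_trans[OF N[OF u] mult_mono]) (use u in \<open>auto intro: seminorm_mono seminorm_nonneg\<close>)
    moreover have "cmod (T u) \<le> \<bar>D\<bar> * schwartz_seminorm (max N M) u"
      by (rule order_trans[OF M[OF u] mult_mono]) (use u in \<open>auto intro: seminorm_mono seminorm_nonneg\<close>)
    ultimately show ?thesis
      using norm_triangle_ineq[of "S u" "T u"] by (simp add: distrib_right)
  qed
  then show ?thesis
    using tempered_lin(1-3)[OF S] tempered_lin(1-3)[OF T] unfolding tempered_def
    by (simp add: distrib_left) blast
qed

lemma tempered_scale:
  assumes T: "T \<in> tempered"
  shows "(\<lambda>u. c * T u) \<in> tempered"
proof -
  obtain N C where N: "\<And>u. u \<in> schwartz \<Longrightarrow> cmod (T u) \<le> C * schwartz_seminorm N u"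
    using tempered_lin(4)[OF T] by blast
  have "cmod (c * T u) \<le> (cmod c * C) * schwartz_seminorm N u" if "u \<in> schwartz" for u
    using mult_left_mono[OF N[OF that] norm_ge_zero[of c]] by (simp add: norm_mult mult_ac)
  then show ?thesis
    using tempered_lin(1-3)[OF T] unfolding tempered_def
    by (simp add: distrib_left mult.left_commute) blast
qed

lemma tempered_translate:
  assumes T: "T \<in> tempered"
  shows "translate \<alpha> T \<in> tempered"
proof -
  obtain N C where N: "\<And>u. u \<in> schwartz \<Longrightarrow> cmod (T u) \<le> C * schwartz_seminorm N u"
    using tempered_lin(4)[OF T] by blast
  have "cmod (translate \<alpha> T u) \<le> (\<bar>C\<bar> * (1 + norm \<alpha>) ^ N) * schwartz_seminorm N u" if u: "u \<in> schwartz" for u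
  proof -
    have s: "(\<lambda>x. u (x + \<alpha>)) \<in> schwartz" by (rule schwartz_translate[OF u])
    have "cmod (translate \<alpha> T u) \<le> C * schwartz_seminorm N (\<lambda>x. u (x + \<alpha>))"
      unfolding translate_def by (rule N[OF s])
    also have "\<dots> \<le> \<bar>C\<bar> * ((1 + norm \<alpha>) ^ N * schwartz_seminorm N u)"
      by (intro mult_mono seminorm_translate u seminorm_nonneg s) auto
    finally show ?thesis by (simp add: mult.assoc)
  qed
  then have "\<exists>N C. \<forall>u\<in>schwartz. cmod (translate \<alpha> T u) \<le> C * schwartz_seminorm N u" by blast
  moreover have "translate \<alpha> T u = 0" if "u \<notin> schwartz" for u
    unfolding translate_def using that by (intro tempered_lin(1)[OF T]) (simp add: schwartz_translate_iff)
  moreover have "translate \<alpha> T (\<lambda>x. u x + v x) = translate \<alpha> T u + translate \<alpha> T v"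
    if "u \<in> schwartz" "v \<in> schwartz" for u v
    unfolding translate_def using that by (intro tempered_lin(2)[OF T]) (auto simp: schwartz_translate_iff)
  moreover have "translate \<alpha> T (\<lambda>x. c * u x) = c * translate \<alpha> T u" if "u \<in> schwartz" for u c
    unfolding translate_def using that by (intro tempered_lin(3)[OF T]) (auto simp: schwartz_translate_iff)
  ultimately show ?thesis unfolding tempered_def by blast
qed

lemma
  assumes T: "is_fourier_fun T g"
  shows sobolev_iff: "T \<in> sobolev \<sigma> \<longleftrightarrow> T \<in> tempered \<and> sob2 \<sigma> g < \<infinity>"
    and sobolev_norm_eq: "sobolev_norm \<sigma> T = sqrt (enn2real (sob2 \<sigma> g))"
proof -
  have f: "is_fourier_fun T (fourier_fun T)" by (rule is_fourier_fun_fourier_fun[OF T])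
  have [measurable]: "fourier_fun T \<in> borel_measurable borel" by (rule is_fourier_funD(1)[OF f])
  have e: "sob2 \<sigma> (fourier_fun T) = sob2 \<sigma> g" by (rule sob2_cong_AE[OF fourier_fun_AE[OF T]])
  have "integrable lborel (\<lambda>\<omega>. (1 + norm \<omega>) powr (2 * \<sigma>) * (cmod (fourier_fun T \<omega>))\<^sup>2) \<longleftrightarrow>
      sob2 \<sigma> (fourier_fun T) < \<infinity>"
    unfolding sob2_def integrable_iff_bounded by (auto simp: abs_mult)
  then show "T \<in> sobolev \<sigma> \<longleftrightarrow> T \<in> tempered \<and> sob2 \<sigma> g < \<infinity>"
    using T by (auto simp: sobolev_def e)
  have "(\<integral>\<omega>. (1 + norm \<omega>) powr (2 * \<sigma>) * (cmod (fourier_fun T \<omega>))\<^sup>2 \<partial>lborel) = enn2real (sob2 \<sigma> (fourier_fun T))"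
    unfolding sob2_def by (rule integral_eq_nn_integral) auto
  then show "sobolev_norm \<sigma> T = sqrt (enn2real (sob2 \<sigma> g))"
    by (simp add: sobolev_norm_def e)
qed

lemma sobolevD:
  assumes "T \<in> sobolev \<sigma>"
  shows "T \<in> tempered" "is_fourier_fun T (fourier_fun T)" "sob2 \<sigma> (fourier_fun T) < \<infinity>"
    "fourier_fun T \<in> borel_measurable borel"
proof -
  show t: "T \<in> tempered" using assms by (simp add: sobolev_def)
  show f: "is_fourier_fun T (fourier_fun T)"
    using assms is_fourier_fun_fourier_fun by (auto simp: sobolev_def)
  show "sob2 \<sigma> (fourier_fun T) < \<infinity>" using sobolev_iff[OF f, of \<sigma>] assms by simp
  show "fourier_fun T \<in> borel_measurable borel" by (rule is_fourier_funD(1)[OF f])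
qed

lemma sobolev_mono:
  assumes "\<sigma> \<le> \<tau>" "T \<in> sobolev \<tau>"
  shows "T \<in> sobolev \<sigma>"
  using sobolev_iff[OF sobolevD(2)[OF assms(2)], of \<sigma>] sobolevD[OF assms(2)] sob2_mono[OF assms(1)]
  by (auto intro: le_less_trans)

lemma is_fourier_fun_zero: "is_fourier_fun (\<lambda>u. 0) (\<lambda>\<omega>. 0)"
  unfolding is_fourier_fun_def fourier_dist_def set_integrable_def by simp

lemma sobolev_zero: "(\<lambda>u. 0) \<in> sobolev \<sigma>"
  by (simp add: sobolev_iff[OF is_fourier_fun_zero] tempered_zero sob2_def)

lemma sobolev_add:
  assumes S: "S \<in> sobolev \<sigma>" and T: "T \<in> sobolev \<sigma>"
  shows "(\<lambda>u. S u + T u) \<in> sobolev \<sigma>"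
proof -
  have "sob2 \<sigma> (\<lambda>\<omega>. fourier_fun S \<omega> + fourier_fun T \<omega>) < \<infinity>"
    by (rule le_less_trans[OF sob2_add_le]) (use sobolevD[OF S] sobolevD[OF T] in \<open>auto simp: ennreal_mult_less_top\<close>)
  then show ?thesis
    using sobolev_iff[OF is_fourier_fun_add[OF sobolevD(2)[OF S] sobolevD(2)[OF T]], of \<sigma>]
      tempered_add[OF sobolevD(1)[OF S] sobolevD(1)[OF T]] by simp
qed

lemma sobolev_scale:
  assumes T: "T \<in> sobolev \<sigma>"
  shows "(\<lambda>u. c * T u) \<in> sobolev \<sigma>"
  using sobolev_iff[OF is_fourier_fun_scale[OF sobolevD(2)[OF T], of c], of \<sigma>]
    tempered_scale[OF sobolevD(1)[OF T], of c] sobolevD(3)[OF T]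
  by (simp add: sob2_scale[OF sobolevD(4)[OF T]] ennreal_mult_less_top)

lemma sobolev_translate:
  assumes T: "T \<in> sobolev \<sigma>"
  shows "translate \<alpha> T \<in> sobolev \<sigma>"
  using sobolev_iff[OF is_fourier_fun_translate[OF sobolevD(2)[OF T], of \<alpha>], of \<sigma>]
    tempered_translate[OF sobolevD(1)[OF T], of \<alpha>] sobolevD(3)[OF T]
  by (simp add: sob2_def norm_mult)

section \<open>Principal shift-invariant spaces on the Fourier side\<close>

definition dual_lattice :: "(real^'n::finite) set" where
  "dual_lattice = (\<lambda>\<alpha>. (2 * pi) *\<^sub>R \<alpha>) ` int_lattice"

lemma cis_lattice:
  assumes "\<alpha> \<in> int_lattice" "\<beta> \<in> dual_lattice"
  shows "cis (\<alpha> \<bullet> \<beta>) = 1"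
proof -
  obtain b where b: "b \<in> int_lattice" "\<beta> = (2 * pi) *\<^sub>R b" using assms(2) by (auto simp: dual_lattice_def)
  have "\<alpha> \<bullet> b \<in> \<int>"
    using assms(1) b(1) unfolding inner_vec_def by (auto simp: int_lattice_def intro!: Ints_sum Ints_mult)
  then obtain n :: int where "\<alpha> \<bullet> b = of_int n" by (auto elim: Ints_cases)
  then show ?thesis by (simp add: b(2))
qed

lemma cis_lattice_shift:
  assumes "\<alpha> \<in> int_lattice" "\<beta> \<in> dual_lattice"
  shows "cis (- (\<alpha> \<bullet> (\<omega> + \<beta>))) = cis (- (\<alpha> \<bullet> \<omega>))"
proof -
  have "cis (- (\<alpha> \<bullet> (\<omega> + \<beta>))) = cis (- (\<alpha> \<bullet> \<omega>)) * inverse (cis (\<alpha> \<bullet> \<beta>))"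
    by (simp add: inner_add_right cis_mult)
  then show ?thesis using cis_lattice[OF assms] by simp
qed

text \<open>The elements whose spectra have the same ratio on the shifted frequencies as the generator.
  Being closed and shift-invariant, this space contains the one generated by \<open>\<phi>\<close>; it replaces the
  full description of the latter by periodic multiples of \<open>\<phi>\<close>'s spectrum.\<close>

definition ratio_space :: "real \<Rightarrow> 'n::finite functional \<Rightarrow> real^'n \<Rightarrow> 'n functional set" where
  "ratio_space \<sigma> \<phi> \<beta> = {T \<in> sobolev \<sigma>. AE \<omega> in lborel.
     fourier_fun T \<omega> * fourier_fun \<phi> (\<omega> + \<beta>) = fourier_fun T (\<omega> + \<beta>) * fourier_fun \<phi> \<omega>}"

lemma AE_translate:
  fixes P :: "real^'n::finite \<Rightarrow> bool"
  assumes "AE x in lborel. P x"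
  shows "AE x in lborel. P (x + \<beta>)"
  using AE_affine[OF assms, of 1 \<beta>] by (simp add: add.commute)

lemma ratio_spaceI:
  assumes T: "T \<in> sobolev \<sigma>" and g: "is_fourier_fun T g"
    and r: "AE \<omega> in lborel. g \<omega> * fourier_fun \<phi> (\<omega> + \<beta>) = g (\<omega> + \<beta>) * fourier_fun \<phi> \<omega>"
  shows "T \<in> ratio_space \<sigma> \<phi> \<beta>"
proof -
  have "AE \<omega> in lborel. fourier_fun T \<omega> * fourier_fun \<phi> (\<omega> + \<beta>) = fourier_fun T (\<omega> + \<beta>) * fourier_fun \<phi> \<omega>"
    using r fourier_fun_AE[OF g] AE_translate[OF fourier_fun_AE[OF g], of \<beta>] by eventually_elim simp
  then show ?thesis using T by (simp add: ratio_space_def)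
qed

lemma ratio_spaceD:
  assumes "T \<in> ratio_space \<sigma> \<phi> \<beta>"
  shows "T \<in> sobolev \<sigma>"
    "AE \<omega> in lborel. fourier_fun T \<omega> * fourier_fun \<phi> (\<omega> + \<beta>) = fourier_fun T (\<omega> + \<beta>) * fourier_fun \<phi> \<omega>"
  using assms by (auto simp: ratio_space_def)

lemma sobolev_norm_tendsto_0_AE_subseq:
  assumes X: "\<And>n. X n \<in> sobolev \<sigma>" and T: "T \<in> sobolev \<sigma>"
    and lim: "(\<lambda>n::nat. sobolev_norm \<sigma> (\<lambda>u. X n u - T u)) \<longlonglongrightarrow> 0"
  shows "\<exists>r. strict_mono r \<and> (AE \<omega> in lborel. (\<lambda>n. fourier_fun (X (r n)) \<omega>) \<longlonglongrightarrow> fourier_fun T \<omega>)"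
proof -
  let ?w = "\<lambda>n \<omega>. (1 + norm \<omega>) powr (2 * \<sigma>) * (cmod (fourier_fun (X n) \<omega> - fourier_fun T \<omega>))\<^sup>2"
  have [measurable]: "fourier_fun T \<in> borel_measurable borel" "fourier_fun (X n) \<in> borel_measurable borel" for n
    using sobolevD(4)[OF T] sobolevD(4)[OF X] by auto
  have d: "is_fourier_fun (\<lambda>u. X n u - T u) (\<lambda>\<omega>. fourier_fun (X n) \<omega> - fourier_fun T \<omega>)" for n
    by (intro is_fourier_fun_diff sobolevD(2)[OF T] sobolevD(2)[OF X])
  have "(\<lambda>u. X n u - T u) \<in> sobolev \<sigma>" for n
    using sobolev_add[OF X[of n] sobolev_scale[OF T, of "-1"]] by simp
  then have fin: "sob2 \<sigma> (\<lambda>\<omega>. fourier_fun (X n) \<omega> - fourier_fun T \<omega>) < \<infinity>" for n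
    using sobolev_iff[OF d] by blast
  have int: "integrable lborel (?w n)" for n
    using fin[of n] unfolding sob2_def by (intro integrableI_nonneg) auto
  have "(\<integral>\<omega>. norm (?w n \<omega>) \<partial>lborel) = (sobolev_norm \<sigma> (\<lambda>u. X n u - T u))\<^sup>2" for n
  proof -
    have "(\<integral>\<omega>. norm (?w n \<omega>) \<partial>lborel) = (\<integral>\<omega>. ?w n \<omega> \<partial>lborel)"
      by (intro Bochner_Integration.integral_cong) auto
    also have "\<dots> = enn2real (sob2 \<sigma> (\<lambda>\<omega>. fourier_fun (X n) \<omega> - fourier_fun T \<omega>))"
      unfolding sob2_def by (rule integral_eq_nn_integral) auto
    finally show ?thesis by (simp add: sobolev_norm_eq[OF d])
  qed
  moreover have "(\<lambda>n. (sobolev_norm \<sigma> (\<lambda>u. X n u - T u))\<^sup>2) \<longlonglongrightarrow> 0\<^sup>2"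
    by (intro tendsto_power lim)
  ultimately have "(\<lambda>n. \<integral>\<omega>. norm (?w n \<omega>) \<partial>lborel) \<longlonglongrightarrow> 0" by simp
  from tendsto_L1_AE_subseq[OF int this] obtain r where r: "strict_mono r"
    "AE \<omega> in lborel. (\<lambda>n. ?w (r n) \<omega>) \<longlonglongrightarrow> 0" by blast
  have "AE \<omega> in lborel. (\<lambda>n. fourier_fun (X (r n)) \<omega>) \<longlonglongrightarrow> fourier_fun T \<omega>"
    using r(2)
  proof eventually_elim
    case (elim \<omega>)
    let ?c = "(1 + norm \<omega>) powr (2 * \<sigma>)"
    have "0 < 1 + norm \<omega>" by (simp add: add_pos_nonneg)
    then have c: "?c \<noteq> 0" by simp
    have "(\<lambda>n. inverse ?c * ?w (r n) \<omega>) \<longlonglongrightarrow> inverse ?c * 0"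
      by (intro tendsto_mult tendsto_const elim)
    then have "(\<lambda>n. (cmod (fourier_fun (X (r n)) \<omega> - fourier_fun T \<omega>))\<^sup>2) \<longlonglongrightarrow> 0"
      unfolding mult.assoc[symmetric] left_inverse[OF c] mult_1_left mult_zero_right .
    then have "(\<lambda>n. sqrt ((cmod (fourier_fun (X (r n)) \<omega> - fourier_fun T \<omega>))\<^sup>2)) \<longlonglongrightarrow> sqrt 0"
      by (rule tendsto_real_sqrt)
    then have "(\<lambda>n. cmod (fourier_fun (X (r n)) \<omega> - fourier_fun T \<omega>)) \<longlonglongrightarrow> 0"
      by (simp only: real_sqrt_zero real_sqrt_abs abs_norm_cancel)
    then have "(\<lambda>n. fourier_fun (X (r n)) \<omega> - fourier_fun T \<omega>) \<longlonglongrightarrow> 0"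
      by (rule tendsto_norm_zero_cancel)
    then show ?case by (rule LIM_zero_cancel)
  qed
  with r(1) show ?thesis by blast
qed

text \<open>The ratio condition survives limits because convergence in the Sobolev norm gives almost everywhere
  convergence of the spectra along a subsequence; it survives integer translations because their symbols
  are periodic under the dual lattice.\<close>

lemma psi_space_subset_ratio_space:
  fixes \<phi> :: "'n::finite functional"
  assumes \<phi>: "\<phi> \<in> sobolev \<sigma>" and \<beta>: "\<beta> \<in> dual_lattice"
  shows "psi_space \<sigma> \<phi> \<subseteq> ratio_space \<sigma> \<phi> \<beta>"
proof -
  let ?V = "ratio_space \<sigma> \<phi> \<beta>"
  have "closed_subspace \<sigma> ?V"
    unfolding closed_subspace_def
  proof (intro conjI ballI allI impI)
    show "?V \<subseteq> sobolev \<sigma>" by (auto simp: ratio_space_def)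
    show "(\<lambda>u. 0) \<in> ?V" by (rule ratio_spaceI[OF sobolev_zero is_fourier_fun_zero]) simp
  next
    fix S T assume ST: "S \<in> ?V" "T \<in> ?V"
    note S = ratio_spaceD[OF ST(1)] and T = ratio_spaceD[OF ST(2)]
    show "(\<lambda>u. S u + T u) \<in> ?V"
    proof (rule ratio_spaceI[OF sobolev_add[OF S(1) T(1)]
          is_fourier_fun_add[OF sobolevD(2)[OF S(1)] sobolevD(2)[OF T(1)]]])
      show "AE \<omega> in lborel. (fourier_fun S \<omega> + fourier_fun T \<omega>) * fourier_fun \<phi> (\<omega> + \<beta>) =
          (fourier_fun S (\<omega> + \<beta>) + fourier_fun T (\<omega> + \<beta>)) * fourier_fun \<phi> \<omega>"
        using S(2) T(2) by eventually_elim (simp add: distrib_right)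
    qed
  next
    fix c T assume "T \<in> ?V"
    note T = ratio_spaceD[OF this]
    show "(\<lambda>u. c * T u) \<in> ?V"
    proof (rule ratio_spaceI[OF sobolev_scale[OF T(1)] is_fourier_fun_scale[OF sobolevD(2)[OF T(1)]]])
      show "AE \<omega> in lborel. (c * fourier_fun T \<omega>) * fourier_fun \<phi> (\<omega> + \<beta>) =
          (c * fourier_fun T (\<omega> + \<beta>)) * fourier_fun \<phi> \<omega>"
        using T(2) by eventually_elim (simp add: mult.assoc)
    qed
  next
    fix T :: "'n functional" and X :: "nat \<Rightarrow> 'n functional"
    assume T: "T \<in> sobolev \<sigma>" and X: "(\<forall>n. X n \<in> ?V) \<and> (\<lambda>n. sobolev_norm \<sigma> (\<lambda>u. X n u - T u)) \<longlonglongrightarrow> 0"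
    have XV: "X n \<in> ?V" for n using X by blast
    obtain r where r: "strict_mono r"
      "AE \<omega> in lborel. (\<lambda>n. fourier_fun (X (r n)) \<omega>) \<longlonglongrightarrow> fourier_fun T \<omega>"
      using sobolev_norm_tendsto_0_AE_subseq[of X \<sigma> T, OF ratio_spaceD(1)[OF XV] T] X by blast
    have "AE \<omega> in lborel. \<forall>n. fourier_fun (X n) \<omega> * fourier_fun \<phi> (\<omega> + \<beta>) =
        fourier_fun (X n) (\<omega> + \<beta>) * fourier_fun \<phi> \<omega>"
      using ratio_spaceD(2)[OF XV] by (simp add: AE_all_countable)
    then have "AE \<omega> in lborel. fourier_fun T \<omega> * fourier_fun \<phi> (\<omega> + \<beta>) = fourier_fun T (\<omega> + \<beta>) * fourier_fun \<phi> \<omega>"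
      using r(2) AE_translate[OF r(2), of \<beta>]
    proof eventually_elim
      case (elim \<omega>)
      have "(\<lambda>n. fourier_fun (X (r n)) \<omega> * fourier_fun \<phi> (\<omega> + \<beta>)) \<longlonglongrightarrow> fourier_fun T \<omega> * fourier_fun \<phi> (\<omega> + \<beta>)"
        by (intro tendsto_mult tendsto_const elim)
      moreover have "(\<lambda>n. fourier_fun (X (r n)) (\<omega> + \<beta>) * fourier_fun \<phi> \<omega>) \<longlonglongrightarrow>
          fourier_fun T (\<omega> + \<beta>) * fourier_fun \<phi> \<omega>"
        by (intro tendsto_mult tendsto_const elim)
      ultimately show ?case using elim(1) LIMSEQ_unique by (simp only:) blast
    qed
    then show "T \<in> ?V" using T by (simp add: ratio_space_def)
  qed
  moreover have "translate \<alpha> ` ?V \<subseteq> ?V" if \<alpha>: "\<alpha> \<in> int_lattice" for \<alpha>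
  proof clarify
    fix T assume "T \<in> ?V"
    note T = ratio_spaceD[OF this]
    show "translate \<alpha> T \<in> ?V"
    proof (rule ratio_spaceI[OF sobolev_translate[OF T(1)] is_fourier_fun_translate[OF sobolevD(2)[OF T(1)]]])
      show "AE \<omega> in lborel. (cis (- (\<alpha> \<bullet> \<omega>)) * fourier_fun T \<omega>) * fourier_fun \<phi> (\<omega> + \<beta>) =
          (cis (- (\<alpha> \<bullet> (\<omega> + \<beta>))) * fourier_fun T (\<omega> + \<beta>)) * fourier_fun \<phi> \<omega>"
        using T(2) unfolding cis_lattice_shift[OF \<alpha> \<beta>] by eventually_elim (simp add: mult.assoc)
    qed
  qed
  moreover have "\<phi> \<in> ?V"
    by (rule ratio_spaceI[OF \<phi> sobolevD(2)[OF \<phi>]]) (simp add: mult.commute)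
  ultimately show ?thesis unfolding psi_space_def by blast
qed

lemma zero_dual_lattice: "0 \<in> dual_lattice"
  unfolding dual_lattice_def int_lattice_def by (auto intro!: image_eqI[of _ _ 0])

lemma psi_space_subset_sobolev: "\<phi> \<in> sobolev \<sigma> \<Longrightarrow> psi_space \<sigma> \<phi> \<subseteq> sobolev \<sigma>"
  using psi_space_subset_ratio_space[OF _ zero_dual_lattice] by (fastforce simp: ratio_space_def)

lemma psi_spaceI:
  assumes "\<And>V. closed_subspace \<sigma> V \<Longrightarrow> (\<And>\<alpha>. \<alpha> \<in> int_lattice \<Longrightarrow> translate \<alpha> ` V \<subseteq> V) \<Longrightarrow> \<phi> \<in> V \<Longrightarrow> T \<in> V"
  shows "T \<in> psi_space \<sigma> \<phi>"
  unfolding psi_space_def by (rule InterI) (rule assms, auto)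

lemma psi_spaceD:
  assumes "T \<in> psi_space \<sigma> \<phi>" "closed_subspace \<sigma> V"
    "\<And>\<alpha>. \<alpha> \<in> int_lattice \<Longrightarrow> translate \<alpha> ` V \<subseteq> V" "\<phi> \<in> V"
  shows "T \<in> V"
  using assms(1) unfolding psi_space_def by (rule InterD) (use assms(2-4) in auto)

lemma closed_subspaceD:
  assumes "closed_subspace \<sigma> V"
  shows "(\<lambda>u. 0) \<in> V" "S \<in> V \<Longrightarrow> T \<in> V \<Longrightarrow> (\<lambda>u. S u + T u) \<in> V" "T \<in> V \<Longrightarrow> (\<lambda>u. c * T u) \<in> V"
  using assms by (simp_all add: closed_subspace_def)

lemma psi_space_zero: "(\<lambda>u. 0) \<in> psi_space \<sigma> \<phi>"
  by (rule psi_spaceI) (rule closed_subspaceD(1))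

lemma psi_space_add:
  assumes "S \<in> psi_space \<sigma> \<phi>" "T \<in> psi_space \<sigma> \<phi>"
  shows "(\<lambda>u. S u + T u) \<in> psi_space \<sigma> \<phi>"
proof (rule psi_spaceI)
  fix V assume V: "closed_subspace \<sigma> V" "\<And>\<alpha>. \<alpha> \<in> int_lattice \<Longrightarrow> translate \<alpha> ` V \<subseteq> V" "\<phi> \<in> V"
  show "(\<lambda>u. S u + T u) \<in> V"
    by (rule closed_subspaceD(2)[OF V(1) psi_spaceD[OF assms(1) V] psi_spaceD[OF assms(2) V]])
qed

lemma psi_space_scale:
  assumes "T \<in> psi_space \<sigma> \<phi>"
  shows "(\<lambda>u. c * T u) \<in> psi_space \<sigma> \<phi>"
proof (rule psi_spaceI)
  fix V assume V: "closed_subspace \<sigma> V" "\<And>\<alpha>. \<alpha> \<in> int_lattice \<Longrightarrow> translate \<alpha> ` V \<subseteq> V" "\<phi> \<in> V"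
  show "(\<lambda>u. c * T u) \<in> V" by (rule closed_subspaceD(3)[OF V(1) psi_spaceD[OF assms V]])
qed

lemma psi_space_translate_generator:
  assumes "\<alpha> \<in> int_lattice"
  shows "translate \<alpha> \<phi> \<in> psi_space \<sigma> \<phi>"
  by (rule psi_spaceI) (use assms in blast)

lemma
  fixes f g :: "'n::finite functional"
  assumes f: "is_fourier_fun f F" and g: "is_fourier_fun g G" and gt: "g \<in> tempered" and h: "h > 0"
  shows sobolev_norm_diff_dilate: "sobolev_norm \<sigma> (\<lambda>u. f u - dilate h g u) =
    sqrt (enn2real (sob2 \<sigma> (\<lambda>\<omega>. F \<omega> - of_real (h ^ CARD('n)) * G (h *\<^sub>R \<omega>))))"
  using sobolev_norm_eq[OF is_fourier_fun_diff[OF f is_fourier_fun_dilate[OF g gt h]]] by simp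

lemma sobolev_norm_nonneg: "0 \<le> sobolev_norm \<sigma> T"
  unfolding sobolev_norm_def by (intro real_sqrt_ge_zero integral_nonneg_AE) auto

section \<open>Necessity: the order of vanishing at the dual lattice\<close>

text \<open>One number \<open>u\<close> cannot be close to both \<open>1\<close> and \<open>0\<close>.  Below, \<open>u\<close> is the spectrum of an approximant at a
  frequency where the target has spectrum \<open>1\<close>, and the second term is the energy that the ratio condition
  forces on it at a shifted frequency, where the target has none.\<close>

lemma two_term_lower_bound:
  fixes u :: complex
  assumes "a \<le> A" "b \<le> B" "0 \<le> a" "0 \<le> b"
  shows "min a b / 4 \<le> A * (cmod (1 - u))\<^sup>2 + B * (cmod u)\<^sup>2"
proof (cases "cmod u \<ge> 1 / 2")
  case True
  have "(1/2)\<^sup>2 \<le> (cmod u)\<^sup>2" using True by (intro power_mono) auto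
  then have "b * (1/4) \<le> B * (cmod u)\<^sup>2"
    using assms by (intro mult_mono) (auto simp: power2_eq_square)
  moreover have "0 \<le> A * (cmod (1 - u))\<^sup>2" using assms by simp
  ultimately show ?thesis by (simp add: min_def)
next
  case False
  then have "1 / 2 \<le> cmod (1 - u)" using norm_triangle_ineq2[of 1 u] by simp
  then have "(1/2)\<^sup>2 \<le> (cmod (1 - u))\<^sup>2" by (intro power_mono) auto
  then have "a * (1/4) \<le> A * (cmod (1 - u))\<^sup>2"
    using assms by (intro mult_mono) (auto simp: power2_eq_square)
  moreover have "0 \<le> B * (cmod u)\<^sup>2" using assms by simp
  ultimately show ?thesis by (simp add: min_def)
qed

lemma AE_punctured_ball_if_AE_dyadic:
  fixes P :: "real^'n::finite \<Rightarrow> bool"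
  assumes R: "R > 0" and P: "\<And>h. 0 < h \<Longrightarrow> h \<le> R \<Longrightarrow> AE x in lborel. h \<le> norm x \<and> norm x < 2 * h \<longrightarrow> P x"
  shows "AE x in lborel. norm x < R \<longrightarrow> P x"
proof -
  have "AE x in lborel. \<forall>j. R / 2 ^ Suc j \<le> norm x \<and> norm x < 2 * (R / 2 ^ Suc j) \<longrightarrow> P x"
    unfolding AE_all_countable
  proof
    fix j
    have "(1::real) \<le> 2 ^ Suc j" by (rule one_le_power) simp
    then show "AE x in lborel. R / 2 ^ Suc j \<le> norm x \<and> norm x < 2 * (R / 2 ^ Suc j) \<longrightarrow> P x"
      using R by (intro P) (auto simp: field_simps)
  qed
  moreover have "AE x in lborel. (x :: real^'n) \<noteq> 0" by (rule AE_lborel_singleton)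
  ultimately show ?thesis
  proof eventually_elim
    case (elim x)
    show ?case
    proof
      assume x: "norm x < R"
      obtain n where n: "(1 / 2) ^ n < norm x / R"
        using real_arch_pow_inv[of "norm x / R" "1/2"] elim(2) R by auto
      define m where "m = (LEAST n. R / 2 ^ n \<le> norm x)"
      have ex: "R / 2 ^ n \<le> norm x" using n R by (simp add: power_one_over field_simps)
      have m: "R / 2 ^ m \<le> norm x" unfolding m_def by (rule LeastI[of _ n]) (rule ex)
      have "m \<noteq> 0" using m x by (intro notI) simp
      then obtain j where j: "m = Suc j" by (cases m) auto
      have "\<not> R / 2 ^ j \<le> norm x" using not_less_Least[of j "\<lambda>n. R / 2 ^ n \<le> norm x"] j m_def by simp
      then show "P x" using elim(1)[rule_format, of j] m j by simp
    qed
  qed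
qed

text \<open>For \<open>h\<close> small let \<open>E\<close> be the part of the shell \<open>h \<le> norm \<xi> < 2 h\<close> on which the spectrum of the generator
  is larger at \<open>\<xi> + \<beta>\<close> than \<open>L h\<^sup>k\<close> times its size at \<open>\<xi>\<close>.  The test distribution has the indicator of \<open>E\<close>,
  dilated by \<open>1 / h\<close>, as its spectrum.  An approximant either misses it on \<open>E\<close> or, by the ratio condition,
  has much energy on \<open>E + \<beta>\<close>; both cost more than the approximation order allows if \<open>L\<close> is large and \<open>E\<close>
  is not a null set.\<close>

lemma approximation_order_implies_vanishing:
  fixes \<phi> :: "'n::finite functional" and k :: nat
  assumes \<phi>: "\<phi> \<in> sobolev \<sigma>" and \<sigma>k: "\<sigma> < real k" and \<eta>: "\<eta>1 > 0" "r > 0"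
    and bnd: "AE \<omega> in lborel. \<omega> \<in> ball 0 r \<longrightarrow> \<eta>1 \<le> cmod (fourier_fun \<phi> \<omega>) \<and> cmod (fourier_fun \<phi> \<omega>) \<le> \<eta>2"
    and ord: "provides_approx_order \<sigma> \<phi> (real k)"
    and \<beta>: "\<beta> \<in> dual_lattice" "\<beta> \<noteq> 0"
  shows "\<exists>C R. R > 0 \<and> (AE \<omega> in lborel. norm \<omega> < R \<longrightarrow> cmod (fourier_fun \<phi> (\<omega> + \<beta>)) \<le> C * norm \<omega> ^ k)"
proof -
  let ?d = "CARD('n)" and ?p = "fourier_fun \<phi>"
  obtain C0 where C0: "\<And>f h. f \<in> sobolev (real k) \<Longrightarrow> h > 0 \<Longrightarrow>
      (INF g\<in>dilate h ` psi_space \<sigma> \<phi>. sobolev_norm \<sigma> (\<lambda>u. f u - g u))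
        \<le> C0 * h powr (real k - \<sigma>) * sobolev_norm (real k) f"
    using ord unfolding provides_approx_order_def by blast
  define C where "C = max 1 C0"
  have C: "C \<ge> 1" "C0 \<le> C" by (auto simp: C_def)
  define b where "b = norm \<beta>"
  have b: "b > 0" using \<beta> by (simp add: b_def)
  \<comment> \<open>Lower bounds of the weight at the frequencies of \<open>E\<close> and, up to a power of \<open>h\<close>, of \<open>E + \<beta>\<close>.\<close>
  define c1 where "c1 = min (1 powr (2 * \<sigma>)) (3 powr (2 * \<sigma>))"
  define c2 where "c2 = min ((b / 2) powr (2 * \<sigma>)) ((2 * b) powr (2 * \<sigma>))"
  have c: "c1 > 0" "c2 > 0" using b by (auto simp: c1_def c2_def)
  \<comment> \<open>The square of twice the guaranteed error, times four because of the loss in the two-term bound; the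
    weight of order \<open>k\<close> is at most \<open>9\<^sup>k\<close> on the rescaled shell.\<close>
  define K where "K = 16 * C\<^sup>2 * 9 ^ k"
  have K: "K > 0" using C by (simp add: K_def)
  define L where "L = sqrt (K / c2)"
  have L: "L > 0" "c2 * L\<^sup>2 = K" using K c by (auto simp: L_def)
  define R where "R = Min {1, r / 2, b / 8, (c1 / K) powr (1 / (2 * (real k - \<sigma>)))}"
  have R: "R > 0" "R \<le> 1" "R \<le> r / 2" "R \<le> b / 8" "R \<le> (c1 / K) powr (1 / (2 * (real k - \<sigma>)))"
    using \<eta> b c K by (auto simp: R_def)
  have [measurable]: "?p \<in> borel_measurable borel" by (rule sobolevD(4)[OF \<phi>])
  have "AE \<omega> in lborel. norm \<omega> < R \<longrightarrow> cmod (?p (\<omega> + \<beta>)) \<le> L * \<eta>2 * norm \<omega> ^ k"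
  proof (rule AE_punctured_ball_if_AE_dyadic[OF R(1)])
    fix h assume h: "0 < h" "h \<le> R"
    define x where "x = h powr (2 * (real k - \<sigma>))"
    have x0: "x > 0" using h by (simp add: x_def)
    have xs: "K * x \<le> c1"
    proof -
      have "x \<le> ((c1 / K) powr (1 / (2 * (real k - \<sigma>)))) powr (2 * (real k - \<sigma>))"
        unfolding x_def using h R(5) \<sigma>k by (intro powr_mono2) auto
      also have "\<dots> = c1 / K" using \<sigma>k c K by (simp add: powr_powr)
      finally show ?thesis using K by (simp add: field_simps)
    qed
    \<comment> \<open>The bad set in the shell; the goal is that it is null.\<close>
    define E where "E = {\<xi>. h \<le> norm \<xi> \<and> norm \<xi> < 2 * h \<and> ?p \<xi> \<noteq> 0 \<and> cmod (?p (\<xi> + \<beta>)) > L * h ^ k * cmod (?p \<xi>)}"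
    have E [measurable]: "E \<in> sets borel" unfolding E_def by measurable
    have Ebd: "norm \<xi> \<le> 2 * h" if "\<xi> \<in> E" for \<xi> using that by (simp add: E_def)
    have bE: "bounded E" using Ebd by (auto simp: bounded_iff)
    have Efin: "emeasure lborel E < \<infinity>" using bE by (rule emeasure_bounded_finite)
    define m where "m = measure lborel E"
    have em: "emeasure lborel E = ennreal m"
      unfolding m_def using Efin by (intro emeasure_eq_ennreal_measure) auto
    have "m = 0"
    proof (rule ccontr)
      assume "m \<noteq> 0"
      then have m: "m > 0" by (simp add: m_def zero_less_measure_iff)
      let ?hd = "h ^ ?d"
      have hd: "?hd > 0" using h by simp
      let ?E = "{\<omega>. h *\<^sub>R \<omega> \<in> E}"
      have "?E \<in> sets borel" by measurable
      moreover have "bounded ?E"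
      proof -
        have "norm \<omega> \<le> 2" if "\<omega> \<in> ?E" for \<omega>
          using Ebd[of "h *\<^sub>R \<omega>"] that h by simp
        then show ?thesis by (auto simp: bounded_iff)
      qed
      ultimately obtain f where f: "f \<in> tempered" "is_fourier_fun f (indicator ?E)"
        using exists_tempered_indicator by blast
      have iE: "(indicator ?E :: 'n fn) = (\<lambda>\<omega>. indicator E (h *\<^sub>R \<omega>))" by (auto simp: indicator_def)
      \<comment> \<open>The norm of the test distribution.\<close>
      have fk: "ennreal ?hd * sob2 (real k) (indicator ?E) \<le> ennreal (9 ^ k * m)"
      proof -
        have "ennreal ?hd * sob2 (real k) (indicator ?E) = scaled2 (real k) h (indicator E)"
          unfolding iE using sob2_dilate[of "indicator E :: 'n fn" h "real k"] h by simp
        also have "\<dots> \<le> (\<integral>\<^sup>+\<xi>. ennreal (9 ^ k) * indicator E \<xi> \<partial>lborel)"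
          unfolding scaled2_def
        proof (intro nn_integral_mono)
          fix \<xi> :: "real^'n"
          show "ennreal ((1 + norm \<xi> / h) powr (2 * real k) * (cmod (indicator E \<xi>))\<^sup>2) \<le> ennreal (9 ^ k) * indicator E \<xi>"
          proof (cases "\<xi> \<in> E")
            case True
            have "1 + norm \<xi> / h \<le> 3" using Ebd[OF True] h by (simp add: divide_le_eq)
            moreover have "0 < 1 + norm \<xi> / h" using h by (simp add: add_pos_nonneg)
            ultimately have "(1 + norm \<xi> / h) powr (2 * real k) \<le> 3 powr (2 * real k)"
              by (intro powr_mono2) auto
            also have "\<dots> = 9 ^ k"
              by (simp add: powr_powr[symmetric] powr_realpow)
            finally show ?thesis using True by (simp add: ennreal_leI)
          qed simp
        qed
        also have "\<dots> = ennreal (9 ^ k * m)"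
          by (simp add: nn_integral_cmult em ennreal_mult m_def)
        finally show ?thesis .
      qed
      have fkfin: "sob2 (real k) (indicator ?E) < \<infinity>"
        by (rule finite_if_mult_finite[OF hd le_less_trans[OF fk]]) simp
      have fsob: "f \<in> sobolev (real k)" using sobolev_iff[OF f(2)] f(1) fkfin by blast
      define N where "N = 9 ^ k * m / ?hd"
      have N: "N > 0" using m hd by (simp add: N_def)
      have fn: "sobolev_norm (real k) f \<le> sqrt N"
      proof -
        obtain y where y: "y \<ge> 0" "sob2 (real k) (indicator ?E) = ennreal y"
          using fkfin by (cases "sob2 (real k) (indicator ?E)") auto
        have "?hd * y \<le> 9 ^ k * m"
          using fk y hd m by (simp add: ennreal_mult'[symmetric])
        then have "y \<le> N" using hd by (simp add: N_def field_simps)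
        then show ?thesis using y by (simp add: sobolev_norm_eq[OF f(2)])
      qed
      let ?B = "C * h powr (real k - \<sigma>) * sqrt N"
      have hp: "h powr (real k - \<sigma>) > 0" using h by simp
      have "(INF g\<in>dilate h ` psi_space \<sigma> \<phi>. sobolev_norm \<sigma> (\<lambda>u. f u - g u)) \<le> ?B"
      proof -
        have "C0 * h powr (real k - \<sigma>) * sobolev_norm (real k) f \<le> C * h powr (real k - \<sigma>) * sqrt N"
          using C hp fn sobolev_norm_nonneg by (intro mult_mono) auto
        then show ?thesis using C0[OF fsob h(1)] by linarith
      qed
      also have "?B < 2 * ?B" using C hp N by simp
      finally obtain g where g: "g \<in> psi_space \<sigma> \<phi>" "sobolev_norm \<sigma> (\<lambda>u. f u - dilate h g u) < 2 * ?B"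
        using psi_space_zero[of \<sigma> \<phi>]
        by (subst (asm) cINF_less_iff) (auto intro!: bdd_belowI2[of _ 0] sobolev_norm_nonneg)
      have gs: "g \<in> sobolev \<sigma>" using psi_space_subset_sobolev[OF \<phi>] g(1) by blast
      let ?g = "fourier_fun g"
      have [measurable]: "?g \<in> borel_measurable borel" by (rule sobolevD(4)[OF gs])
      define u where "u = (\<lambda>\<xi>. of_real ?hd * ?g \<xi>)"
      have [measurable]: "u \<in> borel_measurable borel" unfolding u_def by measurable
      let ?err = "\<lambda>\<omega>. indicator ?E \<omega> - u (h *\<^sub>R \<omega>)"
      have err_eq: "sobolev_norm \<sigma> (\<lambda>u. f u - dilate h g u) = sqrt (enn2real (sob2 \<sigma> ?err))"
        unfolding u_def by (rule sobolev_norm_diff_dilate[OF f(2) sobolevD(2,1)[OF gs] h(1)])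
      have err_fin: "sob2 \<sigma> ?err < \<infinity>"
      proof -
        have "sob2 \<sigma> u < \<infinity>"
          unfolding u_def using sobolevD(3)[OF gs] by (simp add: sob2_scale ennreal_mult_less_top)
        then have "sob2 \<sigma> (\<lambda>\<omega>. - 1 * u (h *\<^sub>R \<omega>)) < \<infinity>"
          using sob2_dilate_finite[of u h \<sigma>] h by (subst sob2_scale) simp_all
        moreover have "sob2 \<sigma> (indicator ?E) < \<infinity>"
          using sob2_mono[of \<sigma> "real k"] \<sigma>k fkfin by (meson le_less_trans less_imp_le)
        ultimately have "sob2 \<sigma> (\<lambda>\<omega>. indicator ?E \<omega> + - 1 * u (h *\<^sub>R \<omega>)) < \<infinity>"
          by (intro le_less_trans[OF sob2_add_le]) (auto simp: ennreal_mult_less_top)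
        then show ?thesis by simp
      qed
      obtain e where e: "e \<ge> 0" "sob2 \<sigma> ?err = ennreal e"
        using err_fin by (cases "sob2 \<sigma> ?err") auto
      have "e < (2 * ?B)\<^sup>2"
      proof -
        have "sqrt e < 2 * ?B" using g(2) e by (simp add: err_eq)
        then have "(sqrt e)\<^sup>2 < (2 * ?B)\<^sup>2" by (rule power_strict_mono) (use e in auto)
        then show ?thesis using e by simp
      qed
      also have "(2 * ?B)\<^sup>2 = K * x / 4 * m / ?hd"
      proof -
        have "(h powr (real k - \<sigma>))\<^sup>2 = x"
          unfolding x_def by (simp add: power2_eq_square powr_add[symmetric])
        then show ?thesis using N by (simp add: power_mult_distrib K_def N_def)
      qed
      finally have upper: "?hd * e < K * x / 4 * m" using hd by (simp add: field_simps)
      have rel: "AE \<xi> in lborel. ?g \<xi> * ?p (\<xi> + \<beta>) = ?g (\<xi> + \<beta>) * ?p \<xi>"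
        using psi_space_subset_ratio_space[OF \<phi> \<beta>(1)] g(1) ratio_spaceD(2) by blast
      let ?w = "\<lambda>\<xi>. (1 + norm \<xi> / h) powr (2 * \<sigma>)"
      \<comment> \<open>\<open>E\<close> and \<open>E + \<beta>\<close> are disjoint, so the two contributions to the error add up.\<close>
      have disj: "\<xi> - \<beta> \<notin> E" if "\<xi> \<in> E" for \<xi>
      proof
        assume "\<xi> - \<beta> \<in> E"
        then have "norm \<beta> \<le> 4 * h"
          using Ebd[OF that] Ebd[of "\<xi> - \<beta>"] norm_triangle_ineq4[of \<xi> "\<xi> - \<beta>"] by simp
        then show False using h R b by (simp add: b_def)
      qed
      have "ennreal (min c1 (K * x) / 4 * m) = (\<integral>\<^sup>+\<xi>. ennreal (min c1 (K * x) / 4) * indicator E \<xi> \<partial>lborel)"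
        using c K x0 m by (simp add: nn_integral_cmult_indicator em ennreal_mult[symmetric])
      also have "\<dots> \<le> (\<integral>\<^sup>+\<xi>. ennreal (indicator E \<xi> * (?w \<xi> * (cmod (1 - u \<xi>))\<^sup>2)) +
          ennreal (indicator E \<xi> * (?w (\<xi> + \<beta>) * (cmod (u (\<xi> + \<beta>)))\<^sup>2)) \<partial>lborel)"
      proof (intro nn_integral_mono_AE)
        show "AE \<xi> in lborel. ennreal (min c1 (K * x) / 4) * indicator E \<xi> \<le>
            ennreal (indicator E \<xi> * (?w \<xi> * (cmod (1 - u \<xi>))\<^sup>2)) +
            ennreal (indicator E \<xi> * (?w (\<xi> + \<beta>) * (cmod (u (\<xi> + \<beta>)))\<^sup>2))"
          using rel
        proof eventually_elim
          case (elim \<xi>)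
          show ?case
          proof (cases "\<xi> \<in> E")
            case True
            then have p0: "?p \<xi> \<noteq> 0" and q: "cmod (?p (\<xi> + \<beta>)) > L * h ^ k * cmod (?p \<xi>)"
              by (auto simp: E_def)
            have ub: "u (\<xi> + \<beta>) = u \<xi> * (?p (\<xi> + \<beta>) / ?p \<xi>)"
              using elim p0 by (simp add: u_def field_simps)
            have q': "(L * h ^ k)\<^sup>2 \<le> (cmod (?p (\<xi> + \<beta>) / ?p \<xi>))\<^sup>2"
              using q p0 L h by (intro power_mono) (auto simp: norm_divide field_simps)
            have n0: "h \<le> norm \<xi>" "norm \<xi> \<le> 2 * h" using True by (auto simp: E_def)
            have w1: "c1 \<le> ?w \<xi>" unfolding c1_def
              by (rule powr_between) (use n0 h in \<open>auto simp: divide_le_eq\<close>)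
            have w2: "c2 * h powr (- 2 * \<sigma>) \<le> ?w (\<xi> + \<beta>)"
            proof -
              have t: "norm (\<xi> + \<beta>) \<le> norm \<xi> + b" "b \<le> norm (\<xi> + \<beta>) + norm \<xi>"
                using norm_triangle_ineq[of \<xi> \<beta>] norm_triangle_ineq4[of "\<xi> + \<beta>" \<xi>] by (auto simp: b_def)
              have "c2 \<le> (h + norm (\<xi> + \<beta>)) powr (2 * \<sigma>)" unfolding c2_def
                by (rule powr_between) (use t n0 h R b in auto)
              then have "c2 * h powr (- 2 * \<sigma>) \<le> (h + norm (\<xi> + \<beta>)) powr (2 * \<sigma>) * h powr (- 2 * \<sigma>)"
                by (rule mult_right_mono) simp
              also have "\<dots> = ?w (\<xi> + \<beta>)"
              proof -
                have "1 + norm (\<xi> + \<beta>) / h = (h + norm (\<xi> + \<beta>)) / h" using h by (simp add: field_simps)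
                then show ?thesis using h by (simp add: powr_divide powr_minus_divide)
              qed
              finally show ?thesis .
            qed
            have "K * x \<le> ?w (\<xi> + \<beta>) * (cmod (?p (\<xi> + \<beta>) / ?p \<xi>))\<^sup>2"
            proof -
              have "x = h powr (- 2 * \<sigma>) * (h ^ k)\<^sup>2"
                using h by (simp add: x_def powr_realpow[symmetric] power2_eq_square powr_add[symmetric])
              then have "K * x = (c2 * h powr (- 2 * \<sigma>)) * (L * h ^ k)\<^sup>2"
                by (simp add: L(2)[symmetric] power_mult_distrib mult_ac)
              also have "\<dots> \<le> ?w (\<xi> + \<beta>) * (cmod (?p (\<xi> + \<beta>) / ?p \<xi>))\<^sup>2"
                by (intro mult_mono w2 q') auto
              finally show ?thesis .
            qed
            from two_term_lower_bound[OF w1 this, of "u \<xi>"]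
            have "min c1 (K * x) / 4 \<le> ?w \<xi> * (cmod (1 - u \<xi>))\<^sup>2 + ?w (\<xi> + \<beta>) * (cmod (u (\<xi> + \<beta>)))\<^sup>2"
              using c K x0 unfolding ub norm_mult power_mult_distrib by (simp add: mult_ac)
            then show ?thesis using True
              by (simp add: ennreal_plus[symmetric] ennreal_leI del: ennreal_plus)
          qed simp
        qed
      qed
      also have "\<dots> = (\<integral>\<^sup>+\<xi>. ennreal (indicator E \<xi> * (?w \<xi> * (cmod (1 - u \<xi>))\<^sup>2)) \<partial>lborel) +
          (\<integral>\<^sup>+\<xi>. ennreal (indicator E \<xi> * (?w (\<xi> + \<beta>) * (cmod (u (\<xi> + \<beta>)))\<^sup>2)) \<partial>lborel)"
        by (rule nn_integral_add) measurable
      also have "(\<integral>\<^sup>+\<xi>. ennreal (indicator E \<xi> * (?w (\<xi> + \<beta>) * (cmod (u (\<xi> + \<beta>)))\<^sup>2)) \<partial>lborel) =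
          (\<integral>\<^sup>+\<xi>. ennreal (indicator E (\<xi> - \<beta>) * (?w \<xi> * (cmod (u \<xi>))\<^sup>2)) \<partial>lborel)"
        using nn_integral_affine[of "\<lambda>\<xi>. ennreal (indicator E (\<xi> - \<beta>) * (?w \<xi> * (cmod (u \<xi>))\<^sup>2))" 1 \<beta>]
        by (simp add: add.commute)
      also have "(\<integral>\<^sup>+\<xi>. ennreal (indicator E \<xi> * (?w \<xi> * (cmod (1 - u \<xi>))\<^sup>2)) \<partial>lborel) + \<dots> =
          (\<integral>\<^sup>+\<xi>. ennreal (indicator E \<xi> * (?w \<xi> * (cmod (1 - u \<xi>))\<^sup>2)) +
            ennreal (indicator E (\<xi> - \<beta>) * (?w \<xi> * (cmod (u \<xi>))\<^sup>2)) \<partial>lborel)"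
        by (rule nn_integral_add[symmetric]) measurable
      also have "\<dots> \<le> scaled2 \<sigma> h (\<lambda>\<xi>. indicator E \<xi> - u \<xi>)"
        unfolding scaled2_def
      proof (intro nn_integral_mono)
        fix \<xi> :: "real^'n"
        show "ennreal (indicator E \<xi> * (?w \<xi> * (cmod (1 - u \<xi>))\<^sup>2)) +
            ennreal (indicator E (\<xi> - \<beta>) * (?w \<xi> * (cmod (u \<xi>))\<^sup>2)) \<le>
            ennreal (?w \<xi> * (cmod (indicator E \<xi> - u \<xi>))\<^sup>2)"
        proof (cases "\<xi> \<in> E")
          case True
          then show ?thesis using disj[OF True] by simp
        next
          case False
          then show ?thesis by (simp add: indicator_def)
        qed
      qed
      also have "\<dots> = ennreal ?hd * sob2 \<sigma> ?err"
      proof -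
        have "(\<lambda>\<omega>. indicator E (h *\<^sub>R \<omega>) - u (h *\<^sub>R \<omega>)) = ?err" by (simp add: iE)
        then show ?thesis using sob2_dilate[of "\<lambda>\<xi>. indicator E \<xi> - u \<xi>" h \<sigma>] h by simp
      qed
      also have "\<dots> = ennreal (?hd * e)" using e hd by (simp add: ennreal_mult)
      finally have "min c1 (K * x) / 4 * m \<le> ?hd * e"
        using e hd by (subst (asm) ennreal_le_iff) auto
      moreover have "min c1 (K * x) = K * x" using xs by simp
      ultimately show False using upper by simp
    qed
    then have "AE \<xi> in lborel. \<xi> \<notin> E"
      using em by (intro AE_not_in) (auto simp: null_sets_def)
    then show "AE \<omega> in lborel. h \<le> norm \<omega> \<and> norm \<omega> < 2 * h \<longrightarrow> cmod (?p (\<omega> + \<beta>)) \<le> L * \<eta>2 * norm \<omega> ^ k"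
      using bnd
    proof eventually_elim
      case (elim \<omega>)
      show ?case
      proof
        assume n: "h \<le> norm \<omega> \<and> norm \<omega> < 2 * h"
        then have "\<omega> \<in> ball 0 r" using h R by simp
        then have p: "\<eta>1 \<le> cmod (?p \<omega>)" "cmod (?p \<omega>) \<le> \<eta>2" using elim(2) by auto
        then have "?p \<omega> \<noteq> 0" using \<eta> by auto
        then have "cmod (?p (\<omega> + \<beta>)) \<le> L * h ^ k * cmod (?p \<omega>)"
          using elim(1) n by (auto simp: E_def)
        also have "\<dots> \<le> L * norm \<omega> ^ k * \<eta>2"
          using L n p h by (intro mult_mono power_mono) auto
        finally show "cmod (?p (\<omega> + \<beta>)) \<le> L * \<eta>2 * norm \<omega> ^ k" by (simp add: mult_ac)
      qed
    qed
  qed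
  then show ?thesis using R(1) by blast
qed

section \<open>One-dimensional Taylor bound from the order of vanishing\<close>

text \<open>Taylor's theorem on \<open>(0, a]\<close>, where \<open>G j\<close> is the \<open>j\<close>-th derivative of \<open>G 0\<close> and no value at \<open>0\<close> is
  given.  In the step from \<open>k\<close> to \<open>k + 1\<close>, the function \<open>G k\<close> is Lipschitz and so has a limit \<open>c\<close> at \<open>0\<close>;
  the induction hypothesis applies once the monomial \<open>c x\<^sup>k / k!\<close> is subtracted from \<open>G 0\<close>.  The order of
  vanishing then forces \<open>c = 0\<close>.\<close>

lemma taylor_chain_bound:
  fixes G :: "nat \<Rightarrow> real \<Rightarrow> complex"
  assumes "a > 0" "N \<ge> 0"
    and "\<And>j x. j < k \<Longrightarrow> x \<in> {0<..a} \<Longrightarrow> (G j has_vector_derivative G (Suc j) x) (at x within {0<..a})"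
    and "\<And>x. x \<in> {0<..a} \<Longrightarrow> cmod (G k x) \<le> N"
    and "\<delta> > 0" "\<And>x. x \<in> {0<..a} \<Longrightarrow> x < \<delta> \<Longrightarrow> cmod (G 0 x) \<le> C * x ^ k"
    and "x \<in> {0<..a}"
  shows "cmod (G 0 x) \<le> N * x ^ k"
  using assms
proof (induction k arbitrary: G a N C \<delta> x)
  case 0
  then show ?case by simp
next
  case (Suc k)
  have lip: "cmod (G k x - G k y) \<le> N * \<bar>x - y\<bar>" if "x \<in> {0<..a}" "y \<in> {0<..a}" for x y
  proof -
    have "cmod (G k x - G k y) \<le> N * norm (x - y)"
    proof (rule differentiable_bound[of "{0<..a}" "G k" "\<lambda>x t. t *\<^sub>R G (Suc k) x"])
      fix x assume x: "x \<in> {0<..a}"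
      show "(G k has_derivative (\<lambda>t. t *\<^sub>R G (Suc k) x)) (at x within {0<..a})"
        using Suc.prems(3)[of k x] x by (simp add: has_vector_derivative_def)
      show "onorm (\<lambda>t. t *\<^sub>R G (Suc k) x) \<le> N"
      proof (rule onorm_le)
        fix t :: real
        show "norm (t *\<^sub>R G (Suc k) x) \<le> N * norm t"
          using mult_right_mono[OF Suc.prems(4)[OF x] abs_ge_zero[of t]] by (simp add: mult.commute)
      qed
    qed (use that in auto)
    then show ?thesis by simp
  qed
  let ?s = "\<lambda>n. a * inverse (real (Suc n))"
  have s: "?s n \<in> {0<..a}" for n
    using Suc.prems(1) by (auto simp: inverse_eq_divide field_simps)
  have s0: "?s \<longlonglongrightarrow> 0"
    using tendsto_mult[OF tendsto_const[of a] LIMSEQ_inverse_real_of_nat] by simp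
  have "Cauchy (\<lambda>n. G k (?s n))"
  proof (rule metric_CauchyI)
    fix e :: real assume e: "e > 0"
    have "Cauchy ?s" using s0 by (intro LIMSEQ_imp_Cauchy)
    then obtain M where M: "\<And>m n. m \<ge> M \<Longrightarrow> n \<ge> M \<Longrightarrow> dist (?s m) (?s n) < e / (N + 1)"
      using metric_CauchyD[of ?s "e / (N + 1)"] e Suc.prems(2) by auto
    have "dist (G k (?s m)) (G k (?s n)) < e" if mn: "m \<ge> M" "n \<ge> M" for m n
    proof -
      have "dist (G k (?s m)) (G k (?s n)) \<le> N * dist (?s m) (?s n)"
        using lip[OF s s, of m n] by (simp only: dist_norm real_norm_def)
      also have "\<dots> \<le> (N + 1) * dist (?s m) (?s n)" by (intro mult_right_mono) auto
      also have "\<dots> < (N + 1) * (e / (N + 1))"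
        using M[OF mn] Suc.prems(2) by (intro mult_strict_left_mono) auto
      also have "\<dots> = e" using Suc.prems(2) by simp
      finally show ?thesis .
    qed
    then show "\<exists>M. \<forall>m\<ge>M. \<forall>n\<ge>M. dist (G k (?s m)) (G k (?s n)) < e" by blast
  qed
  then obtain c where c: "(\<lambda>n. G k (?s n)) \<longlonglongrightarrow> c"
    using Cauchy_convergent convergent_def by blast
  have Gc: "cmod (G k x - c) \<le> N * x" if x: "x \<in> {0<..a}" for x
  proof (rule tendsto_le[OF trivial_limit_sequentially])
    show "(\<lambda>n. cmod (G k x - G k (?s n))) \<longlonglongrightarrow> cmod (G k x - c)" by (intro tendsto_intros c)
    have "(\<lambda>n. N * \<bar>x - ?s n\<bar>) \<longlonglongrightarrow> N * \<bar>x - 0\<bar>" by (intro tendsto_intros s0)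
    then show "(\<lambda>n. N * \<bar>x - ?s n\<bar>) \<longlonglongrightarrow> N * x" using x by simp
    show "\<forall>\<^sub>F n in sequentially. cmod (G k x - G k (?s n)) \<le> N * \<bar>x - ?s n\<bar>"
      by (intro always_eventually allI lip x s)
  qed
  define H where "H = (\<lambda>j x. G j x - of_real (x ^ (k - j) / fact (k - j)) * c)"
  have H0: "cmod (H 0 x) \<le> N * x ^ Suc k" if x: "x \<in> {0<..a}" for x
  proof -
    have xa: "{0<..x} \<subseteq> {0<..a}" using x by auto
    have "cmod (H 0 x) \<le> (N * x) * x ^ k"
    proof (rule Suc.IH[of x "N * x" H "min \<delta> 1" "\<bar>C\<bar> + cmod c / fact k"])
      show "x > 0" "0 \<le> N * x" "x \<in> {0<..x}" "min \<delta> 1 > 0" using x Suc.prems(2,5) by auto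
      show "(H j has_vector_derivative H (Suc j) y) (at y within {0<..x})" if j: "j < k" and y: "y \<in> {0<..x}" for j y
      proof -
        have kj: "k - j = Suc (k - Suc j)" using j by simp
        have "((\<lambda>x. x ^ Suc n / fact (Suc n)) has_real_derivative y ^ n / fact n) (at y within {0<..x})" for n
        proof -
          have "((\<lambda>x. x ^ Suc n) has_real_derivative real (Suc n) * y ^ n) (at y within {0<..x})"
            by (rule DERIV_cong[OF DERIV_power[OF DERIV_ident]]) simp
          from DERIV_cdivide[OF this, of "fact (Suc n)"] show ?thesis
            by (simp add: fact_Suc del: of_nat_Suc power_Suc)
        qed
        then have "((\<lambda>x. x ^ (k - j) / fact (k - j)) has_real_derivative y ^ (k - Suc j) / fact (k - Suc j)) (at y within {0<..x})"
          unfolding kj .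
        then have "((\<lambda>x. of_real (x ^ (k - j) / fact (k - j)) * c) has_vector_derivative
            of_real (y ^ (k - Suc j) / fact (k - Suc j)) * c) (at y within {0<..x})"
          by (intro has_vector_derivative_mult_left has_vector_derivative_of_real)
            (simp add: has_real_derivative_iff_has_vector_derivative)
        moreover have "(G j has_vector_derivative G (Suc j) y) (at y within {0<..x})"
          by (rule has_vector_derivative_within_subset[OF Suc.prems(3) xa]) (use j y xa in auto)
        ultimately show ?thesis unfolding H_def by (intro has_vector_derivative_diff)
      qed
      show "cmod (H k y) \<le> N * x" if y: "y \<in> {0<..x}" for y
      proof -
        have "cmod (H k y) \<le> N * y" using Gc[of y] y xa by (auto simp: H_def)
        also have "\<dots> \<le> N * x" using y Suc.prems(2) by (intro mult_left_mono) auto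
        finally show ?thesis .
      qed
      show "cmod (H 0 y) \<le> (\<bar>C\<bar> + cmod c / fact k) * y ^ k" if y: "y \<in> {0<..x}" "y < min \<delta> 1" for y
      proof -
        have "cmod (H 0 y) \<le> cmod (G 0 y) + cmod (of_real (y ^ k / fact k) * c)"
          unfolding H_def by (simp only: diff_zero) (rule norm_triangle_ineq4)
        also have "cmod (G 0 y) \<le> C * y ^ Suc k" using y xa by (intro Suc.prems(6)) auto
        also have "C * y ^ Suc k \<le> \<bar>C\<bar> * y ^ k"
        proof (rule mult_mono)
          show "y ^ Suc k \<le> y ^ k" using y by (intro power_decreasing) auto
        qed (use y in auto)
        also have "cmod (of_real (y ^ k / fact k) * c) = cmod c / fact k * y ^ k"
          using y by (simp add: norm_mult norm_divide norm_power)
        finally show ?thesis by (simp add: distrib_right)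
      qed
    qed
    then show ?thesis by (simp add: mult_ac)
  qed
  have "c = 0"
  proof (rule ccontr)
    assume "c \<noteq> 0"
    let ?A = "\<bar>C\<bar> + N"
    define y where "y = Min {a, \<delta> / 2, (cmod c / fact k) / (2 * (?A + 1))}"
    have A: "?A + 1 > 0" using Suc.prems(2) by simp
    have y: "0 < y" "y \<le> a" "y \<le> \<delta> / 2" "y \<le> (cmod c / fact k) / (2 * (?A + 1))"
    proof -
      show "0 < y" unfolding y_def
        by (subst Min_gr_iff) (use Suc.prems(1,5) \<open>c \<noteq> 0\<close> A in \<open>auto intro!: divide_pos_pos\<close>)
      show "y \<le> a" "y \<le> \<delta> / 2" "y \<le> (cmod c / fact k) / (2 * (?A + 1))"
        unfolding y_def by (rule Min_le; simp)+
    qed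
    have "cmod c / fact k * y ^ k = cmod (of_real (y ^ k / fact k) * c)"
      using y by (simp add: norm_mult norm_divide norm_power)
    also have "\<dots> = cmod (G 0 y - H 0 y)" by (simp add: H_def)
    also have "\<dots> \<le> cmod (G 0 y) + cmod (H 0 y)" by (rule norm_triangle_ineq4)
    also have "\<dots> \<le> C * y ^ Suc k + N * y ^ Suc k"
      using y Suc.prems(5) by (intro add_mono Suc.prems(6) H0) auto
    also have "\<dots> \<le> (?A * y) * y ^ k"
    proof -
      have "C * y ^ Suc k \<le> \<bar>C\<bar> * y ^ Suc k" using y by (intro mult_right_mono) auto
      then have "C * y ^ Suc k + N * y ^ Suc k \<le> \<bar>C\<bar> * y ^ Suc k + N * y ^ Suc k" by simp
      also have "\<dots> = (?A * y) * y ^ k" by (simp add: algebra_simps)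
      finally show ?thesis .
    qed
    finally have "cmod c / fact k \<le> ?A * y"
      by (rule mult_right_le_imp_le) (use y in simp)
    also have "\<dots> < (?A + 1) * y" using y by (simp add: distrib_right)
    also have "\<dots> \<le> (?A + 1) * ((cmod c / fact k) / (2 * (?A + 1)))"
      using y A by (intro mult_left_mono) auto
    also have "\<dots> = (cmod c / fact k) / 2"
    proof -
      have "B * (X / (2 * B)) = X / 2" if "B > 0" for B X :: real using that by (simp add: field_simps)
      from this[OF A] show ?thesis .
    qed
    finally have "cmod c / fact k < 0" by simp
    then show False by (simp add: divide_less_0_iff)
  qed
  then show ?case using H0[OF Suc.prems(7)] by (simp add: H_def)
qed

section \<open>Dilations of test functions\<close>

definition radial :: "'n::finite fn \<Rightarrow> 'n fn" where
  "radial w z = (\<Sum>i\<in>UNIV. of_real (z $ i) * partial i w z)"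

abbreviation coord_mult :: "'n::finite \<Rightarrow> 'n fn \<Rightarrow> 'n fn" where
  "coord_mult i u \<equiv> (\<lambda>z. of_real (z $ i) * u z)"

text \<open>The operator \<open>\<Sum> D\<^bsub>i\<^sub>1\<^esub> \<cdots> D\<^bsub>i\<^sub>j\<^esub> X\<^bsub>i\<^sub>j\<^esub> \<cdots> X\<^bsub>i\<^sub>1\<^esub>\<close> over all words of length \<open>j\<close>.  Up to sign it is
  what the \<open>j\<close>-th derivative in \<open>x\<close> does to the dilates \<open>x\<^sup>-\<^sup>d u(z / x)\<close>.\<close>

fun dilation_op :: "nat \<Rightarrow> 'n::finite fn \<Rightarrow> 'n fn" where
  "dilation_op 0 u = u"
| "dilation_op (Suc j) u = (\<lambda>z. \<Sum>i\<in>UNIV. partial i (dilation_op j (coord_mult i u)) z)"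

lemma test_coord_mult: "u \<in> test_functions U \<Longrightarrow> coord_mult i u \<in> test_functions U"
  by (rule test_mult[OF smooth_coordinate])

lemma test_dilation_op: "u \<in> test_functions U \<Longrightarrow> dilation_op j u \<in> test_functions U"
  by (induction j arbitrary: u) (auto intro!: test_sum test_partial test_coord_mult)

lemma test_radial: "u \<in> test_functions U \<Longrightarrow> radial u \<in> test_functions U"
  unfolding radial_def by (intro test_sum test_coord_mult test_partial)

lemma partial_sum:
  assumes "finite I" "\<And>j. j \<in> I \<Longrightarrow> smooth (f j)"
  shows "partial i (\<lambda>z. \<Sum>j\<in>I. f j z) = (\<lambda>z. \<Sum>j\<in>I. partial i (f j) z)"
  using assms
proof (induction I rule: finite_induct)
  case (insert j I)
  have "partial i (\<lambda>z. f j z + (\<Sum>j\<in>I. f j z)) x = partial i (f j) x + partial i (\<lambda>z. \<Sum>j\<in>I. f j z) x" for x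
    using insert.prems by (intro partial_add smooth_differentiable smooth_sum) auto
  then show ?case using insert by (simp add: fun_eq_iff)
qed (simp add: partial_const)

lemma fold_partial_sum:
  assumes "finite I" "\<And>j. j \<in> I \<Longrightarrow> smooth (f j)"
  shows "fold partial W (\<lambda>z. \<Sum>j\<in>I. f j z) = (\<lambda>z. \<Sum>j\<in>I. fold partial W (f j) z)"
  using assms(2)
proof (induction W arbitrary: f)
  case (Cons i W)
  have "fold partial W (\<lambda>z. \<Sum>j\<in>I. partial i (f j) z) = (\<lambda>z. \<Sum>j\<in>I. fold partial W (partial i (f j)) z)"
    by (rule Cons.IH) (intro smooth_partial Cons.prems)
  then show ?case by (simp add: partial_sum[OF assms(1) Cons.prems])
qed simp

lemma partial_coord_mult:
  assumes "smooth u"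
  shows "partial l (coord_mult i u) z = (if l = i then u z else 0) + of_real (z $ i) * partial l u z"
  using partial_mult[OF differentiable_coordinate smooth_differentiable[OF assms], of l i z]
  by (simp add: partial_coordinate)

text \<open>The commutator of \<open>dilation_op j\<close> with multiplication by a coordinate is of lower order.\<close>

lemma dilation_op_coord_mult:
  fixes u :: "'n::finite fn"
  assumes "u \<in> test_functions U"
  shows "dilation_op j (coord_mult i u) z =
    of_real (z $ i) * dilation_op j u z + of_nat j * dilation_op (j - 1) (coord_mult i u) z"
  using assms
proof (induction j arbitrary: u z)
  case (Suc j)
  note t = test_coord_mult[OF Suc.prems]
  have sm: "smooth (dilation_op m (coord_mult l u))" "smooth (dilation_op m (coord_mult l (coord_mult i u)))" for m l
    by (rule test_functionsD(1)[OF test_dilation_op[OF test_coord_mult[OF Suc.prems]]],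
        rule test_functionsD(1)[OF test_dilation_op[OF test_coord_mult[OF test_coord_mult[OF Suc.prems]]]])
  have comm: "coord_mult l (coord_mult i u) = coord_mult i (coord_mult l u)" for l
    by (auto simp: mult_ac)
  have 1: "partial l (dilation_op j (coord_mult l (coord_mult i u))) z =
      (if l = i then dilation_op j (coord_mult l u) z else 0) +
      of_real (z $ i) * partial l (dilation_op j (coord_mult l u)) z +
      of_nat j * partial l (dilation_op (j - 1) (coord_mult l (coord_mult i u))) z" for l
  proof -
    have "dilation_op j (coord_mult l (coord_mult i u)) =
        (\<lambda>z. coord_mult i (dilation_op j (coord_mult l u)) z +
           of_nat j * dilation_op (j - 1) (coord_mult l (coord_mult i u)) z)"
      unfolding comm by (rule ext, rule Suc.IH[OF t])
    moreover have "partial l (\<lambda>z. coord_mult i (dilation_op j (coord_mult l u)) z +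
           of_nat j * dilation_op (j - 1) (coord_mult l (coord_mult i u)) z) z =
        partial l (coord_mult i (dilation_op j (coord_mult l u))) z +
        partial l (\<lambda>z. of_nat j * dilation_op (j - 1) (coord_mult l (coord_mult i u)) z) z"
      by (intro partial_add smooth_differentiable smooth_mult smooth_coordinate smooth_const sm)
    moreover have "partial l (\<lambda>z. of_nat j * dilation_op (j - 1) (coord_mult l (coord_mult i u)) z) z =
        of_nat j * partial l (dilation_op (j - 1) (coord_mult l (coord_mult i u))) z"
      by (subst partial_mult) (auto intro: smooth_differentiable[OF smooth_const] smooth_differentiable[OF sm(2)] simp: partial_const)
    ultimately show ?thesis by (simp add: partial_coord_mult[OF sm(1)])
  qed
  have 2: "of_nat j * (\<Sum>l\<in>UNIV. partial l (dilation_op (j - 1) (coord_mult l (coord_mult i u))) z) =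
      of_nat j * dilation_op j (coord_mult i u) z"
    by (cases j) auto
  have "dilation_op (Suc j) (coord_mult i u) z =
      (\<Sum>l\<in>UNIV. partial l (dilation_op j (coord_mult l (coord_mult i u))) z)" by simp
  also have "\<dots> = dilation_op j (coord_mult i u) z + of_real (z $ i) * dilation_op (Suc j) u z +
      of_nat j * (\<Sum>l\<in>UNIV. partial l (dilation_op (j - 1) (coord_mult l (coord_mult i u))) z)"
    unfolding 1 by (simp add: sum.distrib sum_distrib_left)
  finally show ?case unfolding 2 by (simp add: algebra_simps)
qed simp

text \<open>A recursion in the Euler operator \<open>radial\<close>, which is what differentiation in the dilation parameter
  produces.\<close>

lemma dilation_op_Suc_radial:
  fixes u :: "'n::finite fn"
  assumes u: "u \<in> test_functions U"
  shows "dilation_op (Suc j) u z =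
    of_nat (CARD('n) + j) * dilation_op j u z + radial (dilation_op j u) z"
proof -
  have sm: "smooth (dilation_op m u)" "smooth (dilation_op m (coord_mult l u))" for m l
    by (rule test_functionsD(1)[OF test_dilation_op[OF u]],
        rule test_functionsD(1)[OF test_dilation_op[OF test_coord_mult[OF u]]])
  have 1: "partial l (dilation_op j (coord_mult l u)) z =
      dilation_op j u z + of_real (z $ l) * partial l (dilation_op j u) z +
      of_nat j * partial l (dilation_op (j - 1) (coord_mult l u)) z" for l
  proof -
    have "dilation_op j (coord_mult l u) =
        (\<lambda>z. coord_mult l (dilation_op j u) z + of_nat j * dilation_op (j - 1) (coord_mult l u) z)"
      by (rule ext, rule dilation_op_coord_mult[OF u])
    moreover have "partial l (\<lambda>z. coord_mult l (dilation_op j u) z + of_nat j * dilation_op (j - 1) (coord_mult l u) z) z =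
        partial l (coord_mult l (dilation_op j u)) z + partial l (\<lambda>z. of_nat j * dilation_op (j - 1) (coord_mult l u) z) z"
      by (intro partial_add smooth_differentiable smooth_mult smooth_coordinate smooth_const sm)
    moreover have "partial l (\<lambda>z. of_nat j * dilation_op (j - 1) (coord_mult l u) z) z =
        of_nat j * partial l (dilation_op (j - 1) (coord_mult l u)) z"
      by (subst partial_mult) (auto intro: smooth_differentiable[OF smooth_const] smooth_differentiable[OF sm(2)] simp: partial_const)
    ultimately show ?thesis by (simp add: partial_coord_mult[OF sm(1)])
  qed
  have 2: "of_nat j * (\<Sum>l\<in>UNIV. partial l (dilation_op (j - 1) (coord_mult l u)) z) = of_nat j * dilation_op j u z"
    by (cases j) auto
  have "dilation_op (Suc j) u z = (\<Sum>l\<in>UNIV. partial l (dilation_op j (coord_mult l u)) z)" by simp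
  also have "\<dots> = of_nat CARD('n) * dilation_op j u z + radial (dilation_op j u) z +
      of_nat j * (\<Sum>l\<in>UNIV. partial l (dilation_op (j - 1) (coord_mult l u)) z)"
    unfolding 1 by (simp add: sum.distrib sum_distrib_left radial_def)
  finally show ?thesis unfolding 2 by (simp add: algebra_simps)
qed

lemma dilation_op_scale:
  fixes u :: "'n::finite fn"
  assumes "smooth u" "c \<noteq> 0"
  shows "smooth (dilation_op j u) \<and> dilation_op j (\<lambda>z. u (c *\<^sub>R z)) = (\<lambda>z. dilation_op j u (c *\<^sub>R z))"
  using assms(1)
proof (induction j arbitrary: u)
  case (Suc j)
  have sx: "smooth (coord_mult i u)" for i by (intro smooth_mult smooth_coordinate Suc.prems)
  have s: "smooth (dilation_op j (coord_mult i u))" for i using Suc.IH[OF sx] by blast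
  have h: "dilation_op j (\<lambda>z. a * w z) = (\<lambda>z. a * dilation_op j w z)" if "smooth w" for a and w :: "'n fn"
  proof -
    have "smooth (dilation_op j w) \<and> dilation_op j (\<lambda>z. a * w z) = (\<lambda>z. a * dilation_op j w z)"
      using that
    proof (induction j arbitrary: w)
      case (Suc j)
      have sx: "smooth (coord_mult i w)" for i by (intro smooth_mult smooth_coordinate Suc.prems)
      have "coord_mult i (\<lambda>z. a * w z) = (\<lambda>z. a * coord_mult i w z)" for i by (auto simp: mult_ac)
      then have "dilation_op j (coord_mult i (\<lambda>z. a * w z)) = (\<lambda>z. a * dilation_op j (coord_mult i w) z)" for i
        using Suc.IH[OF sx] by simp
      moreover have "partial i (\<lambda>z. a * dilation_op j (coord_mult i w) z) x = a * partial i (dilation_op j (coord_mult i w)) x" for i x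
        using Suc.IH[OF sx] by (subst partial_mult)
          (auto intro: smooth_differentiable[OF smooth_const] smooth_differentiable simp: partial_const)
      ultimately show ?case using Suc.IH[OF sx]
        by (auto simp: sum_distrib_left intro!: smooth_sum smooth_partial)
    qed simp
    then show ?thesis ..
  qed
  have e: "coord_mult i (\<lambda>z. u (c *\<^sub>R z)) = (\<lambda>z. of_real (1 / c) * coord_mult i u (c *\<^sub>R z))" for i
    using assms(2) by (auto simp: fun_eq_iff)
  have sc: "smooth (\<lambda>z. coord_mult i u (c *\<^sub>R z))" for i
    using smooth_affine[OF sx, of c 0] by simp
  have "dilation_op j (coord_mult i (\<lambda>z. u (c *\<^sub>R z))) =
      (\<lambda>z. of_real (1 / c) * dilation_op j (coord_mult i u) (c *\<^sub>R z))" for i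
    unfolding e h[OF sc] using Suc.IH[OF sx, of i] by simp
  moreover have "partial i (\<lambda>z. of_real (1 / c) * dilation_op j (coord_mult i u) (c *\<^sub>R z)) x =
      partial i (dilation_op j (coord_mult i u)) (c *\<^sub>R x)" for i x
  proof -
    have sd: "smooth (\<lambda>z. dilation_op j (coord_mult i u) (c *\<^sub>R z))"
      using smooth_affine[OF s[of i], of c 0] by simp
    have "partial i (\<lambda>z. dilation_op j (coord_mult i u) (c *\<^sub>R z)) x =
        of_real c * partial i (dilation_op j (coord_mult i u)) (c *\<^sub>R x)"
      using partial_affine[of "dilation_op j (coord_mult i u)" c x 0 i] smooth_differentiable[OF s] by simp
    then show ?thesis using assms(2)
      by (subst partial_mult[OF smooth_differentiable[OF smooth_const] smooth_differentiable[OF sd]])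
        (simp add: partial_const)
  qed
  ultimately show ?case using s by (auto intro!: smooth_sum smooth_partial)
qed simp

section \<open>Pairings with dilated test functions\<close>

lemma has_vector_derivative_dilate:
  fixes w :: "'n::finite fn"
  assumes w: "smooth w" and x: "x > 0"
  shows "((\<lambda>x. w ((1 / x) *\<^sub>R y)) has_vector_derivative - of_real (1 / x) * radial w ((1 / x) *\<^sub>R y)) (at x within S)"
proof -
  let ?D = "frechet_derivative w (at ((1 / x) *\<^sub>R y))"
  have d: "((\<lambda>x. (1 / x) *\<^sub>R y) has_derivative (\<lambda>t. (- t / x\<^sup>2) *\<^sub>R y)) (at x within S)"
    using x by (auto intro!: derivative_eq_intros simp: power2_eq_square divide_simps)
  have lin: "linear ?D" using linear_frechet_derivative smooth_differentiable[OF w] by blast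
  have rad: "?D z = (\<Sum>i\<in>UNIV. of_real (z $ i) * partial i w ((1 / x) *\<^sub>R y))" for z
  proof -
    have "?D z = ?D (\<Sum>i\<in>UNIV. (z $ i) *\<^sub>R axis i 1)"
      by (rule arg_cong[of _ _ ?D]) (use basis_expansion[of z] in \<open>simp only: scalar_mult_eq_scaleR\<close>)
    also have "\<dots> = (\<Sum>i\<in>UNIV. (z $ i) *\<^sub>R ?D (axis i 1))"
      by (simp only: linear_sum[OF lin] linear_scale[OF lin])
    finally show ?thesis by (simp add: partial_def scaleR_conv_of_real[where 'a=complex])
  qed
  have "((\<lambda>x. w ((1 / x) *\<^sub>R y)) has_derivative (\<lambda>t. ?D ((- t / x\<^sup>2) *\<^sub>R y))) (at x within S)"
    by (rule has_derivative_compose[OF d has_derivative_frechet[OF smooth_differentiable[OF w]]])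
  moreover have "?D ((- t / x\<^sup>2) *\<^sub>R y) = t *\<^sub>R (- of_real (1 / x) * radial w ((1 / x) *\<^sub>R y))" for t
  proof -
    have "(- t / x\<^sup>2) *\<^sub>R y = (- t / x) *\<^sub>R ((1 / x) *\<^sub>R y)" by (simp add: power2_eq_square)
    then have "?D ((- t / x\<^sup>2) *\<^sub>R y) = (- t / x) *\<^sub>R ?D ((1 / x) *\<^sub>R y)"
      by (simp only: linear_scale[OF lin])
    also have "?D ((1 / x) *\<^sub>R y) = radial w ((1 / x) *\<^sub>R y)" by (simp only: rad radial_def)
    finally show ?thesis by (simp add: scaleR_conv_of_real[where 'a=complex])
  qed
  ultimately show ?thesis by (simp add: has_vector_derivative_def)
qed

lemma dilated_outside_ball:
  assumes w: "w \<in> test_functions (ball 0 r)" and x: "x \<in> {0<..1}" and y: "y \<notin> ball 0 r"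
  shows "w ((1 / x) *\<^sub>R y) = 0"
proof -
  have "r \<le> norm y" using y by simp
  also have "\<dots> \<le> norm ((1 / x) *\<^sub>R y)" using x mult_right_mono[of 1 "1 / x" "norm y"] by simp
  finally have "(1 / x) *\<^sub>R y \<notin> support w" using test_functionsD(3)[OF w] by auto
  then show ?thesis by (rule test_functionsD(4)[OF w])
qed

lemma difference_quotient_diff:
  fixes a d :: complex and t x :: real
  shows "t \<noteq> x \<Longrightarrow> a /\<^sub>R (t - x) - d = (a - (t - x) *\<^sub>R d) /\<^sub>R (t - x)"
  by (simp add: scaleR_diff_right)

text \<open>Differentiation under the integral sign.  On \<open>(x/2, 1]\<close> the dilates of \<open>w\<close> are Lipschitz in the parameter
  with a constant that does not depend on \<open>y\<close>, which dominates the difference quotients.\<close>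

lemma has_vector_derivative_pairing:
  fixes v w :: "'n::finite fn"
  assumes v: "set_integrable lborel (ball 0 r) v" and w: "w \<in> test_functions (ball 0 r)" and x: "x \<in> {0<..1}"
  shows "((\<lambda>x. \<integral>y. v y * w ((1 / x) *\<^sub>R y) \<partial>lborel) has_vector_derivative
    - of_real (1 / x) * (\<integral>y. v y * radial w ((1 / x) *\<^sub>R y) \<partial>lborel)) (at x within {0<..1})"
proof -
  let ?S = "{0<..1::real}" and ?T = "{x/2<..1}"
  have sm: "smooth w" by (rule test_functionsD(1)[OF w])
  have rt: "radial w \<in> test_functions (ball 0 r)" by (rule test_radial[OF w])
  obtain B where B: "\<And>z. cmod (radial w z) \<le> B" using test_bounded[OF rt] by blast
  have B0: "0 \<le> B" using B[of 0] norm_ge_zero order_trans by blast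
  obtain B1 where B1: "\<And>z. cmod (w z) \<le> B1" using test_bounded[OF w] by blast
  let ?v = "\<lambda>y. indicator (ball 0 r) y *\<^sub>R v y"
  have iv: "integrable lborel ?v" using v by (simp add: set_integrable_def)
  have [measurable]: "?v \<in> borel_measurable borel" using borel_measurable_integrable[OF iv] by simp
  have [measurable]: "w \<in> borel_measurable borel" "radial w \<in> borel_measurable borel"
    using smooth_measurable[OF sm] smooth_measurable[OF test_functionsD(1)[OF rt]] by auto
  have vw: "v y * w ((1 / t) *\<^sub>R y) = ?v y * w ((1 / t) *\<^sub>R y)" if "t \<in> ?S" for t y
    using dilated_outside_ball[OF w that, of y] by (cases "y \<in> ball 0 r") simp_all
  have vr: "v y * radial w ((1 / t) *\<^sub>R y) = ?v y * radial w ((1 / t) *\<^sub>R y)" if "t \<in> ?S" for t y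
    using dilated_outside_ball[OF rt that, of y] by (cases "y \<in> ball 0 r") simp_all
  have int: "integrable lborel (\<lambda>y. ?v y * w ((1 / t) *\<^sub>R y))" for t
  proof (rule Bochner_Integration.integrable_bound[OF integrable_mult_left[OF iv, of "of_real B1"]])
    show "AE y in lborel. cmod (?v y * w ((1 / t) *\<^sub>R y)) \<le> cmod (?v y * of_real B1)"
    proof (rule AE_I2)
      fix y
      have "cmod (w ((1 / t) *\<^sub>R y)) \<le> \<bar>B1\<bar>" by (rule order_trans[OF B1 abs_ge_self])
      then show "cmod (?v y * w ((1 / t) *\<^sub>R y)) \<le> cmod (?v y * of_real B1)"
        unfolding norm_mult norm_of_real by (intro mult_left_mono) auto
    qed
  qed measurable
  have lip: "cmod (w ((1 / t) *\<^sub>R y) - w ((1 / x) *\<^sub>R y)) \<le> (2 / x * B) * \<bar>t - x\<bar>" if t: "t \<in> ?T" for t y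
  proof -
    have "cmod (w ((1 / t) *\<^sub>R y) - w ((1 / x) *\<^sub>R y)) \<le> (2 / x * B) * norm (t - x)"
    proof (rule differentiable_bound[of ?T "\<lambda>x. w ((1 / x) *\<^sub>R y)" "\<lambda>x s. s *\<^sub>R (- of_real (1 / x) * radial w ((1 / x) *\<^sub>R y))"])
      fix s assume s: "s \<in> ?T"
      then have s0: "s > 0" using x by auto
      show "((\<lambda>x. w ((1 / x) *\<^sub>R y)) has_derivative (\<lambda>t. t *\<^sub>R (- of_real (1 / s) * radial w ((1 / s) *\<^sub>R y)))) (at s within ?T)"
        using has_vector_derivative_dilate[OF sm s0] by (simp only: has_vector_derivative_def)
      show "onorm (\<lambda>t. t *\<^sub>R (- of_real (1 / s) * radial w ((1 / s) *\<^sub>R y))) \<le> 2 / x * B"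
      proof (rule onorm_le)
        fix t :: real
        have "1 / s \<le> 2 / x" using s x by (auto simp: field_simps)
        then have "1 / s * cmod (radial w ((1 / s) *\<^sub>R y)) \<le> 2 / x * B"
          using s0 x by (intro mult_mono B) auto
        then have "\<bar>t\<bar> * (1 / s * cmod (radial w ((1 / s) *\<^sub>R y))) \<le> \<bar>t\<bar> * (2 / x * B)"
          by (rule mult_left_mono) simp
        then show "norm (t *\<^sub>R (- of_real (1 / s) * radial w ((1 / s) *\<^sub>R y))) \<le> 2 / x * B * norm t"
          using s0 by (simp add: norm_mult norm_divide mult_ac)
      qed
    qed (use t x in auto)
    then show ?thesis by simp
  qed
  let ?J = "\<lambda>t. \<integral>y. ?v y * w ((1 / t) *\<^sub>R y) \<partial>lborel"
  let ?J' = "- of_real (1 / x) * (\<integral>y. ?v y * radial w ((1 / x) *\<^sub>R y) \<partial>lborel)"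
  have lim: "((\<lambda>t. (?J t - ?J x) /\<^sub>R (t - x)) \<longlongrightarrow> ?J') (at x within ?T)"
    unfolding tendsto_at_iff_sequentially comp_def
  proof (intro allI impI)
    fix X :: "nat \<Rightarrow> real" assume X: "\<forall>i. X i \<in> ?T - {x}" "X \<longlonglongrightarrow> x"
    let ?q = "\<lambda>n y. ?v y * ((w ((1 / X n) *\<^sub>R y) - w ((1 / x) *\<^sub>R y)) /\<^sub>R (X n - x))"
    have q: "(?J (X n) - ?J x) /\<^sub>R (X n - x) = (\<integral>y. ?q n y \<partial>lborel)" for n
    proof -
      have "?J (X n) - ?J x = (\<integral>y. ?v y * w ((1 / X n) *\<^sub>R y) - ?v y * w ((1 / x) *\<^sub>R y) \<partial>lborel)"
        by (rule Bochner_Integration.integral_diff[OF int int, symmetric])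
      then have "(?J (X n) - ?J x) /\<^sub>R (X n - x) =
          (\<integral>y. (?v y * w ((1 / X n) *\<^sub>R y) - ?v y * w ((1 / x) *\<^sub>R y)) /\<^sub>R (X n - x) \<partial>lborel)"
        by (simp only: integral_scaleR_right)
      also have "\<dots> = (\<integral>y. ?q n y \<partial>lborel)"
        by (intro Bochner_Integration.integral_cong refl) (simp add: right_diff_distrib scaleR_diff_right)
      finally show ?thesis .
    qed
    have "(\<lambda>n. \<integral>y. ?q n y \<partial>lborel) \<longlonglongrightarrow> (\<integral>y. ?v y * (- of_real (1 / x) * radial w ((1 / x) *\<^sub>R y)) \<partial>lborel)"
    proof (rule integral_dominated_convergence[where w = "\<lambda>y. (2 / x * B) * norm (?v y)"])
      show "integrable lborel (\<lambda>y. (2 / x * B) * norm (?v y))"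
        by (intro integrable_mult_right integrable_norm iv)
      show "AE y in lborel. (\<lambda>n. ?q n y) \<longlonglongrightarrow> ?v y * (- of_real (1 / x) * radial w ((1 / x) *\<^sub>R y))"
      proof (intro AE_I2 tendsto_mult tendsto_const)
        fix y :: "real^'n"
        let ?d = "- of_real (1 / x) * radial w ((1 / x) *\<^sub>R y)"
        have "((\<lambda>t. w ((1 / t) *\<^sub>R y)) has_vector_derivative ?d) (at x within ?T)"
          using has_vector_derivative_dilate[OF sm, of x] x by simp
        then have l: "((\<lambda>t. norm (w ((1 / t) *\<^sub>R y) - w ((1 / x) *\<^sub>R y) - (t - x) *\<^sub>R ?d) / norm (t - x)) \<longlongrightarrow> 0) (at x within ?T)"
          by (simp add: has_vector_derivative_def has_derivative_iff_norm)
        have e: "norm (w ((1 / t) *\<^sub>R y) - w ((1 / x) *\<^sub>R y) - (t - x) *\<^sub>R ?d) / norm (t - x) =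
            norm ((w ((1 / t) *\<^sub>R y) - w ((1 / x) *\<^sub>R y)) /\<^sub>R (t - x) - ?d)" if "t \<noteq> x" for t
        proof -
          have "(w ((1 / t) *\<^sub>R y) - w ((1 / x) *\<^sub>R y)) /\<^sub>R (t - x) - ?d =
              (w ((1 / t) *\<^sub>R y) - w ((1 / x) *\<^sub>R y) - (t - x) *\<^sub>R ?d) /\<^sub>R (t - x)"
            by (rule difference_quotient_diff[OF that])
          then show ?thesis by (simp only: norm_scaleR divide_inverse) (simp add: mult.commute)
        qed
        have "(\<lambda>n. norm (w ((1 / X n) *\<^sub>R y) - w ((1 / x) *\<^sub>R y) - (X n - x) *\<^sub>R ?d) / norm (X n - x)) \<longlonglongrightarrow> 0"
          using l X unfolding tendsto_at_iff_sequentially comp_def by blast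
        then have "(\<lambda>n. norm ((w ((1 / X n) *\<^sub>R y) - w ((1 / x) *\<^sub>R y)) /\<^sub>R (X n - x) - ?d)) \<longlonglongrightarrow> 0"
          using e X(1) by simp
        then have "(\<lambda>n. (w ((1 / X n) *\<^sub>R y) - w ((1 / x) *\<^sub>R y)) /\<^sub>R (X n - x) - ?d) \<longlonglongrightarrow> 0"
          by (rule tendsto_norm_zero_cancel)
        then show "(\<lambda>n. (w ((1 / X n) *\<^sub>R y) - w ((1 / x) *\<^sub>R y)) /\<^sub>R (X n - x)) \<longlonglongrightarrow> ?d"
          by (rule LIM_zero_cancel)
      qed
      show "AE y in lborel. cmod (?q n y) \<le> (2 / x * B) * norm (?v y)" for n
      proof (rule AE_I2)
        fix y :: "real^'n"
        have Xn: "X n \<in> ?T" "X n \<noteq> x" using X(1) by auto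
        have "norm ((w ((1 / X n) *\<^sub>R y) - w ((1 / x) *\<^sub>R y)) /\<^sub>R (X n - x)) \<le> 2 / x * B"
          using lip[OF Xn(1), of y] Xn(2) by (simp only: norm_scaleR abs_inverse) (simp add: inverse_eq_divide divide_le_eq)
        then have "norm (?v y) * norm ((w ((1 / X n) *\<^sub>R y) - w ((1 / x) *\<^sub>R y)) /\<^sub>R (X n - x)) \<le> norm (?v y) * (2 / x * B)"
          by (rule mult_left_mono) simp
        then show "cmod (?q n y) \<le> (2 / x * B) * norm (?v y)"
          by (simp only: norm_mult mult.commute)
      qed
    qed measurable
    also have "(\<integral>y. ?v y * (- of_real (1 / x) * radial w ((1 / x) *\<^sub>R y)) \<partial>lborel) = ?J'"
      by (simp only: mult.left_commute[of "?v _"] integral_mult_right_zero)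
    finally show "(\<lambda>n. (?J (X n) - ?J x) /\<^sub>R (X n - x)) \<longlonglongrightarrow> ?J'" by (simp only: q)
  qed
  have at: "at x within ?T = at x within ?S"
    by (rule at_within_nhd[of x "{x/2<..}"]) (use x in auto)
  have JJ: "(?J has_vector_derivative ?J') (at x within ?S)"
  proof -
    have "((\<lambda>t. norm ((?J t - ?J x) /\<^sub>R (t - x) - ?J')) \<longlongrightarrow> 0) (at x within ?S)"
      using lim unfolding at by (intro tendsto_norm_zero LIM_zero)
    then have "((\<lambda>t. norm (?J t - ?J x - (t - x) *\<^sub>R ?J') / norm (t - x)) \<longlongrightarrow> 0) (at x within ?S)"
    proof (rule Lim_transform_eventually)
      have "norm ((?J t - ?J x) /\<^sub>R (t - x) - ?J') = norm (?J t - ?J x - (t - x) *\<^sub>R ?J') / norm (t - x)" if "t \<noteq> x" for t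
      proof -
        have "(?J t - ?J x) /\<^sub>R (t - x) - ?J' = (?J t - ?J x - (t - x) *\<^sub>R ?J') /\<^sub>R (t - x)"
          by (rule difference_quotient_diff[OF that])
        then show ?thesis by (simp only: norm_scaleR divide_inverse) (simp add: mult.commute)
      qed
      then show "eventually (\<lambda>t. norm ((?J t - ?J x) /\<^sub>R (t - x) - ?J') =
          norm (?J t - ?J x - (t - x) *\<^sub>R ?J') / norm (t - x)) (at x within ?S)"
        by (simp only: eventually_at_filter) simp
    qed
    then show ?thesis unfolding has_vector_derivative_def has_derivative_iff_norm
      by (intro conjI bounded_linear_scaleR_left)
  qed
  have "((\<lambda>x. \<integral>y. v y * w ((1 / x) *\<^sub>R y) \<partial>lborel) has_vector_derivative ?J') (at x within ?S)"
    by (rule has_vector_derivative_transform[OF x _ JJ]) (simp only: vw)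
  then show ?thesis by (simp only: vr[OF x])
qed

lemma inverse_power_derivative:
  fixes x :: real
  assumes "x \<noteq> 0"
  shows "((\<lambda>x. inverse x ^ n) has_real_derivative - (of_nat n * inverse x ^ Suc n)) (at x within S)"
  using DERIV_power[OF DERIV_inverse[OF assms], of n S] by (cases n) (simp_all add: power2_eq_square mult_ac)

text \<open>Each recursion step of \<open>dilation_op\<close> adds a letter to the word \<open>W\<close> and the matching coordinate factor to
  \<open>u\<close>.  After all steps \<open>D\<close> applies to \<open>u\<close> times a monomial, and the absolute monomials add up to the \<open>j\<close>-th
  power of the \<open>\<ell>\<^sub>1\<close> norm.\<close>

lemma pairing_dilation_op_bound:
  fixes v :: "'n::finite fn"
  assumes v: "set_integrable lborel (ball 0 r) v"
    and D: "\<And>W u. length W = k \<Longrightarrow> u \<in> test_functions (ball 0 r) \<Longrightarrow>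
      cmod (\<integral>z. v z * fold partial W u z \<partial>lborel) \<le> M * (\<integral>z. cmod (u z) \<partial>lborel)"
    and u: "u \<in> test_functions (ball 0 r)" and W: "length W + j = k"
  shows "cmod (\<integral>z. v z * fold partial W (dilation_op j u) z \<partial>lborel) \<le>
    M * (\<integral>z. (\<Sum>i\<in>UNIV. \<bar>z $ i\<bar>) ^ j * cmod (u z) \<partial>lborel)"
  using u W
proof (induction j arbitrary: u W)
  case 0
  then show ?case using D[of W u] by simp
next
  case (Suc j)
  let ?s = "\<lambda>z::real^'n. \<Sum>i\<in>UNIV. \<bar>z $ i\<bar>"
  have si: "set_integrable lborel K v" if "compact K" "K \<subseteq> ball 0 r" for K
    by (rule set_integrable_subset[OF v]) (use that in \<open>auto simp: compact_imp_closed\<close>)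
  have tf: "fold partial W' (dilation_op m (coord_mult i u)) \<in> test_functions (ball 0 r)" for W' m i
  proof -
    have "fold partial W' f \<in> test_functions (ball 0 r)" if "f \<in> test_functions (ball 0 r)" for f :: "'n fn"
      using that by (induction W' arbitrary: f) (auto intro: test_partial)
    then show ?thesis using test_dilation_op[OF test_coord_mult[OF Suc.prems(1)]] by blast
  qed
  have e: "fold partial W (dilation_op (Suc j) u) =
      (\<lambda>z. \<Sum>i\<in>UNIV. fold partial (i # W) (dilation_op j (coord_mult i u)) z)"
    unfolding dilation_op.simps
    by (subst fold_partial_sum) (auto intro!: smooth_partial test_functionsD(1)[OF test_dilation_op] test_coord_mult Suc.prems)
  have i: "integrable lborel (\<lambda>z. v z * fold partial (i # W) (dilation_op j (coord_mult i u)) z)" for i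
    by (rule integrable_mult_test[OF tf si])
  have ui: "integrable lborel (\<lambda>z. ?s z ^ j * cmod (coord_mult i u z))" for i
  proof -
    have c: "continuous_on UNIV (\<lambda>z::real^'n. complex_of_real (?s z ^ j))"
      by (intro continuous_intros)
    have "integrable lborel (\<lambda>z. complex_of_real (?s z ^ j) * coord_mult i u z)"
      by (rule integrable_mult_test[OF test_coord_mult[OF Suc.prems(1)]])
        (intro set_integrable_continuous continuous_on_subset[OF c], auto)
    from integrable_norm[OF this] show ?thesis
      by (simp only: norm_mult[of "complex_of_real (?s _ ^ j)"] norm_of_real) (simp add: power_abs abs_of_nonneg sum_nonneg)
  qed
  have "(\<integral>z. v z * fold partial W (dilation_op (Suc j) u) z \<partial>lborel) =
      (\<Sum>i\<in>UNIV. \<integral>z. v z * fold partial (i # W) (dilation_op j (coord_mult i u)) z \<partial>lborel)"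
    unfolding e sum_distrib_left by (rule Bochner_Integration.integral_sum) (rule i)
  also have "cmod \<dots> \<le> (\<Sum>i\<in>UNIV. M * (\<integral>z. ?s z ^ j * cmod (coord_mult i u z) \<partial>lborel))"
    by (intro sum_norm_le Suc.IH test_coord_mult Suc.prems) (use Suc.prems in simp)
  also have "\<dots> = M * (\<integral>z. (\<Sum>i\<in>UNIV. ?s z ^ j * cmod (coord_mult i u z)) \<partial>lborel)"
    by (subst Bochner_Integration.integral_sum[OF ui]) (simp only: sum_distrib_left)
  also have "(\<lambda>z. \<Sum>i\<in>UNIV. ?s z ^ j * cmod (coord_mult i u z)) = (\<lambda>z. ?s z ^ Suc j * cmod (u z))"
    by (rule ext) (simp add: norm_mult sum_distrib_left sum_distrib_right mult_ac)
  finally show ?case .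
qed

text \<open>The dual form of Taylor's theorem.  The function \<open>F(x) = \<integral> v(x z) u(z) dz = x\<^sup>-\<^sup>d \<integral> v(y) u(y/x) dy\<close> is
  smooth even if \<open>v\<close> is not, because all derivatives in \<open>x\<close> fall on \<open>u\<close>.  Its \<open>k\<close>-th derivative pairs \<open>v\<close>
  with derivatives of order \<open>k\<close> of test functions, which \<open>D\<close> bounds, and \<open>F\<close> inherits the order of
  vanishing of \<open>v\<close>.  The claim is Taylor's bound for \<open>F\<close> at \<open>x = 1\<close>.\<close>

lemma taylor_dual:
  fixes v u :: "'n::finite fn"
  assumes r: "r > 0" and v: "set_integrable lborel (ball 0 r) v" and M: "M \<ge> 0"
    and D: "\<And>W u. length W = k \<Longrightarrow> u \<in> test_functions (ball 0 r) \<Longrightarrow>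
      cmod (\<integral>z. v z * fold partial W u z \<partial>lborel) \<le> M * (\<integral>z. cmod (u z) \<partial>lborel)"
    and R: "R > 0" and small: "AE z in lborel. norm z < R \<longrightarrow> cmod (v z) \<le> C * norm z ^ k"
    and u: "u \<in> test_functions (ball 0 r)"
  shows "cmod (\<integral>z. v z * u z \<partial>lborel) \<le> M * (\<integral>z. (\<Sum>i\<in>UNIV. \<bar>z $ i\<bar>) ^ k * cmod (u z) \<partial>lborel)"
proof -
  let ?d = "CARD('n)" and ?s = "\<lambda>z::real^'n. \<Sum>i\<in>UNIV. \<bar>z $ i\<bar>"
  have si: "set_integrable lborel K v" if "compact K" "K \<subseteq> ball 0 r" for K
    by (rule set_integrable_subset[OF v]) (use that in \<open>auto simp: compact_imp_closed\<close>)
  have [measurable]: "u \<in> borel_measurable borel" by (rule smooth_measurable[OF test_functionsD(1)[OF u]])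
  let ?J = "\<lambda>w x. \<integral>y. v y * w ((1 / x) *\<^sub>R y) \<partial>lborel"
  have scaled_test: "(\<lambda>y. w ((1 / x) *\<^sub>R y)) \<in> test_functions (ball 0 r)"
    if "w \<in> test_functions (ball 0 r)" "x \<in> {0<..1}" for w :: "'n fn" and x
  proof -
    have "(\<lambda>y. w ((1 / x) *\<^sub>R y + 0)) \<in> test_functions (ball 0 r)"
    proof (rule test_affine[OF that(1)])
      show "1 / x \<noteq> 0" using that(2) by simp
      fix y :: "real^'n" assume "(1 / x) *\<^sub>R y + 0 \<in> ball 0 r"
      then have "norm y < r * x" using that(2) by (simp add: divide_less_eq)
      also have "\<dots> \<le> r * 1" using that(2) r by (intro mult_left_mono) auto
      finally show "y \<in> ball 0 r" by simp
    qed
    then show ?thesis by simp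
  qed
  have swap: "a * (b * (c * e)) = (a * c) * (b * e)" for a b c e :: real
    by (simp only: mult.assoc mult.left_commute)
  have homog: "(\<integral>y. f y * cmod (u ((1 / x) *\<^sub>R y)) \<partial>lborel) = x ^ (?d + k) * (\<integral>z. f z * cmod (u z) \<partial>lborel)"
    if x: "x > 0" and f: "f \<in> borel_measurable borel" "\<And>z. f (x *\<^sub>R z) = x ^ k * f z" for f :: "real^'n \<Rightarrow> real" and x
  proof -
    have [measurable]: "f \<in> borel_measurable borel" by (rule f(1))
    have "(\<integral>y. complex_of_real (f y * cmod (u ((1 / x) *\<^sub>R y))) \<partial>lborel) =
        of_real (\<bar>x\<bar> ^ ?d) * (\<integral>z. complex_of_real (f (0 + x *\<^sub>R z) * cmod (u ((1 / x) *\<^sub>R (0 + x *\<^sub>R z)))) \<partial>lborel)"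
      by (rule integral_affine) (use x in auto)
    also have "(\<integral>z. complex_of_real (f (0 + x *\<^sub>R z) * cmod (u ((1 / x) *\<^sub>R (0 + x *\<^sub>R z)))) \<partial>lborel) =
        (\<integral>z. complex_of_real (x ^ k * (f z * cmod (u z))) \<partial>lborel)"
      by (intro Bochner_Integration.integral_cong refl) (use x in \<open>simp add: f(2)\<close>)
    also have "\<dots> = of_real (x ^ k * (\<integral>z. f z * cmod (u z) \<partial>lborel))"
      by (simp only: integral_complex_of_real integral_mult_right_zero)
    finally have "complex_of_real (\<integral>y. f y * cmod (u ((1 / x) *\<^sub>R y)) \<partial>lborel) =
        complex_of_real (\<bar>x\<bar> ^ ?d * (x ^ k * (\<integral>z. f z * cmod (u z) \<partial>lborel)))"
      unfolding integral_complex_of_real by (simp only: of_real_mult)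
    then show ?thesis using x by (simp only: of_real_eq_iff) (simp add: power_add mult.assoc)
  qed
  define G where "G = (\<lambda>j x. of_real ((- 1) ^ j * inverse x ^ (?d + j)) * ?J (dilation_op j u) x)"
  have norm_G: "cmod (G j x) = inverse x ^ (?d + j) * cmod (?J (dilation_op j u) x)" if "x > 0" for j x
  proof -
    have "\<bar>(- 1) ^ j * inverse x ^ (?d + j)\<bar> = inverse x ^ (?d + j)"
      using that by (simp only: abs_mult power_abs abs_minus_cancel abs_one power_one abs_inverse abs_of_pos mult_1_left)
    then show ?thesis by (simp only: G_def norm_mult norm_of_real)
  qed
  let ?N = "M * (\<integral>z. ?s z ^ k * cmod (u z) \<partial>lborel)"
  have "cmod (G 0 1) \<le> ?N * 1 ^ k"
  proof (rule taylor_chain_bound[of 1 ?N k G "min 1 (R / r)" "\<bar>C\<bar> * (\<integral>z. norm z ^ k * cmod (u z) \<partial>lborel)" 1])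
    show "0 \<le> ?N" by (intro mult_nonneg_nonneg M integral_nonneg_AE AE_I2 zero_le_power sum_nonneg abs_ge_zero norm_ge_zero)
    show "min 1 (R / r) > 0" using R r by simp
    show "(G j has_vector_derivative G (Suc j) x) (at x within {0<..1})" if "j < k" and x: "x \<in> {0<..1}" for j x
    proof -
      let ?w = "dilation_op j u" and ?c = "\<lambda>j x. (- 1) ^ j * inverse x ^ (?d + j) :: real"
      have w: "?w \<in> test_functions (ball 0 r)" by (rule test_dilation_op[OF u])
      have x0: "x \<noteq> 0" using x by auto
      have "((\<lambda>x. (- 1) ^ j * inverse x ^ (?d + j)) has_real_derivative
          (- 1) ^ j * (- (of_nat (?d + j) * inverse x ^ Suc (?d + j)))) (at x within {0<..1})"
        by (rule DERIV_cmult[OF inverse_power_derivative[OF x0]])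
      then have "(?c j has_real_derivative ?c (Suc j) x * of_nat (?d + j)) (at x within {0<..1})"
        by (rule DERIV_cong) (simp only: power_Suc add_Suc_right mult_minus1 minus_mult_left[symmetric] minus_mult_right[symmetric] mult.assoc mult.commute mult.left_commute)
      then have "((\<lambda>x. complex_of_real (?c j x)) has_vector_derivative of_real (?c (Suc j) x * of_nat (?d + j))) (at x within {0<..1})"
        by (intro has_vector_derivative_of_real) (simp only: has_real_derivative_iff_has_vector_derivative)
      from has_vector_derivative_mult[OF this has_vector_derivative_pairing[OF v w x]]
      have d: "(G j has_vector_derivative (of_real (?c j x) * (- of_real (1 / x) * ?J (radial ?w) x) +
          of_real (?c (Suc j) x * of_nat (?d + j)) * ?J ?w x)) (at x within {0<..1})"
        unfolding G_def .
      have "?J (dilation_op (Suc j) u) x = of_nat (?d + j) * ?J ?w x + ?J (radial ?w) x"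
      proof -
        have i1: "integrable lborel (\<lambda>y. v y * ?w ((1 / x) *\<^sub>R y))"
          by (rule integrable_mult_test[OF scaled_test[OF w x] si])
        have i2: "integrable lborel (\<lambda>y. v y * radial ?w ((1 / x) *\<^sub>R y))"
          by (rule integrable_mult_test[OF scaled_test[OF test_radial[OF w] x] si])
        have "?J (dilation_op (Suc j) u) x =
            (\<integral>y. of_nat (?d + j) * (v y * ?w ((1 / x) *\<^sub>R y)) + v y * radial ?w ((1 / x) *\<^sub>R y) \<partial>lborel)"
          unfolding dilation_op_Suc_radial[OF u]
          by (intro Bochner_Integration.integral_cong refl) (simp only: distrib_left mult.left_commute)
        also have "\<dots> = of_nat (?d + j) * ?J ?w x + ?J (radial ?w) x"
          by (subst Bochner_Integration.integral_add[OF integrable_mult_right[OF i1] i2])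
            (simp only: integral_mult_right_zero)
        finally show ?thesis .
      qed
      moreover have "of_real (?c j x) * (- of_real (1 / x) * A) + of_real (?c (Suc j) x * of_nat n) * B =
          of_real (?c (Suc j) x) * (of_nat n * B + A)" for A B :: complex and n
      proof -
        have c: "complex_of_real (?c (Suc j) x) = - of_real (?c j x) * of_real (1 / x)"
          by (simp only: of_real_mult[symmetric] of_real_minus[symmetric]) (simp add: inverse_eq_divide)
        have alg: "p * (- y * A) + (q * of_nat n) * B = q * (of_nat n * B + A)" if "q = - p * y" for p q y :: complex
          unfolding that by (simp add: algebra_simps)
        show ?thesis unfolding of_real_mult[of "?c (Suc j) x"] of_real_of_nat_eq by (rule alg[OF c])
      qed
      ultimately have "of_real (?c j x) * (- of_real (1 / x) * ?J (radial ?w) x) +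
          of_real (?c (Suc j) x * of_nat (?d + j)) * ?J ?w x = G (Suc j) x"
        unfolding G_def by (simp only:)
      with d show ?thesis by simp
    qed
    show "cmod (G k x) \<le> ?N" if x: "x \<in> {0<..1}" for x
    proof -
      have x0: "x > 0" using x by simp
      let ?ux = "\<lambda>y. u ((1 / x) *\<^sub>R y)"
      have "(\<lambda>y. dilation_op k u ((1 / x) *\<^sub>R y)) = dilation_op k ?ux"
        using dilation_op_scale[OF test_functionsD(1)[OF u], of "1 / x" k] x0 by simp
      then have "cmod (?J (dilation_op k u) x) = cmod (\<integral>y. v y * fold partial [] (dilation_op k ?ux) y \<partial>lborel)"
        by (simp add: fun_eq_iff)
      also have "\<dots> \<le> M * (\<integral>z. ?s z ^ k * cmod (?ux z) \<partial>lborel)"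
        by (rule pairing_dilation_op_bound[OF v D scaled_test[OF u x]]) simp_all
      also have "(\<integral>z. ?s z ^ k * cmod (?ux z) \<partial>lborel) = x ^ (?d + k) * (\<integral>z. ?s z ^ k * cmod (u z) \<partial>lborel)"
      proof (rule homog[OF x0])
        show "?s (x *\<^sub>R z) ^ k = x ^ k * ?s z ^ k" for z
          using x0 by (simp add: abs_mult sum_distrib_left[symmetric] power_mult_distrib)
      qed measurable
      finally have "inverse x ^ (?d + k) * cmod (?J (dilation_op k u) x) \<le>
          inverse x ^ (?d + k) * (M * (x ^ (?d + k) * (\<integral>z. ?s z ^ k * cmod (u z) \<partial>lborel)))"
        using x0 by (intro mult_left_mono) auto
      also have "\<dots> = ?N"
      proof -
        have "inverse x ^ (?d + k) * x ^ (?d + k) = 1"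
          by (simp only: power_mult_distrib[symmetric] left_inverse[OF less_imp_neq[OF x0, symmetric]] power_one)
        then show ?thesis by (simp only: swap mult_1_left)
      qed
      finally show ?thesis by (simp only: norm_G[OF x0])
    qed
    show "cmod (G 0 x) \<le> (\<bar>C\<bar> * (\<integral>z. norm z ^ k * cmod (u z) \<partial>lborel)) * x ^ k"
      if x: "x \<in> {0<..1}" "x < min 1 (R / r)" for x
    proof -
      have x0: "x > 0" using x by simp
      let ?ux = "\<lambda>y. u ((1 / x) *\<^sub>R y)"
      have ux: "?ux \<in> test_functions (ball 0 r)" by (rule scaled_test[OF u x(1)])
      have "cmod (?J u x) \<le> (\<integral>y. \<bar>C\<bar> * (norm y ^ k * cmod (?ux y)) \<partial>lborel)"
      proof (rule order_trans[OF integral_norm_bound], rule integral_mono_AE)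
        show "integrable lborel (\<lambda>y. norm (v y * ?ux y))"
          by (intro integrable_norm integrable_mult_test[OF ux si])
        have "integrable lborel (\<lambda>y. complex_of_real (norm y ^ k) * ?ux y)"
          by (rule integrable_mult_test[OF ux]) (intro set_integrable_continuous continuous_intros, auto)
        from integrable_norm[OF this] show "integrable lborel (\<lambda>y. \<bar>C\<bar> * (norm y ^ k * cmod (?ux y)))"
          by (intro integrable_mult_right) (simp add: norm_mult norm_power)
        show "AE y in lborel. norm (v y * ?ux y) \<le> \<bar>C\<bar> * (norm y ^ k * cmod (?ux y))"
          using small
        proof eventually_elim
          case (elim y)
          show ?case
          proof (cases "?ux y = 0")
            case False
            have "(1 / x) *\<^sub>R y \<in> ball 0 r"
              using False test_functionsD(3,4)[OF u] by blast
            then have "norm y < r * x" using x0 by (simp add: divide_less_eq)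
            also have "\<dots> < R" using x(2) r by (simp add: field_simps)
            finally have "cmod (v y) \<le> C * norm y ^ k" using elim by simp
            also have "\<dots> \<le> \<bar>C\<bar> * norm y ^ k" by (intro mult_right_mono) auto
            finally have "cmod (v y) * cmod (?ux y) \<le> \<bar>C\<bar> * norm y ^ k * cmod (?ux y)"
              by (rule mult_right_mono) simp
            then show ?thesis by (simp only: norm_mult mult.assoc)
          qed simp
        qed
      qed
      also have "\<dots> = \<bar>C\<bar> * (\<integral>y. norm y ^ k * cmod (?ux y) \<partial>lborel)" by (rule integral_mult_right_zero)
      also have "(\<integral>y. norm y ^ k * cmod (?ux y) \<partial>lborel) = x ^ (?d + k) * (\<integral>z. norm z ^ k * cmod (u z) \<partial>lborel)"
        by (rule homog[OF x0]) (use x0 in \<open>auto simp: power_mult_distrib\<close>)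
      finally have "inverse x ^ ?d * cmod (?J u x) \<le>
          inverse x ^ ?d * (\<bar>C\<bar> * (x ^ (?d + k) * (\<integral>z. norm z ^ k * cmod (u z) \<partial>lborel)))"
        using x0 by (intro mult_left_mono) auto
      also have "\<dots> = (\<bar>C\<bar> * (\<integral>z. norm z ^ k * cmod (u z) \<partial>lborel)) * x ^ k"
      proof -
        have "inverse x ^ ?d * x ^ (?d + k) = x ^ k"
          by (simp only: power_add mult.assoc[symmetric] power_mult_distrib[symmetric] left_inverse[OF less_imp_neq[OF x0, symmetric]] power_one mult_1_left)
        then show ?thesis by (simp only: swap mult.commute[of "x ^ k"])
      qed
      finally show ?thesis by (simp only: norm_G[OF x0] add_0_right dilation_op.simps)
    qed
  qed auto
  then show ?thesis by (simp add: G_def)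
qed

section \<open>Pointwise bound from weak derivatives\<close>

lemma fold_partial_translate:
  fixes u :: "'n::finite fn"
  shows "smooth u \<Longrightarrow> fold partial W (\<lambda>y. u (y + a)) = (\<lambda>y. fold partial W u (y + a))"
proof (induction W arbitrary: u)
  case (Cons i W)
  have "partial i (\<lambda>y. u (y + a)) = (\<lambda>y. partial i u (y + a))"
    using partial_affine[of u 1 _ a i] smooth_differentiable[OF Cons.prems] by (auto simp: fun_eq_iff)
  then show ?case using Cons.IH[OF smooth_partial[OF Cons.prems]] by simp
qed simp

text \<open>The bound on the weak derivatives gives the hypothesis of the dual Taylor theorem for \<open>v\<close> moved to the
  origin, and the resulting inequality for all test functions is an almost everywhere bound.\<close>

lemma vanishing_order_bound:
  fixes v :: "'n::finite fn"
  assumes [measurable]: "v \<in> borel_measurable borel"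
    and v2: "\<And>K. compact K \<Longrightarrow> set_integrable lborel K (\<lambda>\<omega>. (cmod (v \<omega>))\<^sup>2)"
    and r: "r > 0" and M: "M \<ge> 0"
    and weak: "\<And>\<gamma>. mi_order \<gamma> = k \<Longrightarrow> \<exists>g. weak_derivative (ball \<beta> r) \<gamma> v g \<and>
      (AE x in lborel. x \<in> ball \<beta> r \<longrightarrow> cmod (g x) \<le> M)"
    and R: "R > 0" and small: "AE z in lborel. norm z < R \<longrightarrow> cmod (v (z + \<beta>)) \<le> C * norm z ^ k"
  shows "AE z in lborel. norm z < r \<longrightarrow> cmod (v (z + \<beta>)) \<le> M * (real CARD('n) * norm z) ^ k"
proof -
  let ?v = "\<lambda>z. v (z + \<beta>)" and ?s = "\<lambda>z::real^'n. \<Sum>i\<in>UNIV. \<bar>z $ i\<bar>"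
  let ?W = "\<lambda>z. M * ?s z ^ k"
  have s_le: "?s z \<le> real CARD('n) * norm z" for z :: "real^'n"
    using sum_bounded_above[of "UNIV :: 'n set" "\<lambda>i. \<bar>z $ i\<bar>" "norm z"] by (simp add: component_le_norm_cart)
  have s0: "0 \<le> ?s z" for z :: "real^'n" by (intro sum_nonneg) simp
  have [measurable]: "cball \<beta> r \<in> sets borel" "ball (0::real^'n) r \<in> sets borel" by simp_all
  have b2: "set_integrable lborel (ball 0 r) (\<lambda>z. (cmod (?v z))\<^sup>2)"
  proof -
    have "integrable lborel (\<lambda>y. indicator (cball \<beta> r) y *\<^sub>R (cmod (v y))\<^sup>2)"
      using v2[of "cball \<beta> r"] by (simp add: set_integrable_def)
    then have "(\<integral>\<^sup>+y. ennreal (indicator (cball \<beta> r) y * (cmod (v y))\<^sup>2) \<partial>lborel) < \<infinity>"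
      by (subst nn_integral_eq_integral) auto
    moreover have mm: "(\<lambda>y. ennreal (indicator (cball \<beta> r) y * (cmod (v y))\<^sup>2)) \<in> borel_measurable borel"
      by (intro measurable_compose[OF _ measurable_ennreal] borel_measurable_times borel_measurable_indicator
          borel_measurable_power borel_measurable_norm) (use assms(1) in auto)
    moreover have "(\<integral>\<^sup>+y. ennreal (indicator (cball \<beta> r) y * (cmod (v y))\<^sup>2) \<partial>lborel) =
        ennreal (\<bar>1\<bar> ^ CARD('n)) * (\<integral>\<^sup>+z. ennreal (indicator (cball \<beta> r) (\<beta> + 1 *\<^sub>R z) * (cmod (v (\<beta> + 1 *\<^sub>R z)))\<^sup>2) \<partial>lborel)"
      by (rule nn_integral_affine[OF mm one_neq_zero])
    ultimately have "(\<integral>\<^sup>+z. ennreal (indicator (cball \<beta> r) (\<beta> + z) * (cmod (v (\<beta> + z)))\<^sup>2) \<partial>lborel) < \<infinity>"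
      by simp
    moreover have "(\<lambda>z. indicator (cball \<beta> r) (\<beta> + z) * (cmod (v (\<beta> + z)))\<^sup>2) \<in> borel_measurable lborel"
      by measurable
    ultimately have "integrable lborel (\<lambda>z. indicator (cball \<beta> r) (\<beta> + z) * (cmod (v (\<beta> + z)))\<^sup>2)"
      by (intro integrableI_nonneg) auto
    moreover have "indicator (cball \<beta> r) (\<beta> + z) = (indicator (cball 0 r) z :: real)" for z
      by (simp add: indicator_def dist_norm)
    ultimately have "set_integrable lborel (cball 0 r) (\<lambda>z. (cmod (?v z))\<^sup>2)"
      by (simp add: set_integrable_def add.commute)
    then show ?thesis by (rule set_integrable_subset) auto
  qed
  have b1: "set_integrable lborel (ball 0 r) ?v"
    unfolding set_integrable_def
  proof (rule Bochner_Integration.integrable_bound)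
    show "integrable lborel (\<lambda>x. indicator (ball 0 r) x + indicator (ball 0 r) x *\<^sub>R (cmod (?v x))\<^sup>2)"
      using b2 by (intro Bochner_Integration.integrable_add integrable_real_indicator emeasure_bounded_finite) (auto simp: set_integrable_def)
    show "AE x in lborel. norm (indicator (ball 0 r) x *\<^sub>R ?v x) \<le> norm (indicator (ball 0 r) x + indicator (ball 0 r) x *\<^sub>R (cmod (?v x))\<^sup>2)"
      using le_one_plus_square by (intro AE_I2) (simp add: indicator_def)
  qed measurable
  have D: "cmod (\<integral>z. ?v z * fold partial W u z \<partial>lborel) \<le> M * (\<integral>z. cmod (u z) \<partial>lborel)"
    if W: "length W = k" and u: "u \<in> test_functions (ball 0 r)" for W u
  proof -
    let ?u = "\<lambda>y. u (y + - \<beta>)"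
    have sm: "smooth u" by (rule test_functionsD(1)[OF u])
    have uu: "?u \<in> test_functions (ball \<beta> r)"
      using test_affine[OF u, of 1 "- \<beta>" "ball \<beta> r"] by (simp add: dist_norm norm_minus_commute)
    have [measurable]: "u \<in> borel_measurable borel" "fold partial W u \<in> borel_measurable borel"
    proof -
      have "smooth (fold partial W u)" using sm by (induction W arbitrary: u) (auto intro: smooth_partial)
      then show "u \<in> borel_measurable borel" "fold partial W u \<in> borel_measurable borel"
        using sm by (auto intro: smooth_measurable)
    qed
    obtain g where g: "weak_derivative (ball \<beta> r) (count_list W) v g"
      "AE x in lborel. x \<in> ball \<beta> r \<longrightarrow> cmod (g x) \<le> M"
      using weak[of "count_list W"] W by (auto simp: mi_order_count_list)
    have ig: "integrable lborel (\<lambda>y. g y * ?u y)"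
      by (rule integrable_mult_test[OF uu]) (use g(1) in \<open>auto simp: weak_derivative_def locally_integrable_on_def\<close>)
    have "(\<integral>z. ?v z * fold partial W u z \<partial>lborel) = (\<integral>y. v y * fold partial W u (y + - \<beta>) \<partial>lborel)"
      using integral_translate[of "\<lambda>y. v y * fold partial W u (y + - \<beta>)" \<beta>] by simp
    also have "\<dots> = (\<integral>y. v y * mpartial (count_list W) ?u y \<partial>lborel)"
      unfolding fold_partial_eq_mpartial[OF uu, of W, symmetric] fold_partial_translate[OF sm] ..
    also have "\<dots> = (-1) ^ mi_order (count_list W) * (\<integral>y. g y * ?u y \<partial>lborel)"
      using g(1) uu by (simp add: weak_derivative_def)
    also have "cmod \<dots> = cmod (\<integral>y. g y * ?u y \<partial>lborel)" by (simp add: norm_mult norm_power)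
    also have "\<dots> \<le> (\<integral>y. M * cmod (?u y) \<partial>lborel)"
    proof (rule order_trans[OF integral_norm_bound], rule integral_mono_AE)
      show "integrable lborel (\<lambda>y. norm (g y * ?u y))" by (intro integrable_norm ig)
      show "integrable lborel (\<lambda>y. M * cmod (?u y))" by (intro integrable_mult_right integrable_norm test_integrable[OF uu])
      show "AE y in lborel. norm (g y * ?u y) \<le> M * cmod (?u y)"
        using g(2)
      proof eventually_elim
        case (elim y)
        show ?case
        proof (cases "y \<in> ball \<beta> r")
          case True
          then show ?thesis using elim by (simp only: norm_mult) (intro mult_right_mono, auto)
        next
          case False
          then have "?u y = 0" using test_functionsD(3,4)[OF uu] by blast
          then show ?thesis by simp
        qed
      qed
    qed
    also have "\<dots> = M * (\<integral>y. cmod (?u y) \<partial>lborel)" by (rule integral_mult_right_zero)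
    also have "(\<integral>y. cmod (?u y) \<partial>lborel) = (\<integral>z. cmod (u z) \<partial>lborel)"
    proof -
      have "(\<integral>y. complex_of_real (cmod (u (y + - \<beta>))) \<partial>lborel) = (\<integral>z. complex_of_real (cmod (u z)) \<partial>lborel)"
        by (rule integral_translate) measurable
      then show ?thesis by (simp only: integral_complex_of_real of_real_eq_iff)
    qed
    finally show ?thesis .
  qed
  have "AE z in lborel. z \<in> ball 0 r \<longrightarrow> cmod (?v z) \<le> ?W z"
  proof (rule AE_bound_if_test_bound[OF r _ _ b2])
    show "?v \<in> borel_measurable borel" by measurable
    show "?W \<in> borel_measurable borel" by measurable
    show "0 \<le> ?W z" for z using M s0[of z] by simp
    show "?W z \<le> M * (real CARD('n) * r) ^ k" if "z \<in> ball 0 r" for z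
    proof -
      have "?s z \<le> real CARD('n) * r"
        using that by (intro order_trans[OF s_le] mult_left_mono) auto
      then show ?thesis using M s0[of z] by (intro mult_left_mono power_mono) auto
    qed
    fix u :: "'n fn" assume u: "u \<in> test_functions (ball 0 r)"
    show "cmod (\<integral>z. ?v z * u z \<partial>lborel) \<le> (\<integral>z. ?W z * cmod (u z) \<partial>lborel)"
      using taylor_dual[OF r b1 M D R small u] by (simp add: mult.assoc)
  qed
  then show ?thesis
  proof eventually_elim
    case (elim z)
    show ?case
    proof
      assume "norm z < r"
      then have "cmod (v (z + \<beta>)) \<le> M * ?s z ^ k" using elim by simp
      also have "\<dots> \<le> M * (real CARD('n) * norm z) ^ k"
        using M s0[of z] s_le[of z] by (intro mult_left_mono power_mono) auto
      finally show "cmod (v (z + \<beta>)) \<le> M * (real CARD('n) * norm z) ^ k" .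
    qed
  qed
qed

section \<open>Trigonometric polynomials\<close>

inductive_set trig :: "'n::finite fn set" where
  char: "\<alpha> \<in> int_lattice \<Longrightarrow> (\<lambda>\<omega>. cis (- (\<alpha> \<bullet> \<omega>))) \<in> trig"
| add: "p \<in> trig \<Longrightarrow> q \<in> trig \<Longrightarrow> (\<lambda>\<omega>. p \<omega> + q \<omega>) \<in> trig"
| scale: "p \<in> trig \<Longrightarrow> (\<lambda>\<omega>. c * p \<omega>) \<in> trig"

lemma trig_const: "(\<lambda>\<omega>. c) \<in> trig"
proof -
  have "(0 :: real^'a) \<in> int_lattice" by (simp add: int_lattice_def)
  from trig.scale[OF trig.char[OF this], of c] show ?thesis by simp
qed

lemma trig_mult:
  assumes "p \<in> trig" "q \<in> trig"
  shows "(\<lambda>\<omega>. p \<omega> * q \<omega>) \<in> trig"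
  using assms(1)
proof induction
  case (char \<alpha>)
  show ?case using assms(2)
  proof induction
    case (char \<alpha>')
    have "\<alpha> + \<alpha>' \<in> int_lattice" using \<open>\<alpha> \<in> int_lattice\<close> char by (simp add: int_lattice_def)
    from trig.char[OF this] show ?case by (simp add: cis_mult inner_add_left)
  next
    case (add p q)
    from trig.add[OF add.IH] show ?case by (simp add: distrib_left)
  next
    case (scale p c)
    from trig.scale[OF scale.IH, of c] show ?case by (simp add: mult.left_commute)
  qed
next
  case (add p q)
  from trig.add[OF add.IH] show ?case by (simp add: distrib_right)
next
  case (scale p c)
  from trig.scale[OF scale.IH, of c] show ?case by (simp add: mult.assoc)
qed

lemma trig_prod: "(\<And>i. i \<in> I \<Longrightarrow> p i \<in> trig) \<Longrightarrow> (\<lambda>\<omega>. \<Prod>i\<in>I. p i \<omega>) \<in> trig"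
  by (induction I rule: infinite_finite_induct) (simp_all add: trig_const trig_mult)

lemma trig_measurable: "p \<in> trig \<Longrightarrow> p \<in> borel_measurable borel"
  by (induction rule: trig.induct) auto

lemma trig_periodic:
  assumes "p \<in> trig" "\<beta> \<in> dual_lattice"
  shows "p (\<omega> + \<beta>) = p \<omega>"
  using assms(1) by induction (simp_all only: cis_lattice_shift[OF _ assms(2)])

lemma trig_cos:
  "(\<lambda>\<omega>::real^'n::finite. complex_of_real (cos (\<omega> $ i - m))) \<in> trig"
proof -
  have e: "complex_of_real (cos (\<omega> $ i - m)) =
      (cis (- m) / 2) * cis (- ((- axis i 1) \<bullet> \<omega>)) + (cis m / 2) * cis (- (axis i 1 \<bullet> \<omega>))" for \<omega> :: "real^'n"
  proof -
    have "complex_of_real (cos t) = (cis t + cis (- t)) / 2" for t by (simp add: complex_eq_iff)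
    moreover have "cis (- m) * cis (- ((- axis i 1) \<bullet> \<omega>)) = cis (\<omega> $ i - m)"
      "cis m * cis (- (axis i 1 \<bullet> \<omega>)) = cis (- (\<omega> $ i - m))"
      by (simp_all add: cis_mult inner_axis')
    ultimately show ?thesis by (simp add: add_divide_distrib)
  qed
  have "axis i (1::real) \<in> int_lattice" "- axis i (1::real) \<in> int_lattice"
    by (auto simp: int_lattice_def axis_def)
  then show ?thesis unfolding e by (intro trig.intros)
qed

lemma trig_real_polynomial:
  assumes "real_polynomial_function p" "(\<lambda>\<omega>. complex_of_real (q \<omega>)) \<in> trig"
  shows "(\<lambda>\<omega>. complex_of_real (p (q \<omega>))) \<in> trig"
  using assms(1)
proof (induction p)
  case (linear f)
  have "f y = f 1 * y" for y
    using linear_scale[OF bounded_linear.linear[OF linear], of y 1] by (simp add: mult.commute)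
  then have "(\<lambda>\<omega>. complex_of_real (f (q \<omega>))) = (\<lambda>\<omega>. of_real (f 1) * of_real (q \<omega>))"
    by (metis of_real_mult)
  then show ?case using trig.scale[OF assms(2)] by simp
next
  case (add f g)
  then show ?case using trig.add by (simp add: trig.add)
next
  case (mult f g)
  then show ?case by (simp add: trig_mult)
qed (simp add: trig_const)

text \<open>The step function at \<open>0\<close> as a bounded limit of polynomials; composed with
  \<open>cos (x - m) - cos \<ell>\<close> it turns into the indicator of an arc.\<close>

lemma polynomial_step:
  "\<exists>p. \<forall>n::nat. real_polynomial_function (p n) \<and> (\<forall>y::real. \<bar>y\<bar> \<le> 2 \<longrightarrow> \<bar>p n y\<bar> \<le> 2) \<and>
     (\<forall>y. \<bar>y\<bar> \<le> 2 \<longrightarrow> (\<lambda>n. p n y) \<longlonglongrightarrow> (if y \<ge> 0 then 1 else 0 :: real))"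
proof -
  define step where "step = (\<lambda>(n::nat) y::real. max 0 (min 1 (1 + real n * y)))"
  have "\<exists>g. real_polynomial_function g \<and> (\<forall>x\<in>{-2..2}. \<bar>step n x - g x\<bar> < inverse (real (Suc n)))" for n
  proof -
    have "continuous_on {-2..2} (step n)" unfolding step_def by (intro continuous_intros)
    from Stone_Weierstrass_real_polynomial_function[OF compact_Icc this, of "inverse (real (Suc n))"]
    show ?thesis by (metis inverse_positive_iff_positive of_nat_0_less_iff zero_less_Suc)
  qed
  then obtain p where p: "\<And>n. real_polynomial_function (p n)"
    "\<And>n x. x \<in> {-2..2} \<Longrightarrow> \<bar>step n x - p n x\<bar> < inverse (real (Suc n))" by metis
  have b: "\<bar>p n y\<bar> \<le> 2" if "\<bar>y\<bar> \<le> 2" for n y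
  proof -
    have "\<bar>step n y\<bar> \<le> 1" by (auto simp: step_def)
    moreover have "inverse (real (Suc n)) \<le> 1" by (simp add: inverse_le_1_iff)
    moreover have "\<bar>step n y - p n y\<bar> < inverse (real (Suc n))" using p(2) that by (auto simp: abs_le_iff)
    ultimately show ?thesis by linarith
  qed
  have l: "(\<lambda>n. p n y) \<longlonglongrightarrow> (if y \<ge> 0 then 1 else 0)" if y: "\<bar>y\<bar> \<le> 2" for y
  proof -
    have "(\<lambda>n. step n y) \<longlonglongrightarrow> (if y \<ge> 0 then 1 else 0)"
    proof (cases "y \<ge> 0")
      case True
      then show ?thesis by (simp add: step_def min_def)
    next
      case False
      obtain N :: nat where N: "1 / (- y) < real N" using reals_Archimedean2 by blast
      have "step n y = 0" if "n \<ge> N" for n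
      proof -
        have "1 < real N * (- y)" using N False by (simp add: field_simps)
        also have "\<dots> \<le> real n * (- y)" using that False by (intro mult_right_mono) auto
        finally show ?thesis by (simp add: step_def)
      qed
      then have "eventually (\<lambda>n. 0 = step n y) sequentially"
        unfolding eventually_sequentially by metis
      then show ?thesis using False by (auto intro: Lim_transform_eventually[OF tendsto_const])
    qed
    moreover have "(\<lambda>n. step n y - p n y) \<longlonglongrightarrow> 0"
    proof (rule Lim_null_comparison[OF _ LIMSEQ_inverse_real_of_nat])
      show "\<forall>\<^sub>F n in sequentially. norm (step n y - p n y) \<le> inverse (real (Suc n))"
      proof (intro always_eventually allI)
        fix n
        have "y \<in> {-2..2}" using y by auto
        from p(2)[OF this, of n] show "norm (step n y - p n y) \<le> inverse (real (Suc n))"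
          unfolding real_norm_def by (rule less_imp_le)
      qed
    qed
    ultimately have "(\<lambda>n. step n y - (step n y - p n y)) \<longlonglongrightarrow> (if y \<ge> 0 then 1 else 0) - 0"
      by (rule tendsto_diff)
    then show ?thesis by simp
  qed
  show ?thesis using p(1) b l by blast
qed

text \<open>The arc from \<open>- pi\<close> to \<open>a\<close> has midpoint \<open>(a - pi) / 2\<close> and half-length \<open>(a + pi) / 2\<close>, and the cosine of
  the distance to the midpoint decreases up to the antipode.\<close>

lemma arc_iff:
  assumes "- pi \<le> x" "x < pi" "- pi \<le> a" "a < pi"
  shows "cos (x - (a - pi) / 2) - cos ((a + pi) / 2) \<ge> 0 \<longleftrightarrow> x \<le> a"
proof -
  define l where "l = (a + pi) / 2"
  define t where "t = x - (a - pi) / 2"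
  have l: "0 \<le> l" "l < pi" using assms by (auto simp: l_def)
  have t: "- l \<le> t" "t < 2 * pi - l" using assms by (auto simp: l_def t_def field_simps)
  have xa: "x \<le> a \<longleftrightarrow> t \<le> l" by (auto simp: l_def t_def field_simps)
  have "cos t - cos l \<ge> 0 \<longleftrightarrow> t \<le> l"
  proof (cases "t \<le> l")
    case True
    then have "\<bar>t\<bar> \<le> l" using t by auto
    then have "cos l \<le> cos \<bar>t\<bar>" using l by (intro cos_monotone_0_pi_le) auto
    then show ?thesis using True by simp
  next
    case False
    have "cos t < cos l"
    proof (cases "t \<le> pi")
      case True
      then show ?thesis using False l by (intro cos_monotone_0_pi) auto
    next
      case F: False
      have "cos (2 * pi - t) < cos l" using F t l by (intro cos_monotone_0_pi) auto
      then show ?thesis by (simp add: cos_diff)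
    qed
    then show ?thesis using False by simp
  qed
  then show ?thesis by (simp add: xa l_def t_def)
qed

definition cube :: "(real^'n::finite) set" where
  "cube = {x. \<forall>i. - pi \<le> x $ i \<and> x $ i < pi}"

text \<open>The representative of \<open>x\<close> modulo the dual lattice in the fundamental cube.\<close>

definition reduce :: "real^'n::finite \<Rightarrow> real^'n" where
  "reduce x = (\<chi> i. x $ i - 2 * pi * of_int \<lfloor>(x $ i + pi) / (2 * pi)\<rfloor>)"

lemma reduce_in_cube: "reduce x \<in> cube"
proof -
  have "- pi \<le> t - 2 * pi * of_int \<lfloor>(t + pi) / (2 * pi)\<rfloor> \<and> t - 2 * pi * of_int \<lfloor>(t + pi) / (2 * pi)\<rfloor> < pi" for t :: real
  proof -
    let ?n = "of_int \<lfloor>(t + pi) / (2 * pi)\<rfloor> :: real"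
    have two_pi: "2 * pi > 0" by simp
    have "?n \<le> (t + pi) / (2 * pi)" "(t + pi) / (2 * pi) < ?n + 1" by linarith+
    then have "?n * (2 * pi) \<le> t + pi" "t + pi < (?n + 1) * (2 * pi)"
      by (simp_all only: pos_le_divide_eq[OF two_pi] pos_divide_less_eq[OF two_pi])
    then show ?thesis by (simp add: algebra_simps)
  qed
  then show ?thesis by (simp add: cube_def reduce_def)
qed

lemma reduce_diff: "x - reduce x \<in> dual_lattice"
  unfolding dual_lattice_def
proof (rule image_eqI)
  show "x - reduce x = (2 * pi) *\<^sub>R (\<chi> i. of_int \<lfloor>(x $ i + pi) / (2 * pi)\<rfloor>)"
    by (simp add: reduce_def vec_eq_iff)
qed (simp add: int_lattice_def)

lemma reduce_shift:
  assumes z: "z \<in> cube" and \<beta>: "\<beta> \<in> dual_lattice"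
  shows "reduce (z + \<beta>) = z"
proof -
  obtain b where b: "b \<in> int_lattice" "\<beta> = (2 * pi) *\<^sub>R b" using \<beta> by (auto simp: dual_lattice_def)
  have "(z + \<beta>) $ i - 2 * pi * of_int \<lfloor>((z + \<beta>) $ i + pi) / (2 * pi)\<rfloor> = z $ i" for i
  proof -
    obtain n :: int where n: "b $ i = of_int n" using b(1) by (auto simp: int_lattice_def elim: Ints_cases)
    have zi: "- pi \<le> z $ i" "z $ i < pi" using z by (auto simp: cube_def)
    have "((z + \<beta>) $ i + pi) / (2 * pi) = (z $ i + pi) / (2 * pi) + of_int n"
      by (simp add: b(2) n field_simps)
    moreover have "\<lfloor>(z $ i + pi) / (2 * pi)\<rfloor> = 0"
      using zi by (intro floor_unique) (auto simp: field_simps)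
    ultimately have "\<lfloor>((z + \<beta>) $ i + pi) / (2 * pi)\<rfloor> = n" by simp
    then show ?thesis by (simp add: b(2) n)
  qed
  then show ?thesis by (simp add: reduce_def vec_eq_iff)
qed

lemma reduce_measurable [measurable]: "reduce \<in> borel_measurable borel"
proof -
  have n [measurable]: "(\<lambda>x::real^'a. x $ i) \<in> borel_measurable borel" for i
    by (intro borel_measurable_continuous_onI continuous_intros)
  have fl: "(\<lambda>x::real^'a. real_of_int \<lfloor>(x $ i + pi) / (2 * pi)\<rfloor>) \<in> borel_measurable borel" for i
    by measurable
  have "(\<lambda>x::real^'a. \<Sum>i\<in>UNIV. (x $ i - 2 * pi * of_int \<lfloor>(x $ i + pi) / (2 * pi)\<rfloor>) *\<^sub>R (axis i 1 :: real^'a)) \<in> borel_measurable borel"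
    by (intro borel_measurable_sum borel_measurable_scaleR borel_measurable_diff borel_measurable_times
        borel_measurable_const n fl)
  also have "(\<lambda>x::real^'a. \<Sum>i\<in>UNIV. (x $ i - 2 * pi * of_int \<lfloor>(x $ i + pi) / (2 * pi)\<rfloor>) *\<^sub>R (axis i 1 :: real^'a)) = reduce"
    by (rule ext) (simp add: reduce_def vec_eq_iff axis_def if_distrib cong: if_cong)
  finally show ?thesis .
qed

lemma trig_reduce:
  assumes "p \<in> trig"
  shows "p (reduce \<omega>) = p \<omega>"
  using trig_periodic[OF assms reduce_diff, of "reduce \<omega>" \<omega>] by simp

text \<open>Density of the trigonometric polynomials in a weighted space of periodic functions.  The
  weight is pushed forward to the fundamental cube, where periodic functions are arbitrary.\<close>

lemma trig_L2_dense:
  fixes W :: "real^'n::finite \<Rightarrow> real"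
  assumes [measurable]: "W \<in> borel_measurable borel" and Wfin: "(\<integral>\<^sup>+\<omega>. ennreal (W \<omega>) \<partial>lborel) < \<infinity>"
  shows "L2_dense (distr (density lborel (\<lambda>\<omega>. ennreal (W \<omega>))) borel reduce) trig"
proof (rule L2_dense.intro)
  let ?M = "distr (density lborel (\<lambda>\<omega>. ennreal (W \<omega>))) borel (reduce :: real^'n \<Rightarrow> _)"
  have red: "reduce \<in> density lborel (\<lambda>\<omega>. ennreal (W \<omega>)) \<rightarrow>\<^sub>M (borel :: (real^'n) measure)" by simp
  show "finite_measure ?M"
  proof (rule finite_measureI)
    have "emeasure ?M (space ?M) = (\<integral>\<^sup>+\<omega>. ennreal (W \<omega>) \<partial>lborel)"
      by (simp add: emeasure_distr[OF red] emeasure_density)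
    then show "emeasure ?M (space ?M) \<noteq> \<infinity>" using Wfin by simp
  qed
  show "sets ?M = sets borel" by simp
  fix a :: "real^'n"
  obtain p where p: "\<And>n. real_polynomial_function (p n)" "\<And>n y::real. \<bar>y\<bar> \<le> 2 \<Longrightarrow> \<bar>p n y\<bar> \<le> (2::real)"
    "\<And>y. \<bar>y\<bar> \<le> 2 \<Longrightarrow> (\<lambda>n::nat. p n y) \<longlonglongrightarrow> (if y \<ge> 0 then 1 else 0)"
    using polynomial_step by metis
  define q where "q = (\<lambda>i x::real^'n. cos (x $ i - (a $ i - pi) / 2) - cos ((a $ i + pi) / 2))"
  have q2: "\<bar>q i x\<bar> \<le> 2" for i x
    using abs_cos_le_one[of "x $ i - (a $ i - pi) / 2"] abs_cos_le_one[of "(a $ i + pi) / 2"]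
    unfolding q_def by linarith
  define c where "c = (\<lambda>i n x. if a $ i \<ge> pi then 1 else if a $ i < - pi then 0 else p n (q i x))"
  define u where "u = (\<lambda>n x. complex_of_real (\<Prod>i\<in>UNIV. c i n x))"
  have "(\<lambda>x. complex_of_real (c i n x)) \<in> trig" for i n
  proof -
    have "(\<lambda>x. complex_of_real (q i x)) \<in> trig"
      using trig.add[OF trig_cos trig_const[of "- of_real (cos ((a $ i + pi) / 2))"], of i "(a $ i - pi) / 2"]
      by (simp add: q_def)
    from trig_real_polynomial[OF p(1) this, of n] show ?thesis
      using trig_const[of 1] trig_const[of 0]
      by (cases "a $ i \<ge> pi"; cases "a $ i < - pi") (simp_all add: c_def)
  qed
  then have "u n \<in> trig" for n
    unfolding u_def of_real_prod by (intro trig_prod)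
  moreover have "cmod (u n x) \<le> 2 ^ CARD('n)" for n x
  proof -
    have "\<bar>c i n x\<bar> \<le> 2" for i using p(2)[OF q2, of n i x] by (simp add: c_def)
    then have "(\<Prod>i\<in>UNIV. \<bar>c i n x\<bar>) \<le> (\<Prod>i\<in>(UNIV::'n set). 2)" by (intro prod_mono) auto
    then show ?thesis by (simp only: u_def norm_of_real abs_prod prod_constant)
  qed
  moreover have "AE x in ?M. (\<lambda>n. u n x) \<longlonglongrightarrow> indicator {..a} x"
  proof -
    have lim: "(\<lambda>n. u n x) \<longlonglongrightarrow> indicator {..a} x" if x: "x \<in> cube" for x
    proof -
      have "(\<lambda>n. c i n x) \<longlonglongrightarrow> (if x $ i \<le> a $ i then 1 else 0)" for i
      proof -
        have xi: "- pi \<le> x $ i" "x $ i < pi" using x by (auto simp: cube_def)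
        consider "a $ i \<ge> pi" | "a $ i < - pi" | "- pi \<le> a $ i" "a $ i < pi" by linarith
        then show ?thesis
        proof cases
          case 1
          then show ?thesis using xi by (simp add: c_def)
        next
          case 2
          then show ?thesis using xi pi_gt_zero by (simp add: c_def)
        next
          case 3
          have "(\<lambda>n. p n (q i x)) \<longlonglongrightarrow> (if q i x \<ge> 0 then 1 else 0)" by (rule p(3)[OF q2])
          moreover have "q i x \<ge> 0 \<longleftrightarrow> x $ i \<le> a $ i" unfolding q_def by (rule arc_iff[OF xi 3])
          ultimately show ?thesis using 3 by (simp add: c_def)
        qed
      qed
      then have L: "(\<lambda>n. u n x) \<longlonglongrightarrow> of_real (\<Prod>i\<in>UNIV. if x $ i \<le> a $ i then 1 else 0)"
        unfolding u_def by (intro tendsto_of_real tendsto_prod)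
      have P: "(\<Prod>i\<in>UNIV. if x $ i \<le> a $ i then 1 else 0 :: real) = (if x \<le> a then 1 else 0)"
        by (auto simp: less_eq_vec_def)
      have "complex_of_real (if x \<le> a then 1 else 0) = indicator {..a} x" by (simp add: indicator_def)
      then show ?thesis using L unfolding P by (simp only:)
    qed
    have c: "(cube :: (real^'n) set) \<in> sets borel"
    proof -
      have cube: "cube = (\<Inter>i\<in>UNIV. {x::real^'n. - pi \<le> x $ i} \<inter> {x. x $ i < pi})" by (auto simp: cube_def)
      have "{x::real^'n. - pi \<le> x $ i} \<inter> {x. x $ i < pi} \<in> sets borel" for i
        by (intro sets.Int borel_closed borel_open closed_Collect_le open_Collect_less continuous_intros)
      then show ?thesis unfolding cube by (intro sets.finite_INT) auto
    qed
    have "AE x in ?M. x \<in> cube"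
      by (subst AE_distr_iff[OF red]) (use c reduce_in_cube in auto)
    then show ?thesis by eventually_elim (rule lim)
  qed
  ultimately show "\<exists>u B. (\<forall>n::nat. u n \<in> trig \<and> (\<forall>x. cmod (u n x) \<le> B)) \<and>
      (AE x in ?M. (\<lambda>n. u n x) \<longlonglongrightarrow> indicator {..a} x)" by blast
qed (auto intro: trig.intros trig_const trig_measurable)

lemma trig_dense:
  fixes W :: "real^'n::finite \<Rightarrow> real" and \<tau> :: "'n fn"
  assumes [measurable]: "W \<in> borel_measurable borel" "\<tau> \<in> borel_measurable borel" and W0: "\<And>\<omega>. 0 \<le> W \<omega>"
    and Wfin: "(\<integral>\<^sup>+\<omega>. ennreal (W \<omega>) \<partial>lborel) < \<infinity>"
    and \<tau>: "(\<integral>\<^sup>+\<omega>. ennreal (W \<omega> * (cmod (\<tau> (reduce \<omega>)))\<^sup>2) \<partial>lborel) < \<infinity>" and e: "e > 0"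
  shows "\<exists>q\<in>trig. (\<integral>\<^sup>+\<omega>. ennreal (W \<omega> * (cmod (\<tau> (reduce \<omega>) - q \<omega>))\<^sup>2) \<partial>lborel) < ennreal e"
proof -
  let ?\<mu> = "density lborel (\<lambda>\<omega>. ennreal (W \<omega>))"
  have red: "reduce \<in> ?\<mu> \<rightarrow>\<^sub>M (borel :: (real^'n) measure)" by simp
  have I: "(\<integral>\<^sup>+x. ennreal ((cmod (g x))\<^sup>2) \<partial>distr ?\<mu> borel reduce) =
      (\<integral>\<^sup>+\<omega>. ennreal (W \<omega> * (cmod (g (reduce \<omega>)))\<^sup>2) \<partial>lborel)"
    if [measurable]: "g \<in> borel_measurable borel" for g :: "'n fn"
  proof -
    have "(\<integral>\<^sup>+x. ennreal ((cmod (g x))\<^sup>2) \<partial>distr ?\<mu> borel reduce) = (\<integral>\<^sup>+\<omega>. ennreal ((cmod (g (reduce \<omega>)))\<^sup>2) \<partial>?\<mu>)"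
      by (rule nn_integral_distr[OF red]) measurable
    also have "\<dots> = (\<integral>\<^sup>+\<omega>. ennreal (W \<omega>) * ennreal ((cmod (g (reduce \<omega>)))\<^sup>2) \<partial>lborel)"
      by (rule nn_integral_density) measurable
    finally show ?thesis by (simp add: ennreal_mult W0)
  qed
  obtain q where q: "q \<in> trig" "(\<integral>\<^sup>+x. ennreal ((cmod (\<tau> x - q x))\<^sup>2) \<partial>distr ?\<mu> borel reduce) < ennreal e"
    using L2_dense.dense_L2[OF trig_L2_dense[OF assms(1) Wfin] assms(2) _ e] \<tau> I[OF assms(2)] by auto
  have [measurable]: "q \<in> borel_measurable borel" by (rule trig_measurable[OF q(1)])
  have "(\<integral>\<^sup>+\<omega>. ennreal (W \<omega> * (cmod (\<tau> (reduce \<omega>) - q \<omega>))\<^sup>2) \<partial>lborel) < ennreal e"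
    using q(2) I[of "\<lambda>x. \<tau> x - q x"] by (simp add: trig_reduce[OF q(1)])
  with q(1) show ?thesis by blast
qed

lemma trig_multiple_in_psi_space:
  assumes "q \<in> trig" "\<phi> \<in> sobolev \<sigma>"
  shows "\<exists>g\<in>psi_space \<sigma> \<phi>. is_fourier_fun g (\<lambda>\<omega>. q \<omega> * fourier_fun \<phi> \<omega>)"
  using assms(1)
proof induction
  case (char \<alpha>)
  show ?case
    using psi_space_translate_generator[OF char] is_fourier_fun_translate[OF sobolevD(2)[OF assms(2)]] by blast
next
  case (add p q)
  then obtain g h where g: "g \<in> psi_space \<sigma> \<phi>" "is_fourier_fun g (\<lambda>\<omega>. p \<omega> * fourier_fun \<phi> \<omega>)"
    and h: "h \<in> psi_space \<sigma> \<phi>" "is_fourier_fun h (\<lambda>\<omega>. q \<omega> * fourier_fun \<phi> \<omega>)" by blast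
  show ?case
    using psi_space_add[OF g(1) h(1)] is_fourier_fun_add[OF g(2) h(2)] by (auto simp: distrib_right)
next
  case (scale p c)
  then obtain g where g: "g \<in> psi_space \<sigma> \<phi>" "is_fourier_fun g (\<lambda>\<omega>. p \<omega> * fourier_fun \<phi> \<omega>)" by blast
  show ?case
    using psi_space_scale[OF g(1), of c] is_fourier_fun_scale[OF g(2), of c] by (auto simp: mult.assoc)
qed

section \<open>Sufficiency: the explicit approximation\<close>

lemma dual_lattice_norm_ge:
  assumes "\<beta> \<in> dual_lattice - {0}"
  shows "2 * pi \<le> norm \<beta>"
proof -
  obtain b where b: "b \<in> int_lattice" "\<beta> = (2 * pi) *\<^sub>R b" "b \<noteq> 0" using assms by (auto simp: dual_lattice_def)
  obtain i where i: "b $ i \<noteq> 0" using b(3) by (auto simp: vec_eq_iff)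
  have "b $ i \<in> \<int>" using b(1) by (simp add: int_lattice_def)
  then have "1 \<le> \<bar>b $ i\<bar>" using i by (rule Ints_nonzero_abs_ge1)
  also have "\<dots> \<le> norm b" by (rule component_le_norm_cart)
  finally show ?thesis using b(2) by simp
qed

lemma countable_dual_lattice: "countable (dual_lattice :: (real^'n::finite) set)"
proof -
  have "dual_lattice \<subseteq> range (\<lambda>b::int^'n. (2 * pi) *\<^sub>R (\<chi> i. of_int (b $ i)) :: real^'n)"
  proof
    fix \<beta> :: "real^'n" assume "\<beta> \<in> dual_lattice"
    then obtain b where b: "b \<in> int_lattice" "\<beta> = (2 * pi) *\<^sub>R b" by (auto simp: dual_lattice_def)
    have "b = (\<chi> i. of_int \<lfloor>b $ i\<rfloor>)"
      using b(1) by (auto simp: int_lattice_def vec_eq_iff elim!: Ints_cases dest: spec)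
    then show "\<beta> \<in> range (\<lambda>b::int^'n. (2 * pi) *\<^sub>R (\<chi> i. of_int (b $ i)) :: real^'n)"
      unfolding b(2) by (intro image_eqI[of _ _ "\<chi> i. \<lfloor>b $ i\<rfloor>"]) auto
  qed
  then show ?thesis by (rule countable_subset) (rule countable_image[OF countableI_type])
qed

lemma nn_integral_UN_le:
  assumes A: "countable A" and B [measurable]: "\<And>b. b \<in> A \<Longrightarrow> B b \<in> sets M" and h [measurable]: "h \<in> borel_measurable M"
    and S: "\<And>F. finite F \<Longrightarrow> F \<subseteq> A \<Longrightarrow> (\<Sum>b\<in>F. \<integral>\<^sup>+x. indicator (B b) x * h x \<partial>M) \<le> (S :: ennreal)"
  shows "(\<integral>\<^sup>+x. indicator (\<Union>b\<in>A. B b) x * h x \<partial>M) \<le> S"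
proof (cases "A = {}")
  case False
  let ?e = "from_nat_into A"
  let ?U = "\<lambda>n. \<Union>b\<in>?e ` {..n}. B b"
  have eA: "?e n \<in> A" for n using False by (rule from_nat_into)
  have Um [measurable]: "?U n \<in> sets M" for n using B eA by (intro sets.finite_UN) auto
  have "indicator (\<Union>b\<in>A. B b) x * h x = (SUP n. indicator (?U n) x * h x)" for x
  proof (cases "x \<in> (\<Union>b\<in>A. B b)")
    case True
    then obtain b where b: "b \<in> A" "x \<in> B b" by blast
    obtain n where "?e n = b" using from_nat_into_surj[OF A b(1)] by blast
    then have "x \<in> ?U n" using b(2) by auto
    then have "h x \<le> (SUP n. indicator (?U n) x * h x)"
      by (intro SUP_upper2[of n]) (simp_all add: indicator_def)
    moreover have "(SUP n. indicator (?U n) x * h x) \<le> h x"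
      by (intro SUP_least) (simp add: indicator_def)
    ultimately show ?thesis using True by (simp add: order_antisym)
  next
    case False
    then have "x \<notin> ?U n" for n using eA by auto
    then show ?thesis using False by simp
  qed
  then have "(\<integral>\<^sup>+x. indicator (\<Union>b\<in>A. B b) x * h x \<partial>M) = (\<integral>\<^sup>+x. (SUP n. indicator (?U n) x * h x) \<partial>M)" by simp
  also have "\<dots> = (SUP n. \<integral>\<^sup>+x. indicator (?U n) x * h x \<partial>M)"
  proof (rule nn_integral_monotone_convergence_SUP)
    show "incseq (\<lambda>n x. indicator (?U n) x * h x)"
      by (auto simp: incseq_def le_fun_def indicator_def)
  qed measurable
  also have "\<dots> \<le> S"
  proof (rule SUP_least)
    fix n
    have "(\<integral>\<^sup>+x. indicator (?U n) x * h x \<partial>M) \<le> (\<integral>\<^sup>+x. (\<Sum>b\<in>?e ` {..n}. indicator (B b) x * h x) \<partial>M)"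
    proof (intro nn_integral_mono)
      fix x
      show "indicator (?U n) x * h x \<le> (\<Sum>b\<in>?e ` {..n}. indicator (B b) x * h x)"
      proof (cases "x \<in> ?U n")
        case True
        then obtain b where b: "b \<in> ?e ` {..n}" "x \<in> B b" by blast
        have "indicator (B b) x * h x \<le> (\<Sum>b\<in>?e ` {..n}. indicator (B b) x * h x)"
          by (rule member_le_sum[OF b(1)]) auto
        then show ?thesis using True b(2) by simp
      qed simp
    qed
    also have "\<dots> = (\<Sum>b\<in>?e ` {..n}. \<integral>\<^sup>+x. indicator (B b) x * h x \<partial>M)"
      using B eA by (intro nn_integral_sum) auto
    also have "\<dots> \<le> S" using eA by (intro S) auto
    finally show "(\<integral>\<^sup>+x. indicator (?U n) x * h x \<partial>M) \<le> S" .
  qed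
  finally show ?thesis .
qed simp

lemma approximation_order_if_small_h:
  fixes \<phi> :: "'n::finite functional"
  assumes \<phi>: "\<phi> \<in> sobolev \<sigma>" and \<sigma>k: "\<sigma> \<le> k" and C: "C \<ge> 0"
    and small: "\<And>(f :: 'n functional) h. f \<in> sobolev k \<Longrightarrow> 0 < h \<Longrightarrow> h < 1 \<Longrightarrow>
      (INF g\<in>dilate h ` psi_space \<sigma> \<phi>. sobolev_norm \<sigma> (\<lambda>u. f u - g u)) \<le> C * h powr (k - \<sigma>) * sobolev_norm k f"
  shows "provides_approx_order \<sigma> \<phi> k"
  unfolding provides_approx_order_def
proof (intro exI[of _ "max 1 C"] ballI allI impI)
  fix f :: "'n functional" and h assume f: "f \<in> sobolev k" and h: "h > (0::real)"
  let ?I = "INF g\<in>dilate h ` psi_space \<sigma> \<phi>. sobolev_norm \<sigma> (\<lambda>u. f u - g u)"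
  have n0: "0 \<le> sobolev_norm k f" by (rule sobolev_norm_nonneg)
  show "?I \<le> max 1 C * h powr (k - \<sigma>) * sobolev_norm k f"
  proof (cases "h < 1")
    case True
    have "?I \<le> C * (h powr (k - \<sigma>) * sobolev_norm k f)" using small[OF f h True] by (simp add: mult.assoc)
    also have "\<dots> \<le> max 1 C * (h powr (k - \<sigma>) * sobolev_norm k f)"
      using n0 by (intro mult_right_mono mult_nonneg_nonneg) auto
    finally show ?thesis by (simp add: mult.assoc)
  next
    case False
    \<comment> \<open>For coarse scales the zero element is good enough.\<close>
    have "dilate h (\<lambda>u. 0) = (\<lambda>u :: 'n fn. 0)" by (simp add: dilate_def fun_eq_iff)
    then have z: "(\<lambda>u :: 'n fn. 0) \<in> dilate h ` psi_space \<sigma> \<phi>"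
      by (intro image_eqI[OF _ psi_space_zero]) (rule sym)
    have "bdd_below ((\<lambda>g. sobolev_norm \<sigma> (\<lambda>u. f u - g u)) ` dilate h ` psi_space \<sigma> \<phi>)"
      by (intro bdd_belowI2[of _ 0] sobolev_norm_nonneg)
    from cINF_lower[OF this z] have "?I \<le> sobolev_norm \<sigma> (\<lambda>u. f u - 0)" .
    also have "\<dots> \<le> sobolev_norm k f"
    proof -
      have "sob2 \<sigma> (fourier_fun f) \<le> sob2 k (fourier_fun f)" by (rule sob2_mono[OF \<sigma>k])
      then have "enn2real (sob2 \<sigma> (fourier_fun f)) \<le> enn2real (sob2 k (fourier_fun f))"
        using sobolevD(3)[OF f] by (intro enn2real_mono) auto
      then show ?thesis by (simp add: sobolev_norm_eq[OF sobolevD(2)[OF f]])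
    qed
    also have "\<dots> \<le> (max 1 C * h powr (k - \<sigma>)) * sobolev_norm k f"
    proof -
      have "1 \<le> h powr (k - \<sigma>)" using False \<sigma>k by (intro ge_one_powr_ge_zero) auto
      then have "1 * 1 \<le> max 1 C * h powr (k - \<sigma>)" by (intro mult_mono) auto
      from mult_right_mono[OF this n0] show ?thesis by simp
    qed
    finally show ?thesis .
  qed
qed

text \<open>Let \<open>Fh\<close> be the spectrum of \<open>f\<close> dilated by \<open>h\<close>, and let \<open>\<tau>\<close> be periodic with \<open>\<tau> = Fh / p\<close> on the ball \<open>B\<close>
  and \<open>\<tau> = 0\<close> on the rest of the cube, where \<open>p\<close> is the spectrum of the generator.  Then \<open>\<tau> p\<close> agrees with
  \<open>Fh\<close> on \<open>B\<close>.  Outside \<open>B\<close> the error consists of the high frequencies of \<open>f\<close> and of the aliases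
  \<open>Fh(z) p(z + \<beta>) / p(z)\<close> on \<open>\<beta> + B\<close>, where the vanishing of \<open>p\<close> at \<open>\<beta>\<close> gains the factor \<open>norm z ^ k\<close>.
  The multiple \<open>\<tau> p\<close> itself is a limit of multiples of \<open>p\<close> by trigonometric polynomials, and those are
  spectra of elements of the shift-invariant space.\<close>

lemma vanishing_implies_approximation_order:
  fixes \<phi> :: "'n::finite functional" and k :: nat
  assumes \<phi>: "\<phi> \<in> sobolev \<sigma>" and \<sigma>k: "\<sigma> < real k" and \<eta>: "\<eta> > 0" and r: "0 < r" "r \<le> pi"
    and low: "AE \<omega> in lborel. \<omega> \<in> ball 0 r \<longrightarrow> \<eta> \<le> cmod (fourier_fun \<phi> \<omega>)"
    and van: "\<And>\<beta>. \<beta> \<in> dual_lattice - {0} \<Longrightarrow>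
      AE z in lborel. norm z < r \<longrightarrow> cmod (fourier_fun \<phi> (z + \<beta>)) \<le> b \<beta> * norm z ^ k"
    and S: "\<And>F. finite F \<Longrightarrow> F \<subseteq> dual_lattice - {0} \<Longrightarrow> (\<Sum>\<beta>\<in>F. norm \<beta> powr (2 * \<sigma>) * (b \<beta>)\<^sup>2) \<le> S"
  shows "provides_approx_order \<sigma> \<phi> (real k)"
proof -
  let ?d = "CARD('n)" and ?p = "fourier_fun \<phi>" and ?B = "ball (0::real^'n) r"
  have [measurable]: "?p \<in> borel_measurable borel" by (rule sobolevD(4)[OF \<phi>])
  define K where "K = max ((1 / 2) powr (2 * \<sigma>)) (2 powr (2 * \<sigma>))"
  have K0: "K \<ge> 0" by (simp add: K_def le_max_iff_disj)
  have S0: "S \<ge> 0" using S[of "{}"] by simp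
  define C1 where "C1 = r powr (- (2 * (real k - \<sigma>)))"
  define C2 where "C2 = K / \<eta>\<^sup>2 * S"
  define Ct where "Ct = 2 * C1 + 2 * C2"
  have C12: "C1 \<ge> 0" "C2 \<ge> 0" using K0 S0 by (auto simp: C1_def C2_def)
  have Ct0: "Ct \<ge> 0" using C12 by (simp add: Ct_def)
  have Bcube: "?B \<subseteq> cube"
  proof
    fix z assume "z \<in> ?B"
    then have "\<bar>z $ i\<bar> < pi" for i using component_le_norm_cart[of z i] r by simp
    then show "z \<in> cube" by (auto simp: cube_def abs_less_iff intro!: less_imp_le) (metis minus_less_iff)
  qed
  show ?thesis
  proof (rule approximation_order_if_small_h[OF \<phi>, where C = "sqrt (2 * Ct)"])
    fix f :: "'n functional" and h :: real
    assume f: "f \<in> sobolev (real k)" and h: "0 < h" "h < 1"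
    let ?F = "fourier_fun f" and ?hd = "h ^ ?d"
    have [measurable]: "?F \<in> borel_measurable borel" by (rule sobolevD(4)[OF f])
    have hd: "?hd > 0" using h by simp
    define x where "x = h powr (2 * (real k - \<sigma>))"
    have x0: "x \<ge> 0" by (simp add: x_def)
    define Y where "Y = enn2real (sob2 (real k) ?F)"
    have Y: "Y \<ge> 0" "sob2 (real k) ?F = ennreal Y"
      using sobolevD(3)[OF f] by (auto simp: Y_def less_top)
    define Fh where "Fh = (\<lambda>\<xi>. ?F ((1 / h) *\<^sub>R \<xi>))"
    have [measurable]: "Fh \<in> borel_measurable borel" unfolding Fh_def by measurable
    have Fk: "scaled2 (real k) h Fh = ennreal (?hd * Y)"
      using sob2_dilate[of Fh h "real k"] h Y by (simp add: Fh_def ennreal_mult)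
    define \<tau>0 where "\<tau>0 = (\<lambda>\<xi>. indicator ?B \<xi> * (Fh \<xi> / ?p \<xi>))"
    define \<tau> where "\<tau> = (\<lambda>\<xi>. \<tau>0 (reduce \<xi>))"
    have [measurable]: "?B \<in> sets borel" by simp
    have [measurable]: "\<tau>0 \<in> borel_measurable borel" unfolding \<tau>0_def by measurable
    have [measurable]: "\<tau> \<in> borel_measurable borel" unfolding \<tau>_def by measurable
    let ?w = "\<lambda>\<sigma> \<xi>. (1 + norm \<xi> / h) powr (2 * \<sigma>)"
    have w0: "0 \<le> ?w \<sigma> \<xi>" for \<sigma> and \<xi> :: "real^'n" by simp
    let ?U = "\<Union>\<beta>\<in>dual_lattice - {0}. {\<xi>::real^'n. \<xi> - \<beta> \<in> ?B}"
    have Sm: "{\<xi>. \<xi> - \<beta> \<in> ?B} \<in> sets borel" for \<beta> by measurable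
    have Um [measurable]: "?U \<in> sets borel"
    proof (rule sets.countable_UN'')
      show "countable (dual_lattice - {0} :: (real^'n) set)" using countable_dual_lattice by simp
      show "{\<xi>. \<xi> - \<beta> \<in> ?B} \<in> sets borel" for \<beta> by (rule Sm)
    qed
    define H where "H = (\<lambda>\<xi>. ?w \<sigma> \<xi> * (cmod (\<tau> \<xi> * ?p \<xi>))\<^sup>2)"
    have [measurable]: "H \<in> borel_measurable borel" unfolding H_def by measurable
    have Hm: "(\<lambda>\<xi>. ennreal (H \<xi>)) \<in> borel_measurable borel" by measurable
    \<comment> \<open>The part of the error on the translates of the ball, where the multiple of the generator
      creates aliases of the low frequencies.\<close>
    have aliases: "(\<integral>\<^sup>+\<xi>. indicator ?U \<xi> * ennreal (H \<xi>) \<partial>lborel) \<le> ennreal (C2 * x * (?hd * Y))"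
    proof (rule nn_integral_UN_le)
      show "countable (dual_lattice - {0} :: (real^'n) set)" using countable_dual_lattice by simp
      fix F :: "(real^'n) set" assume F: "finite F" "F \<subseteq> dual_lattice - {0}"
      have one: "(\<integral>\<^sup>+\<xi>. indicator {\<xi>. \<xi> - \<beta> \<in> ?B} \<xi> * ennreal (H \<xi>) \<partial>lborel) \<le>
          ennreal (K / \<eta>\<^sup>2 * (norm \<beta> powr (2 * \<sigma>) * (b \<beta>)\<^sup>2) * x * (?hd * Y))" if \<beta>: "\<beta> \<in> dual_lattice - {0}" for \<beta>
      proof -
        let ?c = "K / \<eta>\<^sup>2 * (norm \<beta> powr (2 * \<sigma>) * (b \<beta>)\<^sup>2) * x"
        have c0: "?c \<ge> 0" using K0 x0 by simp
        have nb: "2 * pi \<le> norm \<beta>" by (rule dual_lattice_norm_ge[OF \<beta>])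
        have "(\<integral>\<^sup>+\<xi>. indicator {\<xi>. \<xi> - \<beta> \<in> ?B} \<xi> * ennreal (H \<xi>) \<partial>lborel) =
            ennreal (\<bar>1\<bar> ^ ?d) * (\<integral>\<^sup>+z. indicator {\<xi>. \<xi> - \<beta> \<in> ?B} (\<beta> + 1 *\<^sub>R z) * ennreal (H (\<beta> + 1 *\<^sub>R z)) \<partial>lborel)"
          by (rule nn_integral_affine[OF borel_measurable_times_ennreal[OF borel_measurable_indicator[OF Sm] Hm] one_neq_zero])
        also have "\<dots> = (\<integral>\<^sup>+z. indicator ?B z * ennreal (H (z + \<beta>)) \<partial>lborel)"
          by (simp add: add.commute indicator_def)
        also have "\<dots> \<le> (\<integral>\<^sup>+z. ennreal ?c * ennreal (?w (real k) z * (cmod (Fh z))\<^sup>2) \<partial>lborel)"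
        proof (rule nn_integral_mono_AE)
          show "AE z in lborel. indicator ?B z * ennreal (H (z + \<beta>)) \<le> ennreal ?c * ennreal (?w (real k) z * (cmod (Fh z))\<^sup>2)"
            using low van[OF \<beta>]
          proof eventually_elim
            case (elim z)
            show ?case
            proof (cases "z \<in> ?B")
              case True
              then have nz: "norm z < r" by simp
              have p1: "\<eta> \<le> cmod (?p z)" using elim True by blast
              have p2: "cmod (?p (z + \<beta>)) \<le> b \<beta> * norm z ^ k" using elim nz by blast
              have "reduce (z + \<beta>) = z" using Bcube True \<beta> by (intro reduce_shift) auto
              then have t: "\<tau> (z + \<beta>) = Fh z / ?p z" using True by (simp add: \<tau>_def \<tau>0_def)
              have "(cmod (\<tau> (z + \<beta>) * ?p (z + \<beta>)))\<^sup>2 = (cmod (Fh z))\<^sup>2 * (cmod (?p (z + \<beta>)))\<^sup>2 / (cmod (?p z))\<^sup>2"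
                by (simp add: t norm_mult norm_divide power_mult_distrib power_divide)
              also have "\<dots> \<le> (cmod (Fh z))\<^sup>2 * (b \<beta> * norm z ^ k)\<^sup>2 / \<eta>\<^sup>2"
                using p1 p2 \<eta> by (intro frac_le mult_left_mono power_mono mult_nonneg_nonneg) auto
              finally have A: "(cmod (\<tau> (z + \<beta>) * ?p (z + \<beta>)))\<^sup>2 \<le> (cmod (Fh z))\<^sup>2 * (b \<beta> * norm z ^ k)\<^sup>2 / \<eta>\<^sup>2" .
              have t1: "norm (z + \<beta>) \<le> norm z + norm \<beta>" "norm \<beta> \<le> norm (z + \<beta>) + norm z"
                using norm_triangle_ineq[of z \<beta>] norm_triangle_ineq4[of "z + \<beta>" z] by auto
              have "(h + norm (z + \<beta>)) powr (2 * \<sigma>) \<le>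
                  max ((1 / 2 * norm \<beta>) powr (2 * \<sigma>)) ((2 * norm \<beta>) powr (2 * \<sigma>))"
                by (rule powr_between) (use t1 nb nz r h pi_gt3 in auto)
              also have "\<dots> = K * norm \<beta> powr (2 * \<sigma>)"
                unfolding K_def by (simp only: powr_mult max_mult_distrib_right) simp
              finally have "(h + norm (z + \<beta>)) powr (2 * \<sigma>) / h powr (2 * \<sigma>) \<le> K * norm \<beta> powr (2 * \<sigma>) / h powr (2 * \<sigma>)"
                by (rule divide_right_mono) simp
              moreover have "?w \<sigma> (z + \<beta>) = (h + norm (z + \<beta>)) powr (2 * \<sigma>) / h powr (2 * \<sigma>)"
              proof -
                have "1 + norm (z + \<beta>) / h = (h + norm (z + \<beta>)) / h" using h by (simp add: field_simps)
                then show ?thesis using h by (simp add: powr_divide)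
              qed
              ultimately have Bw: "?w \<sigma> (z + \<beta>) \<le> K * norm \<beta> powr (2 * \<sigma>) / h powr (2 * \<sigma>)" by simp
              have "norm z ^ (2 * k) \<le> h ^ (2 * k) * (1 + norm z / h) ^ (2 * k)"
              proof -
                have "norm z \<le> h * (1 + norm z / h)" using h by (simp add: distrib_left)
                then have "norm z ^ (2 * k) \<le> (h * (1 + norm z / h)) ^ (2 * k)" by (intro power_mono) auto
                then show ?thesis by (simp only: power_mult_distrib)
              qed
              moreover have "(1 + norm z / h) ^ (2 * k) = ?w (real k) z"
              proof -
                have "0 < 1 + norm z / h" using h by (simp add: add_pos_nonneg)
                from powr_realpow[OF this, of "2 * k"] show ?thesis by simp
              qed
              ultimately have Zk: "(norm z ^ k)\<^sup>2 \<le> h ^ (2 * k) * ?w (real k) z"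
                by (simp add: power_mult[symmetric] mult.commute)
              have "H (z + \<beta>) \<le> (K * norm \<beta> powr (2 * \<sigma>) / h powr (2 * \<sigma>)) * ((cmod (Fh z))\<^sup>2 * (b \<beta> * norm z ^ k)\<^sup>2 / \<eta>\<^sup>2)"
                unfolding H_def using K0 by (intro mult_mono Bw A) auto
              also have "\<dots> = (K / \<eta>\<^sup>2 * (norm \<beta> powr (2 * \<sigma>) * (b \<beta>)\<^sup>2) / h powr (2 * \<sigma>) * (cmod (Fh z))\<^sup>2) * (norm z ^ k)\<^sup>2"
                by (simp add: power_mult_distrib mult_ac)
              also have "\<dots> \<le> (K / \<eta>\<^sup>2 * (norm \<beta> powr (2 * \<sigma>) * (b \<beta>)\<^sup>2) / h powr (2 * \<sigma>) * (cmod (Fh z))\<^sup>2) * (h ^ (2 * k) * ?w (real k) z)"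
                using K0 by (intro mult_left_mono Zk) auto
              also have "\<dots> = (K / \<eta>\<^sup>2 * (norm \<beta> powr (2 * \<sigma>) * (b \<beta>)\<^sup>2) * (h ^ (2 * k) / h powr (2 * \<sigma>))) * (?w (real k) z * (cmod (Fh z))\<^sup>2)"
                by simp
              also have "h ^ (2 * k) / h powr (2 * \<sigma>) = x"
              proof -
                have "h ^ (2 * k) = h powr (2 * real k)" using powr_realpow[OF h(1), of "2 * k"] by simp
                then show ?thesis by (simp add: x_def powr_diff right_diff_distrib)
              qed
              finally have "H (z + \<beta>) \<le> ?c * (?w (real k) z * (cmod (Fh z))\<^sup>2)" .
              then have "ennreal (H (z + \<beta>)) \<le> ennreal (?c * (?w (real k) z * (cmod (Fh z))\<^sup>2))" by (rule ennreal_leI)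
              also have "\<dots> = ennreal ?c * ennreal (?w (real k) z * (cmod (Fh z))\<^sup>2)"
                using c0 by (intro ennreal_mult) auto
              finally show ?thesis using True by simp
            qed simp
          qed
        qed
        also have "\<dots> = ennreal ?c * scaled2 (real k) h Fh"
          unfolding scaled2_def by (rule nn_integral_cmult) measurable
        also have "\<dots> = ennreal (?c * (?hd * Y))"
          unfolding Fk using c0 hd Y by (simp only: ennreal_mult[symmetric] mult_nonneg_nonneg less_imp_le)
        finally show ?thesis .
      qed
      have "(\<Sum>\<beta>\<in>F. \<integral>\<^sup>+\<xi>. indicator {\<xi>. \<xi> - \<beta> \<in> ?B} \<xi> * ennreal (H \<xi>) \<partial>lborel) \<le>
          (\<Sum>\<beta>\<in>F. ennreal (K / \<eta>\<^sup>2 * (norm \<beta> powr (2 * \<sigma>) * (b \<beta>)\<^sup>2) * x * (?hd * Y)))"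
        using F(2) by (intro sum_mono one) auto
      also have "\<dots> = ennreal (\<Sum>\<beta>\<in>F. K / \<eta>\<^sup>2 * (norm \<beta> powr (2 * \<sigma>) * (b \<beta>)\<^sup>2) * x * (?hd * Y))"
        using K0 x0 hd Y by (intro sum_ennreal) auto
      also have "\<dots> \<le> ennreal (C2 * x * (?hd * Y))"
      proof (rule ennreal_leI)
        have "(\<Sum>\<beta>\<in>F. K / \<eta>\<^sup>2 * (norm \<beta> powr (2 * \<sigma>) * (b \<beta>)\<^sup>2) * x * (?hd * Y)) =
            (K / \<eta>\<^sup>2 * x * (?hd * Y)) * (\<Sum>\<beta>\<in>F. norm \<beta> powr (2 * \<sigma>) * (b \<beta>)\<^sup>2)"
          by (simp add: sum_distrib_left mult_ac)
        also have "\<dots> \<le> (K / \<eta>\<^sup>2 * x * (?hd * Y)) * S"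
          using K0 x0 hd Y by (intro mult_left_mono S F) auto
        also have "\<dots> = C2 * x * (?hd * Y)" by (simp add: C2_def)
        finally show "(\<Sum>\<beta>\<in>F. K / \<eta>\<^sup>2 * (norm \<beta> powr (2 * \<sigma>) * (b \<beta>)\<^sup>2) * x * (?hd * Y)) \<le> C2 * x * (?hd * Y)" .
      qed
      finally show "(\<Sum>\<beta>\<in>F. \<integral>\<^sup>+\<xi>. indicator {\<xi>. \<xi> - \<beta> \<in> ?B} \<xi> * ennreal (H \<xi>) \<partial>lborel) \<le> ennreal (C2 * x * (?hd * Y))" .
    qed measurable
    \<comment> \<open>The high frequencies of \<open>f\<close>, where the weights of the two orders differ by a power of \<open>h\<close>.\<close>
    have high: "(\<integral>\<^sup>+\<xi>. indicator (- ?B) \<xi> * ennreal (?w \<sigma> \<xi> * (cmod (Fh \<xi>))\<^sup>2) \<partial>lborel) \<le> ennreal (C1 * x * (?hd * Y))"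
    proof -
      have "(\<integral>\<^sup>+\<xi>. indicator (- ?B) \<xi> * ennreal (?w \<sigma> \<xi> * (cmod (Fh \<xi>))\<^sup>2) \<partial>lborel) \<le>
          (\<integral>\<^sup>+\<xi>. ennreal (C1 * x) * ennreal (?w (real k) \<xi> * (cmod (Fh \<xi>))\<^sup>2) \<partial>lborel)"
      proof (rule nn_integral_mono)
        fix \<xi> :: "real^'n"
        show "indicator (- ?B) \<xi> * ennreal (?w \<sigma> \<xi> * (cmod (Fh \<xi>))\<^sup>2) \<le> ennreal (C1 * x) * ennreal (?w (real k) \<xi> * (cmod (Fh \<xi>))\<^sup>2)"
        proof (cases "\<xi> \<in> ?B")
          case False
          then have n: "r \<le> norm \<xi>" by simp
          let ?a = "1 + norm \<xi> / h"
          have a0: "?a > 0" using h by (simp add: add_pos_nonneg)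
          have "r / h \<le> ?a" using n h divide_right_mono[OF n, of h] by simp
          then have "?a powr (- (2 * (real k - \<sigma>))) \<le> (r / h) powr (- (2 * (real k - \<sigma>)))"
            using r h \<sigma>k by (intro powr_mono2') auto
          also have "\<dots> = C1 * x"
            unfolding powr_divide powr_minus[of h] C1_def x_def
            by (simp only: divide_inverse inverse_inverse_eq)
          finally have "?a powr (- (2 * (real k - \<sigma>))) * ?w (real k) \<xi> \<le> C1 * x * ?w (real k) \<xi>"
            by (rule mult_right_mono) simp
          moreover have "?a powr (- (2 * (real k - \<sigma>))) * ?w (real k) \<xi> = ?w \<sigma> \<xi>"
            using a0 by (simp add: powr_add[symmetric] algebra_simps)
          ultimately have "?w \<sigma> \<xi> * (cmod (Fh \<xi>))\<^sup>2 \<le> C1 * x * ?w (real k) \<xi> * (cmod (Fh \<xi>))\<^sup>2"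
            by (simp only: mult_right_mono zero_le_power2)
          then have "ennreal (?w \<sigma> \<xi> * (cmod (Fh \<xi>))\<^sup>2) \<le> ennreal ((C1 * x) * (?w (real k) \<xi> * (cmod (Fh \<xi>))\<^sup>2))"
            by (intro ennreal_leI) (simp only: mult.assoc)
          also have "\<dots> = ennreal (C1 * x) * ennreal (?w (real k) \<xi> * (cmod (Fh \<xi>))\<^sup>2)"
            using C12 x0 by (intro ennreal_mult) auto
          finally show ?thesis using False by simp
        qed simp
      qed
      also have "\<dots> = ennreal (C1 * x) * scaled2 (real k) h Fh"
        unfolding scaled2_def by (rule nn_integral_cmult) measurable
      also have "\<dots> = ennreal (C1 * x * (?hd * Y))"
        unfolding Fk using C12 x0 hd Y by (simp only: ennreal_mult[symmetric] mult_nonneg_nonneg less_imp_le)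
      finally show ?thesis .
    qed
    let ?Z = "Ct * x * (?hd * Y)"
    have Z0: "?Z \<ge> 0" using Ct0 x0 hd Y by simp
    have Dle: "scaled2 \<sigma> h (\<lambda>\<xi>. Fh \<xi> - \<tau> \<xi> * ?p \<xi>) \<le> ennreal ?Z"
    proof -
      have "scaled2 \<sigma> h (\<lambda>\<xi>. Fh \<xi> - \<tau> \<xi> * ?p \<xi>) \<le>
          (\<integral>\<^sup>+\<xi>. 2 * (indicator (- ?B) \<xi> * ennreal (?w \<sigma> \<xi> * (cmod (Fh \<xi>))\<^sup>2)) + 2 * (indicator ?U \<xi> * ennreal (H \<xi>)) \<partial>lborel)"
        unfolding scaled2_def
      proof (rule nn_integral_mono_AE)
        show "AE \<xi> in lborel. ennreal (?w \<sigma> \<xi> * (cmod (Fh \<xi> - \<tau> \<xi> * ?p \<xi>))\<^sup>2) \<le>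
            2 * (indicator (- ?B) \<xi> * ennreal (?w \<sigma> \<xi> * (cmod (Fh \<xi>))\<^sup>2)) + 2 * (indicator ?U \<xi> * ennreal (H \<xi>))"
          using low
        proof eventually_elim
          case (elim \<xi>)
          show ?case
          proof (cases "\<xi> \<in> ?B")
            case True
            have "\<xi> \<in> cube" using True Bcube by blast
            then have "reduce \<xi> = \<xi>" using reduce_shift[OF _ zero_dual_lattice, of \<xi>] by simp
            moreover have "?p \<xi> \<noteq> 0" using elim True \<eta> by auto
            ultimately have "\<tau> \<xi> * ?p \<xi> = Fh \<xi>" using True by (simp add: \<tau>_def \<tau>0_def)
            then show ?thesis by simp
          next
            case False
            have tU: "\<tau> \<xi> = 0" if "\<xi> \<notin> ?U"
            proof (rule ccontr)
              assume "\<tau> \<xi> \<noteq> 0"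
              then have red: "reduce \<xi> \<in> ?B" by (auto simp: \<tau>_def \<tau>0_def indicator_def split: if_splits)
              then have "\<xi> - reduce \<xi> \<in> dual_lattice - {0}" using reduce_diff[of \<xi>] False by auto
              then have "\<xi> \<in> ?U" using red by (intro UN_I[of "\<xi> - reduce \<xi>"]) auto
              then show False using that by blast
            qed
            have sq: "?w \<sigma> \<xi> * (cmod (Fh \<xi> - \<tau> \<xi> * ?p \<xi>))\<^sup>2 \<le> 2 * (?w \<sigma> \<xi> * (cmod (Fh \<xi>))\<^sup>2) + 2 * H \<xi>"
            proof -
              have "(cmod (Fh \<xi> - \<tau> \<xi> * ?p \<xi>))\<^sup>2 \<le> (cmod (Fh \<xi>) + cmod (\<tau> \<xi> * ?p \<xi>))\<^sup>2"
                by (intro power_mono norm_triangle_ineq4) simp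
              also have "\<dots> \<le> 2 * (cmod (Fh \<xi>))\<^sup>2 + 2 * (cmod (\<tau> \<xi> * ?p \<xi>))\<^sup>2"
                using sum_squares_bound[of "cmod (Fh \<xi>)" "cmod (\<tau> \<xi> * ?p \<xi>)"] unfolding power2_sum by linarith
              finally have "?w \<sigma> \<xi> * (cmod (Fh \<xi> - \<tau> \<xi> * ?p \<xi>))\<^sup>2 \<le> ?w \<sigma> \<xi> * (2 * (cmod (Fh \<xi>))\<^sup>2 + 2 * (cmod (\<tau> \<xi> * ?p \<xi>))\<^sup>2)"
                by (rule mult_left_mono) simp
              then show ?thesis unfolding H_def by (simp only: distrib_left mult.left_commute)
            qed
            show ?thesis
            proof (cases "\<xi> \<in> ?U")
              case True
              have "ennreal (?w \<sigma> \<xi> * (cmod (Fh \<xi> - \<tau> \<xi> * ?p \<xi>))\<^sup>2) \<le> ennreal (2 * (?w \<sigma> \<xi> * (cmod (Fh \<xi>))\<^sup>2) + 2 * H \<xi>)"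
                by (rule ennreal_leI[OF sq])
              also have "\<dots> = 2 * ennreal (?w \<sigma> \<xi> * (cmod (Fh \<xi>))\<^sup>2) + 2 * ennreal (H \<xi>)"
                by (simp add: H_def ennreal_mult)
              finally show ?thesis using True False by (simp only: indicator_simps Compl_iff) simp
            next
              case F2: False
              have "?w \<sigma> \<xi> * (cmod (Fh \<xi>))\<^sup>2 \<le> 2 * (?w \<sigma> \<xi> * (cmod (Fh \<xi>))\<^sup>2)" by simp
              then have "ennreal (?w \<sigma> \<xi> * (cmod (Fh \<xi>))\<^sup>2) \<le> ennreal (2 * (?w \<sigma> \<xi> * (cmod (Fh \<xi>))\<^sup>2))" by (rule ennreal_leI)
              also have "\<dots> = 2 * ennreal (?w \<sigma> \<xi> * (cmod (Fh \<xi>))\<^sup>2)" by (simp add: ennreal_mult)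
              finally show ?thesis using False tU[OF F2] F2 by (simp only: indicator_simps Compl_iff) simp
            qed
          qed
        qed
      qed
      also have "\<dots> = 2 * (\<integral>\<^sup>+\<xi>. indicator (- ?B) \<xi> * ennreal (?w \<sigma> \<xi> * (cmod (Fh \<xi>))\<^sup>2) \<partial>lborel) +
          2 * (\<integral>\<^sup>+\<xi>. indicator ?U \<xi> * ennreal (H \<xi>) \<partial>lborel)"
      proof -
        have 1: "(\<lambda>\<xi>. indicator (- ?B) \<xi> * ennreal (?w \<sigma> \<xi> * (cmod (Fh \<xi>))\<^sup>2)) \<in> borel_measurable lborel"
          by measurable
        have lb: "a \<in> borel_measurable lborel" if "a \<in> borel_measurable borel" for a :: "real^'n \<Rightarrow> ennreal"
          using that by simp
        have 2: "(\<lambda>\<xi>. indicator ?U \<xi> * ennreal (H \<xi>)) \<in> borel_measurable lborel"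
          by (rule lb[OF borel_measurable_times_ennreal[OF borel_measurable_indicator[OF Um] Hm]])
        have c: "(\<lambda>\<xi>. 2 * a \<xi>) \<in> borel_measurable lborel" if "a \<in> borel_measurable lborel" for a :: "real^'n \<Rightarrow> ennreal"
          using that by simp
        show ?thesis by (simp only: nn_integral_add[OF c[OF 1] c[OF 2]] nn_integral_cmult[OF 1] nn_integral_cmult[OF 2])
      qed
      also have "\<dots> \<le> 2 * ennreal (C1 * x * (?hd * Y)) + 2 * ennreal (C2 * x * (?hd * Y))"
        by (intro add_mono mult_left_mono high aliases) auto
      also have "\<dots> = ennreal (2 * (C1 * x * (?hd * Y)) + 2 * (C2 * x * (?hd * Y)))"
        using C12 x0 hd Y by (simp add: ennreal_mult)
      also have "2 * (C1 * x * (?hd * Y)) + 2 * (C2 * x * (?hd * Y)) = ?Z" by (simp add: Ct_def algebra_simps)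
      finally show ?thesis .
    qed
    have add_le: "scaled2 \<sigma> h (\<lambda>\<xi>. A \<xi> + A' \<xi>) \<le> 2 * scaled2 \<sigma> h A + 2 * scaled2 \<sigma> h A'"
      if [measurable]: "A \<in> borel_measurable borel" "A' \<in> borel_measurable borel" for A A' :: "'n fn"
    proof -
      have "scaled2 \<sigma> h (\<lambda>\<xi>. A \<xi> + A' \<xi>) = ennreal ?hd * sob2 \<sigma> (\<lambda>\<omega>. A (h *\<^sub>R \<omega>) + A' (h *\<^sub>R \<omega>))"
        by (rule sob2_dilate) (use h in auto)
      also have "\<dots> \<le> ennreal ?hd * (2 * sob2 \<sigma> (\<lambda>\<omega>. A (h *\<^sub>R \<omega>)) + 2 * sob2 \<sigma> (\<lambda>\<omega>. A' (h *\<^sub>R \<omega>)))"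
        by (intro mult_left_mono sob2_add_le) auto
      also have "\<dots> = 2 * scaled2 \<sigma> h A + 2 * scaled2 \<sigma> h A'"
        using h by (simp add: sob2_dilate distrib_left mult.left_commute)
      finally show ?thesis .
    qed
    have neg: "scaled2 \<sigma> h (\<lambda>\<xi>. - A \<xi>) = scaled2 \<sigma> h A" for A :: "'n fn" by (simp add: scaled2_def)
    define W where "W = (\<lambda>\<xi>. ?w \<sigma> \<xi> * (cmod (?p \<xi>))\<^sup>2)"
    have Weq: "W \<xi> * (cmod a)\<^sup>2 = ?w \<sigma> \<xi> * (cmod (a * ?p \<xi>))\<^sup>2" for a \<xi>
      by (simp add: W_def norm_mult power_mult_distrib)
    have Wfin: "(\<integral>\<^sup>+\<xi>. ennreal (W \<xi>) \<partial>lborel) < \<infinity>"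
      using scaled2_finite[of ?p h \<sigma>] sobolevD(3)[OF \<phi>] h by (simp add: scaled2_def W_def)
    have tfin: "(\<integral>\<^sup>+\<xi>. ennreal (W \<xi> * (cmod (\<tau>0 (reduce \<xi>)))\<^sup>2) \<partial>lborel) < \<infinity>"
    proof -
      have "scaled2 \<sigma> h (\<lambda>\<xi>. \<tau> \<xi> * ?p \<xi>) = scaled2 \<sigma> h (\<lambda>\<xi>. Fh \<xi> + - (Fh \<xi> - \<tau> \<xi> * ?p \<xi>))" by simp
      also have "\<dots> \<le> 2 * scaled2 \<sigma> h Fh + 2 * scaled2 \<sigma> h (\<lambda>\<xi>. - (Fh \<xi> - \<tau> \<xi> * ?p \<xi>))" by (rule add_le) measurable
      also have "\<dots> < \<infinity>"
      proof -
        have "sob2 \<sigma> ?F < \<infinity>" using sobolevD(3)[OF sobolev_mono[OF less_imp_le[OF \<sigma>k] f]] .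
        then have "scaled2 \<sigma> h Fh < \<infinity>"
          using sob2_dilate[of Fh h \<sigma>] h by (simp add: Fh_def ennreal_mult_less_top)
        moreover have "scaled2 \<sigma> h (\<lambda>\<xi>. - (Fh \<xi> - \<tau> \<xi> * ?p \<xi>)) < \<infinity>"
          unfolding neg by (rule le_less_trans[OF Dle]) simp
        ultimately show ?thesis by (simp add: ennreal_mult_less_top)
      qed
      finally show ?thesis unfolding scaled2_def \<tau>_def by (simp only: Weq)
    qed
    let ?I = "INF g\<in>dilate h ` psi_space \<sigma> \<phi>. sobolev_norm \<sigma> (\<lambda>u. f u - g u)"
    have I0: "0 \<le> ?I" using psi_space_zero by (intro cINF_greatest) (auto intro: sobolev_norm_nonneg)
    have "?I\<^sup>2 \<le> 2 * Ct * x * Y + e" if e: "e > 0" for e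
    proof -
      have e2: "?hd * e / 2 > 0" using hd e by simp
      have "(\<lambda>\<xi>. W \<xi>) \<in> borel_measurable borel" unfolding W_def by measurable
      from trig_dense[OF this _ _ Wfin tfin e2]
      obtain q where q: "q \<in> trig" "(\<integral>\<^sup>+\<xi>. ennreal (W \<xi> * (cmod (\<tau>0 (reduce \<xi>) - q \<xi>))\<^sup>2) \<partial>lborel) < ennreal (?hd * e / 2)"
        by (auto simp: W_def)
      have [measurable]: "q \<in> borel_measurable borel" by (rule trig_measurable[OF q(1)])
      obtain g where g: "g \<in> psi_space \<sigma> \<phi>" "is_fourier_fun g (\<lambda>\<xi>. of_real (inverse ?hd) * (q \<xi> * ?p \<xi>))"
      proof -
        from trig_multiple_in_psi_space[OF trig.scale[OF q(1), of "of_real (inverse ?hd)"] \<phi>]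
        show ?thesis using that by (auto simp: mult.assoc)
      qed
      have gt: "g \<in> tempered" using psi_space_subset_sobolev[OF \<phi>] g(1) sobolevD(1) by blast
      let ?err = "\<lambda>\<omega>. ?F \<omega> - of_real ?hd * (of_real (inverse ?hd) * (q (h *\<^sub>R \<omega>) * ?p (h *\<^sub>R \<omega>)))"
      have "ennreal ?hd * sob2 \<sigma> ?err = scaled2 \<sigma> h (\<lambda>\<xi>. Fh \<xi> - q \<xi> * ?p \<xi>)"
      proof -
        have "?err \<omega> = Fh (h *\<^sub>R \<omega>) - q (h *\<^sub>R \<omega>) * ?p (h *\<^sub>R \<omega>)" for \<omega>
        proof -
          have inv: "?hd * inverse ?hd = 1" by (rule right_inverse[OF less_imp_neq[OF hd, symmetric]])
          have "complex_of_real ?hd * (of_real (inverse ?hd) * X) = X" for X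
            by (simp only: mult.assoc[symmetric] of_real_mult[symmetric] inv of_real_1 mult_1_left)
          then show ?thesis using h by (simp add: Fh_def del: of_real_power of_real_inverse)
        qed
        then show ?thesis using sob2_dilate[of "\<lambda>\<xi>. Fh \<xi> - q \<xi> * ?p \<xi>" h \<sigma>] h by simp
      qed
      also have "(\<lambda>\<xi>. Fh \<xi> - q \<xi> * ?p \<xi>) = (\<lambda>\<xi>. (Fh \<xi> - \<tau> \<xi> * ?p \<xi>) + (\<tau> \<xi> - q \<xi>) * ?p \<xi>)"
        by (auto simp: algebra_simps)
      also have "scaled2 \<sigma> h \<dots> \<le> 2 * scaled2 \<sigma> h (\<lambda>\<xi>. Fh \<xi> - \<tau> \<xi> * ?p \<xi>) + 2 * scaled2 \<sigma> h (\<lambda>\<xi>. (\<tau> \<xi> - q \<xi>) * ?p \<xi>)"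
        by (rule add_le) measurable
      also have "\<dots> \<le> 2 * ennreal ?Z + 2 * ennreal (?hd * e / 2)"
      proof (intro add_mono mult_left_mono Dle)
        show "scaled2 \<sigma> h (\<lambda>\<xi>. (\<tau> \<xi> - q \<xi>) * ?p \<xi>) \<le> ennreal (?hd * e / 2)"
          using less_imp_le[OF q(2)] unfolding scaled2_def \<tau>_def
          by (simp only: Weq)
      qed auto
      also have "\<dots> = ennreal (?hd * (2 * Ct * x * Y + e))"
      proof -
        have two: "2 * ennreal a = ennreal (2 * a)" if "a \<ge> 0" for a
          using that by (simp add: ennreal_mult)
        have "2 * ennreal ?Z + 2 * ennreal (?hd * e / 2) = ennreal (2 * ?Z + 2 * (?hd * e / 2))"
          using Z0 e2 by (simp only: two ennreal_plus[symmetric] less_imp_le mult_nonneg_nonneg zero_le_numeral)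
        then show ?thesis by (simp add: algebra_simps)
      qed
      finally have le: "ennreal ?hd * sob2 \<sigma> ?err \<le> ennreal (?hd * (2 * Ct * x * Y + e))" .
      have R0: "0 \<le> 2 * Ct * x * Y + e" using Ct0 x0 Y e by simp
      have "sob2 \<sigma> ?err < \<infinity>" by (rule finite_if_mult_finite[OF hd le_less_trans[OF le]]) simp
      then obtain y where y: "y \<ge> 0" "sob2 \<sigma> ?err = ennreal y" by (cases "sob2 \<sigma> ?err") auto
      have "?hd * y \<le> ?hd * (2 * Ct * x * Y + e)"
        using le y R0 hd by (simp add: ennreal_mult[symmetric])
      then have yle: "y \<le> 2 * Ct * x * Y + e" using hd by simp
      have "?I \<le> sobolev_norm \<sigma> (\<lambda>u. f u - dilate h g u)"
        using g(1) by (intro cINF_lower bdd_belowI2[of _ 0] sobolev_norm_nonneg) auto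
      also have "\<dots> = sqrt y"
        unfolding sobolev_norm_diff_dilate[OF sobolevD(2)[OF f] g(2) gt h(1)] y(2) using y(1) by simp
      finally have "?I\<^sup>2 \<le> (sqrt y)\<^sup>2" using I0 by (intro power_mono) auto
      then show ?thesis using yle y(1) by simp
    qed
    then have "?I\<^sup>2 \<le> 2 * Ct * x * Y" by (rule field_le_epsilon)
    then have "sqrt (?I\<^sup>2) \<le> sqrt (2 * Ct * x * Y)" by (rule real_sqrt_le_mono)
    moreover have "sqrt x = h powr (real k - \<sigma>)"
    proof -
      have "x = (h powr (real k - \<sigma>))\<^sup>2"
        unfolding x_def by (simp add: power2_eq_square powr_add[symmetric])
      then show ?thesis by simp
    qed
    moreover have "sobolev_norm (real k) f = sqrt Y"
      unfolding Y_def by (rule sobolev_norm_eq[OF sobolevD(2)[OF f]])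
    ultimately show "?I \<le> sqrt (2 * Ct) * h powr (real k - \<sigma>) * sobolev_norm (real k) f"
      using I0 by (simp add: real_sqrt_mult)
  qed (use \<sigma>k Ct0 in auto)
qed

section \<open>The equivalence\<close>

lemma mi_fact_le: "mi_order \<gamma> \<le> k \<Longrightarrow> mi_fact (\<gamma> :: 'n::finite multi_index) \<le> fact k ^ CARD('n)"
proof -
  assume "mi_order \<gamma> \<le> k"
  then have "\<gamma> i \<le> k" for i using member_le_sum[of i UNIV \<gamma>] by (simp add: mi_order_def)
  then have "mi_fact \<gamma> \<le> (\<Prod>i\<in>(UNIV::'n set). fact k)"
    unfolding mi_fact_def by (intro prod_mono conjI fact_mono) auto
  then show ?thesis by simp
qed

lemma weak_derivative_bound_of_Linf:
  fixes v :: "'n::finite fn"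
  assumes "Linf_norm_D \<gamma> v (ball \<beta> r) < ennreal M" "mi_order \<gamma> \<le> k" "M \<ge> 0"
  shows "\<exists>g. weak_derivative (ball \<beta> r) \<gamma> v g \<and>
    (AE x in lborel. x \<in> ball \<beta> r \<longrightarrow> cmod (g x) \<le> M * fact k ^ CARD('n))"
proof -
  let ?R = "restrict_space lborel (ball \<beta> r)"
  obtain g where g: "weak_derivative (ball \<beta> r) \<gamma> v g"
    "esssup ?R (\<lambda>x. ennreal (cmod (g x) / mi_fact \<gamma>)) < ennreal M"
    using assms(1) unfolding Linf_norm_D_def INF_less_iff by blast
  have f0: "mi_fact \<gamma> > 0" unfolding mi_fact_def by (intro prod_pos) simp
  have "AE x in ?R. ennreal (cmod (g x) / mi_fact \<gamma>) \<le> ennreal M"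
    using esssup_AE[where M = ?R and f = "\<lambda>x. ennreal (cmod (g x) / mi_fact \<gamma>)"] by eventually_elim (use g(2) in auto)
  then have "AE x in lborel. x \<in> ball \<beta> r \<longrightarrow> ennreal (cmod (g x) / mi_fact \<gamma>) \<le> ennreal M"
    by (subst (asm) AE_restrict_space_iff) auto
  then have "AE x in lborel. x \<in> ball \<beta> r \<longrightarrow> cmod (g x) \<le> M * fact k ^ CARD('n)"
  proof eventually_elim
    case (elim x)
    show ?case
    proof
      assume "x \<in> ball \<beta> r"
      then have "cmod (g x) \<le> M * mi_fact \<gamma>"
        using elim assms(3) f0 by (simp add: pos_divide_le_eq)
      also have "\<dots> \<le> M * fact k ^ CARD('n)"
        using assms by (intro mult_left_mono mi_fact_le) auto
      finally show "cmod (g x) \<le> M * fact k ^ CARD('n)" .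
    qed
  qed
  with g(1) show ?thesis by blast
qed

text \<open>Vanishing to order \<open>k\<close> with some constant implies vanishing with the constant given by the
  derivatives, and on the whole ball.\<close>

lemma vanishing_with_derivative_constant:
  fixes \<phi> :: "'n::finite functional"
  assumes \<phi>: "\<phi> \<in> sobolev \<sigma>" and r: "r > 0"
    and L: "(SUP \<gamma>\<in>{\<gamma>. mi_order \<gamma> \<le> k}. (Linf_norm_D \<gamma> (fourier_fun \<phi>) (ball \<beta> r))\<^sup>2) = ennreal (m\<^sup>2)" and m: "m \<ge> 0"
    and R: "R > 0" and small: "AE z in lborel. norm z < R \<longrightarrow> cmod (fourier_fun \<phi> (z + \<beta>)) \<le> C * norm z ^ k"
  shows "AE z in lborel. norm z < r \<longrightarrow>
    cmod (fourier_fun \<phi> (z + \<beta>)) \<le> (m * fact k ^ CARD('n) * real CARD('n) ^ k) * norm z ^ k"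
proof -
  let ?p = "fourier_fun \<phi>" and ?A = "fact k ^ CARD('n) :: real"
  \<comment> \<open>The infimum over the weak derivatives need not be attained, hence the slack \<open>1 / (n + 1)\<close>.\<close>
  have "AE z in lborel. norm z < r \<longrightarrow> cmod (?p (z + \<beta>)) \<le>
      ((m + inverse (real (Suc n))) * ?A) * (real CARD('n) * norm z) ^ k" for n
  proof (rule vanishing_order_bound[OF _ _ r _ _ R small])
    show "?p \<in> borel_measurable borel" by (rule sobolevD(4)[OF \<phi>])
    show "set_integrable lborel K (\<lambda>\<omega>. (cmod (?p \<omega>))\<^sup>2)" if "compact K" for K
      by (rule is_fourier_funD(2)[OF sobolevD(2)[OF \<phi>] that])
    show "0 \<le> (m + inverse (real (Suc n))) * ?A" using m by simp
    fix \<gamma> :: "'n multi_index" assume \<gamma>: "mi_order \<gamma> = k"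
    let ?M = "m + inverse (real (Suc n))" and ?l = "Linf_norm_D \<gamma> ?p (ball \<beta> r)"
    have "0 < inverse (real (Suc n))" by simp
    then have M: "m < ?M" "?M \<ge> 0" using m by linarith+
    have "?l\<^sup>2 \<le> ennreal (m\<^sup>2)" unfolding L[symmetric] by (rule SUP_upper) (use \<gamma> in simp)
    also have "\<dots> < ennreal (?M\<^sup>2)"
      unfolding ennreal_less_iff[OF zero_le_power2] by (rule power_strict_mono[OF M(1) m]) simp
    finally have sq: "?l\<^sup>2 < ennreal (?M\<^sup>2)" .
    have "?l < ennreal ?M"
    proof (rule ccontr)
      assume "\<not> ?thesis"
      then have "(ennreal ?M)\<^sup>2 \<le> ?l\<^sup>2" by (intro power_mono) auto
      then show False using sq M by (simp add: ennreal_power)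
    qed
    then show "\<exists>g. weak_derivative (ball \<beta> r) \<gamma> ?p g \<and> (AE x in lborel. x \<in> ball \<beta> r \<longrightarrow> cmod (g x) \<le> ?M * ?A)"
      using \<gamma> M by (intro weak_derivative_bound_of_Linf) auto
  qed
  then have "AE z in lborel. \<forall>n. norm z < r \<longrightarrow> cmod (?p (z + \<beta>)) \<le>
      ((m + inverse (real (Suc n))) * ?A) * (real CARD('n) * norm z) ^ k"
    by (simp only: AE_all_countable) blast
  then show ?thesis
  proof eventually_elim
    case (elim z)
    show ?case
    proof
      assume z: "norm z < r"
      have "(\<lambda>n. ((m + inverse (real (Suc n))) * ?A) * (real CARD('n) * norm z) ^ k) \<longlonglongrightarrow>
          ((m + 0) * ?A) * (real CARD('n) * norm z) ^ k"
        by (intro tendsto_intros LIMSEQ_inverse_real_of_nat)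
      then have "cmod (?p (z + \<beta>)) \<le> ((m + 0) * ?A) * (real CARD('n) * norm z) ^ k"
        by (rule tendsto_lowerbound) (use elim z in auto)
      then show "cmod (?p (z + \<beta>)) \<le> (m * ?A * real CARD('n) ^ k) * norm z ^ k"
        by (simp add: power_mult_distrib mult_ac)
    qed
  qed
qed

theorem theorem12:
  fixes s t r \<eta>\<^sub>1 \<eta>\<^sub>2 :: real and k :: nat and \<phi> :: "'n::finite functional"
  assumes "t < s" and "s < real k"
    and "\<phi> \<in> sobolev s"
    and "\<eta>\<^sub>1 > 0" and "\<eta>\<^sub>2 > 0" and "r > 0"
    and "AE \<omega> in lborel. \<omega> \<in> ball 0 r \<longrightarrow>
           \<eta>\<^sub>1 \<le> cmod (fourier_fun \<phi> \<omega>) \<and> cmod (fourier_fun \<phi> \<omega>) \<le> \<eta>\<^sub>2"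
    and "(\<Sum>\<^sub>\<infinity>\<beta>\<in>(\<lambda>\<alpha>. (2 * pi) *\<^sub>R \<alpha>) ` int_lattice - {0}.
            ennreal (norm \<beta> powr (2 * s)) *
            (SUP \<gamma>\<in>{\<gamma>. mi_order \<gamma> \<le> k}. (Linf_norm_D \<gamma> (fourier_fun \<phi>) (ball \<beta> r))\<^sup>2)) < \<infinity>"
  shows "provides_approx_order s \<phi> (real k) \<longleftrightarrow> provides_approx_order t \<phi> (real k)"
proof -
  let ?p = "fourier_fun \<phi>" and ?L = "dual_lattice - {0} :: (real^'n) set"
  have \<phi>t: "\<phi> \<in> sobolev t" using sobolev_mono[OF less_imp_le[OF assms(1)] assms(3)] .
  define N where "N \<beta> = (SUP \<gamma>\<in>{\<gamma>. mi_order \<gamma> \<le> k}. (Linf_norm_D \<gamma> ?p (ball \<beta> r))\<^sup>2)" for \<beta>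
  define T where "T = (\<Sum>\<^sub>\<infinity>\<beta>\<in>?L. ennreal (norm \<beta> powr (2 * s)) * N \<beta>)"
  have T: "T < \<infinity>" using assms(8) by (simp add: T_def N_def dual_lattice_def)
  have fin_le: "(\<Sum>\<beta>\<in>F. ennreal (norm \<beta> powr (2 * s)) * N \<beta>) \<le> T" if "finite F" "F \<subseteq> ?L" for F
    unfolding T_def by (subst nonneg_infsum_complete) (use that in \<open>auto intro: SUP_upper\<close>)
  define m where "m \<beta> = sqrt (enn2real (N \<beta>))" for \<beta>
  have N: "N \<beta> = ennreal ((m \<beta>)\<^sup>2)" if \<beta>: "\<beta> \<in> ?L" for \<beta>
  proof -
    have "ennreal (norm \<beta> powr (2 * s)) * N \<beta> < \<infinity>" using fin_le[of "{\<beta>}"] \<beta> T by (auto intro: le_less_trans)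
    then have "N \<beta> < \<infinity>" by (rule finite_if_mult_finite[rotated]) (use \<beta> in simp)
    then show ?thesis by (simp add: m_def less_top)
  qed
  define A where "A = fact k ^ CARD('n) * real CARD('n) ^ k"
  define b where "b \<beta> = m \<beta> * fact k ^ CARD('n) * real CARD('n) ^ k" for \<beta>
  define S where "S = A\<^sup>2 * enn2real T"
  have bsum: "(\<Sum>\<beta>\<in>F. norm \<beta> powr (2 * \<sigma>) * (b \<beta>)\<^sup>2) \<le> S" if F: "finite F" "F \<subseteq> ?L" and \<sigma>: "\<sigma> \<le> s" for F \<sigma>
  proof -
    have "ennreal (\<Sum>\<beta>\<in>F. norm \<beta> powr (2 * s) * (m \<beta>)\<^sup>2) = (\<Sum>\<beta>\<in>F. ennreal (norm \<beta> powr (2 * s)) * N \<beta>)"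
      using F(2) by (subst sum_ennreal[symmetric]) (auto intro!: sum.cong simp: N ennreal_mult subset_iff)
    also have "\<dots> \<le> T" by (rule fin_le[OF F])
    also have "T = ennreal (enn2real T)" using T by (cases T) auto
    finally have "(\<Sum>\<beta>\<in>F. norm \<beta> powr (2 * s) * (m \<beta>)\<^sup>2) \<le> enn2real T"
      by (simp only: ennreal_le_iff[OF enn2real_nonneg])
    then have "A\<^sup>2 * (\<Sum>\<beta>\<in>F. norm \<beta> powr (2 * s) * (m \<beta>)\<^sup>2) \<le> S"
      unfolding S_def by (rule mult_left_mono) simp
    moreover have "(\<Sum>\<beta>\<in>F. norm \<beta> powr (2 * \<sigma>) * (b \<beta>)\<^sup>2) \<le> A\<^sup>2 * (\<Sum>\<beta>\<in>F. norm \<beta> powr (2 * s) * (m \<beta>)\<^sup>2)"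
      unfolding sum_distrib_left
    proof (rule sum_mono)
      fix \<beta> assume "\<beta> \<in> F"
      then have "2 * pi \<le> norm \<beta>" using F dual_lattice_norm_ge by blast
      then have "norm \<beta> powr (2 * \<sigma>) \<le> norm \<beta> powr (2 * s)" using \<sigma> pi_gt3 by (intro powr_mono) auto
      then have "norm \<beta> powr (2 * \<sigma>) * (b \<beta>)\<^sup>2 \<le> norm \<beta> powr (2 * s) * (b \<beta>)\<^sup>2" by (rule mult_right_mono) simp
      also have "b \<beta> = A * m \<beta>" by (simp add: b_def A_def)
      finally show "norm \<beta> powr (2 * \<sigma>) * (b \<beta>)\<^sup>2 \<le> A\<^sup>2 * (norm \<beta> powr (2 * s) * (m \<beta>)\<^sup>2)"
        by (simp add: b_def A_def power_mult_distrib mult_ac)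
    qed
    ultimately show ?thesis by linarith
  qed
  \<comment> \<open>The order of vanishing forgets \<open>\<sigma>\<close>, and the sum in \<open>bsum\<close> is finite for every \<open>\<sigma>' \<le> s\<close>.  The radius is
    cut down to \<open>pi\<close> so that the ball lies in the fundamental cube.\<close>
  have key: "provides_approx_order \<sigma>' \<phi> (real k)"
    if \<sigma>: "\<sigma> \<le> s" "provides_approx_order \<sigma> \<phi> (real k)" and \<sigma>': "\<sigma>' \<le> s" for \<sigma> \<sigma>'
  proof (rule vanishing_implies_approximation_order[where r = "min r pi" and b = b and S = S and \<eta> = \<eta>\<^sub>1])
    show "\<phi> \<in> sobolev \<sigma>'" by (rule sobolev_mono[OF \<sigma>' assms(3)])
    show "AE \<omega> in lborel. \<omega> \<in> ball 0 (min r pi) \<longrightarrow> \<eta>\<^sub>1 \<le> cmod (?p \<omega>)"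
      using assms(7) by eventually_elim auto
    fix \<beta> :: "real^'n" assume \<beta>: "\<beta> \<in> ?L"
    have "\<exists>C R. R > 0 \<and> (AE \<omega> in lborel. norm \<omega> < R \<longrightarrow> cmod (?p (\<omega> + \<beta>)) \<le> C * norm \<omega> ^ k)"
      by (rule approximation_order_implies_vanishing[OF sobolev_mono[OF \<sigma>(1) assms(3)] _ assms(4,6,7) \<sigma>(2)])
        (use \<beta> \<sigma> assms(2) in auto)
    then obtain C R where R: "R > 0"
      "AE \<omega> in lborel. norm \<omega> < R \<longrightarrow> cmod (?p (\<omega> + \<beta>)) \<le> C * norm \<omega> ^ k" by blast
    have "AE z in lborel. norm z < r \<longrightarrow> cmod (?p (z + \<beta>)) \<le> b \<beta> * norm z ^ k"
      unfolding b_def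
      by (rule vanishing_with_derivative_constant[OF assms(3,6) _ _ R])
        (use N[OF \<beta>] in \<open>auto simp: N_def m_def\<close>)
    then show "AE z in lborel. norm z < min r pi \<longrightarrow> cmod (?p (z + \<beta>)) \<le> b \<beta> * norm z ^ k"
      by eventually_elim auto
  qed (use assms bsum \<sigma>' in auto)
  show ?thesis
  proof
    assume "provides_approx_order s \<phi> (real k)"
    then show "provides_approx_order t \<phi> (real k)" by (rule key[OF order_refl _ less_imp_le[OF assms(1)]])
  next
    assume "provides_approx_order t \<phi> (real k)"
    then show "provides_approx_order s \<phi> (real k)" by (rule key[OF less_imp_le[OF assms(1)] _ order_refl])
  qed
qed

end
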